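(* Consider the two families of planar piecewise quadratic differential systems, with real parameters $(d_1,d_2,l_1,l_2,m_1,m_2,n_1,n_2)\in\mathbb{R}^8$, defined by the vector fields $$Z_j:\quad \dot x=-y+d_jx+l_jx^2+m_jxy+n_jy^2,\qquad \dot y=x(1-y),\qquad j=1,2.$$ In the horizontal family, $Z_1$ acts on $\{y>0\}$ and $Z_2$ acts on $\{y<0\}$. In the vertical family, $Z_1$ acts on $\{x>0\}$ and $Z_2$ acts on $\{x<0\}$. Then there are values of the parameters such that from the origin of the horizontal family there bifurcate $4$ crossing limit cycles of small amplitude, and there are values of the parameters such that from the origin of the vertical family there bifurcate $7$ crossing limit cycles of small amplitude, in both cases multiplicities taken into account (perturbing inside the respective family).
   Context: For a planar piecewise vector field with separation line $\Sigma$, a crossing periodic orbit is a periodic orbit meeting $\Sigma$ only at points where both vector fields are transversal to $\Sigma$ and point to the same side of it (points where the orbit passes through $\Sigma$ by concatenation). A crossing limit cycle is an isolated crossing periodic orbit. Those considered here surround the origin. Half-return maps and displacement map. When $|d_j|<2$, orbits near the origin turn counterclockwise around it. In the horizontal family let $\Pi_1$ be the half-return map from the positive to the negative $x$-half-axis through $y>0$, and $\Pi_2$ the half-return map from the negative to the positive $x$-half-axis through $y<0$. In the vertical family let $\Pi_1$ be the map from the negative to the positive $y$-half-axis through $x>0$, and $\Pi_2$ the map from the positive to the negative $y$-half-axis through $x<0$. Points of half-axes are parametrized by their distance $r_0$ to the origin. The displacement map is $\Delta(r_0)=\Pi_2^{-1}(r_0)-\Pi_1(r_0)$ for small $r_0>0$.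 Crossing limit cycles near the origin correspond to isolated positive zeros of $\Delta$, and the multiplicity of a limit cycle is the multiplicity of the corresponding zero. "At the parameter value $\lambda_0$, $k$ crossing limit cycles of small amplitude bifurcate from the origin, multiplicities taken into account" means: for every neighborhood $U$ of the origin and every neighborhood $V$ of $\lambda_0$ in the parameter space there is $\lambda\in V$ such that the system with parameter $\lambda$ has $k$ crossing limit cycles contained in $U$ and surrounding the origin, counted with multiplicity. *)

theory Defs
  imports "HOL-Analysis.Analysis"
begin

type_synonym plane = "real \<times> real"
type_synonym field = "plane \<Rightarrow> plane"

text \<open>Parameters in the order \<open>(d1, d2, l1, l2, m1, m2, n1, n2)\<close>, with the product topology.\<close>

type_synonym params = "real \<times> real \<times> real \<times> real \<times> real \<times> real \<times> real \<times> real"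

definition Z :: "real \<Rightarrow> real \<Rightarrow> real \<Rightarrow> real \<Rightarrow> field" where
  "Z d l m n = (\<lambda>(x, y). (- y + d * x + l * x\<^sup>2 + m * x * y + n * y\<^sup>2, x * (1 - y)))"

definition Z1 :: "params \<Rightarrow> field" where
  "Z1 = (\<lambda>(d1, d2, l1, l2, m1, m2, n1, n2). Z d1 l1 m1 n1)"

definition Z2 :: "params \<Rightarrow> field" where
  "Z2 = (\<lambda>(d1, d2, l1, l2, m1, m2, n1, n2). Z d2 l2 m2 n2)"

text \<open>
  A piecewise vector field is given by fields \<open>X\<close>, \<open>Y\<close> on the plane and a unit normal \<open>\<nu>\<close>
  of the separation line \<open>{p. \<nu> \<bullet> p = 0}\<close>: \<open>X\<close> acts where \<open>\<nu> \<bullet> p > 0\<close>, \<open>Y\<close> where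
  \<open>\<nu> \<bullet> p < 0\<close>. The horizontal family has \<open>\<nu> = (0, 1)\<close>, the vertical one \<open>\<nu> = (1, 0)\<close>.
\<close>

definition crossing_point :: "field \<Rightarrow> field \<Rightarrow> plane \<Rightarrow> plane \<Rightarrow> bool" where
  "crossing_point X Y \<nu> p \<longleftrightarrow> \<nu> \<bullet> p = 0 \<and> (\<nu> \<bullet> X p) * (\<nu> \<bullet> Y p) > 0"

text \<open>
  At a crossing point both fields point to the same side, so an orbit arrives with the field of
  the side it leaves and departs with the field of the side it enters. The one-sided derivatives
  express this concatenation, and in particular forbid motion along the separation line.
\<close>

definition crossing_solution :: "field \<Rightarrow> field \<Rightarrow> plane \<Rightarrow> (real \<Rightarrow> plane) \<Rightarrow> bool" where
  "crossing_solution X Y \<nu> \<gamma> \<longleftrightarrow> (\<forall>t.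
     (\<nu> \<bullet> \<gamma> t > 0 \<longrightarrow> (\<gamma> has_vector_derivative X (\<gamma> t)) (at t)) \<and>
     (\<nu> \<bullet> \<gamma> t < 0 \<longrightarrow> (\<gamma> has_vector_derivative Y (\<gamma> t)) (at t)) \<and>
     (\<nu> \<bullet> \<gamma> t = 0 \<longrightarrow> crossing_point X Y \<nu> (\<gamma> t) \<and>
       (if \<nu> \<bullet> X (\<gamma> t) > 0
        then (\<gamma> has_vector_derivative Y (\<gamma> t)) (at_left t) \<and>
             (\<gamma> has_vector_derivative X (\<gamma> t)) (at_right t)
        else (\<gamma> has_vector_derivative X (\<gamma> t)) (at_left t) \<and>
             (\<gamma> has_vector_derivative Y (\<gamma> t)) (at_right t))))"

definition crossing_periodic_orbit :: "field \<Rightarrow> field \<Rightarrow> plane \<Rightarrow> plane set \<Rightarrow> bool" where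
  "crossing_periodic_orbit X Y \<nu> \<Gamma> \<longleftrightarrow> (\<exists>\<gamma> T. crossing_solution X Y \<nu> \<gamma> \<and>
     T > 0 \<and> (\<forall>t. \<gamma> (t + T) = \<gamma> t) \<and> (\<exists>t. \<gamma> t \<noteq> \<gamma> 0) \<and> \<Gamma> = range \<gamma>)"

definition crossing_limit_cycle :: "field \<Rightarrow> field \<Rightarrow> plane \<Rightarrow> plane set \<Rightarrow> bool" where
  "crossing_limit_cycle X Y \<nu> \<Gamma> \<longleftrightarrow> crossing_periodic_orbit X Y \<nu> \<Gamma> \<and>
     (\<exists>W. open W \<and> \<Gamma> \<subseteq> W \<and>
       (\<forall>\<Gamma>'. crossing_periodic_orbit X Y \<nu> \<Gamma>' \<and> \<Gamma>' \<subseteq> W \<longrightarrow> \<Gamma>' = \<Gamma>))"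

text \<open>
  \<open>half_return F \<nu> u r s\<close>: the orbit of \<open>F\<close> starting at distance \<open>r\<close> from the origin on the
  half-axis in direction \<open>u\<close> runs through \<open>\<nu> \<bullet> p > 0\<close> and first returns to the separation line
  at distance \<open>s\<close> on the opposite half-axis. It is a relation because half-return maps are only
  defined locally.
\<close>

definition half_return :: "field \<Rightarrow> plane \<Rightarrow> plane \<Rightarrow> real \<Rightarrow> real \<Rightarrow> bool" where
  "half_return F \<nu> u r s \<longleftrightarrow> r > 0 \<and> s > 0 \<and> (\<exists>T>0. \<exists>\<gamma>.
     \<gamma> 0 = r *\<^sub>R u \<and> \<gamma> T = s *\<^sub>R (- u) \<and>
     (\<forall>t\<in>{0..T}. (\<gamma> has_vector_derivative F (\<gamma> t)) (at t within {0..T})) \<and>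
     (\<forall>t\<in>{0<..<T}. \<nu> \<bullet> \<gamma> t > 0))"

text \<open>
  \<open>start_axis \<nu>\<close> is \<open>\<nu>\<close> turned clockwise by a right angle: the half-axis from which a
  counterclockwise orbit enters \<open>\<nu> \<bullet> p > 0\<close>. It is the positive x-half-axis for
  \<open>\<nu> = (0, 1)\<close> and the negative y-half-axis for \<open>\<nu> = (1, 0)\<close>.
\<close>

definition start_axis :: "plane \<Rightarrow> plane" where
  "start_axis \<nu> = (snd \<nu>, - fst \<nu>)"

definition return1 :: "field \<Rightarrow> plane \<Rightarrow> real \<Rightarrow> real \<Rightarrow> bool" where
  "return1 X \<nu> = half_return X \<nu> (start_axis \<nu>)"

definition return2 :: "field \<Rightarrow> plane \<Rightarrow> real \<Rightarrow> real \<Rightarrow> bool" where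
  "return2 Y \<nu> = half_return Y (- \<nu>) (- start_axis \<nu>)"

definition displacement :: "field \<Rightarrow> field \<Rightarrow> plane \<Rightarrow> real \<Rightarrow> real" where
  "displacement X Y \<nu> r = (THE s. return2 Y \<nu> s r) - (THE s. return1 X \<nu> r s)"

definition displacement_defined :: "field \<Rightarrow> field \<Rightarrow> plane \<Rightarrow> real \<Rightarrow> bool" where
  "displacement_defined X Y \<nu> r \<longleftrightarrow> (\<exists>!s. return2 Y \<nu> s r) \<and> (\<exists>!s. return1 X \<nu> r s)"

text \<open>The differentiability clause keeps every iterated \<open>deriv\<close> below meaningful.\<close>

definition zero_of_multiplicity :: "(real \<Rightarrow> real) \<Rightarrow> real \<Rightarrow> nat \<Rightarrow> bool" where
  "zero_of_multiplicity f r k \<longleftrightarrow> f r = 0 \<and>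
     (\<forall>i<k. \<forall>\<^sub>F s in nhds r. (deriv ^^ i) f field_differentiable (at s)) \<and>
     (\<forall>i<k. (deriv ^^ i) f r = 0) \<and> (deriv ^^ k) f r \<noteq> 0"

definition cycle_of_multiplicity :: "field \<Rightarrow> field \<Rightarrow> plane \<Rightarrow> plane set \<Rightarrow> nat \<Rightarrow> bool" where
  "cycle_of_multiplicity X Y \<nu> \<Gamma> k \<longleftrightarrow> (\<exists>r>0. r *\<^sub>R start_axis \<nu> \<in> \<Gamma> \<and>
     (\<forall>\<^sub>F s in nhds r. displacement_defined X Y \<nu> s) \<and>
     zero_of_multiplicity (displacement X Y \<nu>) r k)"

text \<open>
  \<open>U\<close> contains \<open>k\<close> crossing limit cycles surrounding the origin, counted with multiplicity;
  \<open>U\<close> may be a large set, and further limit cycles in it are not excluded.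
\<close>

definition has_crossing_limit_cycles ::
    "field \<Rightarrow> field \<Rightarrow> plane \<Rightarrow> plane set \<Rightarrow> nat \<Rightarrow> bool" where
  "has_crossing_limit_cycles X Y \<nu> U k \<longleftrightarrow> (\<exists>C mult. finite C \<and>
     (\<forall>\<Gamma>\<in>C. crossing_limit_cycle X Y \<nu> \<Gamma> \<and> \<Gamma> \<subseteq> U \<and> (0, 0) \<in> inside \<Gamma> \<and>
            cycle_of_multiplicity X Y \<nu> \<Gamma> (mult \<Gamma>)) \<and>
     (\<Sum>\<Gamma>\<in>C. mult \<Gamma>) = k)"

definition bifurcate_from_origin ::
    "(params \<Rightarrow> field) \<Rightarrow> (params \<Rightarrow> field) \<Rightarrow> plane \<Rightarrow> params \<Rightarrow> nat \<Rightarrow> bool" where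
  "bifurcate_from_origin X Y \<nu> q0 k \<longleftrightarrow>
     (\<forall>U V. open U \<and> (0, 0) \<in> U \<and> open V \<and> q0 \<in> V \<longrightarrow>
       (\<exists>q\<in>V. has_crossing_limit_cycles (X q) (Y q) \<nu> U k))"

end

theory Submission
  imports Defs
begin

text \<open>
  For \<open>d = m = 0\<close> a half system has a first integral and is, in suitable coordinates, a rotation. Two such
  halves with matching first integrals form a center, and perturbing them in the direction \<open>v\<close> by \<open>\<epsilon> v\<close>
  gives a displacement map that is \<open>\<epsilon>\<close> times an explicit integral \<open>M\<close>, linear in \<open>v\<close>, up to \<open>o(\<epsilon>)\<close> in the
  \<open>C\<^sup>1\<close> sense. Hence \<open>k\<close> simple zeros of \<open>M\<close> near \<open>0\<close> yield \<open>k\<close> hyperbolic crossing limit cycles.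
  Directions for which \<open>M\<close> has order \<open>1, \<dots>, K + 1\<close> at the origin can be combined to create \<open>K\<close> sign changes; one
  more comes from moving the center along a family on which the coefficient of order \<open>K + 1\<close> passes
  through zero. For the horizontal family \<open>K = 3\<close>, for the vertical one \<open>K = 6\<close>.
\<close>

section \<open>Uniqueness for locally Lipschitz fields\<close>

text \<open>The order of the choices shapes the proof: the neighborhood \<open>U\<close> comes
  first, then the center, then the size \<open>\<epsilon>\<close> of the perturbation. The radius
  below which orbits stay in \<open>U\<close> must therefore be uniform over the centers used, and
  the zeros of the first order term have to be placed below it before \<open>\<epsilon>\<close> is
  known. Since all cycles found are hyperbolic, one derivative of the displacement map decides the
  multiplicity, and C^1 estimates are enough. Simplicity of the zeros is not read off from
  expansions: once the sign changes exist, a regular value of a quotient of two first order terms,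
  supplied by Sard's theorem, makes all zeros simple at once. The additional sign change uses two
  different orders: at the special center the first order term has a later leading coefficient,
  whose sign is opposite to that of the coefficient of order \<open>K + 1\<close> at the neighboring
  centers. Isolation is required among all crossing periodic orbits, including those that wind
  several times, so it is proved by comparing the extremal crossings of such an orbit.\<close>

definition lip_balls :: "(plane \<Rightarrow> 'b::real_normed_vector) \<Rightarrow> bool" where
  "lip_balls F \<longleftrightarrow> (\<forall>B. \<exists>L\<ge>0. \<forall>p q. norm p \<le> B \<longrightarrow> norm q \<le> B \<longrightarrow> norm (F p - F q) \<le> L * norm (p - q))"

lemma lip_ballsE:
  assumes "lip_balls F"
  obtains L where "L \<ge> 0" "\<And>p q. norm p \<le> B \<Longrightarrow> norm q \<le> B \<Longrightarrow> norm (F p - F q) \<le> L * norm (p - q)"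
  using assms unfolding lip_balls_def by blast

lemma lip_balls_const: "lip_balls (\<lambda>_. c)"
  unfolding lip_balls_def by (auto intro: exI[of _ 0])

lemma lip_balls_fst: "lip_balls (\<lambda>p. fst p)"
proof -
  have "norm (fst p - fst q) \<le> 1 * norm (p - q)" for p q :: plane
    using norm_fst_le[of "fst (p - q)" "snd (p - q)"] unfolding prod.collapse by simp
  then show ?thesis unfolding lip_balls_def by (meson zero_le_one)
qed

lemma lip_balls_snd: "lip_balls (\<lambda>p. snd p)"
proof -
  have "norm (snd p - snd q) \<le> 1 * norm (p - q)" for p q :: plane
    using norm_snd_le[of "snd (p - q)" "fst (p - q)"] unfolding prod.collapse by simp
  then show ?thesis unfolding lip_balls_def by (meson zero_le_one)
qed

lemma lip_balls_add:
  assumes "lip_balls f" "lip_balls g" shows "lip_balls (\<lambda>p. f p + g p)"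
  unfolding lip_balls_def
proof
  fix B
  obtain L where L: "L \<ge> 0" "\<And>p q. norm p \<le> B \<Longrightarrow> norm q \<le> B \<Longrightarrow> norm (f p - f q) \<le> L * norm (p - q)"
    by (rule lip_ballsE[OF assms(1), of B]) (rule that)
  obtain M where M: "M \<ge> 0" "\<And>p q. norm p \<le> B \<Longrightarrow> norm q \<le> B \<Longrightarrow> norm (g p - g q) \<le> M * norm (p - q)"
    by (rule lip_ballsE[OF assms(2), of B]) (rule that)
  have "norm (f p + g p - (f q + g q)) \<le> (L + M) * norm (p - q)" if "norm p \<le> B" "norm q \<le> B" for p q
  proof -
    have "norm (f p + g p - (f q + g q)) \<le> norm (f p - f q) + norm (g p - g q)"
      by (rule norm_diff_triangle_ineq)
    also have "\<dots> \<le> L * norm (p - q) + M * norm (p - q)" by (rule add_mono[OF L(2)[OF that] M(2)[OF that]])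
    finally show ?thesis by (simp add: algebra_simps)
  qed
  moreover have "L + M \<ge> 0" using L(1) M(1) by simp
  ultimately show "\<exists>K\<ge>0. \<forall>p q. norm p \<le> B \<longrightarrow> norm q \<le> B \<longrightarrow> norm (f p + g p - (f q + g q)) \<le> K * norm (p - q)"
    by blast
qed

lemma lip_balls_minus: "lip_balls f \<Longrightarrow> lip_balls (\<lambda>p. - f p)"
  unfolding lip_balls_def by (simp add: norm_minus_commute)

lemma lip_balls_diff:
  assumes "lip_balls f" "lip_balls g" shows "lip_balls (\<lambda>p. f p - g p)"
  using lip_balls_add[OF assms(1) lip_balls_minus[OF assms(2)]] by simp

text \<open>Products are the reason for working on balls. Each factor is bounded there by its value
  at \<open>0\<close> plus the Lipschitz constant times the radius, and the usual splitting of a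
  difference of products applies.\<close>

lemma lip_balls_mult:
  fixes f g :: "plane \<Rightarrow> real"
  assumes "lip_balls f" "lip_balls g" shows "lip_balls (\<lambda>p. f p * g p)"
  unfolding lip_balls_def
proof
  fix B0 :: real
  \<comment> \<open>The bounds on the factors compare with the point \<open>0\<close>, which must
    lie in the ball even if \<open>B0\<close> is negative.\<close>
  define B where "B = max B0 0"
  obtain L where L: "L \<ge> 0" "\<And>p q. norm p \<le> B \<Longrightarrow> norm q \<le> B \<Longrightarrow> norm (f p - f q) \<le> L * norm (p - q)"
    by (rule lip_ballsE[OF assms(1), of B]) (rule that)
  obtain M where M: "M \<ge> 0" "\<And>p q. norm p \<le> B \<Longrightarrow> norm q \<le> B \<Longrightarrow> norm (g p - g q) \<le> M * norm (p - q)"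
    by (rule lip_ballsE[OF assms(2), of B]) (rule that)
  have B: "B \<ge> 0" "B0 \<le> B" by (auto simp: B_def)
  have bf: "\<bar>f p\<bar> \<le> \<bar>f 0\<bar> + L * B" if "norm p \<le> B" for p
  proof -
    have "\<bar>f p - f 0\<bar> \<le> L * norm p" using L(2)[of p 0] that B by simp
    also have "\<dots> \<le> L * B" using that L(1) by (intro mult_left_mono)
    finally show ?thesis by linarith
  qed
  have bg: "\<bar>g p\<bar> \<le> \<bar>g 0\<bar> + M * B" if "norm p \<le> B" for p
  proof -
    have "\<bar>g p - g 0\<bar> \<le> M * norm p" using M(2)[of p 0] that B by simp
    also have "\<dots> \<le> M * B" using that M(1) by (intro mult_left_mono)
    finally show ?thesis by linarith
  qed
  define K where "K = (\<bar>f 0\<bar> + L * B) * M + (\<bar>g 0\<bar> + M * B) * L"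
  have "norm (f p * g p - f q * g q) \<le> K * norm (p - q)" if "norm p \<le> B" "norm q \<le> B" for p q
  proof -
    have "f p * g p - f q * g q = f p * (g p - g q) + g q * (f p - f q)" by algebra
    then have "\<bar>f p * g p - f q * g q\<bar> \<le> \<bar>f p\<bar> * \<bar>g p - g q\<bar> + \<bar>g q\<bar> * \<bar>f p - f q\<bar>"
      by (metis abs_mult abs_triangle_ineq)
    also have "\<dots> \<le> (\<bar>f 0\<bar> + L * B) * (M * norm (p - q)) + (\<bar>g 0\<bar> + M * B) * (L * norm (p - q))"
      using bf[OF that(1)] bg[OF that(2)] L(2)[OF that] M(2)[OF that] B L(1) M(1)
      by (intro add_mono mult_mono) auto
    finally show ?thesis by (simp add: K_def algebra_simps)
  qed
  moreover have "K \<ge> 0" using L(1) M(1) B by (auto simp: K_def)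
  ultimately show "\<exists>K\<ge>0. \<forall>p q. norm p \<le> B0 \<longrightarrow> norm q \<le> B0 \<longrightarrow> norm (f p * g p - f q * g q) \<le> K * norm (p - q)"
    using B(2) by (meson order_trans)
qed

lemma lip_balls_Pair:
  fixes f g :: "plane \<Rightarrow> real"
  assumes "lip_balls f" "lip_balls g" shows "lip_balls (\<lambda>p. (f p, g p))"
  unfolding lip_balls_def
proof
  fix B
  obtain L where L: "L \<ge> 0" "\<And>p q. norm p \<le> B \<Longrightarrow> norm q \<le> B \<Longrightarrow> norm (f p - f q) \<le> L * norm (p - q)"
    by (rule lip_ballsE[OF assms(1), of B]) (rule that)
  obtain M where M: "M \<ge> 0" "\<And>p q. norm p \<le> B \<Longrightarrow> norm q \<le> B \<Longrightarrow> norm (g p - g q) \<le> M * norm (p - q)"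
    by (rule lip_ballsE[OF assms(2), of B]) (rule that)
  have "norm ((f p, g p) - (f q, g q)) \<le> (L + M) * norm (p - q)" if "norm p \<le> B" "norm q \<le> B" for p q
  proof -
    have "norm ((f p, g p) - (f q, g q)) \<le> norm (f p - f q) + norm (g p - g q)"
      using norm_Pair_le[of "f p - f q" "g p - g q"] by simp
    also have "\<dots> \<le> L * norm (p - q) + M * norm (p - q)" by (rule add_mono[OF L(2)[OF that] M(2)[OF that]])
    finally show ?thesis by (simp add: algebra_simps)
  qed
  moreover have "L + M \<ge> 0" using L(1) M(1) by simp
  ultimately show "\<exists>K\<ge>0. \<forall>p q. norm p \<le> B \<longrightarrow> norm q \<le> B \<longrightarrow> norm ((f p, g p) - (f q, g q)) \<le> K * norm (p - q)"
    by blast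
qed

lemma lip_balls_Z: "lip_balls (Z d l m n)"
proof -
  have "lip_balls (\<lambda>p. (- snd p + d * fst p + l * (fst p * fst p) + m * fst p * snd p + n * (snd p * snd p),
      fst p * (1 - snd p)))"
    by (intro lip_balls_Pair lip_balls_add lip_balls_diff lip_balls_minus lip_balls_mult
        lip_balls_fst lip_balls_snd lip_balls_const)
  moreover have "Z d l m n = (\<lambda>p. (- snd p + d * fst p + l * (fst p * fst p) + m * fst p * snd p + n * (snd p * snd p),
      fst p * (1 - snd p)))"
    by (auto simp: Z_def fun_eq_iff power2_eq_square)
  ultimately show ?thesis by simp
qed

lemma has_vector_derivative_inner_const:
  assumes "(\<gamma> has_vector_derivative v) F"
  shows "((\<lambda>t. e \<bullet> \<gamma> t) has_real_derivative e \<bullet> v) F"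
  using bounded_linear.has_vector_derivative[OF bounded_linear_inner_right assms, of e]
  by (simp add: has_real_derivative_iff_has_vector_derivative)

text \<open>Gronwall's argument: with \<open>L\<close> a Lipschitz constant on a ball containing
  both curves, \<open>exp (- 2 * L * t)\<close> times the squared distance is nonincreasing, and it
  starts at \<open>0\<close>.\<close>

lemma ode_unique:
  fixes \<gamma> \<delta> :: "real \<Rightarrow> plane"
  assumes lip: "lip_balls F"
    and \<gamma>: "\<And>t. t \<in> {0..T} \<Longrightarrow> (\<gamma> has_vector_derivative F (\<gamma> t)) (at t within {0..T})"
    and \<delta>: "\<And>t. t \<in> {0..T} \<Longrightarrow> (\<delta> has_vector_derivative F (\<delta> t)) (at t within {0..T})"
    and init: "\<gamma> 0 = \<delta> 0" and t: "t \<in> {0..T}"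
  shows "\<gamma> t = \<delta> t"
proof -
  have c: "continuous_on {0..T} \<gamma>" "continuous_on {0..T} \<delta>"
    using continuous_on_vector_derivative[of "{0..T}" \<gamma>, OF \<gamma>] continuous_on_vector_derivative[of "{0..T}" \<delta>, OF \<delta>] by blast+
  then have "bounded (\<gamma> ` {0..T} \<union> \<delta> ` {0..T})"
    by (auto intro!: compact_imp_bounded compact_continuous_image)
  then obtain B where B: "\<And>s. s \<in> {0..T} \<Longrightarrow> norm (\<gamma> s) \<le> B \<and> norm (\<delta> s) \<le> B"
    unfolding bounded_iff by (meson UnCI imageI)
  obtain L where L: "L \<ge> 0" "\<And>p q. norm p \<le> B \<Longrightarrow> norm q \<le> B \<Longrightarrow> norm (F p - F q) \<le> L * norm (p - q)"
    by (rule lip_ballsE[OF lip, of B]) (rule that)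
  define v where "v s = (\<gamma> s - \<delta> s) \<bullet> (\<gamma> s - \<delta> s)" for s
  define v' where "v' s = 2 * ((\<gamma> s - \<delta> s) \<bullet> (F (\<gamma> s) - F (\<delta> s)))" for s
  define w where "w s = exp (- 2 * L * s) * v s" for s
  have dv: "(v has_real_derivative v' s) (at s within {0..T})" if "s \<in> {0..T}" for s
  proof -
    have "((\<lambda>s. \<gamma> s - \<delta> s) has_vector_derivative (F (\<gamma> s) - F (\<delta> s))) (at s within {0..T})"
      using \<gamma>[OF that] \<delta>[OF that] by (intro has_vector_derivative_diff)
    from bounded_bilinear.has_vector_derivative[OF bounded_bilinear_inner this this]
    show ?thesis
      unfolding v_def v'_def has_real_derivative_iff_has_vector_derivative
      by (simp add: inner_commute)
  qed
  have v'le: "v' s \<le> 2 * L * v s" if "s \<in> {0..T}" for s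
  proof -
    have "(\<gamma> s - \<delta> s) \<bullet> (F (\<gamma> s) - F (\<delta> s)) \<le> norm (\<gamma> s - \<delta> s) * norm (F (\<gamma> s) - F (\<delta> s))"
      by (rule norm_cauchy_schwarz)
    also have "\<dots> \<le> norm (\<gamma> s - \<delta> s) * (L * norm (\<gamma> s - \<delta> s))"
      using B[OF that] by (intro mult_left_mono L(2)) auto
    also have "\<dots> = L * v s" by (simp add: v_def power2_norm_eq_inner power2_eq_square dot_square_norm)
    finally show ?thesis by (simp add: v'_def)
  qed
  have dw: "(w has_real_derivative exp (- 2 * L * s) * (v' s - 2 * L * v s)) (at s within {0..T})"
    if "s \<in> {0..T}" for s
    unfolding w_def by (auto intro!: derivative_eq_intros dv that simp: algebra_simps)
  have "w t \<le> w 0"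
  proof (cases "t = 0")
    case False
    have "continuous_on {0..t} w"
      by (rule continuous_on_subset[of "{0..T}"])
        (use DERIV_continuous_on[OF dw] t in auto)
    moreover have "\<exists>y. DERIV w s :> y \<and> y \<le> 0" if "0 < s" "s < t" for s
    proof -
      have s: "s \<in> {0..T}" using that t by auto
      have "at s within {0..T} = at s" using that t by (intro at_within_Icc_at) auto
      then have "DERIV w s :> exp (- 2 * L * s) * (v' s - 2 * L * v s)" using dw[OF s] by simp
      moreover have "exp (- 2 * L * s) * (v' s - 2 * L * v s) \<le> 0"
        using v'le[OF s] by (intro mult_nonneg_nonpos) auto
      ultimately show ?thesis by blast
    qed
    ultimately show ?thesis using False t
      by (intro DERIV_nonpos_imp_decreasing_open[of 0 t w]) auto
  qed simp
  also have "w 0 = 0" by (simp add: w_def v_def init)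
  finally have "v t \<le> 0" by (simp add: w_def mult_le_0_iff)
  then show ?thesis using inner_gt_zero_iff[of "\<gamma> t - \<delta> t"] unfolding v_def
    by (metis linorder_not_less right_minus_eq)
qed

section \<open>Half orbits as curves, and their uniqueness in both directions of time\<close>

definition arc :: "field \<Rightarrow> plane \<Rightarrow> plane \<Rightarrow> real \<Rightarrow> real \<Rightarrow> real \<Rightarrow> (real \<Rightarrow> plane) \<Rightarrow> bool" where
  "arc F \<nu> u r s T \<gamma> \<longleftrightarrow> r > 0 \<and> s > 0 \<and> T > 0 \<and> \<gamma> 0 = r *\<^sub>R u \<and> \<gamma> T = s *\<^sub>R (- u) \<and>
     (\<forall>t\<in>{0..T}. (\<gamma> has_vector_derivative F (\<gamma> t)) (at t within {0..T})) \<and>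
     (\<forall>t\<in>{0<..<T}. \<nu> \<bullet> \<gamma> t > 0)"

lemma half_return_iff_arc: "half_return F \<nu> u r s \<longleftrightarrow> (\<exists>T \<gamma>. arc F \<nu> u r s T \<gamma>)"
  unfolding half_return_def arc_def by blast

text \<open>Two orbits from the same point agree as long as both run. When the first one arrives on
  the separation line, a slower one would still be strictly inside the half plane, so both arrive
  together.\<close>

lemma arc_unique_forward:
  assumes lip: "lip_balls F" and u: "\<nu> \<bullet> u = 0" "u \<noteq> 0"
    and 1: "arc F \<nu> u r s T \<gamma>" and 2: "arc F \<nu> u r s' T' \<delta>"
  shows "s = s' \<and> T = T' \<and> (\<forall>t\<in>{0..T}. \<gamma> t = \<delta> t)"
proof -
  have main: "s = s' \<and> T = T' \<and> (\<forall>t\<in>{0..T}. \<gamma> t = \<delta> t)"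
    if 1: "arc F \<nu> u r s T \<gamma>" and 2: "arc F \<nu> u r s' T' \<delta>" and le: "T \<le> T'" for s s' T T' \<gamma> \<delta>
  proof -
    have eq: "\<gamma> t = \<delta> t" if "t \<in> {0..T}" for t
    proof (rule ode_unique[OF lip _ _ _ that])
      show "(\<delta> has_vector_derivative F (\<delta> t)) (at t within {0..T})" if "t \<in> {0..T}" for t
        by (rule has_vector_derivative_within_subset[of _ _ _ "{0..T'}"])
          (use 2 le that in \<open>auto simp: arc_def\<close>)
    qed (use 1 2 in \<open>auto simp: arc_def\<close>)
    have "T = T'"
    proof (rule ccontr)
      assume "T \<noteq> T'"
      then have "\<nu> \<bullet> \<delta> T > 0" using 1 2 le by (auto simp: arc_def)
      moreover have "\<nu> \<bullet> \<gamma> T = 0" using 1 u by (auto simp: arc_def)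
      moreover have "\<gamma> T = \<delta> T" using eq[of T] 1 by (auto simp: arc_def)
      ultimately show False by simp
    qed
    moreover have "s = s'" using eq[of T] 1 2 u \<open>T = T'\<close> by (auto simp: arc_def)
    ultimately show ?thesis using eq by auto
  qed
  show ?thesis
  proof (cases "T \<le> T'")
    case True then show ?thesis using main[OF 1 2] by blast
  next
    case False
    with main[OF 2 1] show ?thesis by auto
  qed
qed

lemma arc_reverse:
  assumes "arc F \<nu> u r s T \<gamma>"
  shows "arc (\<lambda>p. - F p) \<nu> (- u) s r T (\<lambda>t. \<gamma> (T - t))"
proof -
  have "((\<lambda>t. \<gamma> (T - t)) has_vector_derivative - F (\<gamma> (T - t))) (at t within {0..T})" if "t \<in> {0..T}" for t
  proof -
    have 1: "((\<lambda>t. T - t) has_vector_derivative - 1) (at t within {0..T})"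
      by (auto intro!: derivative_eq_intros)
    have "(\<lambda>t. T - t) ` {0..T} = {0..T}"
    proof safe
      fix x assume "x \<in> {0..T}" then show "x \<in> (\<lambda>t. T - t) ` {0..T}" by (intro image_eqI[of _ _ "T - x"]) auto
    qed auto
    then have 2: "(\<gamma> has_vector_derivative F (\<gamma> (T - t))) (at (T - t) within (\<lambda>t. T - t) ` {0..T})"
      using assms that by (auto simp: arc_def)
    show ?thesis using vector_diff_chain_within[OF 1 2] by (simp add: o_def)
  qed
  then show ?thesis using assms by (auto simp: arc_def)
qed

text \<open>The second half-return map enters the displacement through its inverse, so the starting
  point has to be determined by the end point. Reversing time reduces this to the forward statement
  for \<open>- F\<close>.\<close>

lemma arc_unique_backward:
  assumes lip: "lip_balls F" and u: "\<nu> \<bullet> u = 0" "u \<noteq> 0"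
    and 1: "arc F \<nu> u r s T \<gamma>" and 2: "arc F \<nu> u r' s T' \<delta>"
  shows "r = r' \<and> T = T' \<and> (\<forall>t\<in>{0..T}. \<gamma> t = \<delta> t)"
proof -
  have "r = r' \<and> T = T' \<and> (\<forall>t\<in>{0..T}. \<gamma> (T - t) = \<delta> (T' - t))"
    by (rule arc_unique_forward[OF lip_balls_minus[OF lip] _ _ arc_reverse[OF 1] arc_reverse[OF 2]])
      (use u in auto)
  moreover from this have "\<gamma> t = \<delta> t" if "t \<in> {0..T}" for t
    using that by (auto dest!: bspec[of _ _ "T - t"])
  ultimately show ?thesis by blast
qed

section \<open>Closed curves around the origin\<close>

text \<open>A direct argument for star-shaped curves. \<open>D\<close> consists of the points whose
  segment to \<open>0\<close> avoids \<open>S\<close>, and \<open>K\<close> of all segments from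
  \<open>0\<close> to \<open>S\<close>. The open set \<open>D\<close> lies in the compact set
  \<open>K\<close>, and \<open>K\<close> without \<open>S\<close> lies in \<open>D\<close>. Hence
  \<open>D\<close> and the complement of \<open>K\<close> separate the complement of
  \<open>S\<close>, and the component of \<open>0\<close> stays inside \<open>K\<close>.\<close>

lemma inside_if_rays:
  fixes S :: "'a::euclidean_space set"
  assumes S: "compact S" and ray: "\<And>e. e \<noteq> 0 \<Longrightarrow> \<exists>!t. t > 0 \<and> t *\<^sub>R e \<in> S"
    and 0: "0 \<notin> S" and ne: "S \<noteq> {}"
  shows "0 \<in> inside S"
proof -
  define D where "D = {p. \<forall>t\<in>{0..1::real}. t *\<^sub>R p \<notin> S}"
  define K where "K = (\<lambda>(s, q). s *\<^sub>R q) ` ({0..1::real} \<times> S)"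
  have K: "compact K" unfolding K_def
    by (intro compact_continuous_image compact_Times S)
      (auto simp: split_beta intro!: continuous_intros)
  \<comment> \<open>The complement of \<open>D\<close> is the projection of a closed set along the
    compact interval of factors \<open>t\<close>, hence closed.\<close>
  have "closed ((\<lambda>(t, p). t *\<^sub>R p) -` S :: (real \<times> 'a) set)"
    by (intro closed_vimage compact_imp_closed[OF S]) (auto simp: split_beta intro!: continuous_intros)
  from closed_compact_projection[OF compact_Icc[of 0 1] this]
  have "closed {p. \<exists>t\<in>{0..1::real}. t *\<^sub>R p \<in> S}" by (simp add: Bex_def)
  moreover have "D = - {p. \<exists>t\<in>{0..1::real}. t *\<^sub>R p \<in> S}" by (auto simp: D_def)
  ultimately have oD: "open D" by auto
  have DK: "D \<subseteq> K"
  proof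
    fix p assume p: "p \<in> D"
    obtain q where q: "q \<in> S" using ne by blast
    show "p \<in> K"
    proof (cases "p = 0")
      case True then show ?thesis unfolding K_def using q by (intro image_eqI[of _ _ "(0, q)"]) auto
    next
      case False
      then obtain t where t: "t > 0" "t *\<^sub>R p \<in> S" using ray by blast
      then have "\<not> t \<le> 1" using p by (auto simp: D_def)
      then show ?thesis unfolding K_def using t by (intro image_eqI[of _ _ "(1 / t, t *\<^sub>R p)"]) auto
    qed
  qed
  have KD: "p \<in> D" if p: "p \<in> K" "p \<notin> S" for p
  proof -
    obtain s q where q: "q \<in> S" "0 \<le> s" "s \<le> 1" "p = s *\<^sub>R q" using p(1) unfolding K_def by auto
    have "s \<noteq> 1" using q p(2) by auto
    have "q \<noteq> 0" using q 0 by auto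
    have "t *\<^sub>R p \<notin> S" if t: "t \<in> {0..1}" for t
    proof
      assume a: "t *\<^sub>R p \<in> S"
      have "t * s \<noteq> 0" using a q 0 by auto
      then have "t * s > 0" using t q by (simp add: less_le)
      moreover have "(t * s) *\<^sub>R q \<in> S" "1 *\<^sub>R q \<in> S" using a q by auto
      ultimately have "t * s = 1" using ray[OF \<open>q \<noteq> 0\<close>] by (metis zero_less_one)
      moreover have "t * s \<le> 1 * s" using t q by (intro mult_right_mono) auto
      ultimately show False using q \<open>s \<noteq> 1\<close> by simp
    qed
    then show ?thesis by (auto simp: D_def)
  qed
  define C where "C = connected_component_set (- S) 0"
  have C: "connected C" "C \<subseteq> - S" by (auto simp: C_def connected_component_subset)
  have "0 \<in> D" using 0 by (auto simp: D_def)
  have "0 \<in> C" using 0 by (simp add: C_def)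
  have "- K \<inter> C = {}"
  proof (rule ccontr)
    assume "- K \<inter> C \<noteq> {}"
    moreover have "D \<inter> C \<noteq> {}" using \<open>0 \<in> D\<close> \<open>0 \<in> C\<close> by blast
    moreover have "C \<subseteq> D \<union> - K" using KD C(2) by blast
    moreover have "D \<inter> - K \<inter> C = {}" using DK by blast
    moreover have "open (- K)" using K by (simp add: compact_imp_closed open_Compl)
    ultimately show False using C(1) oD unfolding connected_def by blast
  qed
  then have "C \<subseteq> K" by blast
  then have "bounded C" using K bounded_subset compact_imp_bounded by blast
  then show ?thesis using 0 by (simp add: inside_def C_def)
qed

text \<open>The cross product of position and velocity: it is positive exactly when the motion turns
  counterclockwise around the origin.\<close>

definition det2 :: "plane \<Rightarrow> plane \<Rightarrow> real" where
  "det2 p w = fst p * snd w - snd p * fst w"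

lemma start_axis_minus: "start_axis (- \<nu>) = - start_axis \<nu>"
  by (simp add: start_axis_def prod_eq_iff)

lemma start_axis_frame:
  assumes "norm \<nu> = 1"
  shows "\<nu> \<bullet> start_axis \<nu> = 0" "start_axis \<nu> \<bullet> start_axis \<nu> = 1" "start_axis \<nu> \<noteq> 0"
    "(start_axis \<nu> \<bullet> p) * (\<nu> \<bullet> w) - (\<nu> \<bullet> p) * (start_axis \<nu> \<bullet> w) = det2 p w"
    "(start_axis \<nu> \<bullet> p) *\<^sub>R start_axis \<nu> + (\<nu> \<bullet> p) *\<^sub>R \<nu> = p"
proof -
  obtain a b where \<nu>: "\<nu> = (a, b)" by (cases \<nu>)
  have ab: "a * a + b * b = 1" using assms by (simp add: \<nu> norm_Pair power2_eq_square)
  have ab1: "x * (a * a) + x * (b * b) = x" for x using ab by (metis distrib_left mult.right_neutral)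
  obtain p1 p2 where p: "p = (p1, p2)" by (cases p)
  obtain w1 w2 where w: "w = (w1, w2)" by (cases w)
  show "\<nu> \<bullet> start_axis \<nu> = 0" "start_axis \<nu> \<bullet> start_axis \<nu> = 1"
    using ab by (auto simp: start_axis_def \<nu> inner_prod_def)
  then show "start_axis \<nu> \<noteq> 0" by auto
  have "(start_axis \<nu> \<bullet> p) * (\<nu> \<bullet> w) - (\<nu> \<bullet> p) * (start_axis \<nu> \<bullet> w) = (a * a + b * b) * det2 p w"
    by (simp add: start_axis_def \<nu> p w inner_prod_def det2_def) algebra
  then show "(start_axis \<nu> \<bullet> p) * (\<nu> \<bullet> w) - (\<nu> \<bullet> p) * (start_axis \<nu> \<bullet> w) = det2 p w" using ab by simp
  show "(start_axis \<nu> \<bullet> p) *\<^sub>R start_axis \<nu> + (\<nu> \<bullet> p) *\<^sub>R \<nu> = p"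
    using ab1[of p1] ab1[of p2] by (simp add: start_axis_def \<nu> p inner_prod_def algebra_simps)
qed

text \<open>The quotient is the cotangent of the polar angle measured from
  \<open>start_axis \<nu>\<close>. Its derivative is
  \<open>- det2 (\<gamma> t) w / (\<nu> \<bullet> \<gamma> t)\<^sup>2\<close>.\<close>

lemma slope_decreasing:
  fixes \<gamma> :: "real \<Rightarrow> plane"
  assumes \<nu>: "norm \<nu> = 1" and ab: "a < b"
    and d: "\<And>t. t \<in> {a..b} \<Longrightarrow> \<exists>w. (\<gamma> has_vector_derivative w) (at t) \<and> det2 (\<gamma> t) w > 0"
    and nz: "\<And>t. t \<in> {a..b} \<Longrightarrow> \<nu> \<bullet> \<gamma> t \<noteq> 0"
  shows "(start_axis \<nu> \<bullet> \<gamma> b) / (\<nu> \<bullet> \<gamma> b) < (start_axis \<nu> \<bullet> \<gamma> a) / (\<nu> \<bullet> \<gamma> a)"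
proof (rule DERIV_neg_imp_decreasing[OF ab])
  fix t assume "a \<le> t" "t \<le> b"
  then have t: "t \<in> {a..b}" by auto
  obtain w where w: "(\<gamma> has_vector_derivative w) (at t)" "det2 (\<gamma> t) w > 0" using d[OF t] by blast
  have "DERIV (\<lambda>t. (start_axis \<nu> \<bullet> \<gamma> t) / (\<nu> \<bullet> \<gamma> t)) t :>
      ((start_axis \<nu> \<bullet> w) * (\<nu> \<bullet> \<gamma> t) - (start_axis \<nu> \<bullet> \<gamma> t) * (\<nu> \<bullet> w)) / ((\<nu> \<bullet> \<gamma> t) * (\<nu> \<bullet> \<gamma> t))"
    by (intro DERIV_divide has_vector_derivative_inner_const w(1) nz t)
  moreover have "(start_axis \<nu> \<bullet> w) * (\<nu> \<bullet> \<gamma> t) - (start_axis \<nu> \<bullet> \<gamma> t) * (\<nu> \<bullet> w) = - det2 (\<gamma> t) w"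
    using start_axis_frame(4)[OF \<nu>, of "\<gamma> t" w] by (simp add: algebra_simps)
  ultimately have "DERIV (\<lambda>t. (start_axis \<nu> \<bullet> \<gamma> t) / (\<nu> \<bullet> \<gamma> t)) t :> - det2 (\<gamma> t) w / ((\<nu> \<bullet> \<gamma> t) * (\<nu> \<bullet> \<gamma> t))"
    by simp
  moreover have "- det2 (\<gamma> t) w / ((\<nu> \<bullet> \<gamma> t) * (\<nu> \<bullet> \<gamma> t)) < 0"
    using w(2) nz[OF t] by (intro divide_neg_pos) (auto simp: mult_pos_pos zero_less_mult_iff)
  ultimately show "\<exists>y. DERIV (\<lambda>t. (start_axis \<nu> \<bullet> \<gamma> t) / (\<nu> \<bullet> \<gamma> t)) t :> y \<and> y < 0" by blast
qed

text \<open>Existence is the intermediate value theorem for the determinant of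
  \<open>\<gamma> t\<close> and \<open>e\<close>, which changes sign between the two ends of the
  arc. Uniqueness is strict monotonicity of the cotangent of the polar angle in the open half
  plane.\<close>

lemma arc_ray:
  assumes \<nu>: "norm \<nu> = 1" and arc: "arc F \<nu> (start_axis \<nu>) r s T \<gamma>"
    and B: "\<gamma> ` {0..T} \<subseteq> B" and rot: "\<And>p. p \<in> B \<Longrightarrow> p \<noteq> 0 \<Longrightarrow> det2 p (F p) > 0"
    and e: "\<nu> \<bullet> e > 0"
  shows "\<exists>!t. t > 0 \<and> t *\<^sub>R e \<in> \<gamma> ` {0..T}"
proof -
  let ?u = "start_axis \<nu>"
  note fr = start_axis_frame[OF \<nu>]
  have T: "T > 0" and r: "r > 0" "s > 0" and ends: "\<gamma> 0 = r *\<^sub>R ?u" "\<gamma> T = - s *\<^sub>R ?u"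
    and d: "\<And>t. t \<in> {0..T} \<Longrightarrow> (\<gamma> has_vector_derivative F (\<gamma> t)) (at t within {0..T})"
    and pos: "\<And>t. t \<in> {0<..<T} \<Longrightarrow> \<nu> \<bullet> \<gamma> t > 0" using arc by (auto simp: arc_def)
  have c: "continuous_on {0..T} \<gamma>" by (rule continuous_on_vector_derivative[OF d])
  define h where "h t = (?u \<bullet> \<gamma> t) * (\<nu> \<bullet> e) - (\<nu> \<bullet> \<gamma> t) * (?u \<bullet> e)" for t
  have "continuous_on {0..T} h" unfolding h_def by (intro continuous_intros c)
  moreover have "h 0 > 0" "h T < 0" using r e fr by (auto simp: h_def ends)
  ultimately obtain t where t: "0 \<le> t" "t \<le> T" "h t = 0"
    using IVT2'[of h T 0 0] T by (auto simp: less_imp_le)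
  have "t \<noteq> 0" "t \<noteq> T" using t \<open>h 0 > 0\<close> \<open>h T < 0\<close> by auto
  then have tt: "t \<in> {0<..<T}" using t by auto
  define \<tau> where "\<tau> = (\<nu> \<bullet> \<gamma> t) / (\<nu> \<bullet> e)"
  have \<tau>: "\<tau> > 0" using pos[OF tt] e by (simp add: \<tau>_def)
  have "?u \<bullet> \<gamma> t = \<tau> * (?u \<bullet> e)" "\<nu> \<bullet> \<gamma> t = \<tau> * (\<nu> \<bullet> e)"
    using t(3) e by (auto simp: \<tau>_def h_def field_simps)
  then have "\<gamma> t = (\<tau> * (?u \<bullet> e)) *\<^sub>R ?u + (\<tau> * (\<nu> \<bullet> e)) *\<^sub>R \<nu>" using fr(5)[of "\<gamma> t"] by simp
  also have "\<dots> = \<tau> *\<^sub>R ((?u \<bullet> e) *\<^sub>R ?u + (\<nu> \<bullet> e) *\<^sub>R \<nu>)" by (simp add: scaleR_add_right)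
  also have "\<dots> = \<tau> *\<^sub>R e" using fr(5)[of e] by simp
  finally have ex: "\<tau> *\<^sub>R e \<in> \<gamma> ` {0..T}" using t by (metis atLeastAtMost_iff imageI)
  have slope: "t' \<in> {0<..<T} \<and> (?u \<bullet> \<gamma> t') / (\<nu> \<bullet> \<gamma> t') = (?u \<bullet> e) / (\<nu> \<bullet> e)"
    if "t' \<in> {0..T}" "\<gamma> t' = \<sigma> *\<^sub>R e" "\<sigma> > 0" for t' \<sigma>
  proof -
    have "\<nu> \<bullet> \<gamma> t' > 0" using that e by simp
    then have "t' \<noteq> 0" "t' \<noteq> T" using ends fr by auto
    then show ?thesis using that by auto
  qed
  have dec: "(?u \<bullet> \<gamma> t2) / (\<nu> \<bullet> \<gamma> t2) < (?u \<bullet> \<gamma> t1) / (\<nu> \<bullet> \<gamma> t1)"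
    if "t1 \<in> {0<..<T}" "t2 \<in> {0<..<T}" "t1 < t2" for t1 t2
  proof (rule slope_decreasing[OF \<nu> \<open>t1 < t2\<close>])
    fix x assume "x \<in> {t1..t2}"
    then have x: "x \<in> {0<..<T}" using that by auto
    show nz: "\<nu> \<bullet> \<gamma> x \<noteq> 0" using pos[OF x] by simp
    have "(\<gamma> has_vector_derivative F (\<gamma> x)) (at x)"
      using d[of x] x at_within_Icc_at[of 0 x T] by auto
    moreover have "det2 (\<gamma> x) (F (\<gamma> x)) > 0"
      using nz x B by (intro rot) auto
    ultimately show "\<exists>w. (\<gamma> has_vector_derivative w) (at x) \<and> det2 (\<gamma> x) w > 0" by blast
  qed
  show ?thesis
  proof (rule ex1I[of _ \<tau>])
    show "\<tau> > 0 \<and> \<tau> *\<^sub>R e \<in> \<gamma> ` {0..T}" using \<tau> ex by simp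
    fix \<sigma> assume \<sigma>: "\<sigma> > 0 \<and> \<sigma> *\<^sub>R e \<in> \<gamma> ` {0..T}"
    then obtain t1 where t1: "t1 \<in> {0..T}" "\<gamma> t1 = \<sigma> *\<^sub>R e" by auto
    obtain t2 where t2: "t2 \<in> {0..T}" "\<gamma> t2 = \<tau> *\<^sub>R e" using ex by auto
    have "\<not> t1 < t2" "\<not> t2 < t1"
      using slope[OF t1] slope[OF t2 \<tau>] \<sigma> dec[of t1 t2] dec[of t2 t1] by auto
    then have "t1 = t2" by auto
    then have "\<sigma> *\<^sub>R e = \<tau> *\<^sub>R e" using t1 t2 by auto
    moreover have "e \<noteq> 0" using e by auto
    ultimately show "\<sigma> = \<tau>" by simp
  qed
qed

lemma has_vector_derivative_shift:
  fixes f :: "real \<Rightarrow> 'a::real_normed_vector"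
  assumes "(f has_vector_derivative v) (at (t + c) within ((\<lambda>x. x + c) ` S))"
  shows "((\<lambda>t. f (t + c)) has_vector_derivative v) (at t within S)"
proof -
  have "((\<lambda>t. t + c) has_vector_derivative 1) (at t within S)"
    by (auto intro!: derivative_eq_intros)
  from vector_diff_chain_within[OF this, of f v] assms show ?thesis by (simp add: o_def)
qed

lemma has_vector_derivative_at_right:
  fixes f :: "real \<Rightarrow> 'a::real_normed_vector"
  assumes "(f has_vector_derivative v) (at a within {a..b})" "a < b" "\<And>t. t \<in> {a..b} \<Longrightarrow> g t = f t"
  shows "(g has_vector_derivative v) (at_right a)"
proof -
  have "(g has_vector_derivative v) (at a within {a..b})"
    by (rule has_vector_derivative_transform[OF _ _ assms(1)]) (use assms in auto)
  then show ?thesis using assms(2) by (simp add: at_within_Icc_at_right)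
qed

lemma has_vector_derivative_at_left:
  fixes f :: "real \<Rightarrow> 'a::real_normed_vector"
  assumes "(f has_vector_derivative v) (at b within {a..b})" "a < b" "\<And>t. t \<in> {a..b} \<Longrightarrow> g t = f t"
  shows "(g has_vector_derivative v) (at_left b)"
proof -
  have "(g has_vector_derivative v) (at b within {a..b})"
    by (rule has_vector_derivative_transform[OF _ _ assms(1)]) (use assms in auto)
  then show ?thesis using assms(2) by (simp add: at_within_Icc_at_left)
qed

lemma has_vector_derivative_at_interior:
  fixes f :: "real \<Rightarrow> 'a::real_normed_vector"
  assumes "(f has_vector_derivative v) (at t within {a..b})" "a < t" "t < b" "\<And>t. t \<in> {a..b} \<Longrightarrow> g t = f t"
  shows "(g has_vector_derivative v) (at t)"
proof -
  have "(g has_vector_derivative v) (at t within {a..b})"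
    by (rule has_vector_derivative_transform[OF _ _ assms(1)]) (use assms in auto)
  then show ?thesis using assms(2,3) by (simp add: at_within_Icc_at)
qed

text \<open>Construction and isolation of cycles rest on two properties of the fields only: the
  Lipschitz bound, for uniqueness, and counterclockwise rotation on \<open>B\<close> away from the
  origin.\<close>

locale rot_system =
  fixes X Y :: field and \<nu> :: plane and B :: "plane set"
  assumes \<nu>: "norm \<nu> = 1" and lip: "lip_balls X" "lip_balls Y"
    and rotX: "p \<in> B \<Longrightarrow> p \<noteq> 0 \<Longrightarrow> det2 p (X p) > 0"
    and rotY: "p \<in> B \<Longrightarrow> p \<noteq> 0 \<Longrightarrow> det2 p (Y p) > 0"
begin

abbreviation u where "u \<equiv> start_axis \<nu>"

lemmas frame = start_axis_frame[OF \<nu>]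

lemma swap: "rot_system Y X (- \<nu>) B"
  by unfold_locales (use \<nu> lip rotX rotY in auto)

lemma axis:
  assumes "\<nu> \<bullet> p = 0"
  shows "p = (u \<bullet> p) *\<^sub>R u" and "(u \<bullet> p) * (\<nu> \<bullet> w) = det2 p w"
  using frame(5)[of p] frame(4)[of p w] assms by auto

text \<open>On the separation line \<open>det2\<close> reduces to the product of
  \<open>u \<bullet> p\<close> and the normal component of the field. Rotation therefore makes every
  nonzero point of the line in \<open>B\<close> a crossing point, and the half-axis alone decides
  the direction of crossing.\<close>

lemma axis_sign:
  assumes p: "\<nu> \<bullet> p = 0" "p \<in> B" "p \<noteq> 0"
  shows "u \<bullet> p \<noteq> 0" "\<nu> \<bullet> X p > 0 \<longleftrightarrow> u \<bullet> p > 0" "\<nu> \<bullet> Y p > 0 \<longleftrightarrow> u \<bullet> p > 0"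
    "\<nu> \<bullet> X p < 0 \<longleftrightarrow> u \<bullet> p < 0" "\<nu> \<bullet> Y p < 0 \<longleftrightarrow> u \<bullet> p < 0" "crossing_point X Y \<nu> p"
proof -
  show nz: "u \<bullet> p \<noteq> 0" using axis(1)[OF p(1)] p(3) by auto
  have "(u \<bullet> p) * (\<nu> \<bullet> X p) > 0" "(u \<bullet> p) * (\<nu> \<bullet> Y p) > 0"
    using axis(2)[OF p(1)] rotX[OF p(2,3)] rotY[OF p(2,3)] by auto
  then show "\<nu> \<bullet> X p > 0 \<longleftrightarrow> u \<bullet> p > 0" "\<nu> \<bullet> Y p > 0 \<longleftrightarrow> u \<bullet> p > 0"
    "\<nu> \<bullet> X p < 0 \<longleftrightarrow> u \<bullet> p < 0" "\<nu> \<bullet> Y p < 0 \<longleftrightarrow> u \<bullet> p < 0" "crossing_point X Y \<nu> p"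
    using p(1) by (auto simp: crossing_point_def zero_less_mult_iff)
qed

end

section \<open>Concatenation of two half orbits into a crossing periodic orbit\<close>

locale two_arcs = rot_system +
  fixes r s T1 T2 :: real and \<gamma>1 \<gamma>2 :: "real \<Rightarrow> plane"
  assumes arc1: "arc X \<nu> u r s T1 \<gamma>1" and arc2: "arc Y (- \<nu>) (- u) s r T2 \<gamma>2"
    and in_B: "\<gamma>1 ` {0..T1} \<subseteq> B" "\<gamma>2 ` {0..T2} \<subseteq> B"
begin

definition "cycle = \<gamma>1 ` {0..T1} \<union> \<gamma>2 ` {0..T2}"

lemma r: "r > 0" "s > 0" and T: "T1 > 0" "T2 > 0"
  and ends1: "\<gamma>1 0 = r *\<^sub>R u" "\<gamma>1 T1 = - s *\<^sub>R u"
  and ends2: "\<gamma>2 0 = - s *\<^sub>R u" "\<gamma>2 T2 = r *\<^sub>R u"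
  and d1: "t \<in> {0..T1} \<Longrightarrow> (\<gamma>1 has_vector_derivative X (\<gamma>1 t)) (at t within {0..T1})"
  and d2: "t \<in> {0..T2} \<Longrightarrow> (\<gamma>2 has_vector_derivative Y (\<gamma>2 t)) (at t within {0..T2})"
  and pos1: "t \<in> {0<..<T1} \<Longrightarrow> \<nu> \<bullet> \<gamma>1 t > 0"
  and pos2: "t \<in> {0<..<T2} \<Longrightarrow> \<nu> \<bullet> \<gamma>2 t < 0"
  using arc1 arc2 by (auto simp: arc_def)

lemma cont1: "continuous_on {0..T1} \<gamma>1" and cont2: "continuous_on {0..T2} \<gamma>2"
  using continuous_on_vector_derivative[OF d1] continuous_on_vector_derivative[OF d2] by auto

lemma compact_cycle: "compact cycle"
  unfolding cycle_def by (intro compact_Un compact_continuous_image cont1 cont2 compact_Icc)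

lemma cycle_axis:
  assumes "p \<in> cycle" "\<nu> \<bullet> p = 0" shows "p = r *\<^sub>R u \<or> p = - s *\<^sub>R u"
proof -
  from assms(1) consider t where "t \<in> {0..T1}" "p = \<gamma>1 t" | t where "t \<in> {0..T2}" "p = \<gamma>2 t"
    by (auto simp: cycle_def)
  then show ?thesis
  proof cases
    case (1 t)
    then have "t = 0 \<or> t = T1" using pos1[of t] assms(2) by fastforce
    then show ?thesis using 1 ends1 by auto
  next
    case (2 t)
    then have "t = 0 \<or> t = T2" using pos2[of t] assms(2) by fastforce
    then show ?thesis using 2 ends2 by auto
  qed
qed

lemma ray_pos: "t *\<^sub>R u \<in> cycle \<and> t > 0 \<longleftrightarrow> t = r"
proof
  assume t: "t *\<^sub>R u \<in> cycle \<and> t > 0"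
  then have "t *\<^sub>R u = r *\<^sub>R u \<or> t *\<^sub>R u = - s *\<^sub>R u" using cycle_axis[of "t *\<^sub>R u"] frame by auto
  then show "t = r" using t r frame(3) by (metis neg_0_less_iff_less less_asym scaleR_cancel_right)
next
  assume "t = r"
  moreover have "r *\<^sub>R u \<in> cycle" unfolding cycle_def ends1(1)[symmetric] using T by auto
  ultimately show "t *\<^sub>R u \<in> cycle \<and> t > 0" using r by auto
qed

lemma ray_neg: "(- t) *\<^sub>R u \<in> cycle \<and> t > 0 \<longleftrightarrow> t = s"
proof
  assume t: "(- t) *\<^sub>R u \<in> cycle \<and> t > 0"
  then have "(- t) *\<^sub>R u = r *\<^sub>R u \<or> (- t) *\<^sub>R u = - s *\<^sub>R u" using cycle_axis[of "(- t) *\<^sub>R u"] frame by auto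
  then have "- t = r \<or> - t = - s" using frame(3) by (metis scaleR_cancel_right)
  then show "t = s" using t r by auto
next
  assume "t = s"
  moreover have "- s *\<^sub>R u \<in> cycle" unfolding cycle_def ends1(2)[symmetric] using T by auto
  ultimately show "(- t) *\<^sub>R u \<in> cycle \<and> t > 0" using r by auto
qed

lemma zero_notin_cycle: "0 \<notin> cycle"
  using cycle_axis[of 0] r frame(3) by auto

lemma side1: "t \<in> {0..T1} \<Longrightarrow> \<nu> \<bullet> \<gamma>1 t \<ge> 0"
  using pos1[of t] ends1 frame by (cases "t = 0 \<or> t = T1") (auto simp: less_imp_le)

lemma side2: "t \<in> {0..T2} \<Longrightarrow> \<nu> \<bullet> \<gamma>2 t \<le> 0"
  using pos2[of t] ends2 frame by (cases "t = 0 \<or> t = T2") (auto simp: less_imp_le)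

text \<open>A ray in an open half plane can meet only the arc on that side, where
  \<open>arc_ray\<close> applies. The two rays inside the separation line meet the cycle at
  \<open>r *\<^sub>R u\<close> and at \<open>- s *\<^sub>R u\<close>.\<close>

lemma zero_inside_cycle: "0 \<in> inside cycle"
proof (rule inside_if_rays[OF compact_cycle _ zero_notin_cycle])
  show "cycle \<noteq> {}" using T by (auto simp: cycle_def)
  fix e :: plane assume e: "e \<noteq> 0"
  consider "\<nu> \<bullet> e > 0" | "\<nu> \<bullet> e < 0" | "\<nu> \<bullet> e = 0" by linarith
  then show "\<exists>!t. t > 0 \<and> t *\<^sub>R e \<in> cycle"
  proof cases
    case 1
    have "(t > 0 \<and> t *\<^sub>R e \<in> cycle) \<longleftrightarrow> (t > 0 \<and> t *\<^sub>R e \<in> \<gamma>1 ` {0..T1})" for t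
    proof -
      have "t *\<^sub>R e \<notin> \<gamma>2 ` {0..T2}" if "t > 0"
      proof
        assume "t *\<^sub>R e \<in> \<gamma>2 ` {0..T2}"
        then obtain x where x: "x \<in> {0..T2}" "t *\<^sub>R e = \<gamma>2 x" by blast
        have "\<nu> \<bullet> (t *\<^sub>R e) \<le> 0" unfolding x(2) by (rule side2[OF x(1)])
        then show False using that 1 by (simp add: mult_le_0_iff)
      qed
      then show ?thesis by (auto simp: cycle_def)
    qed
    then show ?thesis using arc_ray[OF \<nu> arc1 in_B(1) rotX 1] by simp
  next
    case 2
    have "(t > 0 \<and> t *\<^sub>R e \<in> cycle) \<longleftrightarrow> (t > 0 \<and> t *\<^sub>R e \<in> \<gamma>2 ` {0..T2})" for t
    proof -
      have "t *\<^sub>R e \<notin> \<gamma>1 ` {0..T1}" if "t > 0"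
      proof
        assume "t *\<^sub>R e \<in> \<gamma>1 ` {0..T1}"
        then obtain x where x: "x \<in> {0..T1}" "t *\<^sub>R e = \<gamma>1 x" by blast
        have "\<nu> \<bullet> (t *\<^sub>R e) \<ge> 0" unfolding x(2) by (rule side1[OF x(1)])
        then show False using that 2 by (simp add: zero_le_mult_iff)
      qed
      then show ?thesis by (auto simp: cycle_def)
    qed
    moreover have "\<exists>!t. t > 0 \<and> t *\<^sub>R e \<in> \<gamma>2 ` {0..T2}"
      by (rule arc_ray[of "- \<nu>" Y s r T2 \<gamma>2 B]) (use \<nu> arc2 in_B(2) rotY 2 in \<open>auto simp: start_axis_minus\<close>)
    ultimately show ?thesis by simp
  next
    case 3
    define c where "c = u \<bullet> e"
    have e': "e = c *\<^sub>R u" using axis(1)[OF 3] by (simp add: c_def)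
    then have "c \<noteq> 0" using e by auto
    then consider "c > 0" | "c < 0" by linarith
    then show ?thesis
    proof cases
      case 1
      have "(t > 0 \<and> t *\<^sub>R e \<in> cycle) \<longleftrightarrow> t = r / c" for t
        using ray_pos[of "t * c"] 1 by (auto simp: e' field_simps zero_less_mult_iff)
      then show ?thesis by simp
    next
      case 2
      have "(t > 0 \<and> t *\<^sub>R e \<in> cycle) \<longleftrightarrow> t = - s / c" for t
        using ray_neg[of "- (t * c)"] 2 by (auto simp: e' field_simps zero_less_mult_iff mult_less_0_iff)
      then show ?thesis by simp
    qed
  qed
qed

text \<open>\<open>crossing_solution\<close> demands derivatives at every real time, so the closed
  curve is unrolled to the whole line by reducing time modulo the period.\<close>

definition "\<gamma> t = (let t' = (T1 + T2) * frac (t / (T1 + T2)) in if t' \<le> T1 then \<gamma>1 t' else \<gamma>2 (t' - T1))"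

lemma \<gamma>_periodic: "\<gamma> (t + (T1 + T2)) = \<gamma> t"
proof -
  have "(t + (T1 + T2)) / (T1 + T2) = t / (T1 + T2) + 1" using T by (simp add: field_simps)
  then show ?thesis by (simp add: \<gamma>_def frac_1_eq)
qed

lemma \<gamma>_periodic_int: "\<gamma> (t + of_int k * (T1 + T2)) = \<gamma> t"
proof -
  have "(t + of_int k * (T1 + T2)) / (T1 + T2) = t / (T1 + T2) + of_int k" using T by (simp add: field_simps)
  then show ?thesis by (simp add: \<gamma>_def frac_def)
qed

lemma \<gamma>_1: "t \<in> {0..T1} \<Longrightarrow> \<gamma> t = \<gamma>1 t"
proof -
  assume t: "t \<in> {0..T1}"
  then have "frac (t / (T1 + T2)) = t / (T1 + T2)" using T by (intro frac_eq[THEN iffD2]) (auto simp: field_simps)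
  then show ?thesis using t T by (simp add: \<gamma>_def)
qed

lemma \<gamma>_2: "t \<in> {T1..T1 + T2} \<Longrightarrow> \<gamma> t = \<gamma>2 (t - T1)"
proof -
  assume t: "t \<in> {T1..T1 + T2}"
  consider "t = T1 + T2" | "t = T1" | "T1 < t" "t < T1 + T2" using t by fastforce
  then show ?thesis
  proof cases
    case 1 then show ?thesis using \<gamma>_periodic[of 0] \<gamma>_1[of 0] T ends1 ends2 by simp
  next
    case 2 then show ?thesis using \<gamma>_1[of T1] T ends1 ends2 by simp
  next
    case 3
    then have "frac (t / (T1 + T2)) = t / (T1 + T2)" using T by (intro frac_eq[THEN iffD2]) (auto simp: field_simps)
    then show ?thesis using 3 T by (simp add: \<gamma>_def)
  qed
qed

text \<open>The end of the preceding period, needed for the left derivative at time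
  \<open>0\<close>.\<close>

lemma \<gamma>_0: "t \<in> {- T2..0} \<Longrightarrow> \<gamma> t = \<gamma>2 (t + T2)"
  using \<gamma>_2[of "t + (T1 + T2)"] \<gamma>_periodic[of t] by (simp add: algebra_simps)

lemma range_\<gamma>: "range \<gamma> = cycle"
proof
  show "range \<gamma> \<subseteq> cycle"
  proof
    fix p assume "p \<in> range \<gamma>"
    then obtain t where p: "p = \<gamma> t" by auto
    define t' where "t' = (T1 + T2) * frac (t / (T1 + T2))"
    have "0 \<le> t'" "t' < T1 + T2" using T frac_lt_1[of "t / (T1 + T2)"] by (auto simp: t'_def)
    then show "p \<in> cycle" unfolding p \<gamma>_def Let_def t'_def[symmetric] cycle_def by auto
  qed
  show "cycle \<subseteq> range \<gamma>"
  proof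
    fix p assume "p \<in> cycle"
    then consider t where "t \<in> {0..T1}" "p = \<gamma>1 t" | t where "t \<in> {0..T2}" "p = \<gamma>2 t"
      by (auto simp: cycle_def)
    then show "p \<in> range \<gamma>"
    proof cases
      case (1 t) then show ?thesis using \<gamma>_1[of t] by (metis rangeI)
    next
      case (2 t)
      then have "p = \<gamma> (t + T1)" using \<gamma>_2[of "t + T1"] by simp
      then show ?thesis by blast
    qed
  qed
qed

lemma cycle_subset: "cycle \<subseteq> B" using in_B by (auto simp: cycle_def)

text \<open>The pointwise body of \<open>crossing_solution\<close>, isolated so that it can be moved
  by whole periods.\<close>

definition "good f t \<longleftrightarrow>
     (\<nu> \<bullet> f t > 0 \<longrightarrow> (f has_vector_derivative X (f t)) (at t)) \<and>
     (\<nu> \<bullet> f t < 0 \<longrightarrow> (f has_vector_derivative Y (f t)) (at t)) \<and>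
     (\<nu> \<bullet> f t = 0 \<longrightarrow> crossing_point X Y \<nu> (f t) \<and>
       (if \<nu> \<bullet> X (f t) > 0
        then (f has_vector_derivative Y (f t)) (at_left t) \<and>
             (f has_vector_derivative X (f t)) (at_right t)
        else (f has_vector_derivative X (f t)) (at_left t) \<and>
             (f has_vector_derivative Y (f t)) (at_right t)))"

lemma deriv_\<gamma>_1:
  assumes "t \<in> {0..T1}"
  shows "(\<gamma> has_vector_derivative X (\<gamma> t)) (at t within {0..T1})"
  using has_vector_derivative_transform[OF assms _ d1[OF assms], of \<gamma>] \<gamma>_1 assms by auto

lemma deriv_\<gamma>_2:
  assumes "t \<in> {T1..T1 + T2}"
  shows "(\<gamma> has_vector_derivative Y (\<gamma> t)) (at t within {T1..T1 + T2})"
proof -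
  have "(\<lambda>x. x + - T1) ` {T1..T1 + T2} = {0..T2}" by (simp add: image_add_atLeastAtMost' del: add_uminus_conv_diff)
  then have "((\<lambda>t. \<gamma>2 (t + - T1)) has_vector_derivative Y (\<gamma>2 (t + - T1))) (at t within {T1..T1 + T2})"
    using d2[of "t + - T1"] assms by (intro has_vector_derivative_shift) auto
  from has_vector_derivative_transform[OF assms _ this, of \<gamma>] show ?thesis
    using \<gamma>_2 assms by auto
qed

lemma deriv_\<gamma>_0:
  assumes "t \<in> {- T2..0}"
  shows "(\<gamma> has_vector_derivative Y (\<gamma> t)) (at t within {- T2..0})"
proof -
  have "(\<lambda>x. x + T2) ` {- T2..0} = {0..T2}" by (simp add: image_add_atLeastAtMost')
  then have "((\<lambda>t. \<gamma>2 (t + T2)) has_vector_derivative Y (\<gamma>2 (t + T2))) (at t within {- T2..0})"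
    using d2[of "t + T2"] assms by (intro has_vector_derivative_shift) auto
  from has_vector_derivative_transform[OF assms _ this, of \<gamma>] show ?thesis
    using \<gamma>_0 assms by auto
qed

text \<open>One period is enough. It is taken as \<open>{- T2<..T1}\<close> because around both
  crossing times \<open>0\<close> and \<open>T1\<close> the curve is then given by explicit pieces
  on either side.\<close>

lemma good_\<gamma>_base:
  assumes t: "t \<in> {- T2<..T1}" shows "good \<gamma> t"
proof -
  consider "- T2 < t" "t < 0" | "t = 0" | "0 < t" "t < T1" | "t = T1" using t by fastforce
  then show ?thesis
  proof cases
    case 1
    then have "\<gamma> t = \<gamma>2 (t + T2)" "\<nu> \<bullet> \<gamma>2 (t + T2) < 0" using \<gamma>_0[of t] pos2[of "t + T2"] by auto
    moreover have "(\<gamma> has_vector_derivative Y (\<gamma> t)) (at t)"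
      using has_vector_derivative_at_interior[OF deriv_\<gamma>_0] 1 by auto
    ultimately show ?thesis by (auto simp: good_def)
  next
    case 3
    then have "\<gamma> t = \<gamma>1 t" "\<nu> \<bullet> \<gamma>1 t > 0" using \<gamma>_1[of t] pos1[of t] by auto
    moreover have "(\<gamma> has_vector_derivative X (\<gamma> t)) (at t)"
      using has_vector_derivative_at_interior[OF deriv_\<gamma>_1] 3 by auto
    ultimately show ?thesis by (auto simp: good_def)
  next
    case 2
    have g: "\<gamma> t = r *\<^sub>R u" using \<gamma>_1[of t] 2 T ends1 by auto
    have inB: "\<gamma> t \<in> B" using cycle_subset range_\<gamma> by blast
    have ax: "\<nu> \<bullet> \<gamma> t = 0" "\<gamma> t \<noteq> 0" "u \<bullet> \<gamma> t > 0"
      using g frame(1-3) r by auto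
    moreover have "(\<gamma> has_vector_derivative X (\<gamma> t)) (at_right t)"
      using has_vector_derivative_at_right[OF deriv_\<gamma>_1] 2 T by auto
    moreover have "(\<gamma> has_vector_derivative Y (\<gamma> t)) (at_left t)"
      using has_vector_derivative_at_left[OF deriv_\<gamma>_0] 2 T by auto
    ultimately show ?thesis using axis_sign[OF ax(1) inB ax(2)] by (auto simp: good_def)
  next
    case 4
    have g: "\<gamma> t = - s *\<^sub>R u" using \<gamma>_1[of t] 4 T ends1 by auto
    have inB: "\<gamma> t \<in> B" using cycle_subset range_\<gamma> by blast
    have ax: "\<nu> \<bullet> \<gamma> t = 0" "\<gamma> t \<noteq> 0" "u \<bullet> \<gamma> t < 0"
      using g frame(1-3) r by auto
    moreover have "(\<gamma> has_vector_derivative X (\<gamma> t)) (at_left t)"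
      using has_vector_derivative_at_left[OF deriv_\<gamma>_1] 4 T by auto
    moreover have "(\<gamma> has_vector_derivative Y (\<gamma> t)) (at_right t)"
      using has_vector_derivative_at_right[OF deriv_\<gamma>_2] 4 T by auto
    ultimately show ?thesis using axis_sign[OF ax(1) inB ax(2)] by (auto simp: good_def)
  qed
qed

lemma good_shift:
  assumes "good \<gamma> t" shows "good \<gamma> (t + of_int k * (T1 + T2))"
proof -
  let ?c = "of_int k * (T1 + T2) :: real"
  have eq: "\<gamma> = (\<lambda>x. \<gamma> (x + - ?c))"
    using \<gamma>_periodic_int[of _ "- k"] by (auto simp: fun_eq_iff)
  have val: "\<gamma> (t + ?c) = \<gamma> t" by (rule \<gamma>_periodic_int)
  have sh: "(\<gamma> has_vector_derivative v) (at (t + ?c) within S)"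
    if "(\<gamma> has_vector_derivative v) (at t within ((\<lambda>x. x + - ?c) ` S))" for v S
    by (subst eq, rule has_vector_derivative_shift) (use that in simp)
  have im: "(\<lambda>x. x + - ?c) ` UNIV = UNIV" "(\<lambda>x. x + - ?c) ` {..<t + ?c} = {..<t}"
    "(\<lambda>x. x + - ?c) ` {t + ?c<..} = {t<..}"
    by (auto intro!: image_eqI[of _ _ "_ + ?c"])
  show ?thesis using assms unfolding good_def val
    using sh[of _ UNIV, unfolded im(1)] sh[of _ "{..<t + ?c}", unfolded im(2)]
      sh[of _ "{t + ?c<..}", unfolded im(3)] by auto
qed

lemma crossing_periodic_orbit_cycle: "crossing_periodic_orbit X Y \<nu> cycle"
proof -
  have "good \<gamma> t" for t
  proof -
    define k where "k = \<lfloor>(t + T2) / (T1 + T2)\<rfloor>"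
    have "of_int k \<le> (t + T2) / (T1 + T2)" "(t + T2) / (T1 + T2) < of_int k + 1"
      by (auto simp: k_def)
    then have k: "of_int k * (T1 + T2) \<le> t + T2" "t + T2 < of_int k * (T1 + T2) + (T1 + T2)"
      using T by (auto simp: field_simps)
    \<comment> \<open>The reduced time lies in \<open>{- T2..<T1}\<close>. Its left end is missing
      from the base period; that case is reached from \<open>T1\<close>, moved by one period
      less.\<close>
    show ?thesis
    proof (cases "of_int k * (T1 + T2) = t + T2")
      case False
      then have "good \<gamma> (t - of_int k * (T1 + T2))" using k by (intro good_\<gamma>_base) auto
      from good_shift[OF this, of k] show ?thesis by simp
    next
      case True
      have "good \<gamma> T1" using T by (intro good_\<gamma>_base) auto
      from good_shift[OF this, of "k - 1"] have "good \<gamma> (T1 + of_int (k - 1) * (T1 + T2))" .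
      also have "T1 + of_int (k - 1) * (T1 + T2) = t" using True by (simp add: algebra_simps)
      finally show ?thesis .
    qed
  qed
  then have "crossing_solution X Y \<nu> \<gamma>"
    unfolding crossing_solution_def good_def by blast
  moreover have "\<gamma> T1 \<noteq> \<gamma> 0"
  proof
    assume "\<gamma> T1 = \<gamma> 0"
    then have "(- s) *\<^sub>R u = r *\<^sub>R u" using \<gamma>_1 T ends1 by auto
    then have "- s = r" using frame(3) by (metis scaleR_cancel_right)
    then show False using r by auto
  qed
  ultimately show ?thesis unfolding crossing_periodic_orbit_def range_\<gamma>[symmetric]
    using T \<gamma>_periodic by (metis add_pos_pos)
qed

end

section \<open>Isolation of crossing periodic orbits\<close>

text \<open>Exchanging the two sides turns each statement about leaving the positive half-axis into
  one about leaving the negative half-axis.\<close>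

lemma crossing_solution_swap:
  assumes "crossing_solution X Y \<nu> g" shows "crossing_solution Y X (- \<nu>) g"
  unfolding crossing_solution_def
proof (intro allI conjI impI)
  fix t
  note sol = assms[unfolded crossing_solution_def, rule_format, of t]
  show "(g has_vector_derivative Y (g t)) (at t)" if "- \<nu> \<bullet> g t > 0" using sol that by simp
  show "(g has_vector_derivative X (g t)) (at t)" if "- \<nu> \<bullet> g t < 0" using sol that by simp
  assume "- \<nu> \<bullet> g t = 0"
  then have 0: "\<nu> \<bullet> g t = 0" by simp
  then have cp: "(\<nu> \<bullet> X (g t)) * (\<nu> \<bullet> Y (g t)) > 0" using sol by (auto simp: crossing_point_def)
  then show "crossing_point Y X (- \<nu>) (g t)" using 0 by (auto simp: crossing_point_def mult.commute)
  show "if - \<nu> \<bullet> Y (g t) > 0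
        then (g has_vector_derivative X (g t)) (at_left t) \<and> (g has_vector_derivative Y (g t)) (at_right t)
        else (g has_vector_derivative Y (g t)) (at_left t) \<and> (g has_vector_derivative X (g t)) (at_right t)"
    using sol 0 cp by (auto simp: zero_less_mult_iff split: if_splits)
qed

lemma crossing_solution_isCont:
  assumes "crossing_solution X Y \<nu> g" shows "isCont g t"
proof -
  note sol = assms[unfolded crossing_solution_def, rule_format, of t]
  consider "\<nu> \<bullet> g t > 0" | "\<nu> \<bullet> g t < 0" | "\<nu> \<bullet> g t = 0" by linarith
  then show ?thesis
  proof cases
    case 3
    then obtain v w where "(g has_vector_derivative v) (at_left t)" "(g has_vector_derivative w) (at_right t)"
      using sol by meson
    then show ?thesis
      unfolding continuous_at_split using has_vector_derivative_continuous by blast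
  qed (use sol has_vector_derivative_continuous in \<open>blast+\<close>)
qed

text \<open>An arbitrary crossing periodic orbit in \<open>B\<close> that avoids the origin, not
  known to come from two arcs. The aim is to cut it at its crossings into arcs, to which uniqueness
  applies.\<close>

locale periodic_solution = rot_system +
  fixes g :: "real \<Rightarrow> plane" and T :: real
  assumes sol: "crossing_solution X Y \<nu> g" and T: "T > 0" and per: "g (t + T) = g t"
    and range_B: "range g \<subseteq> B" and zero_notin: "0 \<notin> range g"
begin

lemma swap': "periodic_solution Y X (- \<nu>) B g T"
  using swap crossing_solution_swap[OF sol] T per range_B zero_notin
  by (auto simp: periodic_solution_def periodic_solution_axioms_def)

lemma solD:
  "\<nu> \<bullet> g t > 0 \<Longrightarrow> (g has_vector_derivative X (g t)) (at t)"
  "\<nu> \<bullet> g t < 0 \<Longrightarrow> (g has_vector_derivative Y (g t)) (at t)"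
  using sol by (auto simp: crossing_solution_def)

lemma g_B: "g t \<in> B" "g t \<noteq> 0"
  using range_B zero_notin by (metis rangeI subsetD)+

lemma hit_sign:
  assumes "\<nu> \<bullet> g t = 0"
  shows "u \<bullet> g t \<noteq> 0" "\<nu> \<bullet> X (g t) > 0 \<longleftrightarrow> u \<bullet> g t > 0" "\<nu> \<bullet> Y (g t) > 0 \<longleftrightarrow> u \<bullet> g t > 0"
  using axis_sign[OF assms g_B] by auto

lemma hit_deriv:
  assumes "\<nu> \<bullet> g t = 0"
  shows "u \<bullet> g t > 0 \<Longrightarrow> (g has_vector_derivative Y (g t)) (at_left t)"
    "u \<bullet> g t > 0 \<Longrightarrow> (g has_vector_derivative X (g t)) (at_right t)"
    "u \<bullet> g t < 0 \<Longrightarrow> (g has_vector_derivative X (g t)) (at_left t)"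
    "u \<bullet> g t < 0 \<Longrightarrow> (g has_vector_derivative Y (g t)) (at_right t)"
  using sol[unfolded crossing_solution_def, rule_format, of t] assms hit_sign[OF assms]
  by (auto split: if_splits)

lemma cont: "isCont g t" by (rule crossing_solution_isCont[OF sol])

lemma cont_on: "continuous_on S g" using cont by (simp add: continuous_at_imp_continuous_on)

lemma per_nat: "g (t + of_nat n * T) = g t"
proof (induction n)
  case (Suc n)
  have "g (t + of_nat (Suc n) * T) = g (t + of_nat n * T + T)" by (simp add: algebra_simps)
  then show ?case using per Suc by simp
qed simp

lemma per_int: "g (t + of_int k * T) = g t"
proof (cases "k \<ge> 0")
  case True then show ?thesis using per_nat[of t "nat k"] by simp
next
  case False
  then have "of_nat (nat (- k)) = (- of_int k :: real)" by simp
  then show ?thesis using per_nat[of "t + of_int k * T" "nat (- k)"] by simp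
qed

text \<open>Without a crossing the cotangent of the polar angle would decrease strictly over a full
  period and yet return to its initial value.\<close>

lemma hit_exists: "\<exists>t. \<nu> \<bullet> g t = 0"
proof (rule ccontr)
  assume "\<nexists>t. \<nu> \<bullet> g t = 0"
  then have nz: "\<nu> \<bullet> g t \<noteq> 0" for t by auto
  have "(u \<bullet> g T) / (\<nu> \<bullet> g T) < (u \<bullet> g 0) / (\<nu> \<bullet> g 0)"
  proof (rule slope_decreasing[OF \<nu> T])
    fix t
    show "\<exists>w. (g has_vector_derivative w) (at t) \<and> det2 (g t) w > 0"
      using nz[of t] solD[of t] rotX[OF g_B, of t] rotY[OF g_B, of t] by (meson linorder_neqE_linordered_idom)
  qed (use nz in auto)
  then show False using per[of 0] by simp
qed

text \<open>Right after the crossing the orbit is in the positive half plane, and by periodicity it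
  meets the line again. The first such point cannot be on the positive half-axis, because there
  orbits arrive from the negative half plane.\<close>

lemma next_hit:
  assumes hit: "\<nu> \<bullet> g t0 = 0" "u \<bullet> g t0 > 0"
  obtains t1 where "t0 < t1" "\<nu> \<bullet> g t1 = 0" "u \<bullet> g t1 < 0" "\<And>t. t0 < t \<Longrightarrow> t < t1 \<Longrightarrow> \<nu> \<bullet> g t > 0"
    "arc X \<nu> u (u \<bullet> g t0) (- (u \<bullet> g t1)) (t1 - t0) (\<lambda>t. g (t + t0))"
proof -
  have "((\<lambda>t. \<nu> \<bullet> g t) has_real_derivative \<nu> \<bullet> X (g t0)) (at t0 within {t0<..})"
    by (intro has_vector_derivative_inner_const hit_deriv hit)
  moreover have "\<nu> \<bullet> X (g t0) > 0" using hit_sign[OF hit(1)] hit(2) by simp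
  ultimately obtain d where d: "d > 0" "\<And>h. 0 < h \<Longrightarrow> h < d \<Longrightarrow> 0 < \<nu> \<bullet> g (t0 + h)"
    using has_real_derivative_pos_inc_right[of "\<lambda>t. \<nu> \<bullet> g t" "\<nu> \<bullet> X (g t0)" t0 "{t0<..}"] hit(1) by auto
  have Td: "d \<le> T" using d(2)[of T] T per[of t0] hit by (cases "d \<le> T") auto
  \<comment> \<open>Starting at \<open>t0 + d/2\<close> leaves out the zero at \<open>t0\<close>
    itself and loses nothing, as there is no zero between \<open>t0\<close> and
    \<open>t0 + d\<close>.\<close>
  define S where "S = {t0 + d/2..t0 + T} \<inter> {t. \<nu> \<bullet> g t = 0}"
  have "closed {t. \<nu> \<bullet> g t = 0}"
    by (intro closed_Collect_eq continuous_intros cont_on)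
  then have "compact S" unfolding S_def by (intro compact_Int_closed compact_Icc)
  moreover have "t0 + T \<in> S" using Td d per[of t0] hit by (auto simp: S_def)
  ultimately obtain t1 where t1: "t1 \<in> S" "\<And>t. t \<in> S \<Longrightarrow> t1 \<le> t"
    using compact_attains_inf[of S] by blast
  have lt: "t0 < t1" using t1(1) d by (auto simp: S_def)
  have pos: "\<nu> \<bullet> g t > 0" if t: "t0 < t" "t < t1" for t
  proof (cases "t < t0 + d")
    case True then show ?thesis using d(2)[of "t - t0"] t by simp
  next
    case False
    show ?thesis
    proof (rule ccontr)
      assume n: "\<not> 0 < \<nu> \<bullet> g t"
      have "\<exists>x\<ge>t0 + d/2. x \<le> t \<and> \<nu> \<bullet> g x = 0"
      proof (rule IVT2')
        show "\<nu> \<bullet> g t \<le> 0" using n by simp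
        show "0 \<le> \<nu> \<bullet> g (t0 + d/2)" using d(2)[of "d/2"] d(1) by simp
        show "t0 + d/2 \<le> t" using False d(1) by simp
        show "continuous_on {t0 + d/2..t} (\<lambda>x. \<nu> \<bullet> g x)" by (intro continuous_intros cont_on)
      qed
      then obtain x where "t0 + d/2 \<le> x" "x \<le> t" "\<nu> \<bullet> g x = 0" by auto
      then have "x \<in> S" using t t1(1) by (auto simp: S_def)
      from t1(2)[OF this] show False using \<open>x \<le> t\<close> t by simp
    qed
  qed
  have h1: "\<nu> \<bullet> g t1 = 0" using t1(1) by (simp add: S_def)
  have neg: "u \<bullet> g t1 < 0"
  proof (rule ccontr)
    assume "\<not> u \<bullet> g t1 < 0"
    then have p: "u \<bullet> g t1 > 0" using hit_sign(1)[OF h1] by simp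
    have "((\<lambda>t. \<nu> \<bullet> g t) has_real_derivative \<nu> \<bullet> Y (g t1)) (at t1 within {..<t1})"
      by (intro has_vector_derivative_inner_const hit_deriv h1 p)
    moreover have "\<nu> \<bullet> Y (g t1) > 0" using hit_sign[OF h1] p by simp
    ultimately obtain e where e: "e > 0" "\<And>h. 0 < h \<Longrightarrow> h < e \<Longrightarrow> \<nu> \<bullet> g (t1 - h) < 0"
      using has_real_derivative_pos_inc_left[of "\<lambda>t. \<nu> \<bullet> g t" "\<nu> \<bullet> Y (g t1)" t1 "{..<t1}"] h1 by auto
    define h where "h = min (e/2) ((t1 - t0)/2)"
    have "0 < h" "h < e" "t0 < t1 - h" "t1 - h < t1" using e lt by (auto simp: h_def min_def field_simps)
    then show False using e(2)[of h] pos[of "t1 - h"] by auto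
  qed
  have der: "(g has_vector_derivative X (g t)) (at t within {t0..t1})" if "t \<in> {t0..t1}" for t
  proof -
    consider "t = t0" | "t = t1" | "t0 < t" "t < t1" using \<open>t \<in> {t0..t1}\<close> by fastforce
    then show ?thesis
    proof cases
      case 1 then show ?thesis using hit_deriv(2)[OF hit] lt by (simp add: at_within_Icc_at_right)
    next
      case 2 then show ?thesis using hit_deriv(3)[OF h1 neg] lt by (simp add: at_within_Icc_at_left)
    next
      case 3 then show ?thesis using solD(1)[OF pos[OF 3]] by (rule_tac has_vector_derivative_at_within)
    qed
  qed
  have "arc X \<nu> u (u \<bullet> g t0) (- (u \<bullet> g t1)) (t1 - t0) (\<lambda>t. g (t + t0))"
    unfolding arc_def
  proof (intro conjI ballI)
    show "g (0 + t0) = (u \<bullet> g t0) *\<^sub>R u" using axis(1)[OF hit(1)] by simp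
    show "g (t1 - t0 + t0) = (- (u \<bullet> g t1)) *\<^sub>R - u" using axis(1)[OF h1] by simp
    fix t assume t: "t \<in> {0..t1 - t0}"
    have "(\<lambda>x. x + t0) ` {0..t1 - t0} = {t0..t1}" by (simp add: image_add_atLeastAtMost')
    then show "((\<lambda>t. g (t + t0)) has_vector_derivative X (g (t + t0))) (at t within {0..t1 - t0})"
      using der[of "t + t0"] t by (intro has_vector_derivative_shift) auto
  next
    fix t assume "t \<in> {0<..<t1 - t0}"
    then show "0 < \<nu> \<bullet> g (t + t0)" by (intro pos) auto
  qed (use lt hit neg in auto)
  from that[OF lt h1 neg pos this] show ?thesis .
qed

lemma next_hit':
  assumes hit: "\<nu> \<bullet> g t0 = 0" "u \<bullet> g t0 < 0"
  obtains t1 where "t0 < t1" "\<nu> \<bullet> g t1 = 0" "u \<bullet> g t1 > 0" "\<And>t. t0 < t \<Longrightarrow> t < t1 \<Longrightarrow> \<nu> \<bullet> g t < 0"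
    "arc Y (- \<nu>) (- u) (- (u \<bullet> g t0)) (u \<bullet> g t1) (t1 - t0) (\<lambda>t. g (t + t0))"
proof -
  interpret sw: periodic_solution Y X "- \<nu>" B g T by (rule swap')
  show ?thesis
    by (rule sw.next_hit[of t0]) (use hit that in \<open>auto simp: start_axis_minus\<close>)
qed

definition "start t \<longleftrightarrow> \<nu> \<bullet> g t = 0 \<and> u \<bullet> g t > 0"

text \<open>The orbit avoids the origin, so the strict sign may be relaxed. This makes the set of
  crossing times closed, and extremal crossings are attained.\<close>

lemma start_closed: "start t \<longleftrightarrow> \<nu> \<bullet> g t = 0 \<and> u \<bullet> g t \<ge> 0"
  unfolding start_def using hit_sign(1)[of t] by auto

lemma closed_start: "closed {t. start t}"
  unfolding start_closed by (intro closed_Collect_conj closed_Collect_eq closed_Collect_le continuous_intros cont_on)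

lemma start_per: "start (t + of_int k * T) \<longleftrightarrow> start t"
  by (simp add: start_def per_int)

lemma start_exists: "\<exists>t. start t"
proof -
  obtain t where t: "\<nu> \<bullet> g t = 0" using hit_exists by blast
  show ?thesis
  proof (cases "u \<bullet> g t > 0")
    case False
    then have "u \<bullet> g t < 0" using hit_sign(1)[OF t] by simp
    from next_hit'[OF t this] show ?thesis unfolding start_def by metis
  qed (use t start_def in blast)
qed

lemma next_start:
  assumes "start t0"
  obtains t1 t2 where "t0 < t1" "t1 < t2" "start t2" "\<And>t. t0 < t \<Longrightarrow> t < t2 \<Longrightarrow> \<not> start t"
    "arc X \<nu> u (u \<bullet> g t0) (- (u \<bullet> g t1)) (t1 - t0) (\<lambda>t. g (t + t0))"
    "arc Y (- \<nu>) (- u) (- (u \<bullet> g t1)) (u \<bullet> g t2) (t2 - t1) (\<lambda>t. g (t + t1))"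
proof -
  obtain t1 where t1: "t0 < t1" "\<nu> \<bullet> g t1 = 0" "u \<bullet> g t1 < 0" "\<And>t. t0 < t \<Longrightarrow> t < t1 \<Longrightarrow> \<nu> \<bullet> g t > 0"
    "arc X \<nu> u (u \<bullet> g t0) (- (u \<bullet> g t1)) (t1 - t0) (\<lambda>t. g (t + t0))"
    using next_hit assms unfolding start_def by metis
  obtain t2 where t2: "t1 < t2" "\<nu> \<bullet> g t2 = 0" "u \<bullet> g t2 > 0" "\<And>t. t1 < t \<Longrightarrow> t < t2 \<Longrightarrow> \<nu> \<bullet> g t < 0"
    "arc Y (- \<nu>) (- u) (- (u \<bullet> g t1)) (u \<bullet> g t2) (t2 - t1) (\<lambda>t. g (t + t1))"
    using next_hit'[OF t1(2,3)] by metis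
  have "\<not> start t" if "t0 < t" "t < t2" for t
    using t1(3) t1(4)[of t] t2(4)[of t] that by (cases t t1 rule: linorder_cases) (auto simp: start_def)
  then show ?thesis using that[of t1 t2] t1 t2 by (auto simp: start_def)
qed

text \<open>No backward construction is needed: the direction of crossing excludes starts shortly
  before \<open>t0\<close>, so there is a last earlier start, and its successor can only be
  \<open>t0\<close>.\<close>

lemma prev_start:
  assumes st: "start t0"
  obtains tp t1 where "start tp"
    "arc X \<nu> u (u \<bullet> g tp) (- (u \<bullet> g t1)) (t1 - tp) (\<lambda>t. g (t + tp))"
    "arc Y (- \<nu>) (- u) (- (u \<bullet> g t1)) (u \<bullet> g t0) (t0 - t1) (\<lambda>t. g (t + t1))"
proof -
  have hit: "\<nu> \<bullet> g t0 = 0" "u \<bullet> g t0 > 0" using st by (auto simp: start_def)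
  have "((\<lambda>t. \<nu> \<bullet> g t) has_real_derivative \<nu> \<bullet> Y (g t0)) (at t0 within {..<t0})"
    by (intro has_vector_derivative_inner_const hit_deriv hit)
  moreover have "\<nu> \<bullet> Y (g t0) > 0" using hit_sign[OF hit(1)] hit(2) by simp
  ultimately obtain d where d: "d > 0" "\<And>h. 0 < h \<Longrightarrow> h < d \<Longrightarrow> \<nu> \<bullet> g (t0 - h) < 0"
    using has_real_derivative_pos_inc_left[of "\<lambda>t. \<nu> \<bullet> g t" "\<nu> \<bullet> Y (g t0)" t0 "{..<t0}"] hit(1) by auto
  have free: "\<not> start t" if "t0 - d < t" "t < t0" for t
    using d(2)[of "t0 - t"] that by (auto simp: start_def)
  have stT: "start (t0 - T)" using start_per[of t0 "- 1"] st by simp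
  then have "d \<le> T" using free[of "t0 - T"] T by (cases "d \<le> T") auto
  define S where "S = {t0 - T..t0 - d/2} \<inter> {t. start t}"
  have "compact S" unfolding S_def by (intro compact_Int_closed compact_Icc closed_start)
  moreover have "t0 - T \<in> S" using stT \<open>d \<le> T\<close> d(1) by (auto simp: S_def)
  ultimately obtain tp where tp: "tp \<in> S" "\<And>t. t \<in> S \<Longrightarrow> t \<le> tp"
    using compact_attains_sup[of S] by blast
  then have stp: "start tp" "tp < t0" using d by (auto simp: S_def)
  obtain t1 t2 where n: "tp < t1" "t1 < t2" "start t2" "\<And>t. tp < t \<Longrightarrow> t < t2 \<Longrightarrow> \<not> start t"
    "arc X \<nu> u (u \<bullet> g tp) (- (u \<bullet> g t1)) (t1 - tp) (\<lambda>t. g (t + tp))"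
    "arc Y (- \<nu>) (- u) (- (u \<bullet> g t1)) (u \<bullet> g t2) (t2 - t1) (\<lambda>t. g (t + t1))"
    using next_start[OF stp(1)] by metis
  have "\<not> t0 < t2" using n(4)[OF stp(2)] st by blast
  moreover have "\<not> t2 < t0"
  proof
    assume "t2 < t0"
    then have "t2 \<le> t0 - d" using free[of t2] n(3) by (meson linorder_not_less)
    then have "t2 \<in> S" using n(1-3) tp(1) d(1) by (auto simp: S_def)
    from tp(2)[OF this] show False using n by simp
  qed
  ultimately have "t2 = t0" by simp
  then show ?thesis using that[OF stp(1) n(5)] n(6) by simp
qed

end

text \<open>From radius \<open>s'\<close> on the start half-axis, \<open>p1\<close> is the radius
  reached on the opposite half-axis by following \<open>X\<close> forward and \<open>p2\<close> the
  one reached by following \<open>Y\<close> backward. Their only coincidence near \<open>r\<close>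
  is at \<open>r\<close>, which is what a simple zero of the displacement map provides.\<close>

locale isolated_arcs = two_arcs +
  fixes \<delta> :: real and p1 p2 :: "real \<Rightarrow> real"
  assumes openB: "open B" and \<delta>: "0 < \<delta>" "\<delta> < r"
    and p1: "s' \<in> {r - \<delta><..<r + \<delta>} \<Longrightarrow> half_return X \<nu> u s' (p1 s')"
    and p2: "s' \<in> {r - \<delta><..<r + \<delta>} \<Longrightarrow> half_return Y (- \<nu>) (- u) (p2 s') s'"
    and mono1: "strict_mono_on {r - \<delta><..<r + \<delta>} p1" and mono2: "strict_mono_on {r - \<delta><..<r + \<delta>} p2"
    and eq: "s' \<in> {r - \<delta><..<r + \<delta>} \<Longrightarrow> p1 s' = p2 s' \<Longrightarrow> s' = r"
begin

text \<open>The part of the start half-axis away from \<open>r\<close> is cut out, including the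
  origin because \<open>\<delta> < r\<close>. An orbit in \<open>W\<close> can cross this half-axis
  only at radii where \<open>p1\<close> and \<open>p2\<close> are controlled.\<close>

definition "W = B - {p. \<nu> \<bullet> p = 0 \<and> u \<bullet> p \<ge> 0 \<and> \<bar>u \<bullet> p - r\<bar> \<ge> \<delta>}"

lemma open_W: "open W"
  unfolding W_def
  by (intro open_Diff openB closed_Collect_conj closed_Collect_eq closed_Collect_le continuous_intros)

lemma cycle_W: "cycle \<subseteq> W"
proof
  fix p assume p: "p \<in> cycle"
  have "p = r *\<^sub>R u \<or> p = - s *\<^sub>R u" if "\<nu> \<bullet> p = 0" using cycle_axis[OF p that] .
  then have "\<not> (\<nu> \<bullet> p = 0 \<and> u \<bullet> p \<ge> 0 \<and> \<bar>u \<bullet> p - r\<bar> \<ge> \<delta>)"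
    using frame(2) r \<delta> by auto
  then show "p \<in> W" using p cycle_subset by (auto simp: W_def)
qed

text \<open>The orbit may wind several times before closing, so its crossings are not fixed points
  of the return map by assumption. The largest and the smallest crossing radius are: comparison with
  the next and the previous crossing, by monotonicity of \<open>p1\<close> and \<open>p2\<close>,
  gives \<open>p1 = p2\<close> there. Both radii are thus \<open>r\<close>, every crossing is at
  \<open>r\<close>, and by uniqueness of arcs every turn runs through the given cycle.\<close>

lemma unique:
  assumes "crossing_periodic_orbit X Y \<nu> \<Gamma>" "\<Gamma> \<subseteq> W"
  shows "\<Gamma> = cycle"
proof -
  obtain g T where g: "crossing_solution X Y \<nu> g" "T > 0" "\<And>t. g (t + T) = g t" and \<Gamma>: "\<Gamma> = range g"
    using assms(1) unfolding crossing_periodic_orbit_def by blast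
  have "0 \<notin> W" using r \<delta> by (auto simp: W_def)
  then interpret ps: periodic_solution X Y \<nu> B g T
    by unfold_locales (use g assms(2) in \<open>auto simp: \<Gamma> W_def\<close>)
  let ?I = "{r - \<delta><..<r + \<delta>}"
  have I: "u \<bullet> g t \<in> ?I" if "ps.start t" for t
  proof -
    have "g t \<in> W" using assms(2) \<Gamma> by auto
    then show ?thesis using that \<delta> by (auto simp: W_def ps.start_def abs_le_iff not_le abs_less_iff)
  qed
  have u1: "w = p1 s'" if "half_return X \<nu> u s' w" "s' \<in> ?I" for s' w
    using arc_unique_forward[OF lip(1) frame(1,3)] p1[OF that(2)] that(1)
    unfolding half_return_iff_arc by blast
  have u2: "w = p2 s'" if "half_return Y (- \<nu>) (- u) w s'" "s' \<in> ?I" for s' w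
    using arc_unique_backward[OF lip(2), of "- \<nu>" "- u"] frame(1,3) p2[OF that(2)] that(1)
    unfolding half_return_iff_arc by (metis inner_minus_left inner_minus_right neg_equal_0_iff_equal)
  have nxt: "\<exists>t'. ps.start t' \<and> p1 (u \<bullet> g t) = p2 (u \<bullet> g t')" if st: "ps.start t" for t
  proof -
    obtain t1 t2 where "ps.start t2" and a:
      "arc X \<nu> u (u \<bullet> g t) (- (u \<bullet> g t1)) (t1 - t) (\<lambda>x. g (x + t))"
      "arc Y (- \<nu>) (- u) (- (u \<bullet> g t1)) (u \<bullet> g t2) (t2 - t1) (\<lambda>t. g (t + t1))"
      using ps.next_start[OF st] by metis
    then show ?thesis using u1[OF _ I[OF st]] u2[OF _ I[OF \<open>ps.start t2\<close>]]
      unfolding half_return_iff_arc by metis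
  qed
  have prv: "\<exists>t'. ps.start t' \<and> p1 (u \<bullet> g t') = p2 (u \<bullet> g t)" if st: "ps.start t" for t
  proof -
    obtain tp t1 where "ps.start tp" and a:
      "arc X \<nu> u (u \<bullet> g tp) (- (u \<bullet> g t1)) (t1 - tp) (\<lambda>t. g (t + tp))"
      "arc Y (- \<nu>) (- u) (- (u \<bullet> g t1)) (u \<bullet> g t) (t - t1) (\<lambda>t. g (t + t1))"
      using ps.prev_start[OF st] by metis
    then show ?thesis using u1[OF _ I[OF \<open>ps.start tp\<close>]] u2[OF _ I[OF st]]
      unfolding half_return_iff_arc by metis
  qed
  \<comment> \<open>The starts in one closed period form a compact set and represent all crossing
    points, so the extremal radii exist.\<close>
  define S where "S = {0..T} \<inter> {t. ps.start t}"
  have cS: "compact S" unfolding S_def by (intro compact_Int_closed compact_Icc ps.closed_start)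
  have red: "\<exists>t'\<in>S. g t' = g t" if "ps.start t" for t
  proof -
    define k where "k = \<lfloor>t / T\<rfloor>"
    have "of_int k \<le> t / T" "t / T < of_int k + 1" by (auto simp: k_def)
    then have "0 \<le> t + of_int (- k) * T" "t + of_int (- k) * T \<le> T"
      using g(2) by (auto simp: field_simps)
    moreover have "ps.start (t + of_int (- k) * T)" using ps.start_per that by blast
    ultimately have "t + of_int (- k) * T \<in> S" unfolding S_def by auto
    then show ?thesis using ps.per_int by blast
  qed
  obtain ts where ts: "ps.start ts" using ps.start_exists by blast
  then have neS: "S \<noteq> {}" using red by blast
  have cont: "continuous_on S (\<lambda>t. u \<bullet> g t)" by (intro continuous_intros ps.cont_on)
  obtain ta where ta: "ta \<in> S" "\<And>t. t \<in> S \<Longrightarrow> u \<bullet> g t \<le> u \<bullet> g ta"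
    using continuous_attains_sup[OF cS neS cont] by blast
  obtain tb where tb: "tb \<in> S" "\<And>t. t \<in> S \<Longrightarrow> u \<bullet> g tb \<le> u \<bullet> g t"
    using continuous_attains_inf[OF cS neS cont] by blast
  have sta: "ps.start ta" and stb: "ps.start tb" using ta tb by (auto simp: S_def)
  have le_a: "u \<bullet> g t \<le> u \<bullet> g ta" and ge_b: "u \<bullet> g tb \<le> u \<bullet> g t" if "ps.start t" for t
    using red[OF that] ta(2) tb(2) by metis+
  have lt1: "p1 x < p1 y \<longleftrightarrow> x < y" and lt2: "p2 x < p2 y \<longleftrightarrow> x < y" if "x \<in> ?I" "y \<in> ?I" for x y
    using strict_mono_on_less[OF mono1 that] strict_mono_on_less[OF mono2 that] by auto
  have "p1 (u \<bullet> g ta) = p2 (u \<bullet> g ta)"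
  proof (rule antisym)
    obtain t' where t': "ps.start t'" "p1 (u \<bullet> g ta) = p2 (u \<bullet> g t')" using nxt[OF sta] by blast
    have "\<not> p2 (u \<bullet> g ta) < p2 (u \<bullet> g t')"
      using lt2[OF I[OF sta] I[OF t'(1)]] le_a[OF t'(1)] by simp
    then show "p1 (u \<bullet> g ta) \<le> p2 (u \<bullet> g ta)" using t'(2) by simp
    obtain t' where t': "ps.start t'" "p1 (u \<bullet> g t') = p2 (u \<bullet> g ta)" using prv[OF sta] by blast
    have "\<not> p1 (u \<bullet> g ta) < p1 (u \<bullet> g t')"
      using lt1[OF I[OF sta] I[OF t'(1)]] le_a[OF t'(1)] by simp
    then show "p2 (u \<bullet> g ta) \<le> p1 (u \<bullet> g ta)" using t'(2) by simp
  qed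
  then have ra: "u \<bullet> g ta = r" by (rule eq[OF I[OF sta]])
  have "p1 (u \<bullet> g tb) = p2 (u \<bullet> g tb)"
  proof (rule antisym)
    obtain t' where t': "ps.start t'" "p1 (u \<bullet> g t') = p2 (u \<bullet> g tb)" using prv[OF stb] by blast
    have "\<not> p1 (u \<bullet> g t') < p1 (u \<bullet> g tb)"
      using lt1[OF I[OF t'(1)] I[OF stb]] ge_b[OF t'(1)] by simp
    then show "p1 (u \<bullet> g tb) \<le> p2 (u \<bullet> g tb)" using t'(2) by simp
    obtain t' where t': "ps.start t'" "p1 (u \<bullet> g tb) = p2 (u \<bullet> g t')" using nxt[OF stb] by blast
    have "\<not> p2 (u \<bullet> g t') < p2 (u \<bullet> g tb)"
      using lt2[OF I[OF t'(1)] I[OF stb]] ge_b[OF t'(1)] by simp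
    then show "p2 (u \<bullet> g tb) \<le> p1 (u \<bullet> g tb)" using t'(2) by simp
  qed
  then have rb: "u \<bullet> g tb = r" by (rule eq[OF I[OF stb]])
  have allr: "u \<bullet> g t = r" if "ps.start t" for t
    using le_a[OF that] ge_b[OF that] ra rb by simp
  have step: "ps.start (t + (T1 + T2)) \<and> g ` {t..t + (T1 + T2)} = cycle" if st: "ps.start t" for t
  proof -
    obtain t1 t2 where n: "t < t1" "t1 < t2" "ps.start t2" and a:
      "arc X \<nu> u (u \<bullet> g t) (- (u \<bullet> g t1)) (t1 - t) (\<lambda>x. g (x + t))"
      "arc Y (- \<nu>) (- u) (- (u \<bullet> g t1)) (u \<bullet> g t2) (t2 - t1) (\<lambda>t. g (t + t1))"
      using ps.next_start[OF st] by metis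
    have 1: "s = - (u \<bullet> g t1) \<and> T1 = t1 - t \<and> (\<forall>x\<in>{0..T1}. \<gamma>1 x = g (x + t))"
      by (rule arc_unique_forward[OF lip(1) frame(1,3) arc1]) (use a(1) allr[OF st] in simp)
    have 2: "r = u \<bullet> g t2 \<and> T2 = t2 - t1 \<and> (\<forall>x\<in>{0..T2}. \<gamma>2 x = g (x + t1))"
      by (rule arc_unique_forward[OF lip(2) _ _ arc2]) (use a(2) 1 frame in auto)
    have "g ` {t..t1} = \<gamma>1 ` {0..T1}"
    proof -
      have "{t..t1} = (\<lambda>x. x + t) ` {0..T1}" using 1 by (simp add: image_add_atLeastAtMost')
      then have "g ` {t..t1} = (\<lambda>x. g (x + t)) ` {0..T1}" by (simp only: image_image)
      also have "\<dots> = \<gamma>1 ` {0..T1}" using 1 by (intro image_cong) auto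
      finally show ?thesis .
    qed
    moreover have "g ` {t1..t2} = \<gamma>2 ` {0..T2}"
    proof -
      have "{t1..t2} = (\<lambda>x. x + t1) ` {0..T2}" using 2 by (simp add: image_add_atLeastAtMost')
      then have "g ` {t1..t2} = (\<lambda>x. g (x + t1)) ` {0..T2}" by (simp only: image_image)
      also have "\<dots> = \<gamma>2 ` {0..T2}" using 2 by (intro image_cong) auto
      finally show ?thesis .
    qed
    moreover have "{t..t2} = {t..t1} \<union> {t1..t2}" using n by auto
    moreover have "t2 = t + (T1 + T2)" using 1 2 by auto
    ultimately show ?thesis using n(3) unfolding cycle_def by (metis image_Un)
  qed
  have stn: "ps.start (ts + of_nat n * (T1 + T2))" for n
  proof (induction n)
    case (Suc n)
    then have "ps.start (ts + of_nat n * (T1 + T2) + (T1 + T2))" using step by blast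
    then show ?case by (simp add: algebra_simps)
  qed (use ts in simp)
  have "cycle \<subseteq> range g" using step[OF ts] by (metis image_mono subset_UNIV)
  moreover have "g t \<in> cycle" for t
  proof -
    \<comment> \<open>Any time is first moved past \<open>ts\<close> by whole periods of
      \<open>g\<close>; it then falls into one of the consecutive turns of length
      \<open>T1 + T2\<close>.\<close>
    define k where "k = \<lceil>(ts - t) / T\<rceil>"
    have "(ts - t) / T \<le> of_int k" by (simp add: k_def)
    then have t': "ts \<le> t + of_int k * T" using g(2) by (simp add: field_simps)
    define t' where "t' = t + of_int k * T"
    define n where "n = nat \<lfloor>(t' - ts) / (T1 + T2)\<rfloor>"
    have nn: "(t' - ts) / (T1 + T2) \<ge> 0" using t' T by (simp add: t'_def)
    have "of_nat n \<le> (t' - ts) / (T1 + T2)" "(t' - ts) / (T1 + T2) < of_nat n + 1"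
      using nn unfolding n_def by linarith+
    then have "t' \<in> {ts + of_nat n * (T1 + T2)..ts + of_nat n * (T1 + T2) + (T1 + T2)}"
      using T by (auto simp: field_simps)
    then have "g t' \<in> cycle" using step[OF stn[of n]] by blast
    then show ?thesis by (simp add: t'_def ps.per_int)
  qed
  ultimately show ?thesis using \<Gamma> by auto
qed

lemma crossing_limit_cycle_cycle: "crossing_limit_cycle X Y \<nu> cycle"
  unfolding crossing_limit_cycle_def
  using crossing_periodic_orbit_cycle open_W cycle_W unique by blast

end

section \<open>Scalar equations with a small right-hand side\<close>

lemma abs_exp_minus_le:
  fixes x :: real assumes "\<bar>x\<bar> \<le> 1" shows "\<bar>exp x - 1 - x\<bar> \<le> x\<^sup>2"
proof -
  have 1: "exp x \<ge> 1 + x" by (rule exp_ge_add_one_self)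
  have 2: "exp x \<le> 1 + x + x\<^sup>2"
  proof (cases "x \<ge> 0")
    case True then show ?thesis using exp_bound[of x] assms by simp
  next
    case False
    define y where "y = - x"
    have y: "0 < y" "y \<le> 1" using False assms by (auto simp: y_def)
    have "exp x = 1 / exp y" by (simp add: y_def exp_minus field_simps)
    also have "\<dots> \<le> 1 / (1 + y)"
      using y exp_ge_add_one_self[of y] by (intro divide_left_mono mult_pos_pos) auto
    also have "\<dots> \<le> 1 - y + y\<^sup>2"
    proof -
      have "(1 - y + y\<^sup>2) * (1 + y) = 1 + y ^ 3" by (simp add: algebra_simps power2_eq_square power3_eq_cube)
      moreover have "y ^ 3 \<ge> 0" using y by simp
      ultimately show ?thesis using y by (simp add: divide_le_eq)
    qed
    finally show ?thesis by (simp add: y_def)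
  qed
  show ?thesis unfolding abs_le_iff using 1 2 zero_le_power2[of x] by linarith
qed

text \<open>Banach's fixed point theorem for the integral operator. Clamping time and state to the
  rectangle lets the operator act on all bounded continuous functions; the bound
  \<open>K * (b - a)\<close> shows afterwards that the clamps are inactive. The plain supremum norm
  suffices because \<open>L * (b - a) < 1\<close>, which holds for a small right-hand side.\<close>

lemma picard_scalar:
  fixes H :: "real \<Rightarrow> real \<Rightarrow> real"
  assumes ab: "a \<le> b" and cd: "c \<le> d"
    and cont: "continuous_on ({a..b} \<times> {c..d}) (\<lambda>(\<phi>, x). H \<phi> x)"
    and K: "\<And>\<phi> x. \<phi> \<in> {a..b} \<Longrightarrow> x \<in> {c..d} \<Longrightarrow> \<bar>H \<phi> x\<bar> \<le> K"
    and L: "\<And>\<phi> x y. \<phi> \<in> {a..b} \<Longrightarrow> x \<in> {c..d} \<Longrightarrow> y \<in> {c..d} \<Longrightarrow> \<bar>H \<phi> x - H \<phi> y\<bar> \<le> L * \<bar>x - y\<bar>"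
    and L1: "L \<ge> 0" "L * (b - a) < 1" and R: "c \<le> R - K * (b - a)" "R + K * (b - a) \<le> d"
  obtains f where "f a = R" "\<And>\<phi>. \<phi> \<in> {a..b} \<Longrightarrow> \<bar>f \<phi> - R\<bar> \<le> K * (b - a)"
    "\<And>\<phi>. \<phi> \<in> {a..b} \<Longrightarrow> (f has_real_derivative H \<phi> (f \<phi>)) (at \<phi> within {a..b})"
proof -
  define ct where "ct \<phi> = max a (min b \<phi>)" for \<phi> :: real
  define cx where "cx x = max c (min d x)" for x :: real
  define Hc where "Hc \<phi> x = H (ct \<phi>) (cx x)" for \<phi> x
  have ct: "ct \<phi> \<in> {a..b}" "\<phi> \<in> {a..b} \<Longrightarrow> ct \<phi> = \<phi>" for \<phi> using ab by (auto simp: ct_def)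
  have cx: "cx x \<in> {c..d}" "x \<in> {c..d} \<Longrightarrow> cx x = x" for x using cd by (auto simp: cx_def)
  have cx_lip: "\<bar>cx x - cx y\<bar> \<le> \<bar>x - y\<bar>" for x y by (auto simp: cx_def)
  have cont_ct: "continuous_on S ct" for S unfolding ct_def by (intro continuous_intros)
  have cont_cx: "continuous_on S cx" for S unfolding cx_def by (intro continuous_intros)
  have HcK: "\<bar>Hc \<phi> x\<bar> \<le> K" for \<phi> x unfolding Hc_def by (intro K ct cx)
  have HcL: "\<bar>Hc \<phi> x - Hc \<phi> y\<bar> \<le> L * \<bar>x - y\<bar>" for \<phi> x y
  proof -
    have "\<bar>Hc \<phi> x - Hc \<phi> y\<bar> \<le> L * \<bar>cx x - cx y\<bar>" unfolding Hc_def by (intro L ct cx)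
    also have "\<dots> \<le> L * \<bar>x - y\<bar>" using cx_lip L1(1) by (intro mult_left_mono)
    finally show ?thesis .
  qed
  have HcC: "continuous_on S (\<lambda>\<phi>. Hc \<phi> (h \<phi>))" if "continuous_on S h" for h :: "real \<Rightarrow> real" and S
  proof -
    have "continuous_on S ((\<lambda>(\<phi>, x). H \<phi> x) \<circ> (\<lambda>\<phi>. (ct \<phi>, cx (h \<phi>))))"
      using ct(1) cx(1)
      by (intro continuous_on_compose continuous_on_subset[OF cont] continuous_on_Pair cont_ct
          continuous_on_compose2[OF cont_cx[of UNIV] that]) auto
    then show ?thesis by (simp add: Hc_def o_def)
  qed
  define I where "I h \<phi> = integral {a..\<phi>} (\<lambda>\<psi>. Hc \<psi> (h \<psi>))" for h :: "real \<Rightarrow> real" and \<phi>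
  have I_bound: "\<bar>I h \<phi>\<bar> \<le> K * (b - a)" if "continuous_on UNIV h" "\<phi> \<in> {a..b}" for h \<phi>
  proof -
    have "norm (I h \<phi>) \<le> K * (\<phi> - a)" unfolding I_def
      by (rule integral_bound) (use that HcC HcK continuous_on_subset[OF that(1)] in auto)
    also have "\<dots> \<le> K * (b - a)" using that HcK[of a c] by (intro mult_left_mono) auto
    finally show ?thesis by simp
  qed
  have I_diff: "\<bar>I g \<phi> - I h \<phi>\<bar> \<le> L * (b - a) * M"
    if g: "continuous_on UNIV g" and h: "continuous_on UNIV h" and \<phi>: "\<phi> \<in> {a..b}"
      and M: "\<And>\<psi>. \<bar>g \<psi> - h \<psi>\<bar> \<le> M" for g h \<phi> M
  proof -
    have c: "continuous_on {a..\<phi>} (\<lambda>\<psi>. Hc \<psi> (g \<psi>))" "continuous_on {a..\<phi>} (\<lambda>\<psi>. Hc \<psi> (h \<psi>))"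
      using continuous_on_subset[OF g] continuous_on_subset[OF h] by (auto intro: HcC)
    have "I g \<phi> - I h \<phi> = integral {a..\<phi>} (\<lambda>\<psi>. Hc \<psi> (g \<psi>) - Hc \<psi> (h \<psi>))"
      unfolding I_def by (rule Henstock_Kurzweil_Integration.integral_diff[symmetric])
        (use c in \<open>auto intro: integrable_continuous_interval\<close>)
    also have "norm \<dots> \<le> (L * M) * (\<phi> - a)"
    proof (rule integral_bound)
      fix t
      have "\<bar>Hc t (g t) - Hc t (h t)\<bar> \<le> L * \<bar>g t - h t\<bar>" by (rule HcL)
      also have "\<dots> \<le> L * M" using M L1(1) by (intro mult_left_mono)
      finally show "norm (Hc t (g t) - Hc t (h t)) \<le> L * M" by simp
    qed (use \<phi> c in \<open>auto intro: continuous_on_diff\<close>)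
    also have "\<dots> \<le> (L * M) * (b - a)"
      using \<phi> L1(1) M[of 0] by (intro mult_left_mono mult_nonneg_nonneg) auto
    finally show ?thesis by (simp add: algebra_simps)
  qed
  have I_cont: "continuous_on UNIV (\<lambda>\<phi>. I h (ct \<phi>))" if "continuous_on UNIV h" for h
  proof -
    have "continuous_on {a..b} (I h)" unfolding I_def
      by (intro indefinite_integral_continuous_1 integrable_continuous_interval HcC
          continuous_on_subset[OF that]) auto
    from continuous_on_compose2[OF this cont_ct[of UNIV]] show ?thesis using ct(1) by (auto simp: image_subset_iff)
  qed
  define T :: "(real \<Rightarrow>\<^sub>C real) \<Rightarrow> (real \<Rightarrow>\<^sub>C real)" where
    "T h = Bcontfun (\<lambda>\<phi>. R + I (apply_bcontfun h) (ct \<phi>))" for h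
  have ch: "continuous_on UNIV (apply_bcontfun h)" for h :: "real \<Rightarrow>\<^sub>C real"
    by (rule continuous_on_apply_bcontfun)
  have T: "apply_bcontfun (T h) \<phi> = R + I (apply_bcontfun h) (ct \<phi>)" for h \<phi>
  proof -
    have "(\<lambda>\<phi>. R + I (apply_bcontfun h) (ct \<phi>)) \<in> bcontfun"
    proof (rule bcontfun_normI)
      show "continuous_on UNIV (\<lambda>\<phi>. R + I (apply_bcontfun h) (ct \<phi>))"
        by (intro continuous_on_add continuous_on_const I_cont ch)
      fix \<phi>
      show "norm (R + I (apply_bcontfun h) (ct \<phi>)) \<le> \<bar>R\<bar> + K * (b - a)"
        using I_bound[OF ch ct(1), of h \<phi>] by simp
    qed
    then show ?thesis unfolding T_def by (simp add: Bcontfun_inverse)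
  qed
  have "\<exists>!h. T h = h"
  proof (rule banach_fix_type[of "L * (b - a)"])
    show "0 \<le> L * (b - a)" "L * (b - a) < 1" using L1 ab by auto
    show "\<forall>x y. dist (T x) (T y) \<le> L * (b - a) * dist x y"
    proof (intro allI dist_bound)
      fix x y \<phi>
      show "dist (apply_bcontfun (T x) \<phi>) (apply_bcontfun (T y) \<phi>) \<le> L * (b - a) * dist x y"
        unfolding T dist_real_def using I_diff[OF ch ch ct(1), of x y "dist x y" \<phi>]
          dist_bounded[of x _ y] by (simp add: dist_real_def)
    qed
  qed
  then obtain h where h: "T h = h" by blast
  define f where "f = apply_bcontfun h"
  have cf: "continuous_on S f" for S unfolding f_def using ch continuous_on_subset by blast
  have f: "f \<phi> = R + I f \<phi>" if "\<phi> \<in> {a..b}" for \<phi>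
    using T[of h \<phi>] h ct(2)[OF that] by (simp add: f_def)
  have fR: "\<bar>f \<phi> - R\<bar> \<le> K * (b - a)" if "\<phi> \<in> {a..b}" for \<phi>
    using I_bound[OF cf that] f[OF that] by simp
  have "(f has_real_derivative H \<phi> (f \<phi>)) (at \<phi> within {a..b})" if \<phi>: "\<phi> \<in> {a..b}" for \<phi>
  proof -
    have "((\<lambda>\<phi>. R + I f \<phi>) has_real_derivative 0 + Hc \<phi> (f \<phi>)) (at \<phi> within {a..b})"
      unfolding I_def by (intro DERIV_add DERIV_const integral_has_real_derivative HcC cf \<phi>)
    then have "(f has_real_derivative 0 + Hc \<phi> (f \<phi>)) (at \<phi> within {a..b})"
      unfolding has_real_derivative_iff_has_vector_derivative
      by (rule has_vector_derivative_transform[OF \<phi>, rotated]) (use f in auto)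
    moreover have "f \<phi> \<in> {c..d}" using fR[OF \<phi>] R by auto
    ultimately show ?thesis using ct(2)[OF \<phi>] cx(2) by (simp add: Hc_def)
  qed
  moreover have "f a = R" using f[of a] ab by (simp add: I_def)
  ultimately show ?thesis using that fR by blast
qed

text \<open>The stated derivative is the solution of the linearized equation. Multiplying the
  difference of two solutions by \<open>exp (- \<epsilon> * J \<phi>)\<close> removes the linear
  part. What remains has a derivative that is small compared with the initial difference, by uniform
  continuity of \<open>G'\<close>.\<close>

lemma scalar_flow_derivative:
  fixes G G' :: "real \<Rightarrow> real \<Rightarrow> real" and f :: "real \<Rightarrow> real \<Rightarrow> real"
  assumes ab: "a < b" and \<epsilon>: "\<epsilon> > 0" and S: "open S" "R \<in> S"
    and contG': "continuous_on ({a..b} \<times> {c..d}) (\<lambda>(\<phi>, x). G' \<phi> x)"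
    and dG: "\<And>\<phi> x. \<phi> \<in> {a..b} \<Longrightarrow> x \<in> {c..d} \<Longrightarrow> (G \<phi> has_real_derivative G' \<phi> x) (at x within {c..d})"
    and K: "\<And>\<phi> x. \<phi> \<in> {a..b} \<Longrightarrow> x \<in> {c..d} \<Longrightarrow> \<bar>G' \<phi> x\<bar> \<le> K" and K1: "\<epsilon> * K * (b - a) \<le> 1 / 2"
    and f0: "\<And>x. x \<in> S \<Longrightarrow> f x a = x"
    and fin: "\<And>x \<phi>. x \<in> S \<Longrightarrow> \<phi> \<in> {a..b} \<Longrightarrow> f x \<phi> \<in> {c..d}"
    and df: "\<And>x \<phi>. x \<in> S \<Longrightarrow> \<phi> \<in> {a..b} \<Longrightarrow> (f x has_real_derivative \<epsilon> * G \<phi> (f x \<phi>)) (at \<phi> within {a..b})"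
  shows "((\<lambda>x. f x b) has_real_derivative exp (\<epsilon> * integral {a..b} (\<lambda>\<phi>. G' \<phi> (f R \<phi>)))) (at R)"
proof -
  have K0: "K \<ge> 0" using K[of a "f R a"] fin[OF S(2), of a] ab by force
  have mvt: "\<exists>z\<in>closed_segment x y. G \<phi> y - G \<phi> x = G' \<phi> z * (y - x)"
    if \<phi>: "\<phi> \<in> {a..b}" and xy: "x \<in> {c..d}" "y \<in> {c..d}" for \<phi> x y
  proof -
    have der: "(G \<phi> has_real_derivative G' \<phi> w) (at w within {p..q})" if "{p..q} \<subseteq> {c..d}" "w \<in> {p..q}" for p q w
      using dG[OF \<phi>, of w] that DERIV_subset by blast
    have aux: "\<exists>z\<in>{p..q}. G \<phi> q - G \<phi> p = G' \<phi> z * (q - p)" if "p < q" "{p..q} \<subseteq> {c..d}" for p q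
      by (rule mvt_very_simple[of p q "G \<phi>" "\<lambda>z h. G' \<phi> z * h"])
        (use that der in \<open>auto simp: has_field_derivative_def\<close>)
    consider "x < y" | "y < x" | "x = y" by linarith
    then show ?thesis
    proof cases
      case 1 then show ?thesis using aux[of x y] xy by (auto simp: closed_segment_eq_real_ivl)
    next
      case 2
      then obtain z where "z \<in> {y..x}" "G \<phi> x - G \<phi> y = G' \<phi> z * (x - y)" using aux[of y x] xy by auto
      then show ?thesis using 2 by (intro bexI[of _ z]) (auto simp: closed_segment_eq_real_ivl algebra_simps)
    qed auto
  qed
  have seg: "z \<in> {c..d}" "\<bar>z - x\<bar> \<le> \<bar>y - x\<bar>" if "z \<in> closed_segment x y" "x \<in> {c..d}" "y \<in> {c..d}" for x y z :: real
    using that by (auto simp: closed_segment_eq_real_ivl split: if_splits)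
  have cf: "continuous_on {a..b} (f x)" if "x \<in> S" for x by (rule DERIV_continuous_on[OF df[OF that]])
  define A where "A = (\<lambda>\<phi>. G' \<phi> (f R \<phi>))"
  have cA: "continuous_on {a..b} A"
  proof -
    have "continuous_on {a..b} ((\<lambda>(\<phi>, x). G' \<phi> x) \<circ> (\<lambda>\<phi>. (\<phi>, f R \<phi>)))"
      using fin[OF S(2)] by (intro continuous_on_compose continuous_on_subset[OF contG'] continuous_on_Pair
          continuous_on_id cf S(2)) auto
    then show ?thesis by (simp add: o_def A_def)
  qed
  define J where "J \<phi> = integral {a..\<phi>} A" for \<phi>
  have dJ: "(J has_real_derivative A \<phi>) (at \<phi> within {a..b})" if "\<phi> \<in> {a..b}" for \<phi>
    unfolding J_def by (rule integral_has_real_derivative[OF cA that])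
  have AK: "\<bar>A \<phi>\<bar> \<le> K" if "\<phi> \<in> {a..b}" for \<phi> unfolding A_def using K fin[OF S(2)] that by blast
  have JK: "\<epsilon> * \<bar>J \<phi>\<bar> \<le> 1/2" if "\<phi> \<in> {a..b}" for \<phi>
  proof -
    have "norm (J \<phi>) \<le> K * (\<phi> - a)" unfolding J_def
      by (rule integral_bound) (use that cA AK in \<open>auto intro: continuous_on_subset\<close>)
    also have "\<dots> \<le> K * (b - a)" using that K0 by (intro mult_left_mono) auto
    finally have "\<epsilon> * \<bar>J \<phi>\<bar> \<le> \<epsilon> * (K * (b - a))" using \<epsilon> by (intro mult_left_mono) auto
    moreover have "\<epsilon> * (K * (b - a)) \<le> 1/2" using K1 by (simp only: mult.assoc)
    ultimately show ?thesis by linarith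
  qed
  define E where "E = exp (\<epsilon> * J b)"
  \<comment> \<open>The maximal difference exceeds the initial one by at most half of itself, since
    \<open>\<epsilon> * K * (b - a) \<le> 1 / 2\<close>; so it is at most twice the initial
    one.\<close>
  have bound: "\<bar>f x \<phi> - f R \<phi>\<bar> \<le> 2 * \<bar>x - R\<bar>" if x: "x \<in> S" and \<phi>: "\<phi> \<in> {a..b}" for x \<phi>
  proof -
    define D where "D = (\<lambda>\<phi>. f x \<phi> - f R \<phi>)"
    have cD: "continuous_on {a..b} (\<lambda>\<phi>. \<bar>D \<phi>\<bar>)" unfolding D_def by (intro continuous_intros cf x S(2))
    obtain m where m: "m \<in> {a..b}" "\<And>t. t \<in> {a..b} \<Longrightarrow> \<bar>D t\<bar> \<le> \<bar>D m\<bar>"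
      using continuous_attains_sup[OF compact_Icc _ cD] ab by auto
    have dD: "(D has_real_derivative \<epsilon> * (G t (f x t) - G t (f R t))) (at t within {a..b})" if "t \<in> {a..b}" for t
      unfolding D_def by (auto intro!: derivative_eq_intros df x S(2) that simp: algebra_simps)
    have "norm (D m - D a) \<le> \<epsilon> * K * \<bar>D m\<bar> * norm (m - a)"
    proof (rule field_differentiable_bound[of "{a..b}" D])
      fix t assume t: "t \<in> {a..b}"
      show "(D has_field_derivative \<epsilon> * (G t (f x t) - G t (f R t))) (at t within {a..b})" by (rule dD[OF t])
      obtain z where z: "z \<in> closed_segment (f R t) (f x t)" "G t (f x t) - G t (f R t) = G' t z * (f x t - f R t)"
        using mvt[OF t fin[OF S(2) t] fin[OF x t]] by blast
      have "\<bar>G t (f x t) - G t (f R t)\<bar> \<le> K * \<bar>D m\<bar>"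
        unfolding z(2) abs_mult using K[OF t seg(1)[OF z(1) fin[OF S(2) t] fin[OF x t]]] m(2)[OF t] K0
        by (intro mult_mono) (auto simp: D_def)
      then show "norm (\<epsilon> * (G t (f x t) - G t (f R t))) \<le> \<epsilon> * K * \<bar>D m\<bar>"
        using \<epsilon> by (simp add: abs_mult)
    qed (use m ab in auto)
    also have "\<dots> \<le> \<epsilon> * K * \<bar>D m\<bar> * (b - a)" using m(1) \<epsilon> K0 by (intro mult_left_mono) auto
    also have "\<dots> = (\<epsilon> * K * (b - a)) * \<bar>D m\<bar>" by (simp add: algebra_simps)
    also have "\<dots> \<le> 1/2 * \<bar>D m\<bar>" using K1 by (intro mult_right_mono) auto
    finally have "\<bar>D m - D a\<bar> \<le> 1/2 * \<bar>D m\<bar>" by simp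
    then have "\<bar>D m\<bar> \<le> 2 * \<bar>D a\<bar>" by linarith
    then show ?thesis using m(2)[OF \<phi>] f0[OF x] f0[OF S(2)] by (simp add: D_def)
  qed
  show ?thesis unfolding DERIV_def A_def[symmetric] J_def[symmetric] E_def[symmetric]
  proof (rule LIM_I)
    fix e :: real assume e: "e > 0"
    \<comment> \<open>\<open>Q\<close> bounds the factor of \<open>e'\<close> in the final estimate,
      so that \<open>e'\<close> turns this estimate into \<open>e / 2\<close>.\<close>
    define Q where "Q = 2 * exp 1 * \<epsilon> * (b - a) * E + 1"
    define e' where "e' = e / Q / 2"
    have E0: "E > 0" by (simp add: E_def)
    have den: "Q > 0" unfolding Q_def using \<epsilon> ab E0 by (intro add_pos_pos mult_pos_pos) auto
    have e': "e' > 0" using e den by (simp add: e'_def)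
    have "uniformly_continuous_on ({a..b} \<times> {c..d}) (\<lambda>(\<phi>, x). G' \<phi> x)"
      by (intro compact_uniformly_continuous contG' compact_Times compact_Icc)
    then obtain \<eta> where \<eta>: "\<eta> > 0" "\<And>p q. p \<in> {a..b} \<times> {c..d} \<Longrightarrow> q \<in> {a..b} \<times> {c..d} \<Longrightarrow> dist q p < \<eta> \<Longrightarrow>
        dist ((\<lambda>(\<phi>, x). G' \<phi> x) q) ((\<lambda>(\<phi>, x). G' \<phi> x) p) < e'"
      by (rule uniformly_continuous_onE[OF _ e']) (rule that)
    obtain \<rho> where \<rho>: "\<rho> > 0" "ball R \<rho> \<subseteq> S" using S openE by blast
    define s where "s = min \<rho> (\<eta> / 4)"
    have "norm ((f (R + h) b - f R b) / h - E) < e" if h: "h \<noteq> 0" "norm h < s" for h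
    proof -
      have x: "R + h \<in> S" using \<rho> h by (auto simp: s_def dist_real_def)
      define D where "D = (\<lambda>\<phi>. f (R + h) \<phi> - f R \<phi>)"
      define w where "w = (\<lambda>\<phi>. exp (- \<epsilon> * J \<phi>) * D \<phi>)"
      have D2: "\<bar>D \<phi>\<bar> \<le> 2 * \<bar>h\<bar>" if "\<phi> \<in> {a..b}" for \<phi> using bound[OF x that] by (simp add: D_def)
      have dD: "(D has_real_derivative \<epsilon> * (G t (f (R + h) t) - G t (f R t))) (at t within {a..b})" if "t \<in> {a..b}" for t
        unfolding D_def by (auto intro!: derivative_eq_intros df x S(2) that simp: algebra_simps)
      have "norm (w b - w a) \<le> (exp 1 * \<epsilon> * (e' * (2 * \<bar>h\<bar>))) * norm (b - a)"
      proof (rule field_differentiable_bound[of "{a..b}" w])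
        fix t assume t: "t \<in> {a..b}"
        let ?g = "G t (f (R + h) t) - G t (f R t) - A t * D t"
        show "(w has_field_derivative exp (- \<epsilon> * J t) * \<epsilon> * ?g) (at t within {a..b})"
          unfolding w_def by (auto intro!: derivative_eq_intros dJ dD t simp: algebra_simps)
        obtain z where z: "z \<in> closed_segment (f R t) (f (R + h) t)"
          "G t (f (R + h) t) - G t (f R t) = G' t z * (f (R + h) t - f R t)"
          using mvt[OF t fin[OF S(2) t] fin[OF x t]] by blast
        note sz = seg[OF z(1) fin[OF S(2) t] fin[OF x t]]
        have "\<bar>z - f R t\<bar> \<le> 2 * \<bar>h\<bar>" using sz(2) D2[OF t] by (simp add: D_def)
        then have "dist (t, z) (t, f R t) < \<eta>" using h \<eta>(1) by (simp add: dist_Pair_Pair dist_real_def s_def)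
        from \<eta>(2)[OF _ _ this] have "\<bar>G' t z - A t\<bar> < e'"
          using t sz(1) fin[OF S(2) t] by (simp add: A_def dist_real_def)
        moreover have "?g = (G' t z - A t) * D t" unfolding z(2) by (simp add: D_def algebra_simps)
        ultimately have "\<bar>?g\<bar> \<le> e' * (2 * \<bar>h\<bar>)" using D2[OF t] e' by (auto simp: abs_mult intro!: mult_mono)
        moreover have "exp (- \<epsilon> * J t) \<le> exp 1"
        proof -
          have "- \<epsilon> * J t \<le> \<epsilon> * \<bar>J t\<bar>" using \<epsilon> by (simp add: abs_if)
          then show ?thesis using JK[OF t] by simp
        qed
        ultimately show "norm (exp (- \<epsilon> * J t) * \<epsilon> * ?g) \<le> exp 1 * \<epsilon> * (e' * (2 * \<bar>h\<bar>))"
          using \<epsilon> unfolding norm_mult by (intro mult_mono) auto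
      qed (use ab in auto)
      moreover have "w a = h" using f0[OF x] f0[OF S(2)] by (simp add: w_def D_def J_def)
      moreover have "D b = E * w b" by (simp add: w_def E_def mult_exp_exp flip: mult.assoc)
      ultimately have "\<bar>D b - E * h\<bar> \<le> E * ((exp 1 * \<epsilon> * (e' * (2 * \<bar>h\<bar>))) * (b - a))"
        using E0 ab by (simp add: abs_mult flip: right_diff_distrib)
      then have "\<bar>D b / h - E\<bar> \<le> E * (exp 1 * \<epsilon> * (e' * 2) * (b - a))"
      proof -
        assume le: "\<bar>D b - E * h\<bar> \<le> E * ((exp 1 * \<epsilon> * (e' * (2 * \<bar>h\<bar>))) * (b - a))"
        have "\<bar>D b / h - E\<bar> = \<bar>D b - E * h\<bar> / \<bar>h\<bar>" using h by (simp add: abs_divide[symmetric] diff_divide_distrib)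
        also have "\<dots> \<le> E * ((exp 1 * \<epsilon> * (e' * (2 * \<bar>h\<bar>))) * (b - a)) / \<bar>h\<bar>" using le by (intro divide_right_mono) auto
        also have "\<dots> = E * (exp 1 * \<epsilon> * (e' * 2) * (b - a))" using h by simp
        finally show ?thesis .
      qed
      also have "\<dots> = (2 * exp 1 * \<epsilon> * (b - a) * E) * e'" by (simp add: algebra_simps)
      also have "\<dots> \<le> Q * e'" unfolding Q_def using e' by (intro mult_right_mono) auto
      also have "\<dots> = e / 2" using den by (simp add: e'_def)
      also have "\<dots> < e" using e by simp
      finally show ?thesis by (simp add: D_def)
    qed
    moreover have "s > 0" using \<rho> \<eta> by (simp add: s_def)
    ultimately show "\<exists>s>0. \<forall>x. x \<noteq> 0 \<and> norm (x - 0) < s \<longrightarrow> norm ((f (R + x) b - f R b) / x - E) < e"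
      by (intro exI[of _ s]) auto
  qed
qed

text \<open>The first order expansion in \<open>\<epsilon>\<close>, uniform for \<open>R\<close>
  near \<open>R0\<close>: for small \<open>\<epsilon>\<close> a solution stays near the constant
  \<open>R0\<close>, so the increments of the flow and of its derivative, divided by
  \<open>\<epsilon>\<close>, approach integrals along this constant.\<close>

lemma small_scalar_flow:
  fixes G G' :: "real \<Rightarrow> real \<Rightarrow> real \<Rightarrow> real"
  assumes ab: "a < b" and d: "d > 0" and e1: "e1 > 0"
    and cG: "continuous_on ({0..e1} \<times> {a..b} \<times> {R0 - d..R0 + d}) (\<lambda>(\<epsilon>, \<phi>, x). G \<epsilon> \<phi> x)"
    and cG': "continuous_on ({0..e1} \<times> {a..b} \<times> {R0 - d..R0 + d}) (\<lambda>(\<epsilon>, \<phi>, x). G' \<epsilon> \<phi> x)"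
    and dG: "\<And>\<epsilon> \<phi> x. \<epsilon> \<in> {0..e1} \<Longrightarrow> \<phi> \<in> {a..b} \<Longrightarrow> x \<in> {R0 - d..R0 + d} \<Longrightarrow>
      (G \<epsilon> \<phi> has_real_derivative G' \<epsilon> \<phi> x) (at x within {R0 - d..R0 + d})"
  obtains f where "\<And>e. e > 0 \<Longrightarrow> \<exists>\<delta>>0. \<delta> \<le> e1 \<and> (\<forall>\<epsilon> R. 0 < \<epsilon> \<longrightarrow> \<epsilon> < \<delta> \<longrightarrow> \<bar>R - R0\<bar> < \<delta> \<longrightarrow>
      f \<epsilon> R a = R \<and>
      (\<forall>\<phi>\<in>{a..b}. \<bar>f \<epsilon> R \<phi> - R0\<bar> < d \<and>
        (f \<epsilon> R has_real_derivative \<epsilon> * G \<epsilon> \<phi> (f \<epsilon> R \<phi>)) (at \<phi> within {a..b})) \<and>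
      \<bar>(f \<epsilon> R b - R) / \<epsilon> - integral {a..b} (\<lambda>\<phi>. G 0 \<phi> R0)\<bar> < e \<and>
      (\<exists>D>0. ((\<lambda>R. f \<epsilon> R b) has_real_derivative D) (at R) \<and>
        \<bar>(D - 1) / \<epsilon> - integral {a..b} (\<lambda>\<phi>. G' 0 \<phi> R0)\<bar> < e))"
proof -
  let ?C = "{0..e1} \<times> {a..b} \<times> {R0 - d..R0 + d}"
  have C: "compact ?C" by (intro compact_Times compact_Icc)
  have "bounded ((\<lambda>(\<epsilon>, \<phi>, x). G \<epsilon> \<phi> x) ` ?C \<union> (\<lambda>(\<epsilon>, \<phi>, x). G' \<epsilon> \<phi> x) ` ?C)"
    using compact_continuous_image[OF cG C] compact_continuous_image[OF cG' C] by (simp add: compact_imp_bounded)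
  then obtain K0 where K0: "\<And>y. y \<in> (\<lambda>(\<epsilon>, \<phi>, x). G \<epsilon> \<phi> x) ` ?C \<union> (\<lambda>(\<epsilon>, \<phi>, x). G' \<epsilon> \<phi> x) ` ?C \<Longrightarrow> norm y \<le> K0"
    unfolding bounded_iff by blast
  define K where "K = max K0 1"
  have K1: "K \<ge> 1" by (simp add: K_def)
  have GK: "\<bar>G \<epsilon> \<phi> x\<bar> \<le> K" "\<bar>G' \<epsilon> \<phi> x\<bar> \<le> K"
    if "\<epsilon> \<in> {0..e1}" "\<phi> \<in> {a..b}" "x \<in> {R0 - d..R0 + d}" for \<epsilon> \<phi> x
  proof -
    have "(\<epsilon>, \<phi>, x) \<in> ?C" using that by auto
    then show "\<bar>G \<epsilon> \<phi> x\<bar> \<le> K" "\<bar>G' \<epsilon> \<phi> x\<bar> \<le> K"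
      using K0[of "G \<epsilon> \<phi> x"] K0[of "G' \<epsilon> \<phi> x"] by (force simp: K_def)+
  qed
  define N where "N = K * (b - a)"
  have N: "N > 0" using K1 ab by (simp add: N_def)
  define P where "P \<epsilon> R h \<longleftrightarrow> h a = R \<and> (\<forall>\<phi>\<in>{a..b}. \<bar>h \<phi> - R\<bar> \<le> \<epsilon> * N \<and>
    (h has_real_derivative \<epsilon> * G \<epsilon> \<phi> (h \<phi>)) (at \<phi> within {a..b}))" for \<epsilon> R and h :: "real \<Rightarrow> real"
  \<comment> \<open>The flow is fixed before the tolerance \<open>e\<close>, so that estimates with
    different tolerances speak about the same flow.\<close>
  define f where "f \<epsilon> R = (SOME h. P \<epsilon> R h)" for \<epsilon> R
  show thesis
  proof (rule that[of f])
    fix e :: real assume e: "e > 0"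
  define e' where "e' = e / (2 * (b - a) + 1)"
  have e': "e' > 0" using e ab by (simp add: e'_def)
  have e'2: "e' * (b - a) < e / 2"
  proof -
    have "e' * (2 * (b - a)) < e' * (2 * (b - a) + 1)" using e' by simp
    also have "\<dots> = e" using ab by (simp add: e'_def)
    also have "e' * (2 * (b - a)) = e' * (b - a) * 2" by simp
    finally show ?thesis by (simp only: less_divide_eq_numeral1)
  qed
  obtain \<eta>1 where \<eta>1: "\<eta>1 > 0" "\<And>p q. p \<in> ?C \<Longrightarrow> q \<in> ?C \<Longrightarrow> dist q p < \<eta>1 \<Longrightarrow>
      dist ((\<lambda>(\<epsilon>, \<phi>, x). G \<epsilon> \<phi> x) q) ((\<lambda>(\<epsilon>, \<phi>, x). G \<epsilon> \<phi> x) p) < e'"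
    by (rule uniformly_continuous_onE[OF compact_uniformly_continuous[OF cG C] e']) (rule that)
  obtain \<eta>2 where \<eta>2: "\<eta>2 > 0" "\<And>p q. p \<in> ?C \<Longrightarrow> q \<in> ?C \<Longrightarrow> dist q p < \<eta>2 \<Longrightarrow>
      dist ((\<lambda>(\<epsilon>, \<phi>, x). G' \<epsilon> \<phi> x) q) ((\<lambda>(\<epsilon>, \<phi>, x). G' \<epsilon> \<phi> x) p) < e'"
    by (rule uniformly_continuous_onE[OF compact_uniformly_continuous[OF cG' C] e']) (rule that)
  \<comment> \<open>In order: \<open>\<epsilon>\<close> stays in range; solutions stay within
    \<open>d\<close> of \<open>R0\<close>; the two moduli of continuity apply;
    \<open>\<epsilon> * N \<le> 1/4\<close>; and the quadratic error of the exponential,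
    \<open>\<epsilon> * N\<^sup>2\<close>, is below \<open>e / 2\<close>.\<close>
  define \<delta> where "\<delta> = Min {e1, d / (2 * (1 + N)), \<eta>1 / (2 + N), \<eta>2 / (2 + N), 1 / (4 * (1 + N)), e / (2 * (N\<^sup>2 + 1))}"
  have \<delta>: "\<delta> > 0" "\<delta> \<le> e1" "\<delta> \<le> d / (2 * (1 + N))" "\<delta> \<le> \<eta>1 / (2 + N)" "\<delta> \<le> \<eta>2 / (2 + N)"
     "\<delta> \<le> 1 / (4 * (1 + N))" "\<delta> \<le> e / (2 * (N\<^sup>2 + 1))"
    using e1 d \<eta>1 \<eta>2 e N by (auto simp: \<delta>_def add_pos_nonneg)
  have \<delta>': "\<delta> * (2 * (1 + N)) \<le> d" "\<delta> * (2 + N) \<le> \<eta>1" "\<delta> * (2 + N) \<le> \<eta>2" "\<delta> * (4 * (1 + N)) \<le> 1" "\<delta> * (2 * (N\<^sup>2 + 1)) \<le> e"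
    using \<delta> N by (auto simp: pos_le_divide_eq add_pos_nonneg)
  have \<delta>N: "\<delta> * N \<ge> 0" using \<delta> N by simp
  have small: "\<epsilon> * N \<le> 1/4" "\<epsilon> * N + \<bar>R - R0\<bar> < d" "\<epsilon> + (\<epsilon> * N + \<bar>R - R0\<bar>) < \<eta>1" "\<epsilon> + (\<epsilon> * N + \<bar>R - R0\<bar>) < \<eta>2" "\<epsilon> * N\<^sup>2 < e / 2"
    if "0 < \<epsilon>" "\<epsilon> < \<delta>" "\<bar>R - R0\<bar> < \<delta>" for \<epsilon> R
  proof -
    have 1: "\<epsilon> * N \<le> \<delta> * N" "\<epsilon> * N\<^sup>2 \<le> \<delta> * N\<^sup>2" using that N by (auto intro!: mult_right_mono)
    show "\<epsilon> * N \<le> 1/4" "\<epsilon> * N + \<bar>R - R0\<bar> < d" "\<epsilon> + (\<epsilon> * N + \<bar>R - R0\<bar>) < \<eta>1" "\<epsilon> + (\<epsilon> * N + \<bar>R - R0\<bar>) < \<eta>2" "\<epsilon> * N\<^sup>2 < e / 2"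
      using 1 \<delta>' \<delta>(1) \<delta>N that unfolding distrib_left mult_1_right by linarith+
  qed
  have f: "P \<epsilon> R (f \<epsilon> R)" if c: "0 < \<epsilon>" "\<epsilon> < \<delta>" "\<bar>R - R0\<bar> < \<delta>" for \<epsilon> R
  proof -
    note sm = small[OF c]
    have \<epsilon>: "\<epsilon> \<in> {0..e1}" using c \<delta> by auto
    have "\<exists>h. P \<epsilon> R h"
    proof (rule picard_scalar[of a b "R0 - d" "R0 + d" "\<lambda>\<phi> x. \<epsilon> * G \<epsilon> \<phi> x" "\<epsilon> * K" "\<epsilon> * K" R])
      have "continuous_on ({a..b} \<times> {R0 - d..R0 + d}) ((\<lambda>(\<epsilon>, \<phi>, x). G \<epsilon> \<phi> x) \<circ> (\<lambda>p. (\<epsilon>, p)))"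
        using \<epsilon> by (intro continuous_on_compose continuous_on_subset[OF cG] continuous_intros) auto
      then show "continuous_on ({a..b} \<times> {R0 - d..R0 + d}) (\<lambda>(\<phi>, x). \<epsilon> * G \<epsilon> \<phi> x)"
        by (auto simp: o_def split_beta intro!: continuous_intros)
      show "\<bar>\<epsilon> * G \<epsilon> \<phi> x - \<epsilon> * G \<epsilon> \<phi> y\<bar> \<le> \<epsilon> * K * \<bar>x - y\<bar>"
        if "\<phi> \<in> {a..b}" "x \<in> {R0 - d..R0 + d}" "y \<in> {R0 - d..R0 + d}" for \<phi> x y
      proof -
        have "norm (G \<epsilon> \<phi> x - G \<epsilon> \<phi> y) \<le> K * norm (x - y)"
          by (rule field_differentiable_bound[of "{R0 - d..R0 + d}" _ "G' \<epsilon> \<phi>"])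
            (use that dG \<epsilon> GK(2) in auto)
        then show ?thesis using c(1) by (simp add: abs_mult mult.assoc flip: right_diff_distrib)
      qed
      show "\<bar>\<epsilon> * G \<epsilon> \<phi> x\<bar> \<le> \<epsilon> * K" if "\<phi> \<in> {a..b}" "x \<in> {R0 - d..R0 + d}" for \<phi> x
        using GK(1)[OF \<epsilon> that] c(1) by (simp add: abs_mult)
      have eq: "\<epsilon> * K * (b - a) = \<epsilon> * N" by (simp add: N_def)
      show "\<epsilon> * K * (b - a) < 1" "R0 - d \<le> R - \<epsilon> * K * (b - a)" "R + \<epsilon> * K * (b - a) \<le> R0 + d"
        unfolding eq using sm by linarith+
      fix h assume "h a = R" "\<And>\<phi>. \<phi> \<in> {a..b} \<Longrightarrow> \<bar>h \<phi> - R\<bar> \<le> \<epsilon> * K * (b - a)"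
        "\<And>\<phi>. \<phi> \<in> {a..b} \<Longrightarrow> (h has_real_derivative \<epsilon> * G \<epsilon> \<phi> (h \<phi>)) (at \<phi> within {a..b})"
      then show "\<exists>h. P \<epsilon> R h" unfolding P_def eq by blast
    qed (use ab d c K1 in auto)
    then show ?thesis unfolding f_def by (rule someI_ex)
  qed
  have fa: "f \<epsilon> R a = R" and fR: "\<And>\<phi>. \<phi> \<in> {a..b} \<Longrightarrow> \<bar>f \<epsilon> R \<phi> - R\<bar> \<le> \<epsilon> * N"
    and df: "\<And>\<phi>. \<phi> \<in> {a..b} \<Longrightarrow> (f \<epsilon> R has_real_derivative \<epsilon> * G \<epsilon> \<phi> (f \<epsilon> R \<phi>)) (at \<phi> within {a..b})"
    if "0 < \<epsilon>" "\<epsilon> < \<delta>" "\<bar>R - R0\<bar> < \<delta>" for \<epsilon> R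
    using f[OF that] unfolding P_def by blast+
  have fd: "\<bar>f \<epsilon> R \<phi> - R0\<bar> \<le> \<epsilon> * N + \<bar>R - R0\<bar>" if "0 < \<epsilon>" "\<epsilon> < \<delta>" "\<bar>R - R0\<bar> < \<delta>" "\<phi> \<in> {a..b}" for \<epsilon> R \<phi>
    using fR[OF that] by linarith
  have inC: "f \<epsilon> R \<phi> \<in> {R0 - d..R0 + d}" if "0 < \<epsilon>" "\<epsilon> < \<delta>" "\<bar>R - R0\<bar> < \<delta>" "\<phi> \<in> {a..b}" for \<epsilon> R \<phi>
    using fd[OF that] small(2)[OF that(1-3)] by (simp add: abs_le_iff)
  have contf: "continuous_on {a..b} (\<lambda>\<phi>. H \<epsilon> \<phi> (f \<epsilon> R \<phi>))"
    if c: "0 < \<epsilon>" "\<epsilon> < \<delta>" "\<bar>R - R0\<bar> < \<delta>" and cH: "continuous_on ?C (\<lambda>(\<epsilon>, \<phi>, x). H \<epsilon> \<phi> x)"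
    for H :: "real \<Rightarrow> real \<Rightarrow> real \<Rightarrow> real" and \<epsilon> R
  proof -
    have "continuous_on {a..b} ((\<lambda>(\<epsilon>, \<phi>, x). H \<epsilon> \<phi> x) \<circ> (\<lambda>\<phi>. (\<epsilon>, \<phi>, f \<epsilon> R \<phi>)))"
      using inC[OF c] c \<delta> by (intro continuous_on_compose continuous_on_subset[OF cH] continuous_on_Pair
          continuous_on_const continuous_on_id DERIV_continuous_on[OF df[OF c]]) auto
    then show ?thesis by (simp add: o_def)
  qed
  have cont0: "continuous_on {a..b} (\<lambda>\<phi>. H 0 \<phi> R0)"
    if cH: "continuous_on ?C (\<lambda>(\<epsilon>, \<phi>, x). H \<epsilon> \<phi> x)" for H :: "real \<Rightarrow> real \<Rightarrow> real \<Rightarrow> real"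
  proof -
    have "continuous_on {a..b} ((\<lambda>(\<epsilon>, \<phi>, x). H \<epsilon> \<phi> x) \<circ> (\<lambda>\<phi>. (0, \<phi>, R0)))"
      using d e1 by (intro continuous_on_compose continuous_on_subset[OF cH] continuous_intros) auto
    then show ?thesis by (simp add: o_def)
  qed
  have close: "\<bar>integral {a..b} (\<lambda>\<phi>. H \<epsilon> \<phi> (f \<epsilon> R \<phi>)) - integral {a..b} (\<lambda>\<phi>. H 0 \<phi> R0)\<bar> < e / 2"
    if c: "0 < \<epsilon>" "\<epsilon> < \<delta>" "\<bar>R - R0\<bar> < \<delta>" and cH: "continuous_on ?C (\<lambda>(\<epsilon>, \<phi>, x). H \<epsilon> \<phi> x)"
      and H: "\<And>p q. p \<in> ?C \<Longrightarrow> q \<in> ?C \<Longrightarrow> dist q p < \<eta> \<Longrightarrow>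
        dist ((\<lambda>(\<epsilon>, \<phi>, x). H \<epsilon> \<phi> x) q) ((\<lambda>(\<epsilon>, \<phi>, x). H \<epsilon> \<phi> x) p) < e'"
      and \<eta>: "\<epsilon> + (\<epsilon> * N + \<bar>R - R0\<bar>) < \<eta>" for H :: "real \<Rightarrow> real \<Rightarrow> real \<Rightarrow> real" and \<epsilon> R \<eta>
  proof -
    note cc = contf[OF c cH] cont0[OF cH]
    have "norm (integral {a..b} (\<lambda>\<phi>. H \<epsilon> \<phi> (f \<epsilon> R \<phi>) - H 0 \<phi> R0)) \<le> e' * (b - a)"
    proof (rule integral_bound)
      fix t assume t: "t \<in> {a..b}"
      have "dist (\<epsilon>, t, f \<epsilon> R t) (0, t, R0) \<le> dist \<epsilon> 0 + dist (t, f \<epsilon> R t) (t, R0)"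
        unfolding dist_Pair_Pair by (rule sqrt_sum_squares_le_sum) auto
      also have "\<dots> \<le> \<epsilon> + (\<epsilon> * N + \<bar>R - R0\<bar>)" using fd[OF c t] c by (simp add: dist_Pair_Pair dist_real_def)
      also note \<eta>
      finally have "dist (\<epsilon>, t, f \<epsilon> R t) (0, t, R0) < \<eta>" .
      from H[OF _ _ this] show "norm (H \<epsilon> t (f \<epsilon> R t) - H 0 t R0) \<le> e'"
        using inC[OF c t] t c \<delta> d by (simp add: dist_real_def)
    qed (use ab cc in \<open>auto intro: continuous_on_diff\<close>)
    also note e'2
    finally show ?thesis
      using Henstock_Kurzweil_Integration.integral_diff[OF cc[THEN integrable_continuous_interval]] by simp
  qed
  have main: "f \<epsilon> R a = R \<and>
      (\<forall>\<phi>\<in>{a..b}. \<bar>f \<epsilon> R \<phi> - R0\<bar> < d \<and>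
        (f \<epsilon> R has_real_derivative \<epsilon> * G \<epsilon> \<phi> (f \<epsilon> R \<phi>)) (at \<phi> within {a..b})) \<and>
      \<bar>(f \<epsilon> R b - R) / \<epsilon> - integral {a..b} (\<lambda>\<phi>. G 0 \<phi> R0)\<bar> < e \<and>
      (\<exists>D>0. ((\<lambda>R. f \<epsilon> R b) has_real_derivative D) (at R) \<and>
        \<bar>(D - 1) / \<epsilon> - integral {a..b} (\<lambda>\<phi>. G' 0 \<phi> R0)\<bar> < e)"
    if c: "0 < \<epsilon>" "\<epsilon> < \<delta>" "\<bar>R - R0\<bar> < \<delta>" for \<epsilon> R
  proof -
    have g1: "f \<epsilon> R a = R" by (rule fa[OF c])
    have g2: "\<bar>f \<epsilon> R \<phi> - R0\<bar> < d" if "\<phi> \<in> {a..b}" for \<phi>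
      using fd[OF c that] small(2)[OF c] by linarith
    have g3: "(f \<epsilon> R has_real_derivative \<epsilon> * G \<epsilon> \<phi> (f \<epsilon> R \<phi>)) (at \<phi> within {a..b})" if "\<phi> \<in> {a..b}" for \<phi>
      by (rule df[OF c that])
    have "((\<lambda>\<phi>. \<epsilon> * G \<epsilon> \<phi> (f \<epsilon> R \<phi>)) has_integral f \<epsilon> R b - f \<epsilon> R a) {a..b}"
      by (rule fundamental_theorem_of_calculus)
        (use ab df[OF c] in \<open>auto simp: has_real_derivative_iff_has_vector_derivative\<close>)
    from integral_unique[OF this] have "f \<epsilon> R b - R = \<epsilon> * integral {a..b} (\<lambda>\<phi>. G \<epsilon> \<phi> (f \<epsilon> R \<phi>))"
      using fa[OF c] by simp
    then have "(f \<epsilon> R b - R) / \<epsilon> = integral {a..b} (\<lambda>\<phi>. G \<epsilon> \<phi> (f \<epsilon> R \<phi>))" using c by simp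
    then have g4: "\<bar>(f \<epsilon> R b - R) / \<epsilon> - integral {a..b} (\<lambda>\<phi>. G 0 \<phi> R0)\<bar> < e"
      using close[OF c cG \<eta>1(2) small(3)[OF c]] e by simp
    define I where "I = integral {a..b} (\<lambda>\<phi>. G' \<epsilon> \<phi> (f \<epsilon> R \<phi>))"
    have \<epsilon>: "\<epsilon> \<in> {0..e1}" using c \<delta> by auto
    have der: "((\<lambda>R. f \<epsilon> R b) has_real_derivative exp (\<epsilon> * I)) (at R)"
      unfolding I_def
    proof (rule scalar_flow_derivative[OF ab c(1), of "ball R0 \<delta>" R "R0 - d" "R0 + d" "G' \<epsilon>" "G \<epsilon>" K])
      have "continuous_on ({a..b} \<times> {R0 - d..R0 + d}) ((\<lambda>(\<epsilon>, \<phi>, x). G' \<epsilon> \<phi> x) \<circ> (\<lambda>p. (\<epsilon>, p)))"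
        using \<epsilon> by (intro continuous_on_compose continuous_on_subset[OF cG'] continuous_intros) auto
      then show "continuous_on ({a..b} \<times> {R0 - d..R0 + d}) (\<lambda>(\<phi>, x). G' \<epsilon> \<phi> x)"
        by (auto simp: o_def split_beta)
      show "\<epsilon> * K * (b - a) \<le> 1/2" using small(1)[OF c] by (simp add: N_def)
      show "R \<in> ball R0 \<delta>" using c(3) by (simp add: dist_real_def abs_minus_commute)
      fix x assume "x \<in> ball R0 \<delta>"
      then have x: "\<bar>x - R0\<bar> < \<delta>" by (simp add: dist_real_def abs_minus_commute)
      show "f \<epsilon> x a = x" by (rule fa[OF c(1,2) x])
      show "f \<epsilon> x \<phi> \<in> {R0 - d..R0 + d}" if "\<phi> \<in> {a..b}" for \<phi> by (rule inC[OF c(1,2) x that])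
      show "(f \<epsilon> x has_real_derivative \<epsilon> * G \<epsilon> \<phi> (f \<epsilon> x \<phi>)) (at \<phi> within {a..b})" if "\<phi> \<in> {a..b}" for \<phi>
        by (rule df[OF c(1,2) x that])
    qed (use dG[OF \<epsilon>] GK(2)[OF \<epsilon>] in auto)
    have "norm I \<le> K * (b - a)" unfolding I_def
      by (rule integral_bound) (use ab contf[OF c cG'] GK(2)[OF \<epsilon> _ inC[OF c]] in auto)
    then have IN: "\<bar>I\<bar> \<le> N" by (simp add: N_def)
    have \<epsilon>I: "\<bar>\<epsilon> * I\<bar> \<le> \<epsilon> * N" using IN c(1) by (simp add: abs_mult)
    have "\<bar>exp (\<epsilon> * I) - 1 - \<epsilon> * I\<bar> \<le> (\<epsilon> * I)\<^sup>2"
      using \<epsilon>I small(1)[OF c] by (intro abs_exp_minus_le) linarith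
    also have "\<dots> \<le> (\<epsilon> * N)\<^sup>2" using \<epsilon>I by (simp add: abs_le_square_iff[symmetric] abs_mult N less_imp_le c)
    finally have "\<bar>(exp (\<epsilon> * I) - 1 - \<epsilon> * I) / \<epsilon>\<bar> \<le> (\<epsilon> * N)\<^sup>2 / \<epsilon>"
      using c(1) by (simp add: abs_divide divide_right_mono)
    also have "(\<epsilon> * N)\<^sup>2 / \<epsilon> = \<epsilon> * N\<^sup>2" using c(1) by (simp add: power2_eq_square)
    also have "(exp (\<epsilon> * I) - 1 - \<epsilon> * I) / \<epsilon> = (exp (\<epsilon> * I) - 1) / \<epsilon> - I" using c(1) by (simp add: field_simps)
    finally have "\<bar>(exp (\<epsilon> * I) - 1) / \<epsilon> - I\<bar> < e / 2" using small(5)[OF c] by linarith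
    moreover have "\<bar>I - integral {a..b} (\<lambda>\<phi>. G' 0 \<phi> R0)\<bar> < e / 2"
      unfolding I_def by (rule close[OF c cG' \<eta>2(2) small(4)[OF c]])
    ultimately have "\<bar>(exp (\<epsilon> * I) - 1) / \<epsilon> - integral {a..b} (\<lambda>\<phi>. G' 0 \<phi> R0)\<bar> < e" by linarith
    then have g5: "\<exists>D>0. ((\<lambda>R. f \<epsilon> R b) has_real_derivative D) (at R) \<and>
        \<bar>(D - 1) / \<epsilon> - integral {a..b} (\<lambda>\<phi>. G' 0 \<phi> R0)\<bar> < e" using der by (intro exI[of _ "exp (\<epsilon> * I)"]) auto
    show ?thesis using g1 g2 g3 g4 g5 by (intro conjI ballI)
  qed
  show "\<exists>\<delta>>0. \<delta> \<le> e1 \<and> (\<forall>\<epsilon> R. 0 < \<epsilon> \<longrightarrow> \<epsilon> < \<delta> \<longrightarrow> \<bar>R - R0\<bar> < \<delta> \<longrightarrow>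
      f \<epsilon> R a = R \<and>
      (\<forall>\<phi>\<in>{a..b}. \<bar>f \<epsilon> R \<phi> - R0\<bar> < d \<and>
        (f \<epsilon> R has_real_derivative \<epsilon> * G \<epsilon> \<phi> (f \<epsilon> R \<phi>)) (at \<phi> within {a..b})) \<and>
      \<bar>(f \<epsilon> R b - R) / \<epsilon> - integral {a..b} (\<lambda>\<phi>. G 0 \<phi> R0)\<bar> < e \<and>
      (\<exists>D>0. ((\<lambda>R. f \<epsilon> R b) has_real_derivative D) (at R) \<and>
        \<bar>(D - 1) / \<epsilon> - integral {a..b} (\<lambda>\<phi>. G' 0 \<phi> R0)\<bar> < e))"
    by (intro exI[of _ \<delta>] conjI \<delta>(1,2) allI impI main)
  qed
qed

section \<open>Straightening the unperturbed half systems\<close>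

definition cw :: "real \<Rightarrow> real \<Rightarrow> real \<Rightarrow> real" where
  "cw l n y = (1 - n * y) * (1 - y) powr (2 * l - 1)"

definition cw' :: "real \<Rightarrow> real \<Rightarrow> real \<Rightarrow> real" where
  "cw' l n y = - n * (1 - y) powr (2 * l - 1) - (1 - n * y) * ((2 * l - 1) * (1 - y) powr (2 * l - 2))"

text \<open>
  For \<open>d = m = 0\<close> the function \<open>(1 - y) powr (2 * l) * x\<^sup>2 + P y\<close> with \<open>P' y = 2 * y * cw l n y\<close> is a
  first integral; \<open>cQ y = P y / y\<^sup>2\<close>, written without the removable singularity at \<open>0\<close>.
\<close>

definition cQ :: "real \<Rightarrow> real \<Rightarrow> real \<Rightarrow> real" where
  "cQ l n y = 2 * integral {0..1} (\<lambda>t. t * cw l n (t * y))"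

definition cQ' :: "real \<Rightarrow> real \<Rightarrow> real \<Rightarrow> real" where
  "cQ' l n y = 2 * integral {0..1} (\<lambda>t. t * (t * cw' l n (t * y)))"

text \<open>The square root of \<open>P\<close> with the sign of \<open>y\<close>. Together with
  \<open>\<xi> = x * (1 - y) powr l\<close> it turns the level curves of the first integral into
  circles.\<close>

definition cE :: "real \<Rightarrow> real \<Rightarrow> real \<Rightarrow> real" where
  "cE l n y = y * sqrt (cQ l n y)"

definition cE' :: "real \<Rightarrow> real \<Rightarrow> real \<Rightarrow> real" where
  "cE' l n y = cw l n y / sqrt (cQ l n y)"

definition cE'' :: "real \<Rightarrow> real \<Rightarrow> real \<Rightarrow> real" where
  "cE'' l n y = (cw' l n y * sqrt (cQ l n y) - cw l n y * (cQ' l n y / (2 * sqrt (cQ l n y)))) / cQ l n y"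

text \<open>Small enough that \<open>\<bar>y\<bar> < cc n\<close> keeps both \<open>1 - y\<close>
  and \<open>1 - n * y\<close> above \<open>1/2\<close>; there the weight \<open>cw\<close> is
  positive and smooth.\<close>

definition cc :: "real \<Rightarrow> real" where "cc n = 1 / (2 * (1 + \<bar>n\<bar>))"

lemma cc: "0 < cc n" "cc n \<le> 1 / 2"
  by (auto simp: cc_def field_simps)

lemma cc_bounds:
  assumes "\<bar>y\<bar> < cc n" shows "\<bar>y\<bar> < 1 / 2" "\<bar>n * y\<bar> < 1 / 2"
proof -
  show "\<bar>y\<bar> < 1 / 2" using assms cc[of n] by simp
  have "\<bar>n * y\<bar> \<le> \<bar>n\<bar> * cc n" using assms by (simp add: abs_mult mult_left_mono)
  also have "\<dots> < 1 / 2" by (simp add: cc_def field_simps)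
  finally show "\<bar>n * y\<bar> < 1 / 2" .
qed

lemma cc_scale: "\<bar>y\<bar> < cc n \<Longrightarrow> t \<in> {0..1} \<Longrightarrow> \<bar>t * y\<bar> < cc n"
  by (simp add: abs_mult) (meson abs_ge_zero le_less_trans mult_left_le_one_le)

lemma cw_pos: "\<bar>y\<bar> < cc n \<Longrightarrow> cw l n y > 0"
  using cc_bounds[of y n] by (auto simp: cw_def)

lemma DERIV_cw:
  assumes "\<bar>y\<bar> < cc n"
  shows "(cw l n has_real_derivative cw' l n y) (at y within S)"
proof -
  have "1 - y > 0" using cc_bounds[OF assms] by auto
  moreover have "((\<lambda>y. 1 - y) has_real_derivative - 1) (at y within S)" by (auto intro!: derivative_eq_intros)
  ultimately have "((\<lambda>y. (1 - y) powr (2 * l - 1)) has_real_derivative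
      (2 * l - 1) * (1 - y) powr (2 * l - 1 - 1) * - 1) (at y within S)"
    by (intro DERIV_chain2[OF has_real_derivative_powr])
  moreover have "((\<lambda>y. 1 - n * y) has_real_derivative - n) (at y within S)" by (auto intro!: derivative_eq_intros)
  ultimately have "((\<lambda>y. (1 - n * y) * (1 - y) powr (2 * l - 1)) has_real_derivative
      - n * (1 - y) powr (2 * l - 1) + (2 * l - 1) * (1 - y) powr (2 * l - 1 - 1) * - 1 * (1 - n * y)) (at y within S)"
    by (rule DERIV_mult[rotated])
  then show ?thesis unfolding cw_def[abs_def] cw'_def by (simp add: algebra_simps)
qed

lemma continuous_cw: "continuous_on {y. \<bar>y\<bar> < cc n} (cw l n)" "continuous_on {y. \<bar>y\<bar> < cc n} (cw' l n)"
proof -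
  have "1 - y \<noteq> 0" if "y \<in> {y. \<bar>y\<bar> < cc n}" for y using cc_bounds(1)[of y n] that by auto
  then show "continuous_on {y. \<bar>y\<bar> < cc n} (cw l n)" "continuous_on {y. \<bar>y\<bar> < cc n} (cw' l n)"
    unfolding cw_def[abs_def] cw'_def[abs_def] by (intro continuous_intros ballI; blast)+
qed

lemma continuous_cw_scaled:
  assumes h: "continuous_on {y. \<bar>y\<bar> < cc n} h"
  shows "continuous_on ({y. \<bar>y\<bar> < cc n} \<times> {0..1}) (\<lambda>(y, t). h (t * y) :: real)"
proof -
  have "continuous_on ({y. \<bar>y\<bar> < cc n} \<times> {0..1}) (h \<circ> (\<lambda>(y, t). t * y))"
    by (intro continuous_on_compose continuous_on_subset[OF h])
      (auto simp: split_beta intro!: continuous_intros cc_scale)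
  then show ?thesis by (simp add: o_def split_beta)
qed

lemma open_cc: "open {y. \<bar>y\<bar> < cc n}" "convex {y. \<bar>y\<bar> < cc n}"
proof -
  have "{y. \<bar>y\<bar> < cc n} = {- cc n<..<cc n}" by (auto simp: abs_less_iff)
  then show "open {y. \<bar>y\<bar> < cc n}" "convex {y. \<bar>y\<bar> < cc n}" by auto
qed

lemma DERIV_cQ:
  assumes "\<bar>y\<bar> < cc n" shows "(cQ l n has_real_derivative cQ' l n y) (at y)"
proof -
  let ?U = "{y. \<bar>y\<bar> < cc n}"
  have "((\<lambda>y. integral (cbox 0 1) (\<lambda>t. t * cw l n (t * y))) has_field_derivative
      integral (cbox 0 1) (\<lambda>t. t * (t * cw' l n (t * y)))) (at y within ?U)"
  proof (rule leibniz_rule_field_derivative)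
    fix x t assume "x \<in> ?U" "t \<in> cbox (0::real) 1"
    then have "\<bar>t * x\<bar> < cc n" by (auto intro: cc_scale)
    then show "((\<lambda>x. t * cw l n (t * x)) has_field_derivative t * (t * cw' l n (t * x))) (at x within ?U)"
      using DERIV_cmult[OF DERIV_chain2[OF DERIV_cw DERIV_cmult_Id], of t x n t l ?U] by (simp add: mult.commute)
  next
    fix x assume "x \<in> ?U"
    then have "continuous_on {0..1} ((\<lambda>(y, t). cw l n (t * y)) \<circ> (\<lambda>t. (x, t)))"
      by (intro continuous_on_compose continuous_on_subset[OF continuous_cw_scaled[OF continuous_cw(1)]] continuous_intros) auto
    then show "(\<lambda>t. t * cw l n (t * x)) integrable_on cbox 0 1"
      by (intro integrable_continuous) (auto intro!: continuous_intros simp: o_def)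
  next
    show "continuous_on (?U \<times> cbox 0 1) (\<lambda>(x, t). t * (t * cw' l n (t * x)))"
      using continuous_cw_scaled[OF continuous_cw(2), of n l]
      by (auto simp: split_beta intro!: continuous_intros)
  qed (use assms open_cc in auto)
  then have "((\<lambda>y. integral {0..1} (\<lambda>t. t * cw l n (t * y))) has_field_derivative
      integral {0..1} (\<lambda>t. t * (t * cw' l n (t * y)))) (at y)"
    using at_within_open[OF _ open_cc(1), of y n] assms by simp
  from DERIV_cmult[OF this, of 2] show ?thesis unfolding cQ_def[abs_def] cQ'_def .
qed

lemma continuous_cQ': "continuous_on {y. \<bar>y\<bar> < cc n} (cQ' l n)"
  unfolding cQ'_def[abs_def]
proof (intro continuous_on_mult_left)
  have "continuous_on {y. \<bar>y\<bar> < cc n} (\<lambda>y. integral (cbox 0 1) (\<lambda>t. t * (t * cw' l n (t * y))))"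
    using continuous_cw_scaled[OF continuous_cw(2), of n l]
    by (intro integral_continuous_on_param) (auto simp: split_beta intro!: continuous_intros)
  then show "continuous_on {y. \<bar>y\<bar> < cc n} (\<lambda>y. integral {0..1} (\<lambda>t. t * (t * cw' l n (t * y))))" by simp
qed

lemma continuous_scaled_slice:
  assumes "continuous_on {y. \<bar>y\<bar> < cc n} h" "\<bar>y\<bar> < cc n"
  shows "continuous_on {0..1} (\<lambda>t. h (t * y) :: real)"
proof -
  have "continuous_on {0..1} (h \<circ> (\<lambda>t. t * y))"
    using assms(2) by (intro continuous_on_compose continuous_on_subset[OF assms(1)]) (auto intro!: continuous_intros cc_scale)
  then show ?thesis by (simp add: o_def)
qed

text \<open>This is the derivative of \<open>y\<^sup>2 * cQ l n y = P y\<close> divided by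
  \<open>y\<close>, but valid at \<open>0\<close> as well: it integrates the derivative of
  \<open>t\<^sup>2 * cw l n (t * y)\<close> over the unit interval. It is what removes
  \<open>cQ'\<close> from the derivative of \<open>cE\<close>.\<close>

lemma cQ_ode:
  assumes "\<bar>y\<bar> < cc n" shows "2 * cQ l n y + y * cQ' l n y = 2 * cw l n y"
proof -
  note c = continuous_scaled_slice[OF continuous_cw(1) assms] continuous_scaled_slice[OF continuous_cw(2) assms]
  have "((\<lambda>t. 2 * (t * cw l n (t * y)) + y * (t * (t * cw' l n (t * y)))) has_integral
      1\<^sup>2 * cw l n (1 * y) - 0\<^sup>2 * cw l n (0 * y)) {0..1}"
  proof (rule fundamental_theorem_of_calculus)
    fix t :: real assume t: "t \<in> {0..1}"
    have "((\<lambda>t. t\<^sup>2 * cw l n (t * y)) has_real_derivative 2 * (t * cw l n (t * y)) + y * (t * (t * cw' l n (t * y))))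
        (at t within {0..1})"
      by (auto intro!: derivative_eq_intros DERIV_chain2[where f="cw l n"] DERIV_cw cc_scale assms t
          simp: power2_eq_square algebra_simps)
    then show "((\<lambda>t. t\<^sup>2 * cw l n (t * y)) has_vector_derivative 2 * (t * cw l n (t * y)) + y * (t * (t * cw' l n (t * y))))
        (at t within {0..1})" by (simp add: has_real_derivative_iff_has_vector_derivative)
  qed simp
  from integral_unique[OF this]
  have "integral {0..1} (\<lambda>t. 2 * (t * cw l n (t * y)) + y * (t * (t * cw' l n (t * y)))) = cw l n y" by simp
  also have "integral {0..1} (\<lambda>t. 2 * (t * cw l n (t * y)) + y * (t * (t * cw' l n (t * y)))) =
      integral {0..1} (\<lambda>t. 2 * (t * cw l n (t * y))) + integral {0..1} (\<lambda>t. y * (t * (t * cw' l n (t * y))))"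
    by (rule Henstock_Kurzweil_Integration.integral_add) (auto intro!: integrable_continuous_interval continuous_intros c)
  finally show ?thesis by (simp add: cQ_def cQ'_def)
qed

lemma cQ_pos:
  assumes "\<bar>y\<bar> < cc n" shows "cQ l n y > 0"
proof -
  note c = continuous_scaled_slice[OF continuous_cw(1) assms]
  let ?h = "\<lambda>t. t * cw l n (t * y)"
  have ch: "continuous_on {0..1} ?h" by (intro continuous_intros c)
  have nn: "?h t \<ge> 0" if "t \<in> {0..1}" for t
    using cw_pos[OF cc_scale[OF assms that], of l] that by simp
  have "integral {0..1} ?h \<noteq> 0"
  proof
    assume "integral {0..1} ?h = 0"
    then have "(?h has_integral 0) (cbox 0 1)"
      using integrable_integral[OF integrable_continuous_interval[OF ch]] by simp
    from has_integral_0_cbox_imp_0[OF _ _ this, of 1] show False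
      using ch nn cw_pos[OF assms, of l] by auto
  qed
  moreover have "integral {0..1} ?h \<ge> 0" by (rule integral_nonneg) (use nn integrable_continuous_interval[OF ch] in auto)
  ultimately show ?thesis by (simp add: cQ_def)
qed

lemma DERIV_cE:
  assumes "\<bar>y\<bar> < cc n" shows "(cE l n has_real_derivative cE' l n y) (at y)"
proof -
  have q: "cQ l n y > 0" by (rule cQ_pos[OF assms])
  have "(cE l n has_real_derivative sqrt (cQ l n y) + y * (cQ' l n y * (inverse (sqrt (cQ l n y)) / 2))) (at y)"
    unfolding cE_def[abs_def]
    using DERIV_mult[OF DERIV_ident DERIV_chain2[OF DERIV_real_sqrt[OF q] DERIV_cQ[OF assms]]]
    by (simp add: algebra_simps)
  also have "sqrt (cQ l n y) + y * (cQ' l n y * (inverse (sqrt (cQ l n y)) / 2)) = cE' l n y"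
    using q cQ_ode[OF assms, of l] by (simp add: cE'_def field_simps)
  finally show ?thesis .
qed

lemma DERIV_cE':
  assumes "\<bar>y\<bar> < cc n" shows "(cE' l n has_real_derivative cE'' l n y) (at y)"
proof -
  have q: "cQ l n y > 0" by (rule cQ_pos[OF assms])
  show ?thesis unfolding cE'_def[abs_def] cE''_def
    by (auto intro!: derivative_eq_intros DERIV_chain2[where f=sqrt] DERIV_real_sqrt DERIV_cQ DERIV_cw assms q)
      (use q in \<open>auto simp: field_simps\<close>)
qed

lemma cE'_pos: "\<bar>y\<bar> < cc n \<Longrightarrow> cE' l n y > 0"
  by (simp add: cE'_def cw_pos cQ_pos)

lemma continuous_cQ: "continuous_on {y. \<bar>y\<bar> < cc n} (cQ l n)"
  by (rule DERIV_continuous_on[OF has_field_derivative_at_within[OF DERIV_cQ]]) simp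

lemma continuous_cE'': "continuous_on {y. \<bar>y\<bar> < cc n} (cE'' l n)"
proof -
  have "cQ l n y \<noteq> 0" "2 * sqrt (cQ l n y) \<noteq> 0" if "y \<in> {y. \<bar>y\<bar> < cc n}" for y
    using cQ_pos[of y n l] that by auto
  then show ?thesis unfolding cE''_def[abs_def]
    by (intro continuous_intros continuous_cw continuous_cQ continuous_cQ' ballI; blast)
qed

lemma cE_zero [simp]: "cE l n 0 = 0" by (simp add: cE_def)

lemma cE_mult_cE': "\<bar>y\<bar> < cc n \<Longrightarrow> cE l n y * cE' l n y = y * cw l n y"
  using cQ_pos[of y n l] by (simp add: cE_def cE'_def)

text \<open>It identifies the chart whenever \<open>P\<close> is elementary: both sides have the
  same derivative on an interval and vanish at \<open>0\<close>.\<close>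

lemma cE_square_eqI:
  assumes P: "P 0 = 0" "\<And>y. \<bar>y\<bar> < cc n \<Longrightarrow> (P has_real_derivative 2 * y * cw l n y) (at y)"
    and y: "\<bar>y\<bar> < cc n"
  shows "(cE l n y)\<^sup>2 = P y"
proof -
  have "\<exists>c. \<forall>y\<in>{y. \<bar>y\<bar> < cc n}. (cE l n y)\<^sup>2 - P y = c"
  proof (rule has_field_derivative_zero_constant[OF open_cc(2)])
    fix x assume "x \<in> {y. \<bar>y\<bar> < cc n}"
    then have x: "\<bar>x\<bar> < cc n" by simp
    have "((\<lambda>y. (cE l n y)\<^sup>2 - P y) has_real_derivative 2 * (cE l n x * cE' l n x) - 2 * x * cw l n x) (at x)"
      by (auto intro!: derivative_eq_intros DERIV_cE P(2) x)
    then show "((\<lambda>y. (cE l n y)\<^sup>2 - P y) has_real_derivative 0) (at x within {y. \<bar>y\<bar> < cc n})"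
      unfolding cE_mult_cE'[OF x] by (simp add: has_field_derivative_at_within)
  qed
  then obtain c where c: "\<And>y. \<bar>y\<bar> < cc n \<Longrightarrow> (cE l n y)\<^sup>2 - P y = c" by auto
  from c[of 0] have "c = 0" using cc(1)[of n] P(1) by simp
  then show ?thesis using c[OF y] by simp
qed

lemma cE_strict_mono:
  assumes "\<bar>x\<bar> < cc n" "\<bar>y\<bar> < cc n" "x < y" shows "cE l n x < cE l n y"
proof (rule DERIV_pos_imp_increasing[OF assms(3)])
  fix z assume "x \<le> z" "z \<le> y"
  then have "\<bar>z\<bar> < cc n" using assms by auto
  then show "\<exists>D. DERIV (cE l n) z :> D \<and> D > 0" using DERIV_cE cE'_pos by blast
qed

section \<open>The inverse chart\<close>

definition cd :: "real \<Rightarrow> real" where "cd n = cc n / 2"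

lemma cd: "0 < cd n" "cd n < cc n" "cd n \<le> 1/4"
  using cc[of n] by (auto simp: cd_def)

text \<open>A symmetric radius inside the image of \<open>{- cd n..cd n}\<close>, so that whole
  circles around \<open>0\<close> in the new coordinates lie in the range of the chart.\<close>

definition c\<eta> :: "real \<Rightarrow> real \<Rightarrow> real" where
  "c\<eta> l n = min (- cE l n (- cd n)) (cE l n (cd n))"

lemma c\<eta>_pos: "c\<eta> l n > 0"
  using cE_strict_mono[of "- cd n" n 0 l] cE_strict_mono[of 0 n "cd n" l] cd[of n] by (simp add: c\<eta>_def)

definition cY :: "real \<Rightarrow> real \<Rightarrow> real \<Rightarrow> real" where
  "cY l n = inv_into {- cd n..cd n} (cE l n)"

lemma inj_cE: "inj_on (cE l n) {- cd n..cd n}"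
proof (rule inj_onI)
  fix x y assume "x \<in> {- cd n..cd n}" "y \<in> {- cd n..cd n}" and eq: "cE l n x = cE l n y"
  then have "\<bar>x\<bar> < cc n" "\<bar>y\<bar> < cc n" using cd[of n] by auto
  then show "x = y" using cE_strict_mono[of x n y l] cE_strict_mono[of y n x l] eq
    by (cases x y rule: linorder_cases) auto
qed

lemma cY_cE: "\<bar>y\<bar> \<le> cd n \<Longrightarrow> cY l n (cE l n y) = y"
  unfolding cY_def using inj_cE by (intro inv_into_f_f) auto

lemma cE_cY_aux:
  assumes "\<bar>\<eta>\<bar> < c\<eta> l n" shows "cE l n (cY l n \<eta>) = \<eta> \<and> \<bar>cY l n \<eta>\<bar> < cd n"
proof -
  have c: "continuous_on {- cd n..cd n} (cE l n)"
    using cd[of n] by (intro DERIV_continuous_on[OF has_field_derivative_at_within[OF DERIV_cE]]) auto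
  have b: "cE l n (- cd n) < \<eta>" "\<eta> < cE l n (cd n)" using assms by (auto simp: c\<eta>_def abs_less_iff)
  obtain y where y: "y \<ge> - cd n" "y \<le> cd n" "cE l n y = \<eta>"
    using IVT'[of "cE l n" "- cd n" \<eta> "cd n"] c b cd[of n] by auto
  have "y \<noteq> cd n" "y \<noteq> - cd n" using y b by auto
  then have "\<bar>y\<bar> < cd n" using y by auto
  then show ?thesis using y cY_cE[of y n l] by auto
qed

lemmas cE_cY = cE_cY_aux[THEN conjunct1] and cY_bound = cE_cY_aux[THEN conjunct2]

lemma cY_cc: "\<bar>\<eta>\<bar> < c\<eta> l n \<Longrightarrow> \<bar>cY l n \<eta>\<bar> < cc n"
  using cY_bound[of \<eta> l n] cd[of n] by simp

lemma isCont_cY: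
  assumes "\<bar>\<eta>\<bar> < c\<eta> l n" shows "isCont (cY l n) \<eta>"
proof -
  define y where "y = cY l n \<eta>"
  have y: "\<bar>y\<bar> < cd n" "cE l n y = \<eta>" using cY_bound[OF assms] cE_cY[OF assms] by (auto simp: y_def)
  define d where "d = cd n - \<bar>y\<bar>"
  have "isCont (cY l n) (cE l n y)"
  proof (rule isCont_inverse_function[where d=d and f="cE l n" and g="cY l n"])
    show "0 < d" using y by (simp add: d_def)
    fix z assume z: "\<bar>z - y\<bar> \<le> d"
    then have "\<bar>z\<bar> \<le> cd n" by (auto simp: d_def)
    then show "cY l n (cE l n z) = z" by (rule cY_cE)
    show "isCont (cE l n) z" using \<open>\<bar>z\<bar> \<le> cd n\<close> cd[of n] by (intro DERIV_isCont[OF DERIV_cE]) auto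
  qed
  then show ?thesis by (simp add: y)
qed

definition cY' :: "real \<Rightarrow> real \<Rightarrow> real \<Rightarrow> real" where "cY' l n \<eta> = inverse (cE' l n (cY l n \<eta>))"

definition cY'' :: "real \<Rightarrow> real \<Rightarrow> real \<Rightarrow> real" where
  "cY'' l n \<eta> = - (cE'' l n (cY l n \<eta>) * cY' l n \<eta> * (cY' l n \<eta>)\<^sup>2)"

lemma DERIV_cY:
  assumes "\<bar>\<eta>\<bar> < c\<eta> l n" shows "(cY l n has_real_derivative cY' l n \<eta>) (at \<eta>)"
  unfolding cY'_def
proof (rule DERIV_inverse_function[where f="cE l n" and a="- c\<eta> l n" and b="c\<eta> l n"])
  show "(cE l n has_real_derivative cE' l n (cY l n \<eta>)) (at (cY l n \<eta>))" by (rule DERIV_cE[OF cY_cc[OF assms]])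
  show "cE' l n (cY l n \<eta>) \<noteq> 0" using cE'_pos[OF cY_cc[OF assms], of l] by simp
  show "cE l n (cY l n y) = y" if "- c\<eta> l n < y" "y < c\<eta> l n" for y using that by (intro cE_cY) auto
  show "isCont (cY l n) \<eta>" by (rule isCont_cY[OF assms])
qed (use assms in auto)

lemma cY'_pos: "\<bar>\<eta>\<bar> < c\<eta> l n \<Longrightarrow> cY' l n \<eta> > 0"
  unfolding cY'_def using cE'_pos[OF cY_cc] by simp

lemma DERIV_cY':
  assumes "\<bar>\<eta>\<bar> < c\<eta> l n" shows "(cY' l n has_real_derivative cY'' l n \<eta>) (at \<eta>)"
proof -
  have "((\<lambda>\<eta>. cE' l n (cY l n \<eta>)) has_real_derivative cE'' l n (cY l n \<eta>) * cY' l n \<eta>) (at \<eta>)"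
    by (rule DERIV_chain2[OF DERIV_cE'[OF cY_cc[OF assms]] DERIV_cY[OF assms]])
  from DERIV_inverse_fun[OF this] show ?thesis
    using cE'_pos[OF cY_cc[OF assms], of l] unfolding cY'_def[abs_def] cY''_def
    by (simp add: cY'_def power2_eq_square)
qed

lemma continuous_cY:
  "continuous_on {\<eta>. \<bar>\<eta>\<bar> < c\<eta> l n} (cY l n)" "continuous_on {\<eta>. \<bar>\<eta>\<bar> < c\<eta> l n} (cY' l n)"
  "continuous_on {\<eta>. \<bar>\<eta>\<bar> < c\<eta> l n} (cY'' l n)"
proof -
  show 1: "continuous_on {\<eta>. \<bar>\<eta>\<bar> < c\<eta> l n} (cY l n)"
    by (rule DERIV_continuous_on[OF has_field_derivative_at_within[OF DERIV_cY]]) simp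
  show 2: "continuous_on {\<eta>. \<bar>\<eta>\<bar> < c\<eta> l n} (cY' l n)"
    by (rule DERIV_continuous_on[OF has_field_derivative_at_within[OF DERIV_cY']]) simp
  have "continuous_on {\<eta>. \<bar>\<eta>\<bar> < c\<eta> l n} (cE'' l n \<circ> cY l n)"
    by (intro continuous_on_compose 1 continuous_on_subset[OF continuous_cE'']) (auto intro: cY_cc)
  then show "continuous_on {\<eta>. \<bar>\<eta>\<bar> < c\<eta> l n} (cY'' l n)"
    unfolding cY''_def[abs_def] o_def by (intro continuous_intros 2)
qed

lemma cY_zero [simp]: "cY l n 0 = 0"
  using cY_cE[of 0 n l] cd[of n] by simp

lemma cY'_zero: "cY' l n 0 = 1"
proof -
  have "cQ l n 0 = 1"
  proof -
    have "((\<lambda>t. t) has_integral (1\<^sup>2 / 2 - 0\<^sup>2 / 2)) {0..1::real}"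
      by (rule fundamental_theorem_of_calculus)
        (auto intro!: derivative_eq_intros simp: has_real_derivative_iff_has_vector_derivative[symmetric])
    then show ?thesis by (simp add: cQ_def cw_def integral_unique)
  qed
  then show ?thesis by (simp add: cY'_def cE'_def cw_def)
qed

text \<open>Half the derivative of the identity
  \<open>\<eta>\<^sup>2 = P (cY l n \<eta>)\<close>.\<close>

lemma cY_key:
  assumes "\<bar>\<eta>\<bar> < c\<eta> l n"
  shows "\<eta> = cY l n \<eta> * (1 - n * cY l n \<eta>) * (1 - cY l n \<eta>) powr (2 * l - 1) * cY' l n \<eta>"
proof -
  have "\<eta> * cE' l n (cY l n \<eta>) = cY l n \<eta> * cw l n (cY l n \<eta>)"
    using cE_mult_cE'[OF cY_cc[OF assms], of l] cE_cY[OF assms] by simp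
  moreover have "cE' l n (cY l n \<eta>) > 0" by (rule cE'_pos[OF cY_cc[OF assms]])
  ultimately show ?thesis unfolding cY'_def cw_def by (simp add: field_simps)
qed

lemma cY_pos: "0 < \<eta> \<Longrightarrow> \<eta> < c\<eta> l n \<Longrightarrow> cY l n \<eta> > 0"
  and cY_neg: "\<eta> < 0 \<Longrightarrow> - c\<eta> l n < \<eta> \<Longrightarrow> cY l n \<eta> < 0"
proof -
  have *: "x < y" if "cE l n x < cE l n y" "\<bar>x\<bar> < cc n" "\<bar>y\<bar> < cc n" for x y
    using that cE_strict_mono[of y n x l] by (cases x y rule: linorder_cases) auto
  show "0 < \<eta> \<Longrightarrow> \<eta> < c\<eta> l n \<Longrightarrow> cY l n \<eta> > 0"
    using *[of 0 "cY l n \<eta>"] cE_cY[of \<eta> l n] cY_cc[of \<eta> l n] cc[of n] by auto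
  show "\<eta> < 0 \<Longrightarrow> - c\<eta> l n < \<eta> \<Longrightarrow> cY l n \<eta> < 0"
    using *[of "cY l n \<eta>" 0] cE_cY[of \<eta> l n] cY_cc[of \<eta> l n] cc[of n] by auto
qed

section \<open>Half orbits of the perturbed systems\<close>

text \<open>\<open>h\<close> is the time spent per unit of angle and \<open>\<tau>\<close> inverts
  the elapsed time \<open>H\<close>. Continuing \<open>h\<close> by constants and integrating from
  \<open>\<alpha> - 1\<close> makes \<open>H\<close> differentiable on a neighborhood of the closed
  interval, so the inverse is differentiable at the ends too.\<close>

lemma time_change:
  fixes h :: "real \<Rightarrow> real"
  assumes ab: "\<alpha> < \<beta>" and h: "continuous_on {\<alpha>..\<beta>} h" and pos: "\<And>\<phi>. \<phi> \<in> {\<alpha>..\<beta>} \<Longrightarrow> h \<phi> > 0"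
  obtains T \<tau> where "T > 0" "\<tau> 0 = \<alpha>" "\<tau> T = \<beta>"
    "\<And>t. t \<in> {0..T} \<Longrightarrow> \<tau> t \<in> {\<alpha>..\<beta>}" "\<And>t. t \<in> {0<..<T} \<Longrightarrow> \<tau> t \<in> {\<alpha><..<\<beta>}"
    "\<And>t. t \<in> {0..T} \<Longrightarrow> (\<tau> has_real_derivative inverse (h (\<tau> t))) (at t within {0..T})"
proof -
  define ct where "ct \<phi> = max \<alpha> (min \<beta> \<phi>)" for \<phi>
  have ct: "ct \<phi> \<in> {\<alpha>..\<beta>}" "\<phi> \<in> {\<alpha>..\<beta>} \<Longrightarrow> ct \<phi> = \<phi>" for \<phi> using ab by (auto simp: ct_def)
  define k where "k \<phi> = h (ct \<phi>)" for \<phi>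
  have ck: "continuous_on S k" for S
  proof -
    have "continuous_on S (h \<circ> ct)" using ct(1)
      by (intro continuous_on_compose continuous_on_subset[OF h]) (auto simp: ct_def intro!: continuous_intros)
    then show ?thesis by (simp add: k_def[abs_def] o_def)
  qed
  have kpos: "k \<phi> > 0" for \<phi> using pos ct by (simp add: k_def)
  define H where "H \<phi> = integral {\<alpha> - 1..\<phi>} k - integral {\<alpha> - 1..\<alpha>} k" for \<phi>
  have dH: "(H has_real_derivative k \<phi>) (at \<phi>)" if "\<alpha> - 1 < \<phi>" "\<phi> < \<beta> + 1" for \<phi>
  proof -
    have "((\<lambda>\<phi>. integral {\<alpha> - 1..\<phi>} k) has_real_derivative k \<phi>) (at \<phi> within {\<alpha> - 1..\<beta> + 1})"
      by (rule integral_has_real_derivative) (use ck that in auto)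
    then have "((\<lambda>\<phi>. integral {\<alpha> - 1..\<phi>} k) has_real_derivative k \<phi>) (at \<phi>)"
      using at_within_Icc_at[OF that] by simp
    from DERIV_diff[OF this DERIV_const] show ?thesis unfolding H_def[abs_def] by simp
  qed
  have H_mono: "H x < H y" if "\<alpha> - 1 < x" "x < y" "y < \<beta> + 1" for x y
    by (rule DERIV_pos_imp_increasing[OF that(2)]) (use dH kpos that in \<open>meson le_less_trans less_le_trans\<close>)
  have H\<alpha>: "H \<alpha> = 0" by (simp add: H_def)
  define T where "T = H \<beta>"
  have T: "T > 0" using H_mono[of \<alpha> \<beta>] ab H\<alpha> by (simp add: T_def)
  define a where "a = \<alpha> - 1/2" define b where "b = \<beta> + 1/2"
  have inj: "inj_on H {a..b}"
  proof (rule inj_onI)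
    fix x y assume "x \<in> {a..b}" "y \<in> {a..b}" and eq: "H x = H y"
    then show "x = y" using H_mono[of x y] H_mono[of y x] by (cases x y rule: linorder_cases) (auto simp: a_def b_def)
  qed
  define \<tau> where "\<tau> = inv_into {a..b} H"
  have \<tau>H: "\<tau> (H \<phi>) = \<phi>" if "\<phi> \<in> {a..b}" for \<phi> unfolding \<tau>_def by (rule inv_into_f_f[OF inj that])
  have cH: "continuous_on {a..b} H"
    by (rule DERIV_continuous_on[OF has_field_derivative_at_within[OF dH]]) (auto simp: a_def b_def)
  have pre: "\<exists>\<phi>\<in>{a..b}. H \<phi> = t" if "t \<in> {H a..H b}" for t
    using IVT'[of H a t b] that cH ab by (auto simp: a_def b_def)
  have H\<tau>: "H (\<tau> t) = t" if "t \<in> {H a..H b}" for t using pre[OF that] \<tau>H by metis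
  have Hab: "H a < 0" "T < H b" using H_mono[of a \<alpha>] H_mono[of \<beta> b] H\<alpha> ab by (auto simp: a_def b_def T_def)
  have range: "\<tau> t \<in> {\<alpha>..\<beta>}" "t \<in> {0<..<T} \<Longrightarrow> \<tau> t \<in> {\<alpha><..<\<beta>}" if t: "t \<in> {0..T}" for t
  proof -
    obtain \<phi> where \<phi>: "\<phi> \<in> {a..b}" "H \<phi> = t" using pre[of t] t Hab by auto
    have \<tau>: "\<tau> t = \<phi>" using \<tau>H \<phi> by blast
    have 1: "\<not> \<phi> < \<alpha>" using H_mono[of \<phi> \<alpha>] \<phi> t H\<alpha> ab by (auto simp: a_def b_def)
    have 2: "\<not> \<beta> < \<phi>" using H_mono[of \<beta> \<phi>] \<phi> t ab by (auto simp: a_def b_def T_def)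
    show "\<tau> t \<in> {\<alpha>..\<beta>}" using 1 2 \<tau> by auto
    assume "t \<in> {0<..<T}"
    then have "\<phi> \<noteq> \<alpha>" "\<phi> \<noteq> \<beta>" using \<phi> H\<alpha> by (auto simp: T_def)
    then show "\<tau> t \<in> {\<alpha><..<\<beta>}" using 1 2 \<tau> by auto
  qed
  have "(\<tau> has_real_derivative inverse (h (\<tau> t))) (at t within {0..T})" if t: "t \<in> {0..T}" for t
  proof -
    have \<tau>t: "\<tau> t \<in> {\<alpha>..\<beta>}" by (rule range[OF t])
    have cont: "isCont \<tau> (H (\<tau> t))"
    proof (rule isCont_inverse_function[where d="1/2" and f=H and g=\<tau>])
      fix z assume z: "\<bar>z - \<tau> t\<bar> \<le> 1/2"
      have "z - \<tau> t \<le> 1/2" "- (z - \<tau> t) \<le> 1/2" using z unfolding abs_le_iff by blast+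
      then have "z \<in> {a..b}" using \<tau>t by (auto simp: a_def b_def)
      then show "\<tau> (H z) = z" by (rule \<tau>H)
      show "isCont H z" using \<open>z \<in> {a..b}\<close> by (intro DERIV_isCont[OF dH]) (auto simp: a_def b_def)
    qed simp
    have Ht: "H (\<tau> t) = t" using H\<tau>[of t] t Hab by auto
    have "DERIV \<tau> t :> inverse (k (\<tau> t))"
    proof (rule DERIV_inverse_function[where f=H and a="H a" and b="H b"])
      show "DERIV H (\<tau> t) :> k (\<tau> t)" using \<tau>t by (intro dH) auto
      show "k (\<tau> t) \<noteq> 0" using kpos[of "\<tau> t"] by simp
      show "isCont \<tau> t" using cont Ht by simp
    qed (use t Hab H\<tau> in auto)
    then have "(\<tau> has_real_derivative inverse (k (\<tau> t))) (at t within {0..T})" by (rule has_field_derivative_at_within)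
    then show ?thesis using \<tau>t ct(2) by (simp add: k_def)
  qed
  moreover have "\<tau> 0 = \<alpha>" "\<tau> T = \<beta>" using \<tau>H[of \<alpha>] \<tau>H[of \<beta>] H\<alpha> ab by (auto simp: a_def b_def T_def)
  ultimately show ?thesis using that[of T \<tau>] T range by auto
qed

text \<open>
  One half of the family, \<open>Z (\<epsilon> * dh) (l + \<epsilon> * lh) (\<epsilon> * mh) (n + \<epsilon> * nh)\<close>. In the coordinates
  \<open>\<xi> = x * (1 - y) powr l\<close>, \<open>\<eta> = cE l n y\<close> and after a change of time it reads
  \<open>\<xi>' = - \<eta> + \<epsilon> * S\<close>, \<open>\<eta>' = \<xi>\<close> with \<open>S = A \<eta> * \<xi> + B \<eta> * \<xi>\<^sup>2 + C \<eta>\<close>; \<open>R\<close> and \<open>\<phi>\<close> are polar coordinates of \<open>(\<xi>, \<eta>)\<close>.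
\<close>

locale side =
  fixes l n dh lh mh nh :: real
begin

abbreviation "Y \<equiv> cY l n"
abbreviation "Y' \<equiv> cY' l n"
abbreviation "Y'' \<equiv> cY'' l n"
abbreviation "\<eta>0 \<equiv> c\<eta> l n"
abbreviation "J \<equiv> {\<eta>. \<bar>\<eta>\<bar> < \<eta>0}"

text \<open>\<open>A\<close> carries the directions \<open>dh\<close> and \<open>mh\<close>,
  \<open>B\<close> carries \<open>lh\<close>, and \<open>C\<close> carries \<open>nh\<close>. The
  exponents of \<open>1 - Y \<eta>\<close> add up the factor \<open>powr l\<close> in
  \<open>\<xi>\<close>, the time factor \<open>(1 - Y \<eta>) powr (l - 1) * Y' \<eta>\<close>, and
  a factor \<open>powr - l\<close> for each power of \<open>x\<close>.\<close>

definition "A \<eta> = (dh + mh * Y \<eta>) * (1 - Y \<eta>) powr (l - 1) * Y' \<eta>"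
definition "A' \<eta> = mh * Y' \<eta> * (1 - Y \<eta>) powr (l - 1) * Y' \<eta>
  + (dh + mh * Y \<eta>) * ((1 - l) * (1 - Y \<eta>) powr (l - 2) * Y' \<eta>) * Y' \<eta>
  + (dh + mh * Y \<eta>) * (1 - Y \<eta>) powr (l - 1) * Y'' \<eta>"
definition "B \<eta> = lh * (1 - Y \<eta>) powr - 1 * Y' \<eta>"
definition "B' \<eta> = lh * ((1 - Y \<eta>) powr - 2 * Y' \<eta>) * Y' \<eta> + lh * (1 - Y \<eta>) powr - 1 * Y'' \<eta>"
definition "C \<eta> = nh * (Y \<eta>)\<^sup>2 * (1 - Y \<eta>) powr (2 * l - 1) * Y' \<eta>"
definition "C' \<eta> = nh * (2 * Y \<eta> * Y' \<eta>) * (1 - Y \<eta>) powr (2 * l - 1) * Y' \<eta>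
  + nh * (Y \<eta>)\<^sup>2 * ((1 - 2 * l) * (1 - Y \<eta>) powr (2 * l - 2) * Y' \<eta>) * Y' \<eta>
  + nh * (Y \<eta>)\<^sup>2 * (1 - Y \<eta>) powr (2 * l - 1) * Y'' \<eta>"

lemma Y_lt: "\<bar>\<eta>\<bar> < \<eta>0 \<Longrightarrow> 1 - Y \<eta> > 0"
  using cY_bound[of \<eta> l n] cd[of n] by auto

lemma DERIV_powr_Y:
  assumes "\<bar>\<eta>\<bar> < \<eta>0"
  shows "((\<lambda>\<eta>. (1 - Y \<eta>) powr s) has_real_derivative - s * (1 - Y \<eta>) powr (s - 1) * Y' \<eta>) (at \<eta>)"
proof -
  have "((\<lambda>\<eta>. 1 - Y \<eta>) has_real_derivative - Y' \<eta>) (at \<eta>)"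
    by (auto intro!: derivative_eq_intros DERIV_cY assms)
  from DERIV_chain2[OF has_real_derivative_powr[OF Y_lt[OF assms]] this] show ?thesis by simp
qed

lemma DERIV_ABC:
  assumes "\<bar>\<eta>\<bar> < \<eta>0"
  shows "(A has_real_derivative A' \<eta>) (at \<eta>)" "(B has_real_derivative B' \<eta>) (at \<eta>)"
    "(C has_real_derivative C' \<eta>) (at \<eta>)"
proof -
  note d = DERIV_cY[OF assms] DERIV_cY'[OF assms] DERIV_powr_Y[OF assms]
  have "((\<lambda>\<eta>. (dh + mh * Y \<eta>) * (1 - Y \<eta>) powr (l - 1) * Y' \<eta>) has_real_derivative
    ((mh * Y' \<eta>) * (1 - Y \<eta>) powr (l - 1) + (- (l - 1) * (1 - Y \<eta>) powr (l - 1 - 1) * Y' \<eta>) * (dh + mh * Y \<eta>)) * Y' \<eta>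
    + Y'' \<eta> * ((dh + mh * Y \<eta>) * (1 - Y \<eta>) powr (l - 1))) (at \<eta>)"
    by (intro DERIV_mult d) (auto intro!: derivative_eq_intros d)
  then show "(A has_real_derivative A' \<eta>) (at \<eta>)" unfolding A_def[abs_def] A'_def by (simp add: algebra_simps)
  have "((\<lambda>\<eta>. (lh * (1 - Y \<eta>) powr - 1) * Y' \<eta>) has_real_derivative
    (lh * (- (- 1) * (1 - Y \<eta>) powr (- 1 - 1) * Y' \<eta>)) * Y' \<eta> + Y'' \<eta> * (lh * (1 - Y \<eta>) powr - 1)) (at \<eta>)"
    by (intro DERIV_mult DERIV_cmult d)
  then show "(B has_real_derivative B' \<eta>) (at \<eta>)" unfolding B_def[abs_def] B'_def by (simp add: algebra_simps)
  have "((\<lambda>\<eta>. (nh * (Y \<eta>)\<^sup>2) * (1 - Y \<eta>) powr (2 * l - 1) * Y' \<eta>) has_real_derivative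
    ((nh * (2 * Y \<eta> * Y' \<eta>)) * (1 - Y \<eta>) powr (2 * l - 1)
      + (- (2 * l - 1) * (1 - Y \<eta>) powr (2 * l - 1 - 1) * Y' \<eta>) * (nh * (Y \<eta>)\<^sup>2)) * Y' \<eta>
    + Y'' \<eta> * ((nh * (Y \<eta>)\<^sup>2) * (1 - Y \<eta>) powr (2 * l - 1))) (at \<eta>)"
    by (intro DERIV_mult DERIV_cmult d) (auto intro!: derivative_eq_intros d)
  then show "(C has_real_derivative C' \<eta>) (at \<eta>)" unfolding C_def[abs_def] C'_def by (simp add: algebra_simps)
qed

lemma continuous_powr_Y: "continuous_on J (\<lambda>\<eta>. (1 - Y \<eta>) powr s)"
  by (rule DERIV_continuous_on[OF has_field_derivative_at_within[OF DERIV_powr_Y]]) simp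

lemma continuous_ABC:
  "continuous_on J A" "continuous_on J A'" "continuous_on J B" "continuous_on J B'" "continuous_on J C" "continuous_on J C'"
proof -
  note c = continuous_on_mult continuous_on_add continuous_on_const continuous_on_power continuous_powr_Y continuous_cY
  show "continuous_on J A" "continuous_on J B" "continuous_on J C"
    unfolding A_def[abs_def] B_def[abs_def] C_def[abs_def] by (intro c)+
  show "continuous_on J A'" "continuous_on J B'" "continuous_on J C'"
    unfolding A'_def[abs_def] B'_def[abs_def] C'_def[abs_def] by (intro c)+
qed

definition "S R \<phi> = A (R * sin \<phi>) * (R * cos \<phi>) + B (R * sin \<phi>) * (R * cos \<phi>)\<^sup>2 + C (R * sin \<phi>)"
definition "S' R \<phi> = A' (R * sin \<phi>) * sin \<phi> * (R * cos \<phi>) + A (R * sin \<phi>) * cos \<phi>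
  + (B' (R * sin \<phi>) * sin \<phi> * (R * cos \<phi>)\<^sup>2 + B (R * sin \<phi>) * (2 * R * (cos \<phi>)\<^sup>2)) + C' (R * sin \<phi>) * sin \<phi>"

lemma in_J: "\<bar>R\<bar> < \<eta>0 \<Longrightarrow> \<bar>R * sin \<phi>\<bar> < \<eta>0"
  by (simp add: abs_mult) (meson abs_ge_zero abs_sin_le_one le_less_trans mult_right_le_one_le)

lemma DERIV_S:
  assumes "\<bar>R\<bar> < \<eta>0" shows "((\<lambda>R. S R \<phi>) has_real_derivative S' R \<phi>) (at R)"
proof -
  have i: "((\<lambda>R. R * sin \<phi>) has_real_derivative sin \<phi>) (at R)" "((\<lambda>R. R * cos \<phi>) has_real_derivative cos \<phi>) (at R)"
    by (auto intro!: derivative_eq_intros)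
  note d = DERIV_chain2[OF DERIV_ABC(1)[OF in_J[OF assms, of \<phi>]] i(1)]
    DERIV_chain2[OF DERIV_ABC(2)[OF in_J[OF assms, of \<phi>]] i(1)]
    DERIV_chain2[OF DERIV_ABC(3)[OF in_J[OF assms, of \<phi>]] i(1)]
  have sq: "((\<lambda>R. (R * cos \<phi>)\<^sup>2) has_real_derivative 2 * R * (cos \<phi>)\<^sup>2) (at R)"
    by (auto intro!: derivative_eq_intros simp: power2_eq_square)
  have "((\<lambda>R. S R \<phi>) has_real_derivative
      (A' (R * sin \<phi>) * sin \<phi> * (R * cos \<phi>) + cos \<phi> * A (R * sin \<phi>)
      + (B' (R * sin \<phi>) * sin \<phi> * (R * cos \<phi>)\<^sup>2 + 2 * R * (cos \<phi>)\<^sup>2 * B (R * sin \<phi>)) + C' (R * sin \<phi>) * sin \<phi>)) (at R)"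
    unfolding S_def by (intro DERIV_add DERIV_mult d i sq)
  then show ?thesis by (simp add: S'_def mult.commute)
qed

lemma continuous_S:
  "continuous_on ({R. \<bar>R\<bar> < \<eta>0} \<times> UNIV) (\<lambda>(R, \<phi>). S R \<phi>)"
  "continuous_on ({R. \<bar>R\<bar> < \<eta>0} \<times> UNIV) (\<lambda>(R, \<phi>). S' R \<phi>)"
proof -
  have "continuous_on ({R. \<bar>R\<bar> < \<eta>0} \<times> UNIV) (h \<circ> (\<lambda>(R, \<phi>). R * sin \<phi>))" if "continuous_on J h" for h :: "real \<Rightarrow> real"
    by (intro continuous_on_compose continuous_on_subset[OF that])
      (auto simp: split_beta intro!: continuous_intros in_J)
  then have c: "continuous_on ({R. \<bar>R\<bar> < \<eta>0} \<times> UNIV) (\<lambda>p. h (fst p * sin (snd p)))" if "continuous_on J h" for h :: "real \<Rightarrow> real"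
    using that by (simp add: o_def split_beta)
  show "continuous_on ({R. \<bar>R\<bar> < \<eta>0} \<times> UNIV) (\<lambda>(R, \<phi>). S R \<phi>)"
    "continuous_on ({R. \<bar>R\<bar> < \<eta>0} \<times> UNIV) (\<lambda>(R, \<phi>). S' R \<phi>)"
    unfolding S_def S'_def split_beta by (intro continuous_intros c continuous_ABC)+
qed

definition pt :: "real \<Rightarrow> real \<Rightarrow> plane" where
  "pt R \<phi> = (R * cos \<phi> * (1 - Y (R * sin \<phi>)) powr - l, Y (R * sin \<phi>))"

abbreviation "F \<epsilon> \<equiv> Z (\<epsilon> * dh) (l + \<epsilon> * lh) (\<epsilon> * mh) (n + \<epsilon> * nh)"

text \<open>The angular speed in the new time. With the radial speed
  \<open>\<epsilon> * cos \<phi> * S R \<phi>\<close> it gives the equation for \<open>R\<close> as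
  a function of the angle.\<close>

definition "\<Delta> \<epsilon> R \<phi> = 1 - \<epsilon> * sin \<phi> * S R \<phi> / R"

text \<open>A solution of the radial equation parametrizes an orbit of \<open>F \<epsilon>\<close>
  by the angle, and the scalar factor is the time per angle. The computation rests on
  \<open>cY_key\<close>, which produces the unperturbed terms, and on
  \<open>R * \<Delta> = R - \<epsilon> * sin \<phi> * S\<close>.\<close>

lemma pt_derivative:
  assumes R: "0 < \<rho> \<phi>" "\<rho> \<phi> < \<eta>0" and \<Delta>: "\<Delta> \<epsilon> (\<rho> \<phi>) \<phi> > 0"
    and d: "(\<rho> has_real_derivative \<epsilon> * cos \<phi> * S (\<rho> \<phi>) \<phi> / \<Delta> \<epsilon> (\<rho> \<phi>) \<phi>) (at \<phi> within I)"
  shows "((\<lambda>\<phi>. pt (\<rho> \<phi>) \<phi>) has_vector_derivative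
    ((1 - Y (\<rho> \<phi> * sin \<phi>)) powr (l - 1) * Y' (\<rho> \<phi> * sin \<phi>) / \<Delta> \<epsilon> (\<rho> \<phi>) \<phi>) *\<^sub>R F \<epsilon> (pt (\<rho> \<phi>) \<phi>)) (at \<phi> within I)"
proof -
  define R where "R = \<rho> \<phi>"
  define \<eta> where "\<eta> = R * sin \<phi>"
  define \<xi> where "\<xi> = R * cos \<phi>"
  define D where "D = \<Delta> \<epsilon> R \<phi>"
  define s where "s = S R \<phi>"
  have R0: "R > 0" "D > 0" using R \<Delta> by (auto simp: R_def D_def)
  have \<eta>J: "\<bar>\<eta>\<bar> < \<eta>0" using in_J[of R \<phi>] R by (simp add: R_def \<eta>_def)
  have Deq: "D = 1 - \<epsilon> * sin \<phi> * s / R" by (simp add: D_def \<Delta>_def s_def)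
  have RD: "R * D = R - \<epsilon> * sin \<phi> * s" using R0 by (simp add: Deq field_simps)
  have d': "(\<rho> has_real_derivative \<epsilon> * cos \<phi> * s / D) (at \<phi> within I)" using d by (simp add: R_def s_def D_def)
  have sc: "(sin \<phi>)\<^sup>2 = 1 - (cos \<phi>)\<^sup>2" by (simp add: sin_squared_eq)
  have d\<eta>: "((\<lambda>\<phi>. \<rho> \<phi> * sin \<phi>) has_real_derivative \<xi> / D) (at \<phi> within I)"
  proof -
    have "((\<lambda>\<phi>. \<rho> \<phi> * sin \<phi>) has_real_derivative \<epsilon> * cos \<phi> * s / D * sin \<phi> + cos \<phi> * \<rho> \<phi>) (at \<phi> within I)"
      by (intro DERIV_mult d' has_field_derivative_at_within[OF DERIV_sin])
    also have "\<epsilon> * cos \<phi> * s / D * sin \<phi> + cos \<phi> * \<rho> \<phi> = cos \<phi> * (\<epsilon> * sin \<phi> * s + R * D) / D"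
      using R0 by (simp add: R_def field_simps)
    also have "\<dots> = \<xi> / D" using RD by (simp add: \<xi>_def)
    finally show ?thesis .
  qed
  have d\<xi>: "((\<lambda>\<phi>. \<rho> \<phi> * cos \<phi>) has_real_derivative (\<epsilon> * s - \<eta>) / D) (at \<phi> within I)"
  proof -
    have "((\<lambda>\<phi>. \<rho> \<phi> * cos \<phi>) has_real_derivative \<epsilon> * cos \<phi> * s / D * cos \<phi> + - sin \<phi> * \<rho> \<phi>) (at \<phi> within I)"
      by (intro DERIV_mult d' has_field_derivative_at_within[OF DERIV_cos])
    also have "\<epsilon> * cos \<phi> * s / D * cos \<phi> + - sin \<phi> * \<rho> \<phi> = (\<epsilon> * (cos \<phi>)\<^sup>2 * s - sin \<phi> * (R * D)) / D"
      using R0 by (simp add: R_def field_simps power2_eq_square)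
    also have "\<epsilon> * (cos \<phi>)\<^sup>2 * s - sin \<phi> * (R * D) = \<epsilon> * s * ((cos \<phi>)\<^sup>2 + (sin \<phi>)\<^sup>2) - \<eta>"
      unfolding RD \<eta>_def by algebra
    also have "\<dots> = \<epsilon> * s - \<eta>" by simp
    finally show ?thesis .
  qed
  define y where "y = Y \<eta>"
  define q where "q = 1 - y"
  define g where "g = q powr l"
  define y' where "y' = Y' \<eta>"
  have q: "q > 0" using Y_lt[OF \<eta>J] by (simp add: q_def y_def)
  have g: "g > 0" using q by (simp add: g_def)
  have pw: "q powr - l = 1 / g" "q powr (l - 1) = g / q" "q powr (- l - 1) = 1 / (g * q)"
    "q powr (2 * l - 1) = g * g / q" "q powr - 1 = 1 / q"
    using q by (auto simp: g_def powr_diff powr_minus_divide powr_add[symmetric])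
  have dy: "((\<lambda>\<phi>. Y (\<rho> \<phi> * sin \<phi>)) has_real_derivative y' * (\<xi> / D)) (at \<phi> within I)"
    using DERIV_chain2[where f=Y, OF DERIV_cY d\<eta>] \<eta>J by (simp add: y'_def \<eta>_def R_def)
  have dg: "((\<lambda>\<phi>. (1 - Y (\<rho> \<phi> * sin \<phi>)) powr - l) has_real_derivative (l * (1 / (g * q)) * y') * (\<xi> / D)) (at \<phi> within I)"
    using DERIV_chain2[where f="\<lambda>\<eta>. (1 - Y \<eta>) powr - l", OF DERIV_powr_Y d\<eta>] \<eta>J pw(3)
    by (simp add: y'_def \<eta>_def R_def q_def y_def)
  have dx: "((\<lambda>\<phi>. \<rho> \<phi> * cos \<phi> * (1 - Y (\<rho> \<phi> * sin \<phi>)) powr - l) has_real_derivative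
      (\<epsilon> * s - \<eta>) / D * (1 / g) + (l * (1 / (g * q)) * y') * (\<xi> / D) * \<xi>) (at \<phi> within I)"
    using DERIV_mult[OF d\<xi> dg] pw(1) by (simp add: \<xi>_def R_def q_def y_def \<eta>_def ac_simps)
  have key: "\<eta> = y * (1 - n * y) * (g * g / q) * y'"
    using cY_key[OF \<eta>J] pw(4) by (simp add: y_def q_def y'_def)
  have s: "s = (dh + mh * y) * (g / q) * y' * \<xi> + lh * (1 / q) * y' * \<xi>\<^sup>2 + nh * y\<^sup>2 * (g * g / q) * y'"
    using pw by (simp add: s_def S_def A_def B_def C_def y_def q_def y'_def \<xi>_def \<eta>_def)
  define x where "x = \<xi> * (1 / g)"
  have ptx: "pt (\<rho> \<phi>) \<phi> = (x, y)"
    using pw(1) by (simp add: pt_def x_def \<xi>_def y_def \<eta>_def R_def q_def)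
  have e1: "(\<epsilon> * s - \<eta>) / D * (1 / g) + (l * (1 / (g * q)) * y') * (\<xi> / D) * \<xi>
     = g / q * y' / D * (- y + (\<epsilon> * dh) * x + (l + \<epsilon> * lh) * x\<^sup>2 + (\<epsilon> * mh) * x * y + (n + \<epsilon> * nh) * y\<^sup>2)"
  proof -
    have \<xi>x: "\<xi> = x * g" using g by (simp add: x_def)
    have "((\<epsilon> * s - \<eta>) / D * (1 / g) + (l * (1 / (g * q)) * y') * (\<xi> / D) * \<xi>) * (D * q)
      = g * y' * (- y + (\<epsilon> * dh) * x + (l + \<epsilon> * lh) * x\<^sup>2 + (\<epsilon> * mh) * x * y + (n + \<epsilon> * nh) * y\<^sup>2)"
      unfolding s key \<xi>x using g q R0(2) by (simp add: field_simps power2_eq_square)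
    then show ?thesis using q R0(2) by (simp add: field_simps)
  qed
  have e2: "y' * (\<xi> / D) = g / q * y' / D * (x * (1 - y))"
    using g q R0(2) by (simp add: x_def q_def[symmetric])
  have "((\<lambda>\<phi>. pt (\<rho> \<phi>) \<phi>) has_vector_derivative
      ((\<epsilon> * s - \<eta>) / D * (1 / g) + (l * (1 / (g * q)) * y') * (\<xi> / D) * \<xi>, y' * (\<xi> / D))) (at \<phi> within I)"
    unfolding pt_def using dx dy
    by (intro has_vector_derivative_Pair) (auto simp: has_real_derivative_iff_has_vector_derivative)
  then show ?thesis
    unfolding e1 e2 ptx using pw(2) by (simp add: Z_def y_def q_def y'_def \<eta>_def R_def D_def)
qed

lemma trajectory:
  assumes ab: "\<alpha> < \<beta>" and R: "\<And>\<phi>. \<phi> \<in> {\<alpha>..\<beta>} \<Longrightarrow> 0 < \<rho> \<phi> \<and> \<rho> \<phi> < \<eta>0 \<and> \<Delta> \<epsilon> (\<rho> \<phi>) \<phi> > 0"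
    and d: "\<And>\<phi>. \<phi> \<in> {\<alpha>..\<beta>} \<Longrightarrow>
      (\<rho> has_real_derivative \<epsilon> * cos \<phi> * S (\<rho> \<phi>) \<phi> / \<Delta> \<epsilon> (\<rho> \<phi>) \<phi>) (at \<phi> within {\<alpha>..\<beta>})"
  obtains T \<gamma> where "T > 0" "\<gamma> 0 = pt (\<rho> \<alpha>) \<alpha>" "\<gamma> T = pt (\<rho> \<beta>) \<beta>"
    "\<And>t. t \<in> {0..T} \<Longrightarrow> (\<gamma> has_vector_derivative F \<epsilon> (\<gamma> t)) (at t within {0..T})"
    "\<And>t. t \<in> {0..T} \<Longrightarrow> \<exists>\<phi>\<in>{\<alpha>..\<beta>}. \<gamma> t = pt (\<rho> \<phi>) \<phi>"
    "\<And>t. t \<in> {0<..<T} \<Longrightarrow> \<exists>\<phi>\<in>{\<alpha><..<\<beta>}. \<gamma> t = pt (\<rho> \<phi>) \<phi>"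
proof -
  define h where "h \<phi> = (1 - Y (\<rho> \<phi> * sin \<phi>)) powr (l - 1) * Y' (\<rho> \<phi> * sin \<phi>) / \<Delta> \<epsilon> (\<rho> \<phi>) \<phi>" for \<phi>
  have J: "\<rho> \<phi> * sin \<phi> \<in> J" if "\<phi> \<in> {\<alpha>..\<beta>}" for \<phi> using in_J[of "\<rho> \<phi>" \<phi>] R[OF that] by simp
  have hpos: "h \<phi> > 0" if "\<phi> \<in> {\<alpha>..\<beta>}" for \<phi>
    using Y_lt[of "\<rho> \<phi> * sin \<phi>"] cY'_pos[of "\<rho> \<phi> * sin \<phi>" l n] J[OF that] R[OF that] by (simp add: h_def)
  have c\<rho>: "continuous_on {\<alpha>..\<beta>} \<rho>" by (rule DERIV_continuous_on[OF d])
  have c\<eta>: "continuous_on {\<alpha>..\<beta>} (\<lambda>\<phi>. \<rho> \<phi> * sin \<phi>)" by (intro continuous_intros c\<rho>)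
  have cc: "continuous_on {\<alpha>..\<beta>} (\<lambda>\<phi>. k (\<rho> \<phi> * sin \<phi>))" if "continuous_on J k" for k :: "real \<Rightarrow> real"
    by (rule continuous_on_compose2[OF that c\<eta>]) (use J in auto)
  have cS: "continuous_on {\<alpha>..\<beta>} (\<lambda>\<phi>. S (\<rho> \<phi>) \<phi>)"
  proof -
    have "continuous_on {\<alpha>..\<beta>} (\<lambda>\<phi>. (\<rho> \<phi>, \<phi>))" by (intro continuous_intros c\<rho>)
    moreover have "(\<lambda>\<phi>. (\<rho> \<phi>, \<phi>)) ` {\<alpha>..\<beta>} \<subseteq> J \<times> UNIV" using R by force
    ultimately show ?thesis using continuous_on_compose2[OF continuous_S(1), of "{\<alpha>..\<beta>}" "\<lambda>\<phi>. (\<rho> \<phi>, \<phi>)"] by simp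
  qed
  have nz: "1 - Y (\<rho> \<phi> * sin \<phi>) \<noteq> 0" "\<rho> \<phi> \<noteq> 0" "1 - \<epsilon> * sin \<phi> * S (\<rho> \<phi>) \<phi> / \<rho> \<phi> \<noteq> 0" if "\<phi> \<in> {\<alpha>..\<beta>}" for \<phi>
    using Y_lt[of "\<rho> \<phi> * sin \<phi>"] J[OF that] R[OF that] by (auto simp: \<Delta>_def)
  have "continuous_on {\<alpha>..\<beta>} h" unfolding h_def[abs_def] \<Delta>_def
    by (intro continuous_on_divide continuous_on_mult continuous_on_diff continuous_on_const continuous_on_sin
        continuous_on_id cc[OF continuous_powr_Y] cc[OF continuous_cY(2)] cS c\<rho> ballI nz)
  from time_change[OF ab this hpos] obtain T \<tau> where \<tau>: "T > 0" "\<tau> 0 = \<alpha>" "\<tau> T = \<beta>"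
    "\<And>t. t \<in> {0..T} \<Longrightarrow> \<tau> t \<in> {\<alpha>..\<beta>}" "\<And>t. t \<in> {0<..<T} \<Longrightarrow> \<tau> t \<in> {\<alpha><..<\<beta>}"
    "\<And>t. t \<in> {0..T} \<Longrightarrow> (\<tau> has_real_derivative inverse (h (\<tau> t))) (at t within {0..T})" by metis
  define \<gamma> where "\<gamma> = (\<lambda>\<phi>. pt (\<rho> \<phi>) \<phi>) \<circ> \<tau>"
  have "(\<gamma> has_vector_derivative F \<epsilon> (\<gamma> t)) (at t within {0..T})" if t: "t \<in> {0..T}" for t
  proof -
    have "((\<lambda>\<phi>. pt (\<rho> \<phi>) \<phi>) has_vector_derivative h (\<tau> t) *\<^sub>R F \<epsilon> (pt (\<rho> (\<tau> t)) (\<tau> t))) (at (\<tau> t) within {\<alpha>..\<beta>})"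
      unfolding h_def using R[OF \<tau>(4)[OF t]] by (intro pt_derivative d[OF \<tau>(4)[OF t]]) auto
    then have "((\<lambda>\<phi>. pt (\<rho> \<phi>) \<phi>) has_vector_derivative h (\<tau> t) *\<^sub>R F \<epsilon> (pt (\<rho> (\<tau> t)) (\<tau> t))) (at (\<tau> t) within \<tau> ` {0..T})"
      by (rule has_vector_derivative_within_subset) (use \<tau>(4) in auto)
    from vector_diff_chain_within[OF _ this, of "inverse (h (\<tau> t))"] \<tau>(6)[OF t]
    have "(\<gamma> has_vector_derivative inverse (h (\<tau> t)) *\<^sub>R h (\<tau> t) *\<^sub>R F \<epsilon> (pt (\<rho> (\<tau> t)) (\<tau> t))) (at t within {0..T})"
      by (simp add: has_real_derivative_iff_has_vector_derivative \<gamma>_def)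
    moreover have "inverse (h (\<tau> t)) *\<^sub>R h (\<tau> t) *\<^sub>R v = v" for v :: plane using hpos[OF \<tau>(4)[OF t]] by simp
    ultimately show ?thesis by (simp add: \<gamma>_def)
  qed
  note der = this
  have \<gamma>: "\<gamma> t = pt (\<rho> (\<tau> t)) (\<tau> t)" for t by (simp add: \<gamma>_def)
  show ?thesis
  proof (rule that[of T \<gamma>])
    show "T > 0" by (rule \<tau>(1))
    show "\<gamma> 0 = pt (\<rho> \<alpha>) \<alpha>" "\<gamma> T = pt (\<rho> \<beta>) \<beta>" using \<tau>(2,3) \<gamma> by auto
    show "(\<gamma> has_vector_derivative F \<epsilon> (\<gamma> t)) (at t within {0..T})" if "t \<in> {0..T}" for t by (rule der[OF that])
    show "\<exists>\<phi>\<in>{\<alpha>..\<beta>}. \<gamma> t = pt (\<rho> \<phi>) \<phi>" if "t \<in> {0..T}" for t using \<gamma> \<tau>(4)[OF that] by blast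
    show "\<exists>\<phi>\<in>{\<alpha><..<\<beta>}. \<gamma> t = pt (\<rho> \<phi>) \<phi>" if "t \<in> {0<..<T}" for t using \<gamma> \<tau>(5)[OF that] by blast
  qed
qed

text \<open>\<open>\<sigma> = 1\<close> follows the half orbit in the direction of time, \<open>\<sigma> = -1\<close> against it.\<close>

definition "G \<sigma> \<phi>0 \<epsilon> \<psi> R = \<sigma> * cos (\<phi>0 + \<sigma> * \<psi>) * S R (\<phi>0 + \<sigma> * \<psi>) / \<Delta> \<epsilon> R (\<phi>0 + \<sigma> * \<psi>)"
definition "G' \<sigma> \<phi>0 \<epsilon> \<psi> R = \<sigma> * cos (\<phi>0 + \<sigma> * \<psi>) * (S' R (\<phi>0 + \<sigma> * \<psi>) * \<Delta> \<epsilon> R (\<phi>0 + \<sigma> * \<psi>)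
  + S R (\<phi>0 + \<sigma> * \<psi>) * (\<epsilon> * sin (\<phi>0 + \<sigma> * \<psi>) * ((S' R (\<phi>0 + \<sigma> * \<psi>) * R - S R (\<phi>0 + \<sigma> * \<psi>)) / (R * R))))
  / (\<Delta> \<epsilon> R (\<phi>0 + \<sigma> * \<psi>) * \<Delta> \<epsilon> R (\<phi>0 + \<sigma> * \<psi>))"

text \<open>For \<open>\<epsilon> = 0\<close> the angular speed is \<open>1\<close> and the radius
  is constant. These integrals are therefore the first order changes of the radius, and of its
  derivative in the initial radius, over half a turn.\<close>

definition "M \<sigma> \<phi>0 R = integral {0..pi} (\<lambda>\<psi>. \<sigma> * cos (\<phi>0 + \<sigma> * \<psi>) * S R (\<phi>0 + \<sigma> * \<psi>))"
definition "M' \<sigma> \<phi>0 R = integral {0..pi} (\<lambda>\<psi>. \<sigma> * cos (\<phi>0 + \<sigma> * \<psi>) * S' R (\<phi>0 + \<sigma> * \<psi>))"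

lemma DERIV_G:
  assumes R: "0 < R" "R < \<eta>0" and \<Delta>: "\<Delta> \<epsilon> R (\<phi>0 + \<sigma> * \<psi>) \<noteq> 0"
  shows "(G \<sigma> \<phi>0 \<epsilon> \<psi> has_real_derivative G' \<sigma> \<phi>0 \<epsilon> \<psi> R) (at R)"
proof -
  let ?\<phi> = "\<phi>0 + \<sigma> * \<psi>"
  have dS: "((\<lambda>R. S R ?\<phi>) has_real_derivative S' R ?\<phi>) (at R)" using R by (intro DERIV_S) auto
  have "((\<lambda>R. S R ?\<phi> / R) has_real_derivative (S' R ?\<phi> * R - S R ?\<phi> * 1) / (R * R)) (at R)"
    using R by (intro DERIV_divide dS DERIV_ident) auto
  from DERIV_diff[OF DERIV_const DERIV_cmult[OF this, of "\<epsilon> * sin ?\<phi>"], of 1]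
  have d\<Delta>: "((\<lambda>R. \<Delta> \<epsilon> R ?\<phi>) has_real_derivative - (\<epsilon> * sin ?\<phi> * ((S' R ?\<phi> * R - S R ?\<phi>) / (R * R)))) (at R)"
    unfolding \<Delta>_def by simp
  from DERIV_divide[OF DERIV_cmult[OF dS, of "\<sigma> * cos ?\<phi>"] d\<Delta> \<Delta>]
  show ?thesis unfolding G_def[abs_def] G'_def by (simp add: algebra_simps)
qed

text \<open>\<open>small_scalar_flow\<close> for the radial equation. \<open>d\<close> keeps the
  radius inside \<open>{0<..<Rm}\<close>, and the bound \<open>e1\<close> on
  \<open>\<epsilon>\<close> keeps the angular speed positive, so that the right-hand side is
  differentiable in \<open>R\<close>.\<close>

lemma flow:
  assumes R0: "0 < R0" "R0 < Rm" "Rm \<le> \<eta>0"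
  obtains f where "\<And>e. e > 0 \<Longrightarrow> \<exists>\<delta>>0. \<forall>\<epsilon> R. 0 < \<epsilon> \<longrightarrow> \<epsilon> < \<delta> \<longrightarrow> \<bar>R - R0\<bar> < \<delta> \<longrightarrow>
      f \<epsilon> R 0 = R \<and>
      (\<forall>\<psi>\<in>{0..pi}. 0 < f \<epsilon> R \<psi> \<and> f \<epsilon> R \<psi> < Rm \<and> \<Delta> \<epsilon> (f \<epsilon> R \<psi>) (\<phi>0 + \<sigma> * \<psi>) > 0 \<and>
        (f \<epsilon> R has_real_derivative \<epsilon> * G \<sigma> \<phi>0 \<epsilon> \<psi> (f \<epsilon> R \<psi>)) (at \<psi> within {0..pi})) \<and>
      \<bar>(f \<epsilon> R pi - R) / \<epsilon> - M \<sigma> \<phi>0 R0\<bar> < e \<and>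
      (\<exists>D>0. ((\<lambda>R. f \<epsilon> R pi) has_real_derivative D) (at R) \<and> \<bar>(D - 1) / \<epsilon> - M' \<sigma> \<phi>0 R0\<bar> < e)"
proof -
  define d where "d = min (R0 / 2) ((Rm - R0) / 2)"
  have d: "d > 0" using R0 by (simp add: d_def)
  let ?I = "{R0 - d..R0 + d}"
  have I: "0 < R" "R < Rm" "R < \<eta>0" if "R \<in> ?I" for R
  proof -
    have "d \<le> R0 / 2" "d \<le> (Rm - R0) / 2" unfolding d_def by (rule min.cobounded1, rule min.cobounded2)
    then show "0 < R" "R < Rm" "R < \<eta>0" using that R0 by auto
  qed
  have cc: "continuous_on ({0..e1} \<times> {0..pi} \<times> ?I) (\<lambda>p. h (snd (snd p)) (\<phi>0 + \<sigma> * fst (snd p)))"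
    if h: "continuous_on (J \<times> UNIV) (\<lambda>(R, \<phi>). h R \<phi>)" for h :: "real \<Rightarrow> real \<Rightarrow> real" and e1 :: real
  proof -
    have "continuous_on ({0..e1} \<times> {0..pi} \<times> ?I) ((\<lambda>(R, \<phi>). h R \<phi>) \<circ> (\<lambda>p. (snd (snd p), \<phi>0 + \<sigma> * fst (snd p))))"
      by (intro continuous_on_compose continuous_on_subset[OF h]) (use I in \<open>force intro!: continuous_intros\<close>)+
    then show ?thesis by (simp add: o_def split_beta)
  qed
  have cS: "continuous_on ({0..e1} \<times> {0..pi} \<times> ?I) (\<lambda>p. S (snd (snd p)) (\<phi>0 + \<sigma> * fst (snd p)))"
    "continuous_on ({0..e1} \<times> {0..pi} \<times> ?I) (\<lambda>p. S' (snd (snd p)) (\<phi>0 + \<sigma> * fst (snd p)))" for e1 :: real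
    by (rule cc[OF continuous_S(1)], rule cc[OF continuous_S(2)])
  have Rnz: "snd (snd p) \<noteq> 0" if "p \<in> {0..e1} \<times> {0..pi} \<times> ?I" for p :: "real \<times> real \<times> real" and e1
    using I[of "snd (snd p)"] that by auto
  have cR: "continuous_on ({0..e1} \<times> {0..pi} \<times> ?I) (\<lambda>p :: real \<times> real \<times> real. snd (snd p))"
    and csin: "continuous_on ({0..e1} \<times> {0..pi} \<times> ?I) (\<lambda>p :: real \<times> real \<times> real. sin (\<phi>0 + \<sigma> * fst (snd p)))"
    and ccos: "continuous_on ({0..e1} \<times> {0..pi} \<times> ?I) (\<lambda>p :: real \<times> real \<times> real. \<sigma> * cos (\<phi>0 + \<sigma> * fst (snd p)))"
    and ceps: "continuous_on ({0..e1} \<times> {0..pi} \<times> ?I) (\<lambda>p :: real \<times> real \<times> real. fst p)" for e1 :: real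
    by (intro continuous_intros)+
  have "continuous_on ({0..1::real} \<times> {0..pi} \<times> ?I)
      (\<lambda>p. sin (\<phi>0 + \<sigma> * fst (snd p)) * S (snd (snd p)) (\<phi>0 + \<sigma> * fst (snd p)) / snd (snd p))"
    by (intro continuous_on_divide continuous_on_mult csin cS(1) cR ballI) (erule Rnz)
  then have "bounded ((\<lambda>p. sin (\<phi>0 + \<sigma> * fst (snd p)) * S (snd (snd p)) (\<phi>0 + \<sigma> * fst (snd p)) / snd (snd p)) `
      ({0..1::real} \<times> {0..pi} \<times> ?I))"
    by (intro compact_imp_bounded compact_continuous_image compact_Times compact_Icc)
  then obtain K where "\<forall>x\<in>(\<lambda>p. sin (\<phi>0 + \<sigma> * fst (snd p)) * S (snd (snd p)) (\<phi>0 + \<sigma> * fst (snd p)) / snd (snd p)) `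
      ({0..1::real} \<times> {0..pi} \<times> ?I). norm x \<le> K"
    unfolding bounded_iff by blast
  note K = this[THEN bspec, OF imageI]
  have K': "\<bar>sin (\<phi>0 + \<sigma> * \<psi>) * S R (\<phi>0 + \<sigma> * \<psi>) / R\<bar> \<le> K" if "\<psi> \<in> {0..pi}" "R \<in> ?I" for \<psi> R
    using K[of "(0, \<psi>, R)"] that by (simp add: abs_divide abs_mult)
  \<comment> \<open>With this bound the correction to the angular speed is at most
    \<open>1 / 2\<close>.\<close>
  define e1 where "e1 = 1 / (2 * (\<bar>K\<bar> + 1))"
  have e1: "e1 > 0" by (simp add: e1_def)
  have \<Delta>pos: "\<Delta> \<epsilon> R (\<phi>0 + \<sigma> * \<psi>) > 0" if "\<epsilon> \<in> {0..e1}" "\<psi> \<in> {0..pi}" "R \<in> ?I" for \<epsilon> \<psi> R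
  proof -
    have "\<bar>\<epsilon> * (sin (\<phi>0 + \<sigma> * \<psi>) * S R (\<phi>0 + \<sigma> * \<psi>) / R)\<bar> \<le> e1 * (\<bar>K\<bar> + 1)"
      unfolding abs_mult[of \<epsilon>] using that(1) K'[OF that(2,3)] by (intro mult_mono) auto
    also have "\<dots> = 1 / 2" by (simp add: e1_def)
    finally have "\<epsilon> * (sin (\<phi>0 + \<sigma> * \<psi>) * S R (\<phi>0 + \<sigma> * \<psi>) / R) \<le> 1 / 2" by (rule abs_le_D1)
    then have "\<epsilon> * sin (\<phi>0 + \<sigma> * \<psi>) * S R (\<phi>0 + \<sigma> * \<psi>) / R \<le> 1 / 2"
      by (simp only: mult.assoc times_divide_eq_right)
    then show ?thesis unfolding \<Delta>_def by linarith
  qed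
  have c\<Delta>: "continuous_on ({0..e1} \<times> {0..pi} \<times> ?I) (\<lambda>p. \<Delta> (fst p) (snd (snd p)) (\<phi>0 + \<sigma> * fst (snd p)))"
    unfolding \<Delta>_def
    by (rule continuous_on_diff[OF continuous_on_const
          continuous_on_divide[OF continuous_on_mult[OF continuous_on_mult[OF ceps csin] cS(1)] cR]]) (use Rnz in blast)
  have \<Delta>nz: "\<Delta> (fst p) (snd (snd p)) (\<phi>0 + \<sigma> * fst (snd p)) \<noteq> 0" if "p \<in> {0..e1} \<times> {0..pi} \<times> ?I" for p
    using \<Delta>pos[of "fst p" "fst (snd p)" "snd (snd p)"] that by auto
  have cG: "continuous_on ({0..e1} \<times> {0..pi} \<times> ?I) (\<lambda>(\<epsilon>, \<psi>, R). G \<sigma> \<phi>0 \<epsilon> \<psi> R)"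
    unfolding G_def split_beta
    by (rule continuous_on_divide[OF continuous_on_mult[OF ccos cS(1)] c\<Delta>]) (use \<Delta>nz in blast)
  have RR: "\<forall>p\<in>{0..e1} \<times> {0..pi} \<times> ?I. snd (snd p) * snd (snd p) \<noteq> 0"
  proof
    fix p assume "p \<in> {0..e1} \<times> {0..pi} \<times> ?I"
    from Rnz[OF this] show "snd (snd p) * snd (snd p) \<noteq> 0" by simp
  qed
  have \<Delta>\<Delta>: "\<forall>p\<in>{0..e1} \<times> {0..pi} \<times> ?I.
    \<Delta> (fst p) (snd (snd p)) (\<phi>0 + \<sigma> * fst (snd p)) * \<Delta> (fst p) (snd (snd p)) (\<phi>0 + \<sigma> * fst (snd p)) \<noteq> 0"
  proof
    fix p assume "p \<in> {0..e1} \<times> {0..pi} \<times> ?I"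
    from \<Delta>nz[OF this] show "\<Delta> (fst p) (snd (snd p)) (\<phi>0 + \<sigma> * fst (snd p)) * \<Delta> (fst p) (snd (snd p)) (\<phi>0 + \<sigma> * fst (snd p)) \<noteq> 0" by simp
  qed
  have cG': "continuous_on ({0..e1} \<times> {0..pi} \<times> ?I) (\<lambda>(\<epsilon>, \<psi>, R). G' \<sigma> \<phi>0 \<epsilon> \<psi> R)"
    unfolding G'_def split_beta
    by (rule continuous_on_divide[OF continuous_on_mult[OF ccos continuous_on_add[OF continuous_on_mult[OF cS(2) c\<Delta>]
      continuous_on_mult[OF cS(1) continuous_on_mult[OF continuous_on_mult[OF ceps csin]
      continuous_on_divide[OF continuous_on_diff[OF continuous_on_mult[OF cS(2) cR] cS(1)] continuous_on_mult[OF cR cR] RR]]]]]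
      continuous_on_mult[OF c\<Delta> c\<Delta>] \<Delta>\<Delta>])
  have dG: "(G \<sigma> \<phi>0 \<epsilon> \<psi> has_real_derivative G' \<sigma> \<phi>0 \<epsilon> \<psi> R) (at R within ?I)"
    if "\<epsilon> \<in> {0..e1}" "\<psi> \<in> {0..pi}" "R \<in> ?I" for \<epsilon> \<psi> R
    using I[OF that(3)] \<Delta>pos[OF that] by (intro has_field_derivative_at_within[OF DERIV_G]) auto
  obtain f where f: "\<And>e. e > 0 \<Longrightarrow> \<exists>\<delta>>0. \<delta> \<le> e1 \<and> (\<forall>\<epsilon> R. 0 < \<epsilon> \<longrightarrow> \<epsilon> < \<delta> \<longrightarrow> \<bar>R - R0\<bar> < \<delta> \<longrightarrow>
      f \<epsilon> R 0 = R \<and>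
      (\<forall>\<phi>\<in>{0..pi}. \<bar>f \<epsilon> R \<phi> - R0\<bar> < d \<and>
        (f \<epsilon> R has_real_derivative \<epsilon> * G \<sigma> \<phi>0 \<epsilon> \<phi> (f \<epsilon> R \<phi>)) (at \<phi> within {0..pi})) \<and>
      \<bar>(f \<epsilon> R pi - R) / \<epsilon> - integral {0..pi} (\<lambda>\<phi>. G \<sigma> \<phi>0 0 \<phi> R0)\<bar> < e \<and>
      (\<exists>D>0. ((\<lambda>R. f \<epsilon> R pi) has_real_derivative D) (at R) \<and>
        \<bar>(D - 1) / \<epsilon> - integral {0..pi} (\<lambda>\<phi>. G' \<sigma> \<phi>0 0 \<phi> R0)\<bar> < e))"
    by (rule small_scalar_flow[OF pi_gt_zero d e1 cG cG' dG]) (assumption, assumption, assumption, rule that)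
  have M0: "integral {0..pi} (\<lambda>\<phi>. G \<sigma> \<phi>0 0 \<phi> R0) = M \<sigma> \<phi>0 R0"
    "integral {0..pi} (\<lambda>\<phi>. G' \<sigma> \<phi>0 0 \<phi> R0) = M' \<sigma> \<phi>0 R0"
    by (simp_all add: G_def G'_def \<Delta>_def M_def M'_def)
  show ?thesis
  proof (rule that[of f])
    fix e :: real assume "e > 0"
    from f[OF this] obtain \<delta> where \<delta>: "\<delta> > 0" "\<delta> \<le> e1" and p: "\<And>\<epsilon> R. 0 < \<epsilon> \<Longrightarrow> \<epsilon> < \<delta> \<Longrightarrow> \<bar>R - R0\<bar> < \<delta> \<Longrightarrow>
      f \<epsilon> R 0 = R \<and>
      (\<forall>\<phi>\<in>{0..pi}. \<bar>f \<epsilon> R \<phi> - R0\<bar> < d \<and>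
        (f \<epsilon> R has_real_derivative \<epsilon> * G \<sigma> \<phi>0 \<epsilon> \<phi> (f \<epsilon> R \<phi>)) (at \<phi> within {0..pi})) \<and>
      \<bar>(f \<epsilon> R pi - R) / \<epsilon> - M \<sigma> \<phi>0 R0\<bar> < e \<and>
      (\<exists>D>0. ((\<lambda>R. f \<epsilon> R pi) has_real_derivative D) (at R) \<and>
        \<bar>(D - 1) / \<epsilon> - M' \<sigma> \<phi>0 R0\<bar> < e)" unfolding M0 by blast
    show "\<exists>\<delta>>0. \<forall>\<epsilon> R. 0 < \<epsilon> \<longrightarrow> \<epsilon> < \<delta> \<longrightarrow> \<bar>R - R0\<bar> < \<delta> \<longrightarrow>
      f \<epsilon> R 0 = R \<and>
      (\<forall>\<psi>\<in>{0..pi}. 0 < f \<epsilon> R \<psi> \<and> f \<epsilon> R \<psi> < Rm \<and> \<Delta> \<epsilon> (f \<epsilon> R \<psi>) (\<phi>0 + \<sigma> * \<psi>) > 0 \<and>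
        (f \<epsilon> R has_real_derivative \<epsilon> * G \<sigma> \<phi>0 \<epsilon> \<psi> (f \<epsilon> R \<psi>)) (at \<psi> within {0..pi})) \<and>
      \<bar>(f \<epsilon> R pi - R) / \<epsilon> - M \<sigma> \<phi>0 R0\<bar> < e \<and>
      (\<exists>D>0. ((\<lambda>R. f \<epsilon> R pi) has_real_derivative D) (at R) \<and> \<bar>(D - 1) / \<epsilon> - M' \<sigma> \<phi>0 R0\<bar> < e)"
    proof (rule exI[of _ \<delta>], intro conjI \<delta>(1) allI impI)
      fix \<epsilon> R assume c: "0 < \<epsilon>" "\<epsilon> < \<delta>" "\<bar>R - R0\<bar> < \<delta>"
      note q = p[OF c]
      show "f \<epsilon> R 0 = R" "\<bar>(f \<epsilon> R pi - R) / \<epsilon> - M \<sigma> \<phi>0 R0\<bar> < e"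
        "\<exists>D>0. ((\<lambda>R. f \<epsilon> R pi) has_real_derivative D) (at R) \<and> \<bar>(D - 1) / \<epsilon> - M' \<sigma> \<phi>0 R0\<bar> < e"
        using q by blast+
      show "\<forall>\<psi>\<in>{0..pi}. 0 < f \<epsilon> R \<psi> \<and> f \<epsilon> R \<psi> < Rm \<and> \<Delta> \<epsilon> (f \<epsilon> R \<psi>) (\<phi>0 + \<sigma> * \<psi>) > 0 \<and>
        (f \<epsilon> R has_real_derivative \<epsilon> * G \<sigma> \<phi>0 \<epsilon> \<psi> (f \<epsilon> R \<psi>)) (at \<psi> within {0..pi})"
      proof
        fix \<psi> assume \<psi>: "\<psi> \<in> {0..pi}"
        have b: "\<bar>f \<epsilon> R \<psi> - R0\<bar> < d" and dd: "(f \<epsilon> R has_real_derivative \<epsilon> * G \<sigma> \<phi>0 \<epsilon> \<psi> (f \<epsilon> R \<psi>)) (at \<psi> within {0..pi})"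
          using q \<psi> by blast+
        have fI: "f \<epsilon> R \<psi> \<in> ?I" using b by (auto simp: abs_less_iff)
        have \<epsilon>: "\<epsilon> \<in> {0..e1}" using c \<delta> by auto
        show "0 < f \<epsilon> R \<psi> \<and> f \<epsilon> R \<psi> < Rm \<and> \<Delta> \<epsilon> (f \<epsilon> R \<psi>) (\<phi>0 + \<sigma> * \<psi>) > 0 \<and>
          (f \<epsilon> R has_real_derivative \<epsilon> * G \<sigma> \<phi>0 \<epsilon> \<psi> (f \<epsilon> R \<psi>)) (at \<psi> within {0..pi})"
          using I[OF fI] \<Delta>pos[OF \<epsilon> \<psi> fI] dd by blast
      qed
    qed
  qed
qed

text \<open>For \<open>\<sigma> = - 1\<close> the angle decreases along the radial flow. The orbit
  in the direction of time then begins at the far end, at the angle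
  \<open>\<phi>0 - pi\<close>.\<close>

lemma flow_trajectory:
  assumes \<sigma>: "\<sigma> = 1 \<or> \<sigma> = - 1" and Rm: "Rm \<le> \<eta>0"
    and f: "\<And>\<psi>. \<psi> \<in> {0..pi} \<Longrightarrow> 0 < f \<psi> \<and> f \<psi> < Rm \<and> \<Delta> \<epsilon> (f \<psi>) (\<phi>0 + \<sigma> * \<psi>) > 0 \<and>
        (f has_real_derivative \<epsilon> * G \<sigma> \<phi>0 \<epsilon> \<psi> (f \<psi>)) (at \<psi> within {0..pi})"
    and \<alpha>: "\<alpha> = (if \<sigma> = 1 then \<phi>0 else \<phi>0 - pi)"
  obtains T \<gamma> where "T > 0"
    "\<gamma> 0 = pt (f (\<sigma> * (\<alpha> - \<phi>0))) \<alpha>" "\<gamma> T = pt (f (\<sigma> * (\<alpha> + pi - \<phi>0))) (\<alpha> + pi)"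
    "\<And>t. t \<in> {0..T} \<Longrightarrow> (\<gamma> has_vector_derivative F \<epsilon> (\<gamma> t)) (at t within {0..T})"
    "\<And>t. t \<in> {0..T} \<Longrightarrow> \<exists>R \<phi>. 0 < R \<and> R < Rm \<and> \<gamma> t = pt R \<phi>"
    "\<And>t. t \<in> {0<..<T} \<Longrightarrow> \<exists>R. \<exists>\<phi>\<in>{\<alpha><..<\<alpha> + pi}. 0 < R \<and> R < Rm \<and> \<gamma> t = pt R \<phi>"
proof -
  define \<rho> where "\<rho> \<phi> = f (\<sigma> * (\<phi> - \<phi>0))" for \<phi>
  have in0: "\<sigma> * (\<phi> - \<phi>0) \<in> {0..pi}" if "\<phi> \<in> {\<alpha>..\<alpha> + pi}" for \<phi> using that \<sigma> \<alpha> by auto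
  have bk: "\<phi>0 + \<sigma> * (\<sigma> * (\<phi> - \<phi>0)) = \<phi>" for \<phi> using \<sigma> by auto
  have 1: "0 < \<rho> \<phi> \<and> \<rho> \<phi> < \<eta>0 \<and> \<Delta> \<epsilon> (\<rho> \<phi>) \<phi> > 0" "\<rho> \<phi> < Rm" if "\<phi> \<in> {\<alpha>..\<alpha> + pi}" for \<phi>
  proof -
    have "0 < f (\<sigma> * (\<phi> - \<phi>0)) \<and> f (\<sigma> * (\<phi> - \<phi>0)) < Rm \<and> \<Delta> \<epsilon> (f (\<sigma> * (\<phi> - \<phi>0))) \<phi> > 0"
      using f[OF in0[OF that]] unfolding bk by blast
    then show "0 < \<rho> \<phi> \<and> \<rho> \<phi> < \<eta>0 \<and> \<Delta> \<epsilon> (\<rho> \<phi>) \<phi> > 0" "\<rho> \<phi> < Rm"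
      unfolding \<rho>_def using Rm by linarith+
  qed
  have 2: "(\<rho> has_real_derivative \<epsilon> * cos \<phi> * S (\<rho> \<phi>) \<phi> / \<Delta> \<epsilon> (\<rho> \<phi>) \<phi>) (at \<phi> within {\<alpha>..\<alpha> + pi})"
    if \<phi>: "\<phi> \<in> {\<alpha>..\<alpha> + pi}" for \<phi>
  proof -
    have lin: "((\<lambda>\<phi>. \<sigma> * (\<phi> - \<phi>0)) has_real_derivative \<sigma>) (at \<phi> within {\<alpha>..\<alpha> + pi})"
      by (auto intro!: derivative_eq_intros)
    have sub: "(\<lambda>\<phi>. \<sigma> * (\<phi> - \<phi>0)) ` {\<alpha>..\<alpha> + pi} \<subseteq> {0..pi}" using in0 by blast
    have "(f has_real_derivative \<epsilon> * G \<sigma> \<phi>0 \<epsilon> (\<sigma> * (\<phi> - \<phi>0)) (\<rho> \<phi>)) (at (\<sigma> * (\<phi> - \<phi>0)) within {0..pi})"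
      using f[OF in0[OF \<phi>]] unfolding \<rho>_def by blast
    then have "(f has_real_derivative \<epsilon> * G \<sigma> \<phi>0 \<epsilon> (\<sigma> * (\<phi> - \<phi>0)) (\<rho> \<phi>)) (at (\<sigma> * (\<phi> - \<phi>0)) within (\<lambda>\<phi>. \<sigma> * (\<phi> - \<phi>0)) ` {\<alpha>..\<alpha> + pi})"
      by (rule DERIV_subset[OF _ sub])
    from DERIV_image_chain[OF this lin]
    have "(\<rho> has_real_derivative \<epsilon> * G \<sigma> \<phi>0 \<epsilon> (\<sigma> * (\<phi> - \<phi>0)) (\<rho> \<phi>) * \<sigma>) (at \<phi> within {\<alpha>..\<alpha> + pi})"
      by (simp add: o_def \<rho>_def[abs_def])
    moreover have "G \<sigma> \<phi>0 \<epsilon> (\<sigma> * (\<phi> - \<phi>0)) (\<rho> \<phi>) * \<sigma> = cos \<phi> * S (\<rho> \<phi>) \<phi> / \<Delta> \<epsilon> (\<rho> \<phi>) \<phi>"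
      using \<sigma> by (auto simp: G_def bk)
    ultimately show ?thesis by (simp add: mult.assoc)
  qed
  have ab: "\<alpha> < \<alpha> + pi" by simp
  obtain T \<gamma> where T: "T > 0" "\<gamma> 0 = pt (\<rho> \<alpha>) \<alpha>" "\<gamma> T = pt (\<rho> (\<alpha> + pi)) (\<alpha> + pi)"
    "\<And>t. t \<in> {0..T} \<Longrightarrow> (\<gamma> has_vector_derivative F \<epsilon> (\<gamma> t)) (at t within {0..T})"
    "\<And>t. t \<in> {0..T} \<Longrightarrow> \<exists>\<phi>\<in>{\<alpha>..\<alpha> + pi}. \<gamma> t = pt (\<rho> \<phi>) \<phi>"
    "\<And>t. t \<in> {0<..<T} \<Longrightarrow> \<exists>\<phi>\<in>{\<alpha><..<\<alpha> + pi}. \<gamma> t = pt (\<rho> \<phi>) \<phi>"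
    by (rule trajectory[OF ab 1(1) 2]) (assumption, assumption, rule that)
  show ?thesis
  proof (rule that[of T \<gamma>])
    show "\<exists>R \<phi>. 0 < R \<and> R < Rm \<and> \<gamma> t = pt R \<phi>" if "t \<in> {0..T}" for t using T(5)[OF that] 1 by blast
    show "\<exists>R. \<exists>\<phi>\<in>{\<alpha><..<\<alpha> + pi}. 0 < R \<and> R < Rm \<and> \<gamma> t = pt R \<phi>" if t: "t \<in> {0<..<T}" for t
    proof -
      obtain \<phi> where "\<phi> \<in> {\<alpha><..<\<alpha> + pi}" "\<gamma> t = pt (\<rho> \<phi>) \<phi>" using T(6)[OF t] by blast
      moreover from this have "0 < \<rho> \<phi>" "\<rho> \<phi> < Rm" using 1[of \<phi>] by auto
      ultimately show ?thesis by blast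
    qed
  qed (use T in \<open>auto simp: \<rho>_def\<close>)
qed

end

section \<open>From simple zeros of the first order term to limit cycles\<close>

text \<open>With \<open>N = norm p\<close>, the linear part contributes
  \<open>N * N - d * (x * y)\<close>, at least \<open>3/4 * (N * N)\<close>. The cubic terms are at
  most \<open>(1 + 3 * L)\<close> times the cube of \<open>N\<close>, and \<open>b\<close> makes
  this less than half of \<open>N * N\<close>.\<close>

lemma rotation_bound:
  fixes L :: real
  assumes "L \<ge> 0"
  obtains b where "b > 0" "\<And>d l m n p. \<bar>d\<bar> \<le> 1/4 \<Longrightarrow> \<bar>l\<bar> \<le> L \<Longrightarrow> \<bar>m\<bar> \<le> L \<Longrightarrow> \<bar>n\<bar> \<le> L \<Longrightarrow>
    norm p < b \<Longrightarrow> p \<noteq> 0 \<Longrightarrow> det2 p (Z d l m n p) > 0"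
proof -
  define b where "b = 1 / (2 * (1 + 3 * L))"
  have "b > 0" using assms by (simp add: b_def)
  moreover have "det2 p (Z d l m n p) > 0"
    if c: "\<bar>d\<bar> \<le> 1/4" "\<bar>l\<bar> \<le> L" "\<bar>m\<bar> \<le> L" "\<bar>n\<bar> \<le> L" "norm p < b" "p \<noteq> 0" for d l m n p
  proof -
    obtain x y where p: "p = (x, y)" by (cases p)
    define N where "N = norm p"
    have N: "N > 0" "N < b" using c by (auto simp: N_def)
    have N2: "x * x + y * y = N * N" by (simp add: N_def p norm_Pair power2_eq_square)
    have x: "\<bar>x\<bar> \<le> N" "\<bar>y\<bar> \<le> N" using norm_fst_le[of x y] norm_snd_le[of y x] by (auto simp: N_def p)
    have m3: "\<bar>k * (a1 * (a2 * a3))\<bar> \<le> K * (N * (N * N))" if "\<bar>k\<bar> \<le> K" "\<bar>a1\<bar> \<le> N" "\<bar>a2\<bar> \<le> N" "\<bar>a3\<bar> \<le> N" for k K a1 a2 a3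
      unfolding abs_mult using that N by (intro mult_mono) auto
    have m2: "\<bar>d * (x * y)\<bar> \<le> 1/4 * (N * N)" unfolding abs_mult using c x N by (intro mult_mono) auto
    have b3: "1 * (x * (x * y)) \<le> 1 * (N * (N * N))" by (rule abs_le_D1[OF m3]) (use x in simp_all)
    have b4: "l * (x * (x * y)) \<le> L * (N * (N * N))" by (rule abs_le_D1[OF m3]) (use x c in simp_all)
    have b5: "m * (x * (y * y)) \<le> L * (N * (N * N))" by (rule abs_le_D1[OF m3]) (use x c in simp_all)
    have b6: "n * (y * (y * y)) \<le> L * (N * (N * N))" by (rule abs_le_D1[OF m3]) (use x c in simp_all)
    have b7: "d * (x * y) \<le> 1/4 * (N * N)" by (rule abs_le_D1[OF m2])
    have L3: "(1 + 3 * L) * (N * (N * N)) = 1 * (N * (N * N)) + 3 * (L * (N * (N * N)))" by (simp add: algebra_simps)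
    have "det2 p (Z d l m n p) = (x * x + y * y) - 1 * (x * (x * y)) - d * (x * y) - l * (x * (x * y)) - m * (x * (y * y)) - n * (y * (y * y))"
      by (simp add: det2_def Z_def p algebra_simps power2_eq_square)
    also have "\<dots> \<ge> N * N - 1/4 * (N * N) - (1 + 3 * L) * (N * (N * N))"
      using b3 b4 b5 b6 b7 unfolding N2 L3 by linarith
    also have "N * N - 1/4 * (N * N) - (1 + 3 * L) * (N * (N * N)) = N * N * (3/4 - (1 + 3 * L) * N)" by (simp add: algebra_simps)
    finally have le: "N * N * (3/4 - (1 + 3 * L) * N) \<le> det2 p (Z d l m n p)" .
    have "(1 + 3 * L) * N < (1 + 3 * L) * b" using N assms by (intro mult_strict_left_mono) auto
    also have "(1 + 3 * L) * b = 1/2" using assms by (simp add: b_def field_simps)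
    finally have "N * N * (3/4 - (1 + 3 * L) * N) > 0" using N by (intro mult_pos_pos) auto
    then show ?thesis using le by linarith
  qed
  ultimately show ?thesis using that by blast
qed

text \<open>\<open>r R\<close> and \<open>s R\<close> are the distances from the origin at which the
  unperturbed orbit of chart radius \<open>R\<close> meets the start half-axis and the opposite one.
  That the same two functions serve both halves is the matching condition that makes the unperturbed
  system a center.\<close>

locale geometry =
  fixes \<nu> :: plane and \<phi>0 l1 n1 l2 n2 R1 :: real and r r' s s' :: "real \<Rightarrow> real"
  assumes \<nu>: "norm \<nu> = 1" and R1: "0 < R1" "R1 \<le> c\<eta> l1 n1" "R1 \<le> c\<eta> l2 n2"
    and start_pt: "0 < R \<Longrightarrow> R < R1 \<Longrightarrow> side.pt l1 n1 R \<phi>0 = r R *\<^sub>R start_axis \<nu>"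
      "0 < R \<Longrightarrow> R < R1 \<Longrightarrow> side.pt l2 n2 R \<phi>0 = r R *\<^sub>R start_axis \<nu>"
    and opp_pt: "0 < R \<Longrightarrow> R < R1 \<Longrightarrow> side.pt l1 n1 R (\<phi>0 + pi) = (- s R) *\<^sub>R start_axis \<nu>"
      "0 < R \<Longrightarrow> R < R1 \<Longrightarrow> side.pt l2 n2 R (\<phi>0 - pi) = (- s R) *\<^sub>R start_axis \<nu>"
    and pt_sides: "0 < R \<Longrightarrow> R < R1 \<Longrightarrow> \<phi>0 < \<phi> \<Longrightarrow> \<phi> < \<phi>0 + pi \<Longrightarrow> \<nu> \<bullet> side.pt l1 n1 R \<phi> > 0"
      "0 < R \<Longrightarrow> R < R1 \<Longrightarrow> \<phi>0 - pi < \<phi> \<Longrightarrow> \<phi> < \<phi>0 \<Longrightarrow> \<nu> \<bullet> side.pt l2 n2 R \<phi> < 0"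
    and rs_pos: "0 < R \<Longrightarrow> R < R1 \<Longrightarrow> r R > 0" "0 < R \<Longrightarrow> R < R1 \<Longrightarrow> s R > 0"
    and r_deriv: "0 < R \<Longrightarrow> R < R1 \<Longrightarrow> (r has_real_derivative r' R) (at R)" "0 < R \<Longrightarrow> R < R1 \<Longrightarrow> r' R > 0"
    and s_deriv: "0 < R \<Longrightarrow> R < R1 \<Longrightarrow> (s has_real_derivative s' R) (at R)" "0 < R \<Longrightarrow> R < R1 \<Longrightarrow> s' R > 0"
begin

lemma s_less: "0 < x \<Longrightarrow> x < R1 \<Longrightarrow> 0 < y \<Longrightarrow> y < R1 \<Longrightarrow> s x < s y \<longleftrightarrow> x < y"
proof -
  have *: "s x < s y" if "0 < x" "x < y" "y < R1" for x y
    by (rule DERIV_pos_imp_increasing[OF that(2)]) (use s_deriv that in \<open>meson le_less_trans less_le_trans\<close>)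
  show "0 < x \<Longrightarrow> x < R1 \<Longrightarrow> 0 < y \<Longrightarrow> y < R1 \<Longrightarrow> s x < s y \<longleftrightarrow> x < y"
    using *[of x y] *[of y x] by (cases x y rule: linorder_cases) auto
qed

lemma r_less: "0 < x \<Longrightarrow> x < R1 \<Longrightarrow> 0 < y \<Longrightarrow> y < R1 \<Longrightarrow> r x < r y \<longleftrightarrow> x < y"
proof -
  have *: "r x < r y" if "0 < x" "x < y" "y < R1" for x y
    by (rule DERIV_pos_imp_increasing[OF that(2)]) (use r_deriv that in \<open>meson le_less_trans less_le_trans\<close>)
  show "0 < x \<Longrightarrow> x < R1 \<Longrightarrow> 0 < y \<Longrightarrow> y < R1 \<Longrightarrow> r x < r y \<longleftrightarrow> x < y"
    using *[of x y] *[of y x] by (cases x y rule: linorder_cases) auto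
qed

text \<open>The displacement map takes the distance to the origin as its argument, while the flow is
  computed in the chart radius. This local inverse of \<open>r\<close> translates between
  them.\<close>

lemma r_inverse:
  assumes I: "0 \<le> a" "b \<le> R1" "a < R0" "R0 < b"
  obtains \<delta> g where "0 < \<delta>" "\<delta> < r R0" "g (r R0) = R0"
    "\<And>x. x \<in> {r R0 - \<delta><..<r R0 + \<delta>} \<Longrightarrow> a < g x \<and> g x < b \<and> r (g x) = x"
    "\<And>x. x \<in> {r R0 - \<delta><..<r R0 + \<delta>} \<Longrightarrow> (g has_real_derivative inverse (r' (g x))) (at x)"
proof -
  define c where "c = (a + R0) / 2" define d where "d = (R0 + b) / 2"
  have cd: "a < c" "c < R0" "R0 < d" "d < b" "0 < c" "d < R1" using I by (auto simp: c_def d_def)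
  have der: "(r has_real_derivative r' x) (at x)" "r' x > 0" if "c \<le> x" "x \<le> d" for x using r_deriv[of x] that cd by auto
  have inj: "inj_on r {c..d}"
  proof (rule inj_onI)
    fix x y assume "x \<in> {c..d}" "y \<in> {c..d}" "r x = r y"
    then show "x = y" using r_less[of x y] r_less[of y x] cd by (cases x y rule: linorder_cases) auto
  qed
  define g where "g = inv_into {c..d} r"
  have gr: "g (r x) = x" if "x \<in> {c..d}" for x unfolding g_def by (rule inv_into_f_f[OF inj that])
  have cont: "continuous_on {c..d} r"
    by (rule DERIV_continuous_on[OF has_field_derivative_at_within[OF der(1)]]) auto
  have lt: "r c < r R0" "r R0 < r d" using r_less[of c R0] r_less[of R0 d] cd by auto
  have rg: "r (g x) = x \<and> c < g x \<and> g x < d" if x: "r c < x" "x < r d" for x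
  proof -
    obtain y where y: "c \<le> y" "y \<le> d" "r y = x" using IVT'[of r c x d] x cd cont by auto
    then have "g x = y" using gr[of y] by auto
    moreover have "y \<noteq> c" "y \<noteq> d" using y x by auto
    ultimately show ?thesis using y by auto
  qed
  define \<delta> where "\<delta> = min (min (r R0 - r c) (r d - r R0)) (r R0 / 2)"
  have r0: "r R0 > 0" using rs_pos(1)[of R0] I by simp
  have \<delta>: "0 < \<delta>" "\<delta> < r R0" using lt r0 by (auto simp: \<delta>_def)
  have \<delta>': "\<delta> \<le> r R0 - r c" "\<delta> \<le> r d - r R0" by (auto simp: \<delta>_def)
  show ?thesis
  proof (rule that[of \<delta> g])
    show "0 < \<delta>" "\<delta> < r R0" by (rule \<delta>)+
    show "g (r R0) = R0" using gr cd by simp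
    fix x assume "x \<in> {r R0 - \<delta><..<r R0 + \<delta>}"
    then have x: "r c < x" "x < r d" using \<delta>' by auto
    note rgx = rg[OF x]
    show "a < g x \<and> g x < b \<and> r (g x) = x" using rgx cd by auto
    show "(g has_real_derivative inverse (r' (g x))) (at x)"
    proof (rule DERIV_inverse_function[where f=r and a="r c" and b="r d"])
      show "(r has_real_derivative r' (g x)) (at (g x))" "r' (g x) \<noteq> 0" using der[of "g x"] rgx by auto
      have "isCont g (r (g x))"
      proof (rule isCont_inverse_function2[where f=r and g=g and a=c and b=d])
        show "c < g x" "g x < d" using rgx by auto
        fix z assume z: "c \<le> z" "z \<le> d"
        then show "g (r z) = z" using gr by simp
        show "isCont r z" by (rule DERIV_isCont[OF der(1)[OF z]])
      qed
      then show "isCont g x" using rgx by simp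
    qed (use x rg in auto)
  qed
qed

end

section \<open>Half-return maps of a perturbed center and its hyperbolic cycles\<close>

locale perturbation = geometry +
  fixes dh1 lh1 mh1 nh1 dh2 lh2 mh2 nh2 :: real

sublocale perturbation \<subseteq> s1: side l1 n1 dh1 lh1 mh1 nh1 .
sublocale perturbation \<subseteq> s2: side l2 n2 dh2 lh2 mh2 nh2 .

context perturbation
begin

abbreviation "u \<equiv> start_axis \<nu>"

text \<open>The first half is followed forward and the second against time, from the same point. The
  displacement map subtracts in the opposite order, so its first order term is a negative multiple
  of \<open>M\<close>.\<close>

definition "M R = s1.M 1 \<phi>0 R - s2.M (- 1) \<phi>0 R"
definition "M' R = s1.M' 1 \<phi>0 R - s2.M' (- 1) \<phi>0 R"

lemma arc1:
  assumes Rm: "Rm \<le> R1" and f: "\<And>\<psi>. \<psi> \<in> {0..pi} \<Longrightarrow> 0 < f \<psi> \<and> f \<psi> < Rm \<and> s1.\<Delta> \<epsilon> (f \<psi>) (\<phi>0 + 1 * \<psi>) > 0 \<and>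
        (f has_real_derivative \<epsilon> * s1.G 1 \<phi>0 \<epsilon> \<psi> (f \<psi>)) (at \<psi> within {0..pi})"
    and B: "\<And>R \<phi>. 0 < R \<Longrightarrow> R < Rm \<Longrightarrow> s1.pt R \<phi> \<in> B"
  shows "\<exists>T \<gamma>. arc (s1.F \<epsilon>) \<nu> u (r (f 0)) (s (f pi)) T \<gamma> \<and> \<gamma> ` {0..T} \<subseteq> B"
proof -
  have Rm': "Rm \<le> s1.\<eta>0" using Rm R1 by simp
  obtain T \<gamma> where T: "T > 0"
    "\<gamma> 0 = s1.pt (f (1 * (\<phi>0 - \<phi>0))) \<phi>0" "\<gamma> T = s1.pt (f (1 * (\<phi>0 + pi - \<phi>0))) (\<phi>0 + pi)"
    "\<And>t. t \<in> {0..T} \<Longrightarrow> (\<gamma> has_vector_derivative s1.F \<epsilon> (\<gamma> t)) (at t within {0..T})"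
    "\<And>t. t \<in> {0..T} \<Longrightarrow> \<exists>R \<phi>. 0 < R \<and> R < Rm \<and> \<gamma> t = s1.pt R \<phi>"
    "\<And>t. t \<in> {0<..<T} \<Longrightarrow> \<exists>R. \<exists>\<phi>\<in>{\<phi>0<..<\<phi>0 + pi}. 0 < R \<and> R < Rm \<and> \<gamma> t = s1.pt R \<phi>"
    by (rule s1.flow_trajectory[of 1 Rm f \<epsilon> \<phi>0 \<phi>0, OF disjI1[OF refl] Rm' f]) (assumption, simp, rule that)
  have b: "0 < f 0" "f 0 < R1" "0 < f pi" "f pi < R1" using f[of 0] f[of pi] Rm by auto
  have "arc (s1.F \<epsilon>) \<nu> u (r (f 0)) (s (f pi)) T \<gamma>"
    unfolding arc_def
  proof (intro conjI ballI)
    show "\<gamma> 0 = r (f 0) *\<^sub>R u" "\<gamma> T = s (f pi) *\<^sub>R (- u)"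
      unfolding T(2,3) using start_pt(1)[OF b(1,2)] opp_pt(1)[OF b(3,4)] by simp_all
    show "r (f 0) > 0" "s (f pi) > 0" by (rule rs_pos(1)[OF b(1,2)], rule rs_pos(2)[OF b(3,4)])
    show "T > 0" by (rule T(1))
    show "(\<gamma> has_vector_derivative s1.F \<epsilon> (\<gamma> t)) (at t within {0..T})" if "t \<in> {0..T}" for t by (rule T(4)[OF that])
    fix t assume "t \<in> {0<..<T}"
    from T(6)[OF this] obtain R \<phi> where R: "\<phi> \<in> {\<phi>0<..<\<phi>0 + pi}" "0 < R" "R < Rm" "\<gamma> t = s1.pt R \<phi>" by blast
    then show "0 < \<nu> \<bullet> \<gamma> t" unfolding R(4) using Rm by (intro pt_sides(1)) auto
  qed
  moreover have "\<gamma> ` {0..T} \<subseteq> B"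
  proof
    fix p assume "p \<in> \<gamma> ` {0..T}"
    then obtain t where t: "t \<in> {0..T}" "p = \<gamma> t" by blast
    from T(5)[OF t(1)] B show "p \<in> B" unfolding t(2) by metis
  qed
  ultimately show ?thesis by blast
qed

lemma arc2:
  assumes Rm: "Rm \<le> R1" and f: "\<And>\<psi>. \<psi> \<in> {0..pi} \<Longrightarrow> 0 < f \<psi> \<and> f \<psi> < Rm \<and> s2.\<Delta> \<epsilon> (f \<psi>) (\<phi>0 + (- 1) * \<psi>) > 0 \<and>
        (f has_real_derivative \<epsilon> * s2.G (- 1) \<phi>0 \<epsilon> \<psi> (f \<psi>)) (at \<psi> within {0..pi})"
    and B: "\<And>R \<phi>. 0 < R \<Longrightarrow> R < Rm \<Longrightarrow> s2.pt R \<phi> \<in> B"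
  shows "\<exists>T \<gamma>. arc (s2.F \<epsilon>) (- \<nu>) (- u) (s (f pi)) (r (f 0)) T \<gamma> \<and> \<gamma> ` {0..T} \<subseteq> B"
proof -
  have Rm': "Rm \<le> s2.\<eta>0" using Rm R1 by simp
  obtain T \<gamma> where T: "T > 0"
    "\<gamma> 0 = s2.pt (f ((- 1) * (\<phi>0 - pi - \<phi>0))) (\<phi>0 - pi)" "\<gamma> T = s2.pt (f ((- 1) * (\<phi>0 - pi + pi - \<phi>0))) (\<phi>0 - pi + pi)"
    "\<And>t. t \<in> {0..T} \<Longrightarrow> (\<gamma> has_vector_derivative s2.F \<epsilon> (\<gamma> t)) (at t within {0..T})"
    "\<And>t. t \<in> {0..T} \<Longrightarrow> \<exists>R \<phi>. 0 < R \<and> R < Rm \<and> \<gamma> t = s2.pt R \<phi>"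
    "\<And>t. t \<in> {0<..<T} \<Longrightarrow> \<exists>R. \<exists>\<phi>\<in>{\<phi>0 - pi<..<\<phi>0 - pi + pi}. 0 < R \<and> R < Rm \<and> \<gamma> t = s2.pt R \<phi>"
    by (rule s2.flow_trajectory[of "- 1" Rm f \<epsilon> \<phi>0 "\<phi>0 - pi", OF disjI2[OF refl] Rm' f]) (assumption, simp, rule that)
  have b: "0 < f 0" "f 0 < R1" "0 < f pi" "f pi < R1" using f[of 0] f[of pi] Rm by auto
  have "arc (s2.F \<epsilon>) (- \<nu>) (- u) (s (f pi)) (r (f 0)) T \<gamma>"
    unfolding arc_def
  proof (intro conjI ballI)
    show "\<gamma> 0 = s (f pi) *\<^sub>R (- u)" "\<gamma> T = r (f 0) *\<^sub>R (- (- u))"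
      unfolding T(2,3) using start_pt(2)[OF b(1,2)] opp_pt(2)[OF b(3,4)] by simp_all
    show "r (f 0) > 0" "s (f pi) > 0" by (rule rs_pos(1)[OF b(1,2)], rule rs_pos(2)[OF b(3,4)])
    show "T > 0" by (rule T(1))
    show "(\<gamma> has_vector_derivative s2.F \<epsilon> (\<gamma> t)) (at t within {0..T})" if "t \<in> {0..T}" for t by (rule T(4)[OF that])
    fix t assume "t \<in> {0<..<T}"
    from T(6)[OF this] obtain R \<phi> where R: "\<phi> \<in> {\<phi>0 - pi<..<\<phi>0 - pi + pi}" "0 < R" "R < Rm" "\<gamma> t = s2.pt R \<phi>" by blast
    have "\<nu> \<bullet> s2.pt R \<phi> < 0" using R(1-3) Rm by (intro pt_sides(2)) auto
    then show "0 < - \<nu> \<bullet> \<gamma> t" unfolding R(4) by simp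
  qed
  moreover have "\<gamma> ` {0..T} \<subseteq> B"
  proof
    fix p assume "p \<in> \<gamma> ` {0..T}"
    then obtain t where t: "t \<in> {0..T}" "p = \<gamma> t" by blast
    from T(5)[OF t(1)] B show "p \<in> B" unfolding t(2) by metis
  qed
  ultimately show ?thesis by blast
qed

text \<open>Near \<open>z\<close> the difference of the two half flows is
  \<open>\<epsilon> * M\<close> up to \<open>o(\<epsilon>)\<close> in the C^1 sense, so near a
  simple zero of \<open>M\<close> it is strictly monotone with exactly one zero. The last clause
  records where the cycle meets the start half-axis; it later tells cycles of different zeros
  apart.\<close>

lemma local_cycle:
  assumes Rm: "0 < Rm" "Rm \<le> R1" and oB: "open B"
    and B: "\<And>R \<phi>. 0 < R \<Longrightarrow> R < Rm \<Longrightarrow> s1.pt R \<phi> \<in> B" "\<And>R \<phi>. 0 < R \<Longrightarrow> R < Rm \<Longrightarrow> s2.pt R \<phi> \<in> B"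
    and \<epsilon>0: "\<epsilon>0 > 0"
    and rot: "\<And>\<epsilon> p. 0 < \<epsilon> \<Longrightarrow> \<epsilon> < \<epsilon>0 \<Longrightarrow> p \<in> B \<Longrightarrow> p \<noteq> 0 \<Longrightarrow> det2 p (s1.F \<epsilon> p) > 0"
      "\<And>\<epsilon> p. 0 < \<epsilon> \<Longrightarrow> \<epsilon> < \<epsilon>0 \<Longrightarrow> p \<in> B \<Longrightarrow> p \<noteq> 0 \<Longrightarrow> det2 p (s2.F \<epsilon> p) > 0"
    and z: "0 < z" "z < Rm" "M z = 0" "M' z \<noteq> 0" and h: "h > 0"
  shows "\<exists>\<epsilon>1>0. \<forall>\<epsilon>. 0 < \<epsilon> \<longrightarrow> \<epsilon> < \<epsilon>1 \<longrightarrow> (\<exists>R \<Gamma>. \<bar>R - z\<bar> < h \<and> 0 < R \<and> R < Rm \<and>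
    crossing_limit_cycle (s1.F \<epsilon>) (s2.F \<epsilon>) \<nu> \<Gamma> \<and> \<Gamma> \<subseteq> B \<and> 0 \<in> inside \<Gamma> \<and>
    cycle_of_multiplicity (s1.F \<epsilon>) (s2.F \<epsilon>) \<nu> \<Gamma> 1 \<and> (\<forall>t. t *\<^sub>R u \<in> \<Gamma> \<and> t > 0 \<longleftrightarrow> t = r R))"
proof -
  have Rm': "Rm \<le> s1.\<eta>0" "Rm \<le> s2.\<eta>0" using Rm R1 by auto
  obtain f1 where f1: "\<And>e. e > 0 \<Longrightarrow> \<exists>\<delta>>0. \<forall>\<epsilon> R. 0 < \<epsilon> \<longrightarrow> \<epsilon> < \<delta> \<longrightarrow> \<bar>R - z\<bar> < \<delta> \<longrightarrow>
      f1 \<epsilon> R 0 = R \<and>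
      (\<forall>\<psi>\<in>{0..pi}. 0 < f1 \<epsilon> R \<psi> \<and> f1 \<epsilon> R \<psi> < Rm \<and> s1.\<Delta> \<epsilon> (f1 \<epsilon> R \<psi>) (\<phi>0 + 1 * \<psi>) > 0 \<and>
        (f1 \<epsilon> R has_real_derivative \<epsilon> * s1.G 1 \<phi>0 \<epsilon> \<psi> (f1 \<epsilon> R \<psi>)) (at \<psi> within {0..pi})) \<and>
      \<bar>(f1 \<epsilon> R pi - R) / \<epsilon> - s1.M 1 \<phi>0 z\<bar> < e \<and>
      (\<exists>D>0. ((\<lambda>R. f1 \<epsilon> R pi) has_real_derivative D) (at R) \<and> \<bar>(D - 1) / \<epsilon> - s1.M' 1 \<phi>0 z\<bar> < e)"
    by (rule s1.flow[OF z(1,2) Rm'(1)]) (rule that)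
  obtain f2 where f2: "\<And>e. e > 0 \<Longrightarrow> \<exists>\<delta>>0. \<forall>\<epsilon> R. 0 < \<epsilon> \<longrightarrow> \<epsilon> < \<delta> \<longrightarrow> \<bar>R - z\<bar> < \<delta> \<longrightarrow>
      f2 \<epsilon> R 0 = R \<and>
      (\<forall>\<psi>\<in>{0..pi}. 0 < f2 \<epsilon> R \<psi> \<and> f2 \<epsilon> R \<psi> < Rm \<and> s2.\<Delta> \<epsilon> (f2 \<epsilon> R \<psi>) (\<phi>0 + (- 1) * \<psi>) > 0 \<and>
        (f2 \<epsilon> R has_real_derivative \<epsilon> * s2.G (- 1) \<phi>0 \<epsilon> \<psi> (f2 \<epsilon> R \<psi>)) (at \<psi> within {0..pi})) \<and>
      \<bar>(f2 \<epsilon> R pi - R) / \<epsilon> - s2.M (- 1) \<phi>0 z\<bar> < e \<and>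
      (\<exists>D>0. ((\<lambda>R. f2 \<epsilon> R pi) has_real_derivative D) (at R) \<and> \<bar>(D - 1) / \<epsilon> - s2.M' (- 1) \<phi>0 z\<bar> < e)"
    by (rule s2.flow[OF z(1,2) Rm'(2)]) (rule that)
  define \<kappa> where "\<kappa> = \<bar>M' z\<bar>"
  define sg where "sg = sgn (M' z)"
  have \<kappa>: "\<kappa> > 0" "sg * M' z = \<kappa>" "\<bar>sg\<bar> = 1" "sg \<noteq> 0" using z(4) by (auto simp: \<kappa>_def sg_def sgn_if)
  \<comment> \<open>Tolerance for the derivatives: a quarter of \<open>\<kappa>\<close> for each
    half leaves a slope of at least \<open>\<epsilon> * (\<kappa> / 2)\<close>.\<close>
  have e4: "\<kappa> / 4 > 0" using \<kappa> by simp
  obtain \<delta>1 where \<delta>1: "\<delta>1 > 0" and p1: "\<And>\<epsilon> R. 0 < \<epsilon> \<Longrightarrow> \<epsilon> < \<delta>1 \<Longrightarrow> \<bar>R - z\<bar> < \<delta>1 \<Longrightarrow>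
      f1 \<epsilon> R 0 = R \<and>
      (\<forall>\<psi>\<in>{0..pi}. 0 < f1 \<epsilon> R \<psi> \<and> f1 \<epsilon> R \<psi> < Rm \<and> s1.\<Delta> \<epsilon> (f1 \<epsilon> R \<psi>) (\<phi>0 + 1 * \<psi>) > 0 \<and>
        (f1 \<epsilon> R has_real_derivative \<epsilon> * s1.G 1 \<phi>0 \<epsilon> \<psi> (f1 \<epsilon> R \<psi>)) (at \<psi> within {0..pi})) \<and>
      (\<exists>D>0. ((\<lambda>R. f1 \<epsilon> R pi) has_real_derivative D) (at R) \<and> \<bar>(D - 1) / \<epsilon> - s1.M' 1 \<phi>0 z\<bar> < \<kappa> / 4)"
    using f1[OF e4] by blast
  obtain \<delta>2 where \<delta>2: "\<delta>2 > 0" and p2: "\<And>\<epsilon> R. 0 < \<epsilon> \<Longrightarrow> \<epsilon> < \<delta>2 \<Longrightarrow> \<bar>R - z\<bar> < \<delta>2 \<Longrightarrow>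
      f2 \<epsilon> R 0 = R \<and>
      (\<forall>\<psi>\<in>{0..pi}. 0 < f2 \<epsilon> R \<psi> \<and> f2 \<epsilon> R \<psi> < Rm \<and> s2.\<Delta> \<epsilon> (f2 \<epsilon> R \<psi>) (\<phi>0 + (- 1) * \<psi>) > 0 \<and>
        (f2 \<epsilon> R has_real_derivative \<epsilon> * s2.G (- 1) \<phi>0 \<epsilon> \<psi> (f2 \<epsilon> R \<psi>)) (at \<psi> within {0..pi})) \<and>
      (\<exists>D>0. ((\<lambda>R. f2 \<epsilon> R pi) has_real_derivative D) (at R) \<and> \<bar>(D - 1) / \<epsilon> - s2.M' (- 1) \<phi>0 z\<bar> < \<kappa> / 4)"
    using f2[OF e4] by blast
  define \<delta> where "\<delta> = min (min \<delta>1 \<delta>2) h"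
  have \<delta>: "\<delta> > 0" "\<delta> \<le> \<delta>1" "\<delta> \<le> \<delta>2" "\<delta> \<le> h" using \<delta>1 \<delta>2 h by (auto simp: \<delta>_def)
  define k where "k = \<delta> / 2"
  have k: "k > 0" "k < \<delta>" using \<delta> by (auto simp: k_def)
  \<comment> \<open>Tolerance for the values: the difference at \<open>z\<close> is then below
    \<open>\<epsilon> * (\<kappa> * k / 4)\<close>, while moving by \<open>k\<close> changes it by
    at least twice that amount. This forces a zero within \<open>k\<close> of
    \<open>z\<close>.\<close>
  have e8: "\<kappa> * k / 8 > 0" using \<kappa> k by simp
  have zz: "\<bar>z - z\<bar> < x \<longleftrightarrow> x > 0" for x by simp
  obtain \<delta>3 where \<delta>3: "\<delta>3 > 0" "\<And>\<epsilon>. 0 < \<epsilon> \<Longrightarrow> \<epsilon> < \<delta>3 \<Longrightarrow> \<bar>(f1 \<epsilon> z pi - z) / \<epsilon> - s1.M 1 \<phi>0 z\<bar> < \<kappa> * k / 8"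
    using f1[OF e8] zz by meson
  obtain \<delta>4 where \<delta>4: "\<delta>4 > 0" "\<And>\<epsilon>. 0 < \<epsilon> \<Longrightarrow> \<epsilon> < \<delta>4 \<Longrightarrow> \<bar>(f2 \<epsilon> z pi - z) / \<epsilon> - s2.M (- 1) \<phi>0 z\<bar> < \<kappa> * k / 8"
    using f2[OF e8] zz by meson
  define \<epsilon>1 where "\<epsilon>1 = min (min \<delta> \<epsilon>0) (min \<delta>3 \<delta>4)"
  have \<epsilon>1: "\<epsilon>1 > 0" using \<delta> \<epsilon>0 \<delta>3 \<delta>4 by (simp add: \<epsilon>1_def)
  have "\<exists>R \<Gamma>. \<bar>R - z\<bar> < h \<and> 0 < R \<and> R < Rm \<and>
    crossing_limit_cycle (s1.F \<epsilon>) (s2.F \<epsilon>) \<nu> \<Gamma> \<and> \<Gamma> \<subseteq> B \<and> 0 \<in> inside \<Gamma> \<and>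
    cycle_of_multiplicity (s1.F \<epsilon>) (s2.F \<epsilon>) \<nu> \<Gamma> 1 \<and> (\<forall>t. t *\<^sub>R u \<in> \<Gamma> \<and> t > 0 \<longleftrightarrow> t = r R)"
    if \<epsilon>: "0 < \<epsilon>" "\<epsilon> < \<epsilon>1" for \<epsilon>
  proof -
    have e: "\<epsilon> < \<delta>" "\<epsilon> < \<epsilon>0" "\<epsilon> < \<delta>3" "\<epsilon> < \<delta>4" "\<epsilon> < \<delta>1" "\<epsilon> < \<delta>2" using \<epsilon> \<delta> by (auto simp: \<epsilon>1_def)
    define E1 where "E1 R = f1 \<epsilon> R pi" for R
    define E2 where "E2 R = f2 \<epsilon> R pi" for R
    have q1: "f1 \<epsilon> R 0 = R \<and>
      (\<forall>\<psi>\<in>{0..pi}. 0 < f1 \<epsilon> R \<psi> \<and> f1 \<epsilon> R \<psi> < Rm \<and> s1.\<Delta> \<epsilon> (f1 \<epsilon> R \<psi>) (\<phi>0 + 1 * \<psi>) > 0 \<and>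
        (f1 \<epsilon> R has_real_derivative \<epsilon> * s1.G 1 \<phi>0 \<epsilon> \<psi> (f1 \<epsilon> R \<psi>)) (at \<psi> within {0..pi})) \<and>
      (\<exists>D>0. (E1 has_real_derivative D) (at R) \<and> \<bar>(D - 1) / \<epsilon> - s1.M' 1 \<phi>0 z\<bar> < \<kappa> / 4)"
      and q2: "f2 \<epsilon> R 0 = R \<and>
      (\<forall>\<psi>\<in>{0..pi}. 0 < f2 \<epsilon> R \<psi> \<and> f2 \<epsilon> R \<psi> < Rm \<and> s2.\<Delta> \<epsilon> (f2 \<epsilon> R \<psi>) (\<phi>0 + (- 1) * \<psi>) > 0 \<and>
        (f2 \<epsilon> R has_real_derivative \<epsilon> * s2.G (- 1) \<phi>0 \<epsilon> \<psi> (f2 \<epsilon> R \<psi>)) (at \<psi> within {0..pi})) \<and>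
      (\<exists>D>0. (E2 has_real_derivative D) (at R) \<and> \<bar>(D - 1) / \<epsilon> - s2.M' (- 1) \<phi>0 z\<bar> < \<kappa> / 4)"
      if "\<bar>R - z\<bar> < \<delta>" for R
      using p1[of \<epsilon> R] p2[of \<epsilon> R] that \<epsilon>(1) e \<delta> unfolding E1_def[abs_def] E2_def[abs_def] by auto
    have RI: "0 < R" "R < Rm" and EI: "0 < E1 R" "E1 R < Rm" "0 < E2 R" "E2 R < Rm" if "\<bar>R - z\<bar> < \<delta>" for R
    proof -
      have "0 \<in> {0..pi}" "pi \<in> {0..pi}" by auto
      then show "0 < R" "R < Rm" "0 < E1 R" "E1 R < Rm" "0 < E2 R" "E2 R < Rm"
        using q1[OF that] q2[OF that] unfolding E1_def E2_def by metis+
    qed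
    have "\<forall>R. \<exists>D. \<bar>R - z\<bar> < \<delta> \<longrightarrow> D > 0 \<and> (E1 has_real_derivative D) (at R) \<and> \<bar>(D - 1) / \<epsilon> - s1.M' 1 \<phi>0 z\<bar> < \<kappa> / 4" using q1 by meson
    from choice[OF this] obtain D1 where D1: "\<And>R. \<bar>R - z\<bar> < \<delta> \<Longrightarrow> D1 R > 0 \<and> (E1 has_real_derivative D1 R) (at R) \<and> \<bar>(D1 R - 1) / \<epsilon> - s1.M' 1 \<phi>0 z\<bar> < \<kappa> / 4" by blast
    have "\<forall>R. \<exists>D. \<bar>R - z\<bar> < \<delta> \<longrightarrow> D > 0 \<and> (E2 has_real_derivative D) (at R) \<and> \<bar>(D - 1) / \<epsilon> - s2.M' (- 1) \<phi>0 z\<bar> < \<kappa> / 4" using q2 by meson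
    from choice[OF this] obtain D2 where D2: "\<And>R. \<bar>R - z\<bar> < \<delta> \<Longrightarrow> D2 R > 0 \<and> (E2 has_real_derivative D2 R) (at R) \<and> \<bar>(D2 R - 1) / \<epsilon> - s2.M' (- 1) \<phi>0 z\<bar> < \<kappa> / 4" by blast
    have arcs1: "\<exists>T \<gamma>. arc (s1.F \<epsilon>) \<nu> u (r R) (s (E1 R)) T \<gamma> \<and> \<gamma> ` {0..T} \<subseteq> B" if "\<bar>R - z\<bar> < \<delta>" for R
    proof -
      have "f1 \<epsilon> R 0 = R" using q1[OF that] by blast
      moreover have "\<exists>T \<gamma>. arc (s1.F \<epsilon>) \<nu> u (r (f1 \<epsilon> R 0)) (s (f1 \<epsilon> R pi)) T \<gamma> \<and> \<gamma> ` {0..T} \<subseteq> B"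
        by (rule arc1[OF Rm(2) _ B(1)]) (use q1[OF that] in blast)
      ultimately show ?thesis by (simp add: E1_def)
    qed
    have arcs2: "\<exists>T \<gamma>. arc (s2.F \<epsilon>) (- \<nu>) (- u) (s (E2 R)) (r R) T \<gamma> \<and> \<gamma> ` {0..T} \<subseteq> B" if "\<bar>R - z\<bar> < \<delta>" for R
    proof -
      have "f2 \<epsilon> R 0 = R" using q2[OF that] by blast
      moreover have "\<exists>T \<gamma>. arc (s2.F \<epsilon>) (- \<nu>) (- u) (s (f2 \<epsilon> R pi)) (r (f2 \<epsilon> R 0)) T \<gamma> \<and> \<gamma> ` {0..T} \<subseteq> B"
        by (rule arc2[OF Rm(2) _ B(2)]) (use q2[OF that] in blast)
      ultimately show ?thesis by (simp add: E2_def)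
    qed
    \<comment> \<open>The sign \<open>sg\<close> of \<open>M' z\<close> normalizes the difference to
      an increasing function.\<close>
    define D where "D R = sg * (E1 R - E2 R)" for R
    define D' where "D' R = sg * (D1 R - D2 R)" for R
    have dD: "(D has_real_derivative D' R) (at R)" if "\<bar>R - z\<bar> < \<delta>" for R
      unfolding D_def[abs_def] D'_def using D1[OF that] D2[OF that] by (intro DERIV_cmult DERIV_diff) auto
    have D'big: "D' R > \<epsilon> * (\<kappa> / 2)" if "\<bar>R - z\<bar> < \<delta>" for R
    proof -
      have "\<bar>(D1 R - D2 R) / \<epsilon> - M' z\<bar> < \<kappa> / 2"
        using D1[OF that] D2[OF that] unfolding M'_def diff_divide_distrib by linarith
      then have "\<bar>sg * ((D1 R - D2 R) / \<epsilon> - M' z)\<bar> < \<kappa> / 2" by (simp add: abs_mult \<kappa>)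
      then have "\<bar>D' R / \<epsilon> - \<kappa>\<bar> < \<kappa> / 2" using \<kappa>(2) by (simp add: D'_def right_diff_distrib)
      then have "D' R / \<epsilon> > \<kappa> / 2" by linarith
      then show ?thesis using \<epsilon>(1) by (simp add: field_simps)
    qed
    have mono: "D x < D y" if "\<bar>x - z\<bar> < \<delta>" "\<bar>y - z\<bar> < \<delta>" "x < y" for x y
    proof (rule DERIV_pos_imp_increasing[OF that(3)])
      fix w assume w: "x \<le> w" "w \<le> y"
      then have w': "\<bar>w - z\<bar> < \<delta>" using that by (simp add: abs_less_iff)
      have "D' w > 0" using D'big[OF w'] \<epsilon>(1) \<kappa>(1) by (meson half_gt_zero less_trans mult_pos_pos)
      then show "\<exists>d. (D has_real_derivative d) (at w) \<and> 0 < d" using dD[OF w'] by blast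
    qed
    have growth: "D y - D x \<ge> (y - x) * (\<epsilon> * (\<kappa> / 2))" if "\<bar>x - z\<bar> < \<delta>" "\<bar>y - z\<bar> < \<delta>" "x < y" for x y
    proof -
      have "\<exists>w. x < w \<and> w < y \<and> D y - D x = (y - x) * D' w"
        by (rule MVT2[OF that(3)]) (use that in \<open>auto intro!: dD simp: abs_less_iff\<close>)
      then obtain w where w: "x < w" "w < y" "D y - D x = (y - x) * D' w" by blast
      have "\<bar>w - z\<bar> < \<delta>" using w that by (simp add: abs_less_iff)
      from D'big[OF this] show ?thesis unfolding w(3) using that(3) by (intro mult_left_mono) auto
    qed
    have Dz: "\<bar>D z\<bar> < \<epsilon> * (\<kappa> * k / 4)"
    proof -
      have "\<bar>(E1 z - E2 z) / \<epsilon> - M z\<bar> < \<kappa> * k / 4"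
        using \<delta>3(2)[OF \<epsilon>(1) e(3)] \<delta>4(2)[OF \<epsilon>(1) e(4)] unfolding M_def E1_def E2_def diff_divide_distrib by linarith
      then have "\<bar>(E1 z - E2 z) / \<epsilon>\<bar> < \<kappa> * k / 4" using z(3) by simp
      then have "\<bar>E1 z - E2 z\<bar> / \<epsilon> < \<kappa> * k / 4" using \<epsilon>(1) by simp
      then have "\<bar>E1 z - E2 z\<bar> < \<epsilon> * (\<kappa> * k / 4)" using \<epsilon>(1) by (simp add: field_simps)
      then show ?thesis by (simp add: D_def abs_mult \<kappa>)
    qed
    have in_k: "\<bar>z - z\<bar> < \<delta>" "\<bar>z + k - z\<bar> < \<delta>" "\<bar>z - k - z\<bar> < \<delta>" using k \<delta> by auto
    have pos_k: "\<epsilon> * (\<kappa> * k / 4) > 0" using \<epsilon> \<kappa> k by simp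
    have hi: "D (z + k) > 0"
      using growth[OF in_k(1,2)] k Dz pos_k by (simp add: algebra_simps abs_less_iff)
    have lo: "D (z - k) < 0"
      using growth[OF in_k(3,1)] k Dz pos_k by (simp add: algebra_simps abs_less_iff)
    have "continuous_on {z - k..z + k} D"
      by (rule DERIV_continuous_on[OF has_field_derivative_at_within[OF dD]]) (use k in \<open>auto simp: abs_less_iff\<close>)
    then obtain R0 where R0: "z - k \<le> R0" "R0 \<le> z + k" "D R0 = 0"
      using IVT'[of D "z - k" 0 "z + k"] hi lo k by auto
    have R0\<delta>: "\<bar>R0 - z\<bar> < \<delta>" using R0 k by auto
    have EE: "E1 R0 = E2 R0" using R0(3) \<kappa>(4) by (simp add: D_def)
    define x0 where "x0 = r R0"
    have "0 \<le> max 0 (z - \<delta>)" "min R1 (z + \<delta>) \<le> R1" "max 0 (z - \<delta>) < R0" "R0 < min R1 (z + \<delta>)"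
      using RI[OF R0\<delta>] R0\<delta> Rm by (auto simp: abs_less_iff)
    from r_inverse[OF this, folded x0_def] obtain \<delta>' g where g: "0 < \<delta>'" "\<delta>' < x0" "g x0 = R0"
      "\<And>x. x \<in> {x0 - \<delta>'<..<x0 + \<delta>'} \<Longrightarrow> max 0 (z - \<delta>) < g x \<and> g x < min R1 (z + \<delta>) \<and> r (g x) = x"
      "\<And>x. x \<in> {x0 - \<delta>'<..<x0 + \<delta>'} \<Longrightarrow> (g has_real_derivative inverse (r' (g x))) (at x)" by blast
    let ?I = "{x0 - \<delta>'<..<x0 + \<delta>'}"
    have gI: "\<bar>g x - z\<bar> < \<delta>" "r (g x) = x" "0 < g x" "g x < R1" if "x \<in> ?I" for x
      using g(4)[OF that] by (auto simp: abs_less_iff)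
    \<comment> \<open>The half-return maps in terms of distances: \<open>g\<close> passes to the
      chart radius, \<open>E1\<close> and \<open>E2\<close> follow the half flows, and
      \<open>s\<close> passes back to the distance on the opposite half-axis.\<close>
    define P1 where "P1 x = s (E1 (g x))" for x
    define P2 where "P2 x = s (E2 (g x))" for x
    have ret1: "half_return (s1.F \<epsilon>) \<nu> u x (P1 x)" if "x \<in> ?I" for x
      unfolding half_return_iff_arc P1_def using arcs1[OF gI(1)[OF that]] gI(2)[OF that] by auto
    have ret2: "half_return (s2.F \<epsilon>) (- \<nu>) (- u) (P2 x) x" if "x \<in> ?I" for x
      unfolding half_return_iff_arc P2_def using arcs2[OF gI(1)[OF that]] gI(2)[OF that] by auto
    have E_R1: "0 < E1 R" "E1 R < R1" "0 < E2 R" "E2 R < R1" if "\<bar>R - z\<bar> < \<delta>" for R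
      using EI[OF that] Rm by auto
    have dP1: "(P1 has_real_derivative s' (E1 (g x)) * (D1 (g x) * inverse (r' (g x)))) (at x)" if "x \<in> ?I" for x
      unfolding P1_def[abs_def] using D1[OF gI(1)[OF that]] E_R1[OF gI(1)[OF that]] g(5)[OF that]
      by (intro DERIV_chain2[where f=s] DERIV_chain2[where f=E1] s_deriv) auto
    have dP2: "(P2 has_real_derivative s' (E2 (g x)) * (D2 (g x) * inverse (r' (g x)))) (at x)" if "x \<in> ?I" for x
      unfolding P2_def[abs_def] using D2[OF gI(1)[OF that]] E_R1[OF gI(1)[OF that]] g(5)[OF that]
      by (intro DERIV_chain2[where f=s] DERIV_chain2[where f=E2] s_deriv) auto
    have mono1: "strict_mono_on ?I P1"
    proof (rule strict_mono_onI)
      fix x y assume xy: "x \<in> ?I" "y \<in> ?I" "x < y"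
      show "P1 x < P1 y"
      proof (rule DERIV_pos_imp_increasing[OF xy(3)])
        fix w assume "x \<le> w" "w \<le> y"
        then have w: "w \<in> ?I" using xy by auto
        have "s' (E1 (g w)) * (D1 (g w) * inverse (r' (g w))) > 0"
          using D1[OF gI(1)[OF w]] s_deriv(2) E_R1[OF gI(1)[OF w]] r_deriv(2)[OF gI(3,4)[OF w]] by simp
        then show "\<exists>d. (P1 has_real_derivative d) (at w) \<and> 0 < d" using dP1[OF w] by blast
      qed
    qed
    have mono2: "strict_mono_on ?I P2"
    proof (rule strict_mono_onI)
      fix x y assume xy: "x \<in> ?I" "y \<in> ?I" "x < y"
      show "P2 x < P2 y"
      proof (rule DERIV_pos_imp_increasing[OF xy(3)])
        fix w assume "x \<le> w" "w \<le> y"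
        then have w: "w \<in> ?I" using xy by auto
        have "s' (E2 (g w)) * (D2 (g w) * inverse (r' (g w))) > 0"
          using D2[OF gI(1)[OF w]] s_deriv(2) E_R1[OF gI(1)[OF w]] r_deriv(2)[OF gI(3,4)[OF w]] by simp
        then show "\<exists>d. (P2 has_real_derivative d) (at w) \<and> 0 < d" using dP2[OF w] by blast
      qed
    qed
    have eqP: "x = x0" if x: "x \<in> ?I" and eq: "P1 x = P2 x" for x
    proof -
      have "E1 (g x) = E2 (g x)"
        using eq E_R1[OF gI(1)[OF x]] s_less[of "E1 (g x)" "E2 (g x)"] s_less[of "E2 (g x)" "E1 (g x)"]
        by (auto simp: P1_def P2_def)
      then have "D (g x) = 0" by (simp add: D_def)
      then have "g x = R0" using mono[OF gI(1)[OF x] R0\<delta>] mono[OF R0\<delta> gI(1)[OF x]] R0(3)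
        by (cases "g x" R0 rule: linorder_cases) auto
      then show ?thesis using gI(2)[OF x] by (simp add: x0_def)
    qed
    have x0: "x0 \<in> ?I" using g(1) by simp
    obtain T1 \<gamma>1 where a1: "arc (s1.F \<epsilon>) \<nu> u x0 (s (E1 R0)) T1 \<gamma>1" "\<gamma>1 ` {0..T1} \<subseteq> B" using arcs1[OF R0\<delta>] unfolding x0_def by blast
    obtain T2 \<gamma>2 where a2: "arc (s2.F \<epsilon>) (- \<nu>) (- u) (s (E1 R0)) x0 T2 \<gamma>2" "\<gamma>2 ` {0..T2} \<subseteq> B"
      using arcs2[OF R0\<delta>] unfolding x0_def EE by blast
    interpret iso: isolated_arcs "s1.F \<epsilon>" "s2.F \<epsilon>" \<nu> B x0 "s (E1 R0)" T1 T2 \<gamma>1 \<gamma>2 \<delta>' P1 P2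
      by unfold_locales (use \<nu> lip_balls_Z rot[OF \<epsilon>(1) e(2)] a1 a2 oB g(1,2) ret1 ret2 mono1 mono2 eqP in auto)
    have un: "half_return (s1.F \<epsilon>) \<nu> u x w \<longleftrightarrow> w = P1 x" "half_return (s2.F \<epsilon>) (- \<nu>) (- u) w x \<longleftrightarrow> w = P2 x"
      if x: "x \<in> ?I" for x w
    proof -
      show "half_return (s1.F \<epsilon>) \<nu> u x w \<longleftrightarrow> w = P1 x"
        using ret1[OF x] arc_unique_forward[OF iso.lip(1) iso.frame(1,3)] unfolding half_return_iff_arc by blast
      have "- \<nu> \<bullet> - u = 0" "- u \<noteq> 0" using iso.frame(1,3) by auto
      then show "half_return (s2.F \<epsilon>) (- \<nu>) (- u) w x \<longleftrightarrow> w = P2 x"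
        using ret2[OF x] arc_unique_backward[OF iso.lip(2)] unfolding half_return_iff_arc by blast
    qed
    have disp: "displacement (s1.F \<epsilon>) (s2.F \<epsilon>) \<nu> x = P2 x - P1 x" if "x \<in> ?I" for x
      unfolding displacement_def return1_def return2_def un[OF that] by simp
    have defd: "displacement_defined (s1.F \<epsilon>) (s2.F \<epsilon>) \<nu> x" if "x \<in> ?I" for x
      unfolding displacement_defined_def return1_def return2_def un[OF that] by simp
    have ev: "\<forall>\<^sub>F x in nhds x0. x \<in> ?I" by (rule eventually_nhds_in_open[OF _ x0]) simp
    define dd where "dd x = s' (E2 (g x)) * (D2 (g x) * inverse (r' (g x))) - s' (E1 (g x)) * (D1 (g x) * inverse (r' (g x)))" for x
    have ddisp: "(displacement (s1.F \<epsilon>) (s2.F \<epsilon>) \<nu> has_real_derivative dd x) (at x)" if x: "x \<in> ?I" for x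
    proof -
      have "((\<lambda>x. P2 x - P1 x) has_real_derivative dd x) (at x)"
        unfolding dd_def by (intro DERIV_diff dP1 dP2 x)
      moreover have e2: "\<forall>\<^sub>F y in nhds x. P2 y - P1 y = displacement (s1.F \<epsilon>) (s2.F \<epsilon>) \<nu> y"
        using eventually_nhds_in_open[OF open_greaterThanLessThan x] by (rule eventually_mono) (simp add: disp)
      ultimately show ?thesis using DERIV_cong_ev[OF refl e2 refl] by simp
    qed
    have ddnz: "dd x0 \<noteq> 0"
    proof -
      \<comment> \<open>At the zero both terms share the factors from \<open>s\<close> and
        \<open>g\<close>, because \<open>E1 R0 = E2 R0\<close>; only the difference of the flow
        derivatives remains.\<close>
      have "dd x0 = s' (E1 R0) * inverse (r' R0) * (D2 R0 - D1 R0)"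
        unfolding dd_def g(3) EE by (simp add: algebra_simps)
      moreover have "D2 R0 - D1 R0 \<noteq> 0"
        using D'big[OF R0\<delta>] \<epsilon>(1) \<kappa>(1) by (auto simp: D'_def mult_less_0_iff)
      moreover have "s' (E1 R0) > 0" "r' R0 > 0" using s_deriv(2) E_R1[OF R0\<delta>] r_deriv(2)[of R0] RI[OF R0\<delta>] Rm by auto
      ultimately show ?thesis by simp
    qed
    have zero: "zero_of_multiplicity (displacement (s1.F \<epsilon>) (s2.F \<epsilon>) \<nu>) x0 1"
      unfolding zero_of_multiplicity_def
    proof (intro conjI allI impI)
      show d0: "displacement (s1.F \<epsilon>) (s2.F \<epsilon>) \<nu> x0 = 0"
        unfolding disp[OF x0] P1_def P2_def g(3) EE by simp
      show "(deriv ^^ 1) (displacement (s1.F \<epsilon>) (s2.F \<epsilon>) \<nu>) x0 \<noteq> 0"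
        using DERIV_imp_deriv[OF ddisp[OF x0]] ddnz by simp
      fix i :: nat assume "i < 1"
      then have i: "i = 0" by simp
      show "(deriv ^^ i) (displacement (s1.F \<epsilon>) (s2.F \<epsilon>) \<nu>) x0 = 0" using d0 i by simp
      show "\<forall>\<^sub>F x in nhds x0. (deriv ^^ i) (displacement (s1.F \<epsilon>) (s2.F \<epsilon>) \<nu>) field_differentiable at x"
        using ev by (rule eventually_mono) (use ddisp i in \<open>auto simp: field_differentiable_def\<close>)
    qed
    have mult: "cycle_of_multiplicity (s1.F \<epsilon>) (s2.F \<epsilon>) \<nu> iso.cycle 1"
      unfolding cycle_of_multiplicity_def
    proof (intro exI[of _ x0] conjI zero)
      show "x0 > 0" using g(1,2) by linarith
      show "x0 *\<^sub>R u \<in> iso.cycle" using iso.ray_pos[of x0] by blast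
      show "\<forall>\<^sub>F x in nhds x0. displacement_defined (s1.F \<epsilon>) (s2.F \<epsilon>) \<nu> x"
        using ev by (rule eventually_mono) (rule defd)
    qed
    have "\<bar>R0 - z\<bar> < h" using R0\<delta> \<delta> by simp
    then show ?thesis
      using iso.crossing_limit_cycle_cycle iso.cycle_subset iso.zero_inside_cycle mult iso.ray_pos RI[OF R0\<delta>]
      unfolding x0_def by blast
  qed
  then show ?thesis using \<epsilon>1 by blast
qed

end

section \<open>Uniform bounds for the charts\<close>

lemma powr_bounds:
  fixes q a :: real
  assumes "1/2 \<le> q" "q \<le> 2" "\<bar>a\<bar> \<le> k"
  shows "exp (- (k * ln 2)) \<le> q powr a" "q powr a \<le> exp (k * ln 2)"
proof -
  have "ln (1/2) \<le> ln q" "ln q \<le> ln 2" using assms by (subst ln_le_cancel_iff; simp)+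
  then have "\<bar>ln q\<bar> \<le> ln 2" by (simp add: ln_div abs_le_iff)
  then have "\<bar>a * ln q\<bar> \<le> k * ln 2" unfolding abs_mult using assms by (intro mult_mono) auto
  then show "exp (- (k * ln 2)) \<le> q powr a" "q powr a \<le> exp (k * ln 2)"
    using assms(1) by (auto simp: powr_def abs_le_iff)
qed

lemma cw_lower:
  assumes y: "\<bar>y\<bar> < cc n" and L: "\<bar>l\<bar> \<le> L"
  shows "exp (- ((2 * L + 1) * ln 2)) / 2 \<le> cw l n y"
proof -
  have b: "1 - n * y \<ge> 1/2" "1/2 \<le> 1 - y" "1 - y \<le> 2" using cc_bounds[OF y] by (auto simp: abs_less_iff)
  have "exp (- ((2 * L + 1) * ln 2)) \<le> (1 - y) powr (2 * l - 1)"
    by (rule powr_bounds(1)[OF b(2,3)]) (use L in auto)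
  then have "(1/2) * exp (- ((2 * L + 1) * ln 2)) \<le> (1 - n * y) * (1 - y) powr (2 * l - 1)"
    using b by (intro mult_mono) auto
  then show ?thesis by (simp add: cw_def)
qed

text \<open>\<open>cQ\<close> is a mean of values of \<open>cw\<close> with the weight
  \<open>2 * t\<close> of total mass one.\<close>

lemma cQ_lower:
  assumes y: "\<bar>y\<bar> < cc n" and c: "\<And>y. \<bar>y\<bar> < cc n \<Longrightarrow> c \<le> cw l n y"
  shows "c \<le> cQ l n y"
proof -
  note cc = continuous_scaled_slice[OF continuous_cw(1) y]
  have "((\<lambda>t. t) has_integral (1\<^sup>2 / 2 - 0\<^sup>2 / 2)) {0..1::real}"
    by (rule fundamental_theorem_of_calculus)
      (auto intro!: derivative_eq_intros simp: has_real_derivative_iff_has_vector_derivative[symmetric])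
  then have 1: "integral {0..1} (\<lambda>t. t * c) = c / 2" by (simp add: integral_unique)
  have "integral {0..1} (\<lambda>t. t * c) \<le> integral {0..1} (\<lambda>t. t * cw l n (t * y))"
    by (rule integral_le)
      (auto intro!: integrable_continuous_interval continuous_intros cc mult_left_mono c cc_scale y)
  then show ?thesis unfolding 1 by (simp add: cQ_def)
qed

text \<open>The neighborhood is fixed before the center moves, so the size and the distortion of the
  charts must be uniform in bounded \<open>l\<close> and \<open>n\<close>. A lower bound for the
  weight passes to \<open>cQ\<close> and gives
  \<open>sqrt c * \<bar>y\<bar> \<le> \<bar>cE l n y\<bar>\<close>. This bounds the radius of the
  chart from below and the growth of its inverse from above.\<close>

lemma chart_uniform:
  fixes L :: real
  assumes L: "L \<ge> 0"
  obtains \<eta> K where "\<eta> > 0" "K > 0"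
    "\<And>l n. \<bar>l\<bar> \<le> L \<Longrightarrow> \<bar>n\<bar> \<le> L \<Longrightarrow> \<eta> \<le> c\<eta> l n"
    "\<And>l n x. \<bar>l\<bar> \<le> L \<Longrightarrow> \<bar>n\<bar> \<le> L \<Longrightarrow> \<bar>x\<bar> < c\<eta> l n \<Longrightarrow> \<bar>cY l n x\<bar> \<le> K * \<bar>x\<bar>"
    "\<And>l n R \<phi>. \<bar>l\<bar> \<le> L \<Longrightarrow> \<bar>n\<bar> \<le> L \<Longrightarrow> 0 < R \<Longrightarrow> R < \<eta> \<Longrightarrow> norm (side.pt l n R \<phi>) \<le> K * R"
proof -
  define c where "c = exp (- ((2 * L + 1) * ln 2)) / 2"
  have c: "c > 0" by (simp add: c_def)
  have lowE: "sqrt c * \<bar>y\<bar> \<le> \<bar>cE l n y\<bar>" if "\<bar>l\<bar> \<le> L" "\<bar>y\<bar> < cc n" for l n y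
  proof -
    have "c \<le> cQ l n y" using cQ_lower[OF that(2) cw_lower[OF _ that(1)]] by (simp add: c_def)
    then have "sqrt c \<le> sqrt (cQ l n y)" by simp
    then show ?thesis using cQ_pos[OF that(2), of l] by (simp add: cE_def abs_mult mult.commute mult_left_mono)
  qed
  define \<eta> where "\<eta> = sqrt c / (4 * (1 + L))"
  define K where "K = exp (L * ln 2) + 1 / sqrt c"
  have \<eta>: "\<eta> > 0" and K: "K > 0" using c L by (auto simp: \<eta>_def K_def add_pos_pos)
  have 1: "\<eta> \<le> c\<eta> l n" if "\<bar>l\<bar> \<le> L" "\<bar>n\<bar> \<le> L" for l n
  proof -
    have "1 / (4 * (1 + L)) \<le> cd n" unfolding cd_def cc_def using that by (simp add: frac_le)
    then have "sqrt c * (1 / (4 * (1 + L))) \<le> sqrt c * cd n" using c by (intro mult_left_mono) auto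
    then have "\<eta> \<le> sqrt c * cd n" by (simp add: \<eta>_def)
    moreover have "sqrt c * cd n \<le> \<bar>cE l n (cd n)\<bar>" "sqrt c * cd n \<le> \<bar>cE l n (- cd n)\<bar>"
      using lowE[OF that(1), of "cd n" n] lowE[OF that(1), of "- cd n" n] cd[of n] by auto
    moreover have "cE l n (cd n) > 0" "cE l n (- cd n) < 0"
      using cE_strict_mono[of "- cd n" n 0 l] cE_strict_mono[of 0 n "cd n" l] cd[of n] by auto
    ultimately show ?thesis by (simp add: c\<eta>_def)
  qed
  have 2: "sqrt c * \<bar>cY l n x\<bar> \<le> \<bar>x\<bar>" if "\<bar>l\<bar> \<le> L" "\<bar>x\<bar> < c\<eta> l n" for l n x
    using lowE[OF that(1) cY_cc[OF that(2)]] cE_cY[OF that(2)] by simp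
  have 3: "\<bar>cY l n x\<bar> \<le> (1 / sqrt c) * \<bar>x\<bar>" if "\<bar>l\<bar> \<le> L" "\<bar>x\<bar> < c\<eta> l n" for l n x
    using 2[OF that] c by (simp add: field_simps)
  have Kc: "(1 / sqrt c) * \<bar>x\<bar> \<le> K * \<bar>x\<bar>" for x by (rule mult_right_mono) (auto simp: K_def)
  have 4: "norm (side.pt l n R \<phi>) \<le> K * R" if h: "\<bar>l\<bar> \<le> L" "\<bar>n\<bar> \<le> L" "0 < R" "R < \<eta>" for l n R \<phi>
  proof -
    have x: "\<bar>R * sin \<phi>\<bar> \<le> R" "\<bar>R * cos \<phi>\<bar> \<le> R" using h by (auto simp: abs_mult mult_left_le)
    then have xl: "\<bar>R * sin \<phi>\<bar> < c\<eta> l n" using h 1[OF h(1,2)] by linarith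
    have "\<bar>cY l n (R * sin \<phi>)\<bar> < 1/4" using cY_bound[OF xl] cd[of n] by linarith
    then have q: "1/2 \<le> 1 - cY l n (R * sin \<phi>)" "1 - cY l n (R * sin \<phi>) \<le> 2" by linarith+
    have "norm (side.pt l n R \<phi>) \<le> \<bar>R * cos \<phi> * (1 - cY l n (R * sin \<phi>)) powr - l\<bar> + \<bar>cY l n (R * sin \<phi>)\<bar>"
      unfolding side.pt_def by (metis norm_Pair_le real_norm_def)
    also have "\<dots> \<le> R * exp (L * ln 2) + (1 / sqrt c) * R"
    proof (rule add_mono)
      show "\<bar>R * cos \<phi> * (1 - cY l n (R * sin \<phi>)) powr - l\<bar> \<le> R * exp (L * ln 2)"
        unfolding abs_mult[of "R * cos \<phi>"] using x powr_bounds(2)[OF q, of "- l" L] h by (intro mult_mono) auto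
      have "\<bar>cY l n (R * sin \<phi>)\<bar> \<le> (1 / sqrt c) * \<bar>R * sin \<phi>\<bar>" by (rule 3[OF h(1) xl])
      also have "\<dots> \<le> (1 / sqrt c) * R" using x c by (intro mult_left_mono) auto
      finally show "\<bar>cY l n (R * sin \<phi>)\<bar> \<le> (1 / sqrt c) * R" .
    qed
    finally show ?thesis by (simp add: K_def algebra_simps)
  qed
  show ?thesis
  proof (rule that[OF \<eta> K])
    show "\<bar>cY l n x\<bar> \<le> K * \<bar>x\<bar>" if "\<bar>l\<bar> \<le> L" "\<bar>n\<bar> \<le> L" "\<bar>x\<bar> < c\<eta> l n" for l n x
      using 3[OF that(1,3)] Kc[of x] by linarith
  qed (use 1 4 in blast)+
qed

section \<open>The first order term as a function of radius and direction\<close>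

context side
begin

lemma continuous_slice:
  assumes "\<bar>R\<bar> < \<eta>0"
  shows "continuous_on UNIV (S R)" "continuous_on UNIV (S' R)"
proof -
  have "continuous_on UNIV ((\<lambda>(R, \<phi>). S R \<phi>) \<circ> (\<lambda>\<phi>. (R, \<phi>)))" "continuous_on UNIV ((\<lambda>(R, \<phi>). S' R \<phi>) \<circ> (\<lambda>\<phi>. (R, \<phi>)))"
    using assms
    by (intro continuous_on_compose continuous_on_subset[OF continuous_S(1)] continuous_intros; force)
      (intro continuous_on_compose continuous_on_subset[OF continuous_S(2)] continuous_intros; use assms in force)
  then show "continuous_on UNIV (S R)" "continuous_on UNIV (S' R)" by (simp_all add: o_def)
qed

lemma DERIV_M:
  assumes R: "0 < R" "R < \<eta>0"
  shows "(M \<sigma> \<phi>0 has_real_derivative M' \<sigma> \<phi>0 R) (at R)"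
proof -
  let ?U = "{0<..<\<eta>0}"
  have h: "continuous_on (?U \<times> cbox 0 pi) (\<lambda>p. k (fst p) (\<phi>0 + \<sigma> * snd p))"
    if k: "continuous_on ({R. \<bar>R\<bar> < \<eta>0} \<times> UNIV) (\<lambda>(R, \<phi>). k R \<phi>)" for k :: "real \<Rightarrow> real \<Rightarrow> real"
  proof -
    have "continuous_on (?U \<times> cbox 0 pi) ((\<lambda>(R, \<phi>). k R \<phi>) \<circ> (\<lambda>p. (fst p, \<phi>0 + \<sigma> * snd p)))"
      by (intro continuous_on_compose continuous_on_subset[OF k]) (auto intro!: continuous_intros)
    then show ?thesis by (simp add: o_def split_beta)
  qed
  have "((\<lambda>R. integral (cbox 0 pi) (\<lambda>\<psi>. \<sigma> * cos (\<phi>0 + \<sigma> * \<psi>) * S R (\<phi>0 + \<sigma> * \<psi>))) has_field_derivative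
      integral (cbox 0 pi) (\<lambda>\<psi>. \<sigma> * cos (\<phi>0 + \<sigma> * \<psi>) * S' R (\<phi>0 + \<sigma> * \<psi>))) (at R within ?U)"
  proof (rule leibniz_rule_field_derivative)
    fix x t assume x: "x \<in> ?U"
    show "((\<lambda>R. \<sigma> * cos (\<phi>0 + \<sigma> * t) * S R (\<phi>0 + \<sigma> * t)) has_field_derivative \<sigma> * cos (\<phi>0 + \<sigma> * t) * S' x (\<phi>0 + \<sigma> * t)) (at x within ?U)"
      by (intro DERIV_cmult has_field_derivative_at_within[OF DERIV_S]) (use x in auto)
  next
    fix x assume x: "x \<in> ?U"
    have "continuous_on (cbox 0 pi) (\<lambda>\<psi>. S x (\<phi>0 + \<sigma> * \<psi>))"
      by (rule continuous_on_compose2[OF continuous_slice(1)]) (use x in \<open>auto intro!: continuous_intros\<close>)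
    then show "(\<lambda>\<psi>. \<sigma> * cos (\<phi>0 + \<sigma> * \<psi>) * S x (\<phi>0 + \<sigma> * \<psi>)) integrable_on cbox 0 pi"
      by (intro integrable_continuous continuous_on_mult continuous_intros)
  next
    show "continuous_on (?U \<times> cbox 0 pi) (\<lambda>(x, t). \<sigma> * cos (\<phi>0 + \<sigma> * t) * S' x (\<phi>0 + \<sigma> * t))"
      unfolding split_beta by (intro continuous_on_mult h[OF continuous_S(2)] continuous_intros)
  qed (use R in auto)
  then show ?thesis using at_within_open[of R ?U] R by (simp add: M_def[abs_def] M'_def)
qed

lemma integrable_M:
  assumes "\<bar>R\<bar> < \<eta>0"
  shows "(\<lambda>\<psi>. \<sigma> * cos (\<phi>0 + \<sigma> * \<psi>) * S R (\<phi>0 + \<sigma> * \<psi>)) integrable_on {0..pi}"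
proof -
  have "continuous_on {0..pi} (\<lambda>\<psi>. S R (\<phi>0 + \<sigma> * \<psi>))"
    by (rule continuous_on_compose2[OF continuous_slice(1)[OF assms]]) (auto intro!: continuous_intros)
  then show ?thesis by (intro integrable_continuous_interval continuous_on_mult continuous_intros)
qed

end

lemma side_M_linear:
  assumes "\<bar>R\<bar> < c\<eta> l n"
  shows "side.M l n (a * d + b * d') (a * k + b * k') (a * m + b * m') (a * h + b * h') \<sigma> \<phi>0 R =
    a * side.M l n d k m h \<sigma> \<phi>0 R + b * side.M l n d' k' m' h' \<sigma> \<phi>0 R"
proof -
  have "side.S l n (a * d + b * d') (a * k + b * k') (a * m + b * m') (a * h + b * h') R \<phi> =
      a * side.S l n d k m h R \<phi> + b * side.S l n d' k' m' h' R \<phi>" for \<phi>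
    unfolding side.S_def side.A_def side.B_def side.C_def by algebra
  then have eq: "\<sigma> * cos (\<phi>0 + \<sigma> * \<psi>) * side.S l n (a * d + b * d') (a * k + b * k') (a * m + b * m') (a * h + b * h') R (\<phi>0 + \<sigma> * \<psi>) =
      a * (\<sigma> * cos (\<phi>0 + \<sigma> * \<psi>) * side.S l n d k m h R (\<phi>0 + \<sigma> * \<psi>)) +
      b * (\<sigma> * cos (\<phi>0 + \<sigma> * \<psi>) * side.S l n d' k' m' h' R (\<phi>0 + \<sigma> * \<psi>))" for \<psi>
    by (simp add: algebra_simps)
  show ?thesis
    unfolding side.M_def eq
    using side.integrable_M[OF assms, of \<sigma> \<phi>0 d k m h] side.integrable_M[OF assms, of \<sigma> \<phi>0 d' k' m' h']
    by (simp add: Henstock_Kurzweil_Integration.integral_add integrable_on_mult_right)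
qed

text \<open>The term \<open>M\<close> of a perturbed center with the direction as an argument,
  ordered as in \<open>params\<close>. Here \<open>k1\<close>, \<open>k2\<close> are the increments
  of \<open>l1\<close>, \<open>l2\<close>, and \<open>h1\<close>, \<open>h2\<close> those of
  \<open>n1\<close>, \<open>n2\<close>.\<close>

definition gM :: "real \<Rightarrow> real \<Rightarrow> real \<Rightarrow> real \<Rightarrow> real \<Rightarrow> params \<Rightarrow> real \<Rightarrow> real" where
  "gM \<phi>0 l1 n1 l2 n2 = (\<lambda>(d1, d2, k1, k2, m1, m2, h1, h2) R.
     side.M l1 n1 d1 k1 m1 h1 1 \<phi>0 R - side.M l2 n2 d2 k2 m2 h2 (- 1) \<phi>0 R)"

definition gM' :: "real \<Rightarrow> real \<Rightarrow> real \<Rightarrow> real \<Rightarrow> real \<Rightarrow> params \<Rightarrow> real \<Rightarrow> real" where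
  "gM' \<phi>0 l1 n1 l2 n2 = (\<lambda>(d1, d2, k1, k2, m1, m2, h1, h2) R.
     side.M' l1 n1 d1 k1 m1 h1 1 \<phi>0 R - side.M' l2 n2 d2 k2 m2 h2 (- 1) \<phi>0 R)"

lemma DERIV_gM:
  assumes "0 < R" "R < c\<eta> l1 n1" "R < c\<eta> l2 n2"
  shows "(gM \<phi>0 l1 n1 l2 n2 v has_real_derivative gM' \<phi>0 l1 n1 l2 n2 v R) (at R)"
  using assms by (cases v) (auto simp: gM_def[abs_def] gM'_def intro!: DERIV_diff side.DERIV_M)

lemma gM_linear:
  assumes "\<bar>R\<bar> < c\<eta> l1 n1" "\<bar>R\<bar> < c\<eta> l2 n2"
  shows "gM \<phi>0 l1 n1 l2 n2 (a *\<^sub>R v + b *\<^sub>R w) R = a * gM \<phi>0 l1 n1 l2 n2 v R + b * gM \<phi>0 l1 n1 l2 n2 w R"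
proof -
  obtain d1 d2 k1 k2 m1 m2 h1 h2 where v: "v = (d1, d2, k1, k2, m1, m2, h1, h2)" by (cases v) auto
  obtain d1' d2' k1' k2' m1' m2' h1' h2' where w: "w = (d1', d2', k1', k2', m1', m2', h1', h2')" by (cases w) auto
  show ?thesis unfolding v w by (simp add: gM_def side_M_linear assms) (simp add: algebra_simps)
qed

definition base :: "real \<Rightarrow> real \<Rightarrow> real \<Rightarrow> real \<Rightarrow> params" where
  "base l1 n1 l2 n2 = (0, 0, l1, l2, 0, 0, n1, n2)"

text \<open>The point is that \<open>\<rho>\<close> depends on \<open>U\<close>, \<open>L\<close>
  and \<open>R0\<close> alone: the center, the direction and the zeros can be chosen after it.
  Orbits with chart radius below \<open>\<rho>\<close> stay in a ball contained in \<open>U\<close>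
  on which both fields rotate.\<close>

lemma cycles_from_simple_zeros:
  fixes U :: "plane set" and L R0 :: real
  assumes U: "open U" "0 \<in> U" and L: "L \<ge> 0" and R0: "R0 > 0"
  obtains \<rho> where "\<rho> > 0" "\<rho> \<le> R0"
    "\<And>\<nu> \<phi>0 l1 n1 l2 n2 R1 r r' s s' v Zs. geometry \<nu> \<phi>0 l1 n1 l2 n2 R1 r r' s s' \<Longrightarrow> \<rho> \<le> R1 \<Longrightarrow>
      \<bar>l1\<bar> \<le> L \<Longrightarrow> \<bar>n1\<bar> \<le> L \<Longrightarrow> \<bar>l2\<bar> \<le> L \<Longrightarrow> \<bar>n2\<bar> \<le> L \<Longrightarrow> finite Zs \<Longrightarrow> Zs \<subseteq> {0<..<\<rho>} \<Longrightarrow>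
      (\<forall>z\<in>Zs. gM \<phi>0 l1 n1 l2 n2 v z = 0 \<and> gM' \<phi>0 l1 n1 l2 n2 v z \<noteq> 0) \<Longrightarrow>
      \<exists>\<epsilon>1>0. \<forall>\<epsilon>. 0 < \<epsilon> \<longrightarrow> \<epsilon> < \<epsilon>1 \<longrightarrow>
        has_crossing_limit_cycles (Z1 (base l1 n1 l2 n2 + \<epsilon> *\<^sub>R v)) (Z2 (base l1 n1 l2 n2 + \<epsilon> *\<^sub>R v)) \<nu> U (card Zs)"
proof -
  have L1: "L + 1 \<ge> 0" using L by simp
  obtain b where b: "b > 0" "\<And>d l m n p. \<bar>d\<bar> \<le> 1/4 \<Longrightarrow> \<bar>l\<bar> \<le> L + 1 \<Longrightarrow> \<bar>m\<bar> \<le> L + 1 \<Longrightarrow> \<bar>n\<bar> \<le> L + 1 \<Longrightarrow>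
    norm p < b \<Longrightarrow> p \<noteq> 0 \<Longrightarrow> det2 p (Z d l m n p) > 0"
    by (rule rotation_bound[OF L1]) (rule that)
  obtain \<eta> K where \<eta>: "\<eta> > 0" and K: "K > 0"
    and ptK: "\<And>l n R \<phi>. \<bar>l\<bar> \<le> L \<Longrightarrow> \<bar>n\<bar> \<le> L \<Longrightarrow> 0 < R \<Longrightarrow> R < \<eta> \<Longrightarrow> norm (side.pt l n R \<phi>) \<le> K * R"
    by (rule chart_uniform[OF L]) (rule that)
  obtain \<beta> where \<beta>: "\<beta> > 0" "ball 0 \<beta> \<subseteq> U" using U openE by blast
  define B where "B = ball (0 :: plane) (min b \<beta>)"
  have B: "open B" "B \<subseteq> U" using \<beta> by (auto simp: B_def)
  define \<rho> where "\<rho> = min R0 (min \<eta> (min b \<beta> / K))"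
  have \<rho>: "\<rho> > 0" "\<rho> \<le> R0" using \<eta> K b \<beta> R0 by (simp_all add: \<rho>_def)
  have inB: "side.pt l n R \<phi> \<in> B" if "\<bar>l\<bar> \<le> L" "\<bar>n\<bar> \<le> L" "0 < R" "R < \<rho>" for l n R \<phi>
  proof -
    have "R < min b \<beta> / K" "R < \<eta>" using that(4) by (auto simp: \<rho>_def)
    then have "K * R < min b \<beta>" using K by (simp add: field_simps)
    then show ?thesis using ptK[OF that(1-3) \<open>R < \<eta>\<close>, of \<phi>] by (simp add: B_def)
  qed
  show ?thesis
  proof (rule that[OF \<rho>])
    fix \<nu> \<phi>0 l1 n1 l2 n2 R1 r r' s s' and v :: params and Zs
    assume geo: "geometry \<nu> \<phi>0 l1 n1 l2 n2 R1 r r' s s'" and \<rho>R1: "\<rho> \<le> R1"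
      and bd: "\<bar>l1\<bar> \<le> L" "\<bar>n1\<bar> \<le> L" "\<bar>l2\<bar> \<le> L" "\<bar>n2\<bar> \<le> L" and fin: "finite Zs" and Zs: "Zs \<subseteq> {0<..<\<rho>}"
      and zero: "\<forall>z\<in>Zs. gM \<phi>0 l1 n1 l2 n2 v z = 0 \<and> gM' \<phi>0 l1 n1 l2 n2 v z \<noteq> 0"
    obtain d1 d2 k1 k2 m1 m2 h1 h2 where v: "v = (d1, d2, k1, k2, m1, m2, h1, h2)" by (cases v) auto
    interpret geometry \<nu> \<phi>0 l1 n1 l2 n2 R1 r r' s s' by (rule geo)
    interpret perturbation \<nu> \<phi>0 l1 n1 l2 n2 R1 r r' s s' d1 k1 m1 h1 d2 k2 m2 h2 ..
    have Mv: "M z = gM \<phi>0 l1 n1 l2 n2 v z" "M' z = gM' \<phi>0 l1 n1 l2 n2 v z" for z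
      by (simp_all add: M_def M'_def gM_def gM'_def v)
    have Fv: "s1.F \<epsilon> = Z1 (base l1 n1 l2 n2 + \<epsilon> *\<^sub>R v)" "s2.F \<epsilon> = Z2 (base l1 n1 l2 n2 + \<epsilon> *\<^sub>R v)" for \<epsilon>
      by (simp_all add: Z1_def Z2_def base_def v)
    define N where "N = \<bar>d1\<bar> + \<bar>d2\<bar> + \<bar>k1\<bar> + \<bar>k2\<bar> + \<bar>m1\<bar> + \<bar>m2\<bar> + \<bar>h1\<bar> + \<bar>h2\<bar> + 1"
    define \<epsilon>0 where "\<epsilon>0 = 1 / (4 * N)"
    have N: "N > 0" by (simp add: N_def add_nonneg_pos)
    then have \<epsilon>0: "\<epsilon>0 > 0" by (simp add: \<epsilon>0_def)
    have small: "\<bar>\<epsilon> * x\<bar> \<le> 1/4" if "0 < \<epsilon>" "\<epsilon> < \<epsilon>0" "\<bar>x\<bar> \<le> N" for \<epsilon> x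
    proof -
      have "\<bar>\<epsilon> * x\<bar> \<le> \<epsilon>0 * N" unfolding abs_mult using that by (intro mult_mono) auto
      then show ?thesis using N by (simp add: \<epsilon>0_def)
    qed
    have xN: "\<bar>d1\<bar> \<le> N" "\<bar>d2\<bar> \<le> N" "\<bar>k1\<bar> \<le> N" "\<bar>k2\<bar> \<le> N" "\<bar>m1\<bar> \<le> N" "\<bar>m2\<bar> \<le> N" "\<bar>h1\<bar> \<le> N" "\<bar>h2\<bar> \<le> N"
      by (simp_all add: N_def)
    have rot: "det2 p (Z (0 + \<epsilon> * d) (l + \<epsilon> * k) (0 + \<epsilon> * m) (n + \<epsilon> * h) p) > 0"
      if "0 < \<epsilon>" "\<epsilon> < \<epsilon>0" "p \<in> B" "p \<noteq> 0" "\<bar>d\<bar> \<le> N" "\<bar>k\<bar> \<le> N" "\<bar>m\<bar> \<le> N" "\<bar>h\<bar> \<le> N" "\<bar>l\<bar> \<le> L" "\<bar>n\<bar> \<le> L"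
      for \<epsilon> p d k m h l n
    proof (rule b(2)[OF _ _ _ _ _ that(4)])
      show "\<bar>0 + \<epsilon> * d\<bar> \<le> 1 / 4" using small[OF that(1,2,5)] by simp
      show "\<bar>l + \<epsilon> * k\<bar> \<le> L + 1" using small[OF that(1,2,6)] that(9) by linarith
      show "\<bar>0 + \<epsilon> * m\<bar> \<le> L + 1" using small[OF that(1,2,7)] L by linarith
      show "\<bar>n + \<epsilon> * h\<bar> \<le> L + 1" using small[OF that(1,2,8)] that(10) by linarith
      show "norm p < b" using that(3) by (simp add: B_def)
    qed
    have rot1: "det2 p (s1.F \<epsilon> p) > 0" if "0 < \<epsilon>" "\<epsilon> < \<epsilon>0" "p \<in> B" "p \<noteq> 0" for \<epsilon> p
      using rot[OF that xN(1,3,5,7) bd(1,2)] by simp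
    have rot2: "det2 p (s2.F \<epsilon> p) > 0" if "0 < \<epsilon>" "\<epsilon> < \<epsilon>0" "p \<in> B" "p \<noteq> 0" for \<epsilon> p
      using rot[OF that xN(2,4,6,8) bd(3,4)] by simp
    \<comment> \<open>The zeros are at least \<open>2 * h\<close> apart and each cycle has its chart
      radius within \<open>h\<close> of its zero. Different zeros hence give different cycles, and
      the sum of multiplicities is \<open>card Zs\<close>.\<close>
    have "\<exists>h>0. \<forall>x\<in>Zs. \<forall>y\<in>Zs. x \<noteq> y \<longrightarrow> 2 * h \<le> \<bar>x - y\<bar>"
    proof -
      let ?D = "insert 1 ((\<lambda>(x, y). \<bar>x - y\<bar>) ` {p \<in> Zs \<times> Zs. fst p \<noteq> snd p})"
      have f: "finite ?D" using fin by auto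
      have "Min ?D > 0" using f by (subst Min_gr_iff) auto
      moreover have "Min ?D \<le> \<bar>x - y\<bar>" if "x \<in> Zs" "y \<in> Zs" "x \<noteq> y" for x y
      proof (rule Min_le[OF f])
        have "(x, y) \<in> {p \<in> Zs \<times> Zs. fst p \<noteq> snd p}" using that by simp
        then show "\<bar>x - y\<bar> \<in> ?D" by force
      qed
      ultimately show ?thesis by (intro exI[of _ "Min ?D / 2"]) auto
    qed
    then obtain h where h: "h > 0" "\<And>x y. x \<in> Zs \<Longrightarrow> y \<in> Zs \<Longrightarrow> x \<noteq> y \<Longrightarrow> 2 * h \<le> \<bar>x - y\<bar>" by blast
    have "\<forall>z\<in>Zs. \<exists>\<epsilon>1>0. \<forall>\<epsilon>. 0 < \<epsilon> \<longrightarrow> \<epsilon> < \<epsilon>1 \<longrightarrow> (\<exists>R \<Gamma>. \<bar>R - z\<bar> < h \<and> 0 < R \<and> R < \<rho> \<and>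
      crossing_limit_cycle (s1.F \<epsilon>) (s2.F \<epsilon>) \<nu> \<Gamma> \<and> \<Gamma> \<subseteq> B \<and> 0 \<in> inside \<Gamma> \<and>
      cycle_of_multiplicity (s1.F \<epsilon>) (s2.F \<epsilon>) \<nu> \<Gamma> 1 \<and> (\<forall>t. t *\<^sub>R u \<in> \<Gamma> \<and> t > 0 \<longleftrightarrow> t = r R))"
    proof
      fix z assume z: "z \<in> Zs"
      have "0 < z" "z < \<rho>" "M z = 0" "M' z \<noteq> 0" using z Zs bspec[OF zero z] Mv by auto
      then show "\<exists>\<epsilon>1>0. \<forall>\<epsilon>. 0 < \<epsilon> \<longrightarrow> \<epsilon> < \<epsilon>1 \<longrightarrow> (\<exists>R \<Gamma>. \<bar>R - z\<bar> < h \<and> 0 < R \<and> R < \<rho> \<and>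
        crossing_limit_cycle (s1.F \<epsilon>) (s2.F \<epsilon>) \<nu> \<Gamma> \<and> \<Gamma> \<subseteq> B \<and> 0 \<in> inside \<Gamma> \<and>
        cycle_of_multiplicity (s1.F \<epsilon>) (s2.F \<epsilon>) \<nu> \<Gamma> 1 \<and> (\<forall>t. t *\<^sub>R u \<in> \<Gamma> \<and> t > 0 \<longleftrightarrow> t = r R))"
        by (intro local_cycle[OF \<rho>(1) \<rho>R1 B(1) inB[OF bd(1,2)] inB[OF bd(3,4)] \<epsilon>0 rot1 rot2 _ _ _ _ h(1)])
    qed
    from bchoice[OF this] obtain E where E: "\<And>z. z \<in> Zs \<Longrightarrow> E z > 0"
      and cyc: "\<And>z \<epsilon>. z \<in> Zs \<Longrightarrow> 0 < \<epsilon> \<Longrightarrow> \<epsilon> < E z \<Longrightarrow> (\<exists>R \<Gamma>. \<bar>R - z\<bar> < h \<and> 0 < R \<and> R < \<rho> \<and>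
      crossing_limit_cycle (s1.F \<epsilon>) (s2.F \<epsilon>) \<nu> \<Gamma> \<and> \<Gamma> \<subseteq> B \<and> 0 \<in> inside \<Gamma> \<and>
      cycle_of_multiplicity (s1.F \<epsilon>) (s2.F \<epsilon>) \<nu> \<Gamma> 1 \<and> (\<forall>t. t *\<^sub>R u \<in> \<Gamma> \<and> t > 0 \<longleftrightarrow> t = r R))" by blast
    define \<epsilon>1 where "\<epsilon>1 = Min (insert 1 (E ` Zs))"
    have \<epsilon>1: "\<epsilon>1 > 0" unfolding \<epsilon>1_def using fin E by (subst Min_gr_iff) auto
    have \<epsilon>1E: "\<epsilon>1 \<le> E z" if "z \<in> Zs" for z unfolding \<epsilon>1_def using fin that by (intro Min_le) auto
    have "has_crossing_limit_cycles (s1.F \<epsilon>) (s2.F \<epsilon>) \<nu> U (card Zs)" if \<epsilon>: "0 < \<epsilon>" "\<epsilon> < \<epsilon>1" for \<epsilon>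
    proof -
      have "\<forall>z\<in>Zs. \<exists>p. \<bar>fst p - z\<bar> < h \<and> 0 < fst p \<and> fst p < \<rho> \<and>
        crossing_limit_cycle (s1.F \<epsilon>) (s2.F \<epsilon>) \<nu> (snd p) \<and> snd p \<subseteq> B \<and> 0 \<in> inside (snd p) \<and>
        cycle_of_multiplicity (s1.F \<epsilon>) (s2.F \<epsilon>) \<nu> (snd p) 1 \<and> (\<forall>t. t *\<^sub>R u \<in> snd p \<and> t > 0 \<longleftrightarrow> t = r (fst p))"
      proof
        fix z assume z: "z \<in> Zs"
        have "\<epsilon> < E z" using \<epsilon>1E[OF z] \<epsilon> by simp
        from cyc[OF z \<epsilon>(1) this] obtain R \<Gamma> where "\<bar>R - z\<bar> < h \<and> 0 < R \<and> R < \<rho> \<and>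
          crossing_limit_cycle (s1.F \<epsilon>) (s2.F \<epsilon>) \<nu> \<Gamma> \<and> \<Gamma> \<subseteq> B \<and> 0 \<in> inside \<Gamma> \<and>
          cycle_of_multiplicity (s1.F \<epsilon>) (s2.F \<epsilon>) \<nu> \<Gamma> 1 \<and> (\<forall>t. t *\<^sub>R u \<in> \<Gamma> \<and> t > 0 \<longleftrightarrow> t = r R)" by blast
        then show "\<exists>p. \<bar>fst p - z\<bar> < h \<and> 0 < fst p \<and> fst p < \<rho> \<and>
          crossing_limit_cycle (s1.F \<epsilon>) (s2.F \<epsilon>) \<nu> (snd p) \<and> snd p \<subseteq> B \<and> 0 \<in> inside (snd p) \<and>
          cycle_of_multiplicity (s1.F \<epsilon>) (s2.F \<epsilon>) \<nu> (snd p) 1 \<and> (\<forall>t. t *\<^sub>R u \<in> snd p \<and> t > 0 \<longleftrightarrow> t = r (fst p))"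
          by (intro exI[of _ "(R, \<Gamma>)"]) simp
      qed
      from bchoice[OF this] obtain P where P: "\<And>z. z \<in> Zs \<Longrightarrow> \<bar>fst (P z) - z\<bar> < h \<and> 0 < fst (P z) \<and> fst (P z) < \<rho> \<and>
        crossing_limit_cycle (s1.F \<epsilon>) (s2.F \<epsilon>) \<nu> (snd (P z)) \<and> snd (P z) \<subseteq> B \<and> 0 \<in> inside (snd (P z)) \<and>
        cycle_of_multiplicity (s1.F \<epsilon>) (s2.F \<epsilon>) \<nu> (snd (P z)) 1 \<and> (\<forall>t. t *\<^sub>R u \<in> snd (P z) \<and> t > 0 \<longleftrightarrow> t = r (fst (P z)))"
        by blast
      have inj: "inj_on (\<lambda>z. snd (P z)) Zs"
      proof (rule inj_onI)
        fix x y assume x: "x \<in> Zs" and y: "y \<in> Zs" and eq: "snd (P x) = snd (P y)"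
        have "r (fst (P x)) = r (fst (P y))" using P[OF x] P[OF y] eq by metis
        moreover have "0 < fst (P x)" "fst (P x) < R1" "0 < fst (P y)" "fst (P y) < R1" using P[OF x] P[OF y] \<rho>R1 by auto
        ultimately have "fst (P x) = fst (P y)"
          using r_less[of "fst (P x)" "fst (P y)"] r_less[of "fst (P y)" "fst (P x)"] by (metis less_irrefl linorder_neqE_linordered_idom)
        then have "\<bar>x - y\<bar> < 2 * h" using P[OF x] P[OF y] by (simp add: abs_less_iff)
        then show "x = y" using h(2)[OF x y] by linarith
      qed
      show ?thesis unfolding has_crossing_limit_cycles_def
      proof (intro exI[of _ "(\<lambda>z. snd (P z)) ` Zs"] exI[of _ "\<lambda>_. 1"] conjI)
        show "finite ((\<lambda>z. snd (P z)) ` Zs)" using fin by simp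
        show "(\<Sum>\<Gamma>\<in>(\<lambda>z. snd (P z)) ` Zs. 1) = card Zs" using card_image[OF inj] by simp
        show "\<forall>\<Gamma>\<in>(\<lambda>z. snd (P z)) ` Zs. crossing_limit_cycle (s1.F \<epsilon>) (s2.F \<epsilon>) \<nu> \<Gamma> \<and> \<Gamma> \<subseteq> U \<and> (0, 0) \<in> inside \<Gamma> \<and>
            cycle_of_multiplicity (s1.F \<epsilon>) (s2.F \<epsilon>) \<nu> \<Gamma> 1"
        proof
          fix \<Gamma> assume "\<Gamma> \<in> (\<lambda>z. snd (P z)) ` Zs"
          then obtain z where z: "z \<in> Zs" "\<Gamma> = snd (P z)" by blast
          show "crossing_limit_cycle (s1.F \<epsilon>) (s2.F \<epsilon>) \<nu> \<Gamma> \<and> \<Gamma> \<subseteq> U \<and> (0, 0) \<in> inside \<Gamma> \<and>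
            cycle_of_multiplicity (s1.F \<epsilon>) (s2.F \<epsilon>) \<nu> \<Gamma> 1"
            unfolding z(2) zero_prod_def[symmetric] using P[OF z(1)] B(2) by blast
        qed
      qed
    qed
    then show "\<exists>\<epsilon>1>0. \<forall>\<epsilon>. 0 < \<epsilon> \<longrightarrow> \<epsilon> < \<epsilon>1 \<longrightarrow>
        has_crossing_limit_cycles (Z1 (base l1 n1 l2 n2 + \<epsilon> *\<^sub>R v)) (Z2 (base l1 n1 l2 n2 + \<epsilon> *\<^sub>R v)) \<nu> U (card Zs)"
      unfolding Fv using \<epsilon>1 by blast
  qed
qed

section \<open>Creating simple zeros\<close>

text \<open>The critical values of a differentiable function form a null set by Sard's theorem, and
  a null set cannot contain an interval. The function is moved to \<open>real^1\<close> to fit the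
  form of that theorem.\<close>

lemma regular_value:
  fixes h h' :: "real \<Rightarrow> real"
  assumes h: "\<And>x. x \<in> S \<Longrightarrow> (h has_real_derivative h' x) (at x)" and \<delta>: "\<delta> > 0"
  obtains \<tau> where "\<bar>\<tau>\<bar> < \<delta>" "\<And>x. x \<in> S \<Longrightarrow> h x = \<tau> \<Longrightarrow> h' x \<noteq> 0"
proof -
  define C :: "(real^1) set" where "C = {v. v $ 1 \<in> S \<and> h' (v $ 1) = 0}"
  define f :: "real^1 \<Rightarrow> real^1" where "f v = h (v $ 1) *\<^sub>R 1" for v
  have "negligible (f ` C)"
  proof (rule baby_Sard[where f' = "\<lambda>_ _. 0"])
    fix v assume v: "v \<in> C"
    then have "(h has_real_derivative 0) (at (v $ 1))" using h[of "v $ 1"] by (auto simp: C_def)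
    then have "(h has_derivative (\<lambda>t. 0)) (at (v $ 1))"
      unfolding has_field_derivative_def by (simp add: mult_zero_left[abs_def])
    then have "((\<lambda>v. h (v $ 1)) has_derivative (\<lambda>t. 0)) (at v within C)"
      using has_derivative_compose[of "\<lambda>v. v $ 1" "\<lambda>v. v $ 1" v C h "\<lambda>t. 0"]
      by (simp add: bounded_linear_imp_has_derivative bounded_linear_vec_nth)
    then show "(f has_derivative (\<lambda>_. 0)) (at v within C)"
      unfolding f_def[abs_def] by (auto intro!: derivative_eq_intros)
    have "matrix (\<lambda>_ :: real^1. 0 :: real^1) = 0" by (simp add: matrix_def vec_eq_iff)
    then show "rank (matrix (\<lambda>_ :: real^1. 0 :: real^1)) < CARD(1)" by simp
  qed simp
  moreover have "open {v :: real^1. \<bar>v $ 1\<bar> < \<delta>}"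
    by (intro open_Collect_less continuous_intros)
  moreover have "{v :: real^1. \<bar>v $ 1\<bar> < \<delta>} \<noteq> {}" using \<delta> by (auto intro!: exI[of _ 0])
  ultimately have "\<not> {v :: real^1. \<bar>v $ 1\<bar> < \<delta>} \<subseteq> f ` C"
    using open_not_negligible negligible_subset by blast
  then obtain v where v: "\<bar>v $ 1\<bar> < \<delta>" "v \<notin> f ` C" by blast
  show ?thesis
  proof (rule that[OF v(1)])
    fix x assume x: "x \<in> S" "h x = v $ 1"
    show "h' x \<noteq> 0"
    proof
      assume "h' x = 0"
      then have "vec x \<in> C" using x by (simp add: C_def)
      moreover have "f (vec x) = v" using x by (simp add: f_def vec_eq_iff forall_1)
      ultimately show False using v(2) by blast
    qed
  qed
qed

text \<open>Sign changes are counted instead of zeros, because strict signs at finitely many fixed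
  points survive every small perturbation.\<close>

definition alternates :: "nat \<Rightarrow> (real \<Rightarrow> real) \<Rightarrow> real \<Rightarrow> bool" where
  "alternates n F \<rho> \<longleftrightarrow> (\<exists>x :: nat \<Rightarrow> real. (\<forall>i\<le>n. 0 < x i \<and> x i < \<rho> \<and> F (x i) \<noteq> 0) \<and>
     (\<forall>i<n. x i < x (Suc i) \<and> F (x i) * F (x (Suc i)) < 0))"

lemma sign_perturb:
  fixes a b :: real
  assumes "a * b < 0" "\<bar>a' - a\<bar> < \<bar>a\<bar>" "\<bar>b' - b\<bar> < \<bar>b\<bar>"
  shows "a' * b' < 0"
proof -
  consider "a > 0" "b < 0" | "a < 0" "b > 0" using assms(1) by (auto simp: mult_less_0_iff)
  then show ?thesis using assms(2,3) by cases (auto simp: mult_less_0_iff abs_if split: if_splits)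
qed

lemma alternates_perturb:
  fixes n :: nat and F e :: "'a \<Rightarrow> real"
  assumes "\<forall>i\<le>n. F (x i) \<noteq> (0 :: real)"
  obtains t0 where "t0 > 0" "\<And>t i. \<bar>t\<bar> < t0 \<Longrightarrow> i \<le> n \<Longrightarrow> \<bar>t * e (x i)\<bar> < \<bar>F (x i)\<bar>"
proof -
  \<comment> \<open>The summand \<open>1\<close> keeps the denominator positive where
    \<open>e\<close> vanishes.\<close>
  define t0 where "t0 = Min ((\<lambda>i. \<bar>F (x i)\<bar> / (\<bar>e (x i)\<bar> + 1)) ` {..n})"
  have f: "finite ((\<lambda>i. \<bar>F (x i)\<bar> / (\<bar>e (x i)\<bar> + 1)) ` {..n})" "(\<lambda>i. \<bar>F (x i)\<bar> / (\<bar>e (x i)\<bar> + 1)) ` {..n} \<noteq> {}" by auto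
  have "t0 > 0" unfolding t0_def Min_gr_iff[OF f] using assms by (auto intro!: divide_pos_pos add_nonneg_pos)
  moreover have "\<bar>t * e (x i)\<bar> < \<bar>F (x i)\<bar>" if "\<bar>t\<bar> < t0" "i \<le> n" for t i
  proof -
    have "t0 \<le> \<bar>F (x i)\<bar> / (\<bar>e (x i)\<bar> + 1)" unfolding t0_def using that(2) by (intro Min_le) auto
    then have "\<bar>t\<bar> * (\<bar>e (x i)\<bar> + 1) < \<bar>F (x i)\<bar>" using that(1) by (simp add: pos_less_divide_eq[symmetric] add_nonneg_pos)
    moreover have "\<bar>t\<bar> * \<bar>e (x i)\<bar> \<le> \<bar>t\<bar> * (\<bar>e (x i)\<bar> + 1)" by (simp add: mult_left_mono)
    ultimately show ?thesis by (simp add: abs_mult)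
  qed
  ultimately show ?thesis using that by blast
qed

text \<open>Near \<open>0\<close> the added term \<open>\<tau> * c * R ^ k\<close> dominates
  \<open>F\<close>. With the sign opposite to that of \<open>F\<close> at the first point it creates
  a sign change further to the left, and for small \<open>\<tau>\<close> all old signs
  remain.\<close>

lemma alternates_add:
  assumes alt: "alternates n F \<rho>" and F: "((\<lambda>R. F R / R ^ k) \<longlongrightarrow> 0) (at_right 0)"
    and e: "((\<lambda>R. e R / R ^ k) \<longlongrightarrow> c) (at_right 0)" "c \<noteq> 0"
  obtains \<tau> where "alternates (Suc n) (\<lambda>R. F R + \<tau> * e R) \<rho>"
proof -
  obtain x :: "nat \<Rightarrow> real" where x: "\<And>i. i \<le> n \<Longrightarrow> 0 < x i \<and> x i < \<rho> \<and> F (x i) \<noteq> 0"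
    "\<And>i. i < n \<Longrightarrow> x i < x (Suc i) \<and> F (x i) * F (x (Suc i)) < 0"
    using alt unfolding alternates_def by blast
  have "\<forall>i\<le>n. F (x i) \<noteq> 0" using x by blast
  from alternates_perturb[of n F x e, OF this] obtain t0 where
    t0: "t0 > 0" "\<And>t i. \<bar>t\<bar> < t0 \<Longrightarrow> i \<le> n \<Longrightarrow> \<bar>t * e (x i)\<bar> < \<bar>F (x i)\<bar>" by blast
  define \<tau> where "\<tau> = - sgn (F (x 0)) * sgn c * (t0 / 2)"
  have F0: "F (x 0) \<noteq> 0" using x(1)[of 0] by simp
  have \<tau>: "\<bar>\<tau>\<bar> < t0" "\<tau> \<noteq> 0" using t0 e(2) F0 by (auto simp: \<tau>_def abs_mult sgn_if)
  have "((\<lambda>R. F R / R ^ k + \<tau> * (e R / R ^ k)) \<longlongrightarrow> 0 + \<tau> * c) (at_right 0)"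
    by (intro tendsto_intros F e(1))
  then have lim: "((\<lambda>R. F (x 0) * (F R / R ^ k + \<tau> * (e R / R ^ k))) \<longlongrightarrow> F (x 0) * (\<tau> * c)) (at_right 0)"
    by (intro tendsto_intros) simp
  have "F (x 0) * (\<tau> * c) = - (\<bar>F (x 0)\<bar> * \<bar>c\<bar> * (t0 / 2))"
    by (simp add: \<tau>_def sgn_if)
  also have "\<dots> < 0" using F0 e(2) t0(1) by simp
  finally have neg: "F (x 0) * (\<tau> * c) < 0" .
  from order_tendstoD(2)[OF lim neg]
  have ev: "\<forall>\<^sub>F R in at_right 0. F (x 0) * (F R / R ^ k + \<tau> * (e R / R ^ k)) < 0" .
  have "\<forall>\<^sub>F R in at_right (0::real). R \<in> {0<..<x 0}"
    using x(1)[of 0] by (intro eventually_at_right_real) simp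
  from eventually_happens'[OF _ eventually_conj[OF ev this]] obtain y where
    y: "F (x 0) * (F y / y ^ k + \<tau> * (e y / y ^ k)) < 0" "0 < y" "y < x 0" by auto
  have yk: "y ^ k > 0" using y by simp
  have "F (x 0) * (F y + \<tau> * e y) = F (x 0) * (F y / y ^ k + \<tau> * (e y / y ^ k)) * y ^ k"
    using y(2) by (simp add: field_simps)
  also have "\<dots> < 0" using y(1) yk by (simp add: mult_neg_pos)
  finally have sy: "F (x 0) * (F y + \<tau> * e y) < 0" .
  define x' where "x' i = (case i of 0 \<Rightarrow> y | Suc j \<Rightarrow> x j)" for i
  let ?F = "\<lambda>R. F R + \<tau> * e R"
  have keep: "\<bar>?F (x i) - F (x i)\<bar> < \<bar>F (x i)\<bar>" if "i \<le> n" for i using t0(2)[OF \<tau>(1) that] by simp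
  have nz: "?F (x i) \<noteq> 0" if "i \<le> n" for i using keep[OF that] by auto
  have "alternates (Suc n) ?F \<rho>"
    unfolding alternates_def
  proof (intro exI[of _ x'] conjI allI impI)
    fix i assume i: "i \<le> Suc n"
    show "0 < x' i" "x' i < \<rho>" "?F (x' i) \<noteq> 0"
      using i y sy x(1)[of 0] x(1)[of "i - 1"] nz[of "i - 1"] by (auto simp: x'_def split: nat.split)
  next
    fix i assume i: "i < Suc n"
    show "x' i < x' (Suc i)"
      using i y x(2)[of "i - 1"] by (auto simp: x'_def split: nat.split)
    show "?F (x' i) * ?F (x' (Suc i)) < 0"
    proof (cases i)
      case 0
      have "?F (x 0) * (F y + \<tau> * e y) < 0"
        by (rule sign_perturb[OF sy keep]) (use sy in auto)
      then show ?thesis by (simp add: x'_def 0 mult.commute)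
    next
      case (Suc j)
      then have "?F (x j) * ?F (x (Suc j)) < 0"
        using i x(2)[of j] by (intro sign_perturb[OF _ keep keep]) auto
      then show ?thesis by (simp add: x'_def Suc)
    qed
  qed
  then show ?thesis by (rule that)
qed

text \<open>The perturbations are added from the highest order downwards. After \<open>e K\<close>,
  of order \<open>Suc K\<close>, the function is still small compared with \<open>R ^ K\<close>,
  which is what the next step requires.\<close>

lemma alternates_iterate:
  fixes e :: "nat \<Rightarrow> real \<Rightarrow> real"
  assumes "alternates n F \<rho>" and "((\<lambda>R. F R / R ^ K) \<longlongrightarrow> 0) (at_right 0)"
    and e: "\<And>k. k < K \<Longrightarrow> ((\<lambda>R. e k R / R ^ Suc k) \<longlongrightarrow> c k) (at_right 0)" "\<And>k. k < K \<Longrightarrow> c k \<noteq> 0"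
  shows "\<exists>\<tau>. alternates (n + K) (\<lambda>R. F R + (\<Sum>k<K. \<tau> k * e k R)) \<rho>"
  using assms
proof (induction K arbitrary: n F)
  case 0 then show ?case by simp
next
  case (Suc K)
  have ek: "((\<lambda>R. e K R / R ^ Suc K) \<longlongrightarrow> c K) (at_right 0)" "c K \<noteq> 0" using Suc.prems by auto
  obtain \<tau>0 where \<tau>0: "alternates (Suc n) (\<lambda>R. F R + \<tau>0 * e K R) \<rho>"
    by (rule alternates_add[OF Suc.prems(1,2) ek])
  have "((\<lambda>R. R * (F R / R ^ Suc K) + \<tau>0 * (R * (e K R / R ^ Suc K))) \<longlongrightarrow> 0 * 0 + \<tau>0 * (0 * c K)) (at_right 0)"
    by (intro tendsto_intros Suc.prems(2) ek(1))
  moreover have "\<forall>\<^sub>F R in at_right 0. R * (F R / R ^ Suc K) + \<tau>0 * (R * (e K R / R ^ Suc K)) = (F R + \<tau>0 * e K R) / R ^ K"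
    using eventually_at_right_less[of 0] by eventually_elim (simp add: add_divide_distrib)
  ultimately have lim: "((\<lambda>R. (F R + \<tau>0 * e K R) / R ^ K) \<longlongrightarrow> 0) (at_right 0)"
    by (simp add: tendsto_cong)
  have "\<exists>\<tau>. alternates (Suc n + K) (\<lambda>R. (F R + \<tau>0 * e K R) + (\<Sum>k<K. \<tau> k * e k R)) \<rho>"
    by (rule Suc.IH[OF \<tau>0 lim]) (use Suc.prems in auto)
  then obtain \<tau> where \<tau>: "alternates (Suc n + K) (\<lambda>R. (F R + \<tau>0 * e K R) + (\<Sum>k<K. \<tau> k * e k R)) \<rho>" by blast
  have "(\<lambda>R. (F R + \<tau>0 * e K R) + (\<Sum>k<K. \<tau> k * e k R)) = (\<lambda>R. F R + (\<Sum>k<Suc K. (\<tau>(K := \<tau>0)) k * e k R))"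
    by (auto simp: fun_eq_iff)
  then show ?case using \<tau> by (intro exI[of _ "\<tau>(K := \<tau>0)"]) (simp only: add_Suc_shift)
qed

text \<open>Where \<open>e\<close> is positive, \<open>F + \<tau> * e\<close> vanishes exactly where
  \<open>- F / e\<close> takes the value \<open>\<tau>\<close>, and the zero is simple when
  \<open>\<tau>\<close> is a regular value of this quotient. A small regular value keeps the signs
  at the chosen points, and the intermediate value theorem gives a zero in each gap.\<close>

lemma simple_zeros:
  fixes F F' e e' :: "real \<Rightarrow> real"
  assumes alt: "alternates n F \<rho>"
    and dF: "\<And>R. 0 < R \<Longrightarrow> R < \<rho> \<Longrightarrow> (F has_real_derivative F' R) (at R)"
    and de: "\<And>R. 0 < R \<Longrightarrow> R < \<rho> \<Longrightarrow> (e has_real_derivative e' R) (at R)"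
    and epos: "\<And>R. 0 < R \<Longrightarrow> R < \<rho> \<Longrightarrow> e R > 0"
  obtains \<tau> Zs where "finite Zs" "card Zs = n" "Zs \<subseteq> {0<..<\<rho>}"
    "\<And>z. z \<in> Zs \<Longrightarrow> F z + \<tau> * e z = 0 \<and> F' z + \<tau> * e' z \<noteq> 0"
proof -
  obtain x :: "nat \<Rightarrow> real" where x: "\<And>i. i \<le> n \<Longrightarrow> 0 < x i \<and> x i < \<rho> \<and> F (x i) \<noteq> 0"
    "\<And>i. i < n \<Longrightarrow> x i < x (Suc i) \<and> F (x i) * F (x (Suc i)) < 0"
    using alt unfolding alternates_def by blast
  have "\<forall>i\<le>n. F (x i) \<noteq> 0" using x by blast
  from alternates_perturb[of n F x e, OF this] obtain t0 where
    t0: "t0 > 0" "\<And>t i. \<bar>t\<bar> < t0 \<Longrightarrow> i \<le> n \<Longrightarrow> \<bar>t * e (x i)\<bar> < \<bar>F (x i)\<bar>" by blast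
  define h where "h R = - (F R / e R)" for R
  define h' where "h' R = - ((F' R * e R - F R * e' R) / (e R * e R))" for R
  have dh: "(h has_real_derivative h' R) (at R)" if "R \<in> {0<..<\<rho>}" for R
    unfolding h_def[abs_def] h'_def using that epos[of R] by (intro DERIV_minus DERIV_divide dF de) auto
  obtain \<tau> where \<tau>: "\<bar>\<tau>\<bar> < t0" "\<And>R. R \<in> {0<..<\<rho>} \<Longrightarrow> h R = \<tau> \<Longrightarrow> h' R \<noteq> 0"
    by (rule regular_value[OF dh t0(1)]) (assumption, rule that)
  let ?F = "\<lambda>R. F R + \<tau> * e R"
  have keep: "\<bar>?F (x i) - F (x i)\<bar> < \<bar>F (x i)\<bar>" if "i \<le> n" for i using t0(2)[OF \<tau>(1) that] by simp
  have "\<exists>z. x i < z \<and> z < x (Suc i) \<and> ?F z = 0" if i: "i < n" for i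
  proof -
    have s: "?F (x i) * ?F (x (Suc i)) < 0"
      using i x(2)[of i] by (intro sign_perturb[OF _ keep keep]) auto
    have c: "continuous_on {x i..x (Suc i)} ?F"
    proof (intro continuous_on_add continuous_on_mult continuous_on_const)
      have sub: "0 < w \<and> w < \<rho>" if "w \<in> {x i..x (Suc i)}" for w using that x(1)[of i] x(1)[of "Suc i"] i by auto
      show "continuous_on {x i..x (Suc i)} F" "continuous_on {x i..x (Suc i)} e"
        by (rule DERIV_continuous_on[OF has_field_derivative_at_within[OF dF]]; use sub in blast)
          (rule DERIV_continuous_on[OF has_field_derivative_at_within[OF de]]; use sub in blast)
    qed
    have "\<exists>z\<ge>x i. z \<le> x (Suc i) \<and> ?F z = 0"
    proof (cases "?F (x i) < 0")
      case True
      then show ?thesis using s IVT'[of ?F "x i" 0 "x (Suc i)"] c x(2)[OF i] by (auto simp: mult_less_0_iff)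
    next
      case False
      then show ?thesis using s IVT2'[of ?F "x (Suc i)" 0 "x i"] c x(2)[OF i] by (auto simp: mult_less_0_iff)
    qed
    then obtain z where z: "x i \<le> z" "z \<le> x (Suc i)" "?F z = 0" by auto
    moreover have "z \<noteq> x i" "z \<noteq> x (Suc i)" using z s by auto
    ultimately show ?thesis by (intro exI[of _ z]) auto
  qed
  then have "\<forall>i. \<exists>z. i < n \<longrightarrow> x i < z \<and> z < x (Suc i) \<and> ?F z = 0" by blast
  from choice[OF this] obtain z where z: "\<And>i. i < n \<Longrightarrow> x i < z i \<and> z i < x (Suc i) \<and> ?F (z i) = 0" by blast
  have xmono: "x i \<le> x j" if "i \<le> j" "j \<le> n" for i j
    using that
  proof (induction j)
    case (Suc j) then show ?case using x(2)[of j] by (cases "i = Suc j") (auto intro: order_trans less_imp_le)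
  qed simp
  have zmono: "z i < z j" if "i < j" "j < n" for i j
  proof -
    have "z i < x (Suc i)" "x (Suc i) \<le> x j" "x j < z j" using z[of i] z[of j] xmono[of "Suc i" j] that by auto
    then show ?thesis by linarith
  qed
  have inj: "inj_on z {..<n}"
  proof (rule inj_onI)
    fix i j assume "i \<in> {..<n}" "j \<in> {..<n}" "z i = z j"
    then show "i = j" using zmono[of i j] zmono[of j i] by (cases i j rule: linorder_cases) auto
  qed
  show ?thesis
  proof (rule that[of "z ` {..<n}"])
    show "finite (z ` {..<n})" by simp
    show "card (z ` {..<n}) = n" using card_image[OF inj] by simp
    show "z ` {..<n} \<subseteq> {0<..<\<rho>}"
    proof
      fix w assume "w \<in> z ` {..<n}"
      then obtain i where i: "i < n" "w = z i" by auto
      then show "w \<in> {0<..<\<rho>}" using z[of i] x(1)[of i] x(1)[of "Suc i"] by auto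
    qed
    then have range: "0 < z i" "z i < \<rho>" if "i < n" for i using that by auto
    fix w assume "w \<in> z ` {..<n}"
    then obtain i where i: "i < n" "w = z i" by auto
    have ep: "e w > 0" using epos range[OF i(1)] i(2) by simp
    have F0: "F w + \<tau> * e w = 0" using z[OF i(1)] i(2) by simp
    then have Fe: "F w = - \<tau> * e w" by simp
    then have "h w = \<tau>" using ep by (simp add: h_def)
    then have "h' w \<noteq> 0" using \<tau>(2)[of w] range[OF i(1)] i(2) by simp
    moreover have "h' w = - ((F' w + \<tau> * e' w) / e w)" unfolding h'_def Fe using ep by (simp add: field_simps)
    ultimately have "F' w + \<tau> * e' w \<noteq> 0" by auto
    then show "F w + \<tau> * e w = 0 \<and> F' w + \<tau> * e' w \<noteq> 0" using F0 by simp
  qed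
qed

section \<open>Dependence on the parameters\<close>

text \<open>Joint continuity in the center and the point is what lets a sign of the first order term
  at a fixed radius survive a small move of the center.\<close>

lemma tendsto_cQ:
  assumes t: "(l \<longlongrightarrow> l0) F" "(n \<longlongrightarrow> n0) F" "(y \<longlongrightarrow> y0) F" and y0: "\<bar>y0\<bar> < cc n0"
  shows "((\<lambda>x. cQ (l x) (n x) (y x)) \<longlongrightarrow> cQ l0 n0 y0) F"
proof -
  define U where "U = {p :: real \<times> real \<times> real. \<bar>snd (snd p)\<bar> < cc (fst (snd p))}"
  have oU: "open U" unfolding U_def cc_def by (intro open_Collect_less continuous_intros) (auto simp: add_nonneg_eq_0_iff)
  have nz: "1 - s * snd (snd p) \<noteq> 0" if "p \<in> U" "s \<in> {0..1}" for p s
    using cc_bounds(1)[OF cc_scale, of "snd (snd p)" "fst (snd p)" s] that by (auto simp: U_def)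
  have "continuous_on (U \<times> cbox 0 1) (\<lambda>(p, s). s * cw (fst p) (fst (snd p)) (s * snd (snd p)))"
    unfolding cw_def split_beta by (intro continuous_intros) (use nz in auto)
  from integral_continuous_on_param[OF this]
  have "continuous_on U (\<lambda>p. cQ (fst p) (fst (snd p)) (snd (snd p)))"
    unfolding cQ_def by (intro continuous_intros) simp
  then have "isCont (\<lambda>p. cQ (fst p) (fst (snd p)) (snd (snd p))) (l0, n0, y0)"
    using oU y0 by (simp add: continuous_on_eq_continuous_at U_def)
  from isCont_tendsto_compose[OF this tendsto_Pair[OF t(1) tendsto_Pair[OF t(2,3)]]] show ?thesis by simp
qed

lemma tendsto_cw:
  assumes "(l \<longlongrightarrow> l0) F" "(n \<longlongrightarrow> n0) F" "(y \<longlongrightarrow> y0) F" and y0: "\<bar>y0\<bar> < cc n0"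
  shows "((\<lambda>x. cw (l x) (n x) (y x)) \<longlongrightarrow> cw l0 n0 y0) F"
  unfolding cw_def using cc_bounds(1)[OF y0] by (intro tendsto_intros assms) auto

lemma tendsto_cE:
  assumes "(l \<longlongrightarrow> l0) F" "(n \<longlongrightarrow> n0) F" "(y \<longlongrightarrow> y0) F" "\<bar>y0\<bar> < cc n0"
  shows "((\<lambda>x. cE (l x) (n x) (y x)) \<longlongrightarrow> cE l0 n0 y0) F"
  unfolding cE_def by (intro tendsto_intros tendsto_cQ assms)

lemma tendsto_cd: "(n \<longlongrightarrow> n0) F \<Longrightarrow> ((\<lambda>x. cd (n x)) \<longlongrightarrow> cd n0) F"
  unfolding cd_def cc_def by (intro tendsto_intros) (auto simp: add_nonneg_eq_0_iff)

text \<open>Bracketing: for \<open>a < y0 < b\<close> the inequalities between \<open>cE\<close> at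
  \<open>a\<close>, the value \<open>\<eta>0\<close>, and \<open>cE\<close> at \<open>b\<close> are
  strict, hence persist for nearby parameters and trap the inverse between \<open>a\<close> and
  \<open>b\<close>. The ends \<open>cd\<close> of the inversion interval move continuously as
  well.\<close>

lemma tendsto_cY:
  assumes t: "(l \<longlongrightarrow> l0) F" "(n \<longlongrightarrow> n0) F" "(\<eta> \<longlongrightarrow> \<eta>0) F" and \<eta>0: "\<bar>\<eta>0\<bar> < c\<eta> l0 n0"
  shows "((\<lambda>x. cY (l x) (n x) (\<eta> x)) \<longlongrightarrow> cY l0 n0 \<eta>0) F"
proof (rule order_tendstoI)
  define y0 where "y0 = cY l0 n0 \<eta>0"
  have y0: "\<bar>y0\<bar> < cd n0" "cE l0 n0 y0 = \<eta>0" using cY_bound[OF \<eta>0] cE_cY[OF \<eta>0] by (auto simp: y0_def)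
  have key: "\<forall>\<^sub>F x in F. a < cY (l x) (n x) (\<eta> x) \<and> cY (l x) (n x) (\<eta> x) < b"
    if ab: "- cd n0 < a" "a < y0" "y0 < b" "b < cd n0" for a b
  proof -
    have cc: "\<bar>a\<bar> < cc n0" "\<bar>b\<bar> < cc n0" "\<bar>y0\<bar> < cc n0" using ab cd[of n0] by auto
    have lt: "cE l0 n0 a < \<eta>0" "\<eta>0 < cE l0 n0 b" using cE_strict_mono ab cc y0(2) by metis+
    have "((\<lambda>x. \<eta> x - cE (l x) (n x) a) \<longlongrightarrow> \<eta>0 - cE l0 n0 a) F" "((\<lambda>x. cE (l x) (n x) b - \<eta> x) \<longlongrightarrow> cE l0 n0 b - \<eta>0) F"
      "((\<lambda>x. a + cd (n x)) \<longlongrightarrow> a + cd n0) F" "((\<lambda>x. cd (n x) - b) \<longlongrightarrow> cd n0 - b) F"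
      by (intro tendsto_intros tendsto_cE t cc tendsto_cd)+
    then have "\<forall>\<^sub>F x in F. 0 < \<eta> x - cE (l x) (n x) a" "\<forall>\<^sub>F x in F. 0 < cE (l x) (n x) b - \<eta> x"
      "\<forall>\<^sub>F x in F. 0 < a + cd (n x)" "\<forall>\<^sub>F x in F. 0 < cd (n x) - b"
      using lt ab by (auto dest: order_tendstoD(1)[where a=0])
    then show ?thesis
    proof eventually_elim
      case (elim x)
      have "continuous_on {a..b} (cE (l x) (n x))"
        using cd[of "n x"] elim by (intro DERIV_continuous_on[OF has_field_derivative_at_within[OF DERIV_cE]]) auto
      then obtain y where y: "a \<le> y" "y \<le> b" "cE (l x) (n x) y = \<eta> x"
        using IVT'[of "cE (l x) (n x)" a "\<eta> x" b] elim ab by auto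
      moreover have "y \<noteq> a" "y \<noteq> b" using y elim by auto
      moreover have "cY (l x) (n x) (\<eta> x) = y" using cY_cE[of y "n x" "l x"] y elim by auto
      ultimately show ?case by auto
    qed
  qed
  show "\<forall>\<^sub>F x in F. c < cY (l x) (n x) (\<eta> x)" if "c < cY l0 n0 \<eta>0" for c
  proof -
    have "\<forall>\<^sub>F x in F. (max c (- cd n0) + y0) / 2 < cY (l x) (n x) (\<eta> x) \<and> cY (l x) (n x) (\<eta> x) < (y0 + cd n0) / 2"
      by (rule key) (use that y0 in \<open>auto simp: y0_def\<close>)
    then show ?thesis by eventually_elim (use that in \<open>auto simp: y0_def\<close>)
  qed
  show "\<forall>\<^sub>F x in F. cY (l x) (n x) (\<eta> x) < c" if "cY l0 n0 \<eta>0 < c" for c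
  proof -
    have "\<forall>\<^sub>F x in F. (y0 - cd n0) / 2 < cY (l x) (n x) (\<eta> x) \<and> cY (l x) (n x) (\<eta> x) < (min c (cd n0) + y0) / 2"
      by (rule key) (use that y0 in \<open>auto simp: y0_def\<close>)
    then show ?thesis by eventually_elim (use that in \<open>auto simp: y0_def\<close>)
  qed
qed

lemma tendsto_cY':
  assumes t: "(l \<longlongrightarrow> l0) F" "(n \<longlongrightarrow> n0) F" "(\<eta> \<longlongrightarrow> \<eta>0) F" and \<eta>0: "\<bar>\<eta>0\<bar> < c\<eta> l0 n0"
  shows "((\<lambda>x. cY' (l x) (n x) (\<eta> x)) \<longlongrightarrow> cY' l0 n0 \<eta>0) F"
proof -
  note c = cY_cc[OF \<eta>0]
  show ?thesis unfolding cY'_def cE'_def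
    using cQ_pos[OF c, of l0] cw_pos[OF c, of l0] by (intro tendsto_intros tendsto_cQ tendsto_cw tendsto_cY t \<eta>0 c) auto
qed

lemma tendsto_side_S:
  fixes F :: "'a :: t2_space filter"
  assumes t: "(l \<longlongrightarrow> l0) F" "(n \<longlongrightarrow> n0) F" "(d \<longlongrightarrow> d0) F" "(k \<longlongrightarrow> k0) F" "(m \<longlongrightarrow> m0) F" "(h \<longlongrightarrow> h0) F"
    "(\<phi> \<longlongrightarrow> \<phi>0) F" and R: "\<bar>R\<bar> < c\<eta> l0 n0"
  shows "((\<lambda>x. side.S (l x) (n x) (d x) (k x) (m x) (h x) R (\<phi> x)) \<longlongrightarrow> side.S l0 n0 d0 k0 m0 h0 R \<phi>0) F"
proof -
  note R' = side.in_J[OF R, of \<phi>0]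
  have nz: "1 - cY l0 n0 (R * sin \<phi>0) \<noteq> 0" using side.Y_lt[OF R'] by simp
  show ?thesis unfolding side.S_def side.A_def side.B_def side.C_def
    by (intro tendsto_intros tendsto_sin tendsto_cos tendsto_cY tendsto_cY' t R' disjI1 nz)
qed

lemma continuous_side_M:
  fixes T :: "real set"
  assumes c: "continuous_on T l" "continuous_on T n" "continuous_on T d" "continuous_on T k" "continuous_on T m" "continuous_on T h"
    and R: "\<And>t. t \<in> T \<Longrightarrow> \<bar>R\<bar> < c\<eta> (l t) (n t)"
  shows "continuous_on T (\<lambda>t. side.M (l t) (n t) (d t) (k t) (m t) (h t) \<sigma> \<phi>0 R)"
proof -
  have ct: "((\<lambda>p. f (fst p)) \<longlongrightarrow> f t) (at (t, \<psi>) within T \<times> cbox 0 pi)"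
    if "continuous_on T f" "t \<in> T" "\<psi> \<in> cbox 0 pi" for f :: "real \<Rightarrow> real" and t \<psi>
  proof -
    have "continuous_on (T \<times> cbox 0 pi) (\<lambda>p. f (fst p))"
      by (rule continuous_on_compose2[OF that(1)]) (auto intro!: continuous_intros)
    then show ?thesis using that by (auto simp: continuous_on_def)
  qed
  have "continuous_on (T \<times> cbox 0 pi) (\<lambda>p. \<sigma> * cos (\<phi>0 + \<sigma> * snd p) *
      side.S (l (fst p)) (n (fst p)) (d (fst p)) (k (fst p)) (m (fst p)) (h (fst p)) R (\<phi>0 + \<sigma> * snd p))"
    unfolding continuous_on_def
  proof
    fix p assume "p \<in> T \<times> cbox 0 pi"
    then obtain t \<psi> where p: "p = (t, \<psi>)" "t \<in> T" "\<psi> \<in> cbox 0 pi" by auto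
    show "((\<lambda>p. \<sigma> * cos (\<phi>0 + \<sigma> * snd p) *
      side.S (l (fst p)) (n (fst p)) (d (fst p)) (k (fst p)) (m (fst p)) (h (fst p)) R (\<phi>0 + \<sigma> * snd p)) \<longlongrightarrow>
      \<sigma> * cos (\<phi>0 + \<sigma> * snd p) * side.S (l (fst p)) (n (fst p)) (d (fst p)) (k (fst p)) (m (fst p)) (h (fst p)) R (\<phi>0 + \<sigma> * snd p))
      (at p within T \<times> cbox 0 pi)"
      unfolding p(1) fst_conv snd_conv
      by (intro tendsto_intros tendsto_side_S ct c p(2,3) R tendsto_snd[where a="(t, \<psi>)", unfolded snd_conv] tendsto_ident_at)
  qed
  from integral_continuous_on_param[OF this[unfolded split_beta[symmetric, of "\<lambda>t \<psi>. \<sigma> * cos (\<phi>0 + \<sigma> * \<psi>) *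
      side.S (l t) (n t) (d t) (k t) (m t) (h t) R (\<phi>0 + \<sigma> * \<psi>)", abs_def]]]
  show ?thesis by (simp add: side.M_def)
qed

lemma continuous_gM:
  fixes T :: "real set"
  assumes "continuous_on T l1" "continuous_on T n1" "continuous_on T l2" "continuous_on T n2"
    "continuous_on T d1" "continuous_on T d2" "continuous_on T m1" "continuous_on T m2"
    and "\<And>t. t \<in> T \<Longrightarrow> \<bar>R\<bar> < c\<eta> (l1 t) (n1 t)" "\<And>t. t \<in> T \<Longrightarrow> \<bar>R\<bar> < c\<eta> (l2 t) (n2 t)"
  shows "continuous_on T (\<lambda>t. gM \<phi>0 (l1 t) (n1 t) (l2 t) (n2 t) (d1 t, d2 t, 0, 0, m1 t, m2 t, 0, 0) R)"
  unfolding gM_def prod.case by (intro continuous_on_diff continuous_side_M continuous_on_const assms)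

section \<open>A criterion for bifurcation\<close>

lemma gM_sum:
  fixes K :: nat
  assumes "\<bar>R\<bar> < c\<eta> l1 n1" "\<bar>R\<bar> < c\<eta> l2 n2"
  shows "gM \<phi>0 l1 n1 l2 n2 (w + (\<Sum>k<K. \<tau> k *\<^sub>R v k)) R =
    gM \<phi>0 l1 n1 l2 n2 w R + (\<Sum>k<K. \<tau> k * gM \<phi>0 l1 n1 l2 n2 (v k) R)"
proof (induction K)
  case (Suc K)
  have "w + (\<Sum>k<Suc K. \<tau> k *\<^sub>R v k) = 1 *\<^sub>R (w + (\<Sum>k<K. \<tau> k *\<^sub>R v k)) + \<tau> K *\<^sub>R v K" by simp
  from arg_cong[OF this, of "\<lambda>v. gM \<phi>0 l1 n1 l2 n2 v R"] show ?case
    using Suc gM_linear[OF assms, of \<phi>0 1 "w + (\<Sum>k<K. \<tau> k *\<^sub>R v k)" "\<tau> K" "v K"] by (simp del: scaleR_one sum.lessThan_Suc) simp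
qed simp

lemma alternates_cong:
  assumes "alternates n F \<rho>" "\<And>R. 0 < R \<Longrightarrow> R < \<rho> \<Longrightarrow> F R = G R"
  shows "alternates n G \<rho>"
proof -
  obtain x :: "nat \<Rightarrow> real" where x: "\<And>i. i \<le> n \<Longrightarrow> 0 < x i \<and> x i < \<rho> \<and> F (x i) \<noteq> 0"
    "\<And>i. i < n \<Longrightarrow> x i < x (Suc i) \<and> F (x i) * F (x (Suc i)) < 0"
    using assms(1) unfolding alternates_def by blast
  have eq: "G (x i) = F (x i)" if "i \<le> n" for i using x(1)[OF that] assms(2) by simp
  show ?thesis unfolding alternates_def by (intro exI[of _ x]) (simp add: eq x)
qed

text \<open>At \<open>t = 0\<close> the first order term has the sign of \<open>c\<close> at some
  radius \<open>Rb\<close>, and by continuity in \<open>t\<close> this persists for a small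
  \<open>t > 0\<close>. For that \<open>t\<close> the term has the opposite sign near the origin,
  which is the additional sign change. The directions \<open>e t k\<close> of orders
  \<open>1\<close> to \<open>K\<close> add \<open>K\<close> more, and \<open>e t 0\<close>, positive
  on the whole range, then makes all zeros simple.\<close>

lemma bifurcation_criterion:
  fixes \<phi>0 :: real and l1 n1 l2 n2 :: "real \<Rightarrow> real" and w :: "real \<Rightarrow> params" and e :: "real \<Rightarrow> nat \<Rightarrow> params"
  defines "m t \<equiv> gM \<phi>0 (l1 t) (n1 t) (l2 t) (n2 t)"
  assumes \<delta>0: "\<delta>0 > 0" and R1: "R1 > 0" and K: "K > 0"
    and geo: "\<And>t. t \<in> {0..\<delta>0} \<Longrightarrow> geometry \<nu> \<phi>0 (l1 t) (n1 t) (l2 t) (n2 t) R1 (r t) (r' t) (s t) (s' t)"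
    and bd: "\<And>t. t \<in> {0..\<delta>0} \<Longrightarrow> \<bar>l1 t\<bar> \<le> L \<and> \<bar>n1 t\<bar> \<le> L \<and> \<bar>l2 t\<bar> \<le> L \<and> \<bar>n2 t\<bar> \<le> L"
    and cont: "continuous_on {0..\<delta>0} l1" "continuous_on {0..\<delta>0} n1" "continuous_on {0..\<delta>0} l2" "continuous_on {0..\<delta>0} n2"
    and contF: "\<And>R. 0 < R \<Longrightarrow> R < R1 \<Longrightarrow> continuous_on {0..\<delta>0} (\<lambda>t. m t (w t) R)"
    and F0: "((\<lambda>R. m 0 (w 0) R / R ^ N) \<longlongrightarrow> c) (at_right 0)"
    and Ft: "\<And>t. 0 < t \<Longrightarrow> t < \<delta>0 \<Longrightarrow> ((\<lambda>R. m t (w t) R / R ^ Suc K) \<longlongrightarrow> \<kappa> t) (at_right 0)"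
      "\<And>t. 0 < t \<Longrightarrow> t < \<delta>0 \<Longrightarrow> \<kappa> t * c < 0"
    and e: "\<And>t k. 0 < t \<Longrightarrow> t < \<delta>0 \<Longrightarrow> k < K \<Longrightarrow> \<exists>a. a \<noteq> 0 \<and> ((\<lambda>R. m t (e t k) R / R ^ Suc k) \<longlongrightarrow> a) (at_right 0)"
    and epos: "\<And>t R. 0 < t \<Longrightarrow> t < \<delta>0 \<Longrightarrow> 0 < R \<Longrightarrow> R < R1 \<Longrightarrow> m t (e t 0) R > 0"
  shows "bifurcate_from_origin Z1 Z2 \<nu> (base (l1 0) (n1 0) (l2 0) (n2 0)) (Suc K)"
  unfolding bifurcate_from_origin_def
proof (intro allI impI)
  fix U :: "plane set" and V :: "params set"
  assume "open U \<and> (0, 0) \<in> U \<and> open V \<and> base (l1 0) (n1 0) (l2 0) (n2 0) \<in> V"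
  then have U: "open U" "0 \<in> U" and V: "open V" "base (l1 0) (n1 0) (l2 0) (n2 0) \<in> V" by (auto simp: zero_prod_def)
  have L: "L \<ge> 0" using bd[of 0] \<delta>0 by auto
  obtain \<rho> where \<rho>: "\<rho> > 0" "\<rho> \<le> R1" and cycles:
    "\<And>\<nu> \<phi>0 l1 n1 l2 n2 R1 r r' s s' v Zs. geometry \<nu> \<phi>0 l1 n1 l2 n2 R1 r r' s s' \<Longrightarrow> \<rho> \<le> R1 \<Longrightarrow>
      \<bar>l1\<bar> \<le> L \<Longrightarrow> \<bar>n1\<bar> \<le> L \<Longrightarrow> \<bar>l2\<bar> \<le> L \<Longrightarrow> \<bar>n2\<bar> \<le> L \<Longrightarrow> finite Zs \<Longrightarrow> Zs \<subseteq> {0<..<\<rho>} \<Longrightarrow>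
      (\<forall>z\<in>Zs. gM \<phi>0 l1 n1 l2 n2 v z = 0 \<and> gM' \<phi>0 l1 n1 l2 n2 v z \<noteq> 0) \<Longrightarrow>
      \<exists>\<epsilon>1>0. \<forall>\<epsilon>. 0 < \<epsilon> \<longrightarrow> \<epsilon> < \<epsilon>1 \<longrightarrow>
        has_crossing_limit_cycles (Z1 (base l1 n1 l2 n2 + \<epsilon> *\<^sub>R v)) (Z2 (base l1 n1 l2 n2 + \<epsilon> *\<^sub>R v)) \<nu> U (card Zs)"
    by (rule cycles_from_simple_zeros[OF U L R1]) (rule that)
  have F: "at 0 within {0..\<delta>0} = at_right 0" by (rule at_within_Icc_at_right[OF \<delta>0])
  have lim: "(f \<longlongrightarrow> f 0) (at_right 0)" if "continuous_on {0..\<delta>0} f" for f :: "real \<Rightarrow> real"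
    using that \<delta>0 F unfolding continuous_on_def by force
  have c: "c \<noteq> 0" using Ft(2)[of "\<delta>0 / 2"] \<delta>0 by auto
  have "((\<lambda>R. m 0 (w 0) R / R ^ N * c) \<longlongrightarrow> c * c) (at_right 0)" by (intro tendsto_intros F0)
  moreover have "c * c > 0" using c by (auto simp: zero_less_mult_iff linorder_neq_iff)
  ultimately have "\<forall>\<^sub>F R in at_right 0. m 0 (w 0) R / R ^ N * c > 0" by (rule order_tendstoD(1))
  moreover have "\<forall>\<^sub>F R in at_right (0::real). R \<in> {0<..<\<rho>}" by (rule eventually_at_right_real[OF \<rho>(1)])
  ultimately have "\<forall>\<^sub>F R in at_right 0. m 0 (w 0) R / R ^ N * c > 0 \<and> R \<in> {0<..<\<rho>}" by (rule eventually_conj)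
  then obtain Rb where Rb: "m 0 (w 0) Rb / Rb ^ N * c > 0" "0 < Rb" "Rb < \<rho>"
    using eventually_happens'[of "at_right (0::real)"] by auto
  then have Rbc: "m 0 (w 0) Rb * c > 0" by (simp add: zero_less_mult_iff zero_less_divide_iff divide_less_0_iff)
  have "((\<lambda>t. m t (w t) Rb) \<longlongrightarrow> m 0 (w 0) Rb) (at_right 0)" using Rb \<rho> by (intro lim contF) auto
  then have "((\<lambda>t. m t (w t) Rb * c) \<longlongrightarrow> m 0 (w 0) Rb * c) (at_right 0)" by (intro tendsto_intros)
  then have ev1: "\<forall>\<^sub>F t in at_right 0. m t (w t) Rb * c > 0" by (rule order_tendstoD(1)) (rule Rbc)
  have "((\<lambda>t. base (l1 t) (n1 t) (l2 t) (n2 t)) \<longlongrightarrow> base (l1 0) (n1 0) (l2 0) (n2 0)) (at_right 0)"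
    unfolding base_def by (intro tendsto_intros lim cont)
  then have ev2: "\<forall>\<^sub>F t in at_right 0. base (l1 t) (n1 t) (l2 t) (n2 t) \<in> V" by (rule topological_tendstoD) (rule V)+
  have ev3: "\<forall>\<^sub>F t in at_right (0::real). t \<in> {0<..<\<delta>0}" by (rule eventually_at_right_real[OF \<delta>0])
  have "\<exists>t. m t (w t) Rb * c > 0 \<and> base (l1 t) (n1 t) (l2 t) (n2 t) \<in> V \<and> t \<in> {0<..<\<delta>0}"
    by (rule eventually_happens'[of "at_right (0::real)"]) (intro trivial_limit_at_right_real eventually_conj ev1 ev2 ev3)+
  then obtain t where t: "m t (w t) Rb * c > 0" "base (l1 t) (n1 t) (l2 t) (n2 t) \<in> V" "0 < t" "t < \<delta>0" by auto
  then have tI: "t \<in> {0..\<delta>0}" by simp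
  interpret g: geometry \<nu> \<phi>0 "l1 t" "n1 t" "l2 t" "n2 t" R1 "r t" "r' t" "s t" "s' t" by (rule geo[OF tI])
  have small: "\<bar>R\<bar> < c\<eta> (l1 t) (n1 t)" "\<bar>R\<bar> < c\<eta> (l2 t) (n2 t)" if "0 < R" "R < \<rho>" for R
    using that \<rho> g.R1 by auto
  have "((\<lambda>R. m t (w t) R / R ^ Suc K * c) \<longlongrightarrow> \<kappa> t * c) (at_right 0)" by (intro tendsto_intros Ft(1) t)
  then have "\<forall>\<^sub>F R in at_right 0. m t (w t) R / R ^ Suc K * c < 0" by (rule order_tendstoD(2)) (intro Ft(2) t)
  moreover have "\<forall>\<^sub>F R in at_right (0::real). R \<in> {0<..<Rb}" by (rule eventually_at_right_real[OF Rb(2)])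
  ultimately have "\<forall>\<^sub>F R in at_right 0. m t (w t) R / R ^ Suc K * c < 0 \<and> R \<in> {0<..<Rb}" by (rule eventually_conj)
  \<comment> \<open>\<open>Rb\<close> was chosen before \<open>t\<close>, whereas \<open>Ra\<close>
    comes after it: for the fixed \<open>t\<close> the coefficient \<open>\<kappa> t\<close> decides
    the sign closer to the origin.\<close>
  then obtain Ra where Ra: "m t (w t) Ra / Ra ^ Suc K * c < 0" "0 < Ra" "Ra < Rb"
    using eventually_happens'[of "at_right (0::real)"] by auto
  then have "m t (w t) Ra * c < 0" by (simp add: mult_less_0_iff zero_less_divide_iff divide_less_0_iff zero_less_mult_iff)
  with t(1) have opp: "m t (w t) Ra * m t (w t) Rb < 0"
    by (auto simp: mult_less_0_iff zero_less_mult_iff)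
  have alt: "alternates 1 (m t (w t)) \<rho>"
    unfolding alternates_def
    by (intro exI[of _ "\<lambda>i. if i = 0 then Ra else Rb"]) (use opp Ra Rb in \<open>auto simp: le_Suc_eq\<close>)
  have "((\<lambda>R. R * (m t (w t) R / R ^ Suc K)) \<longlongrightarrow> 0 * \<kappa> t) (at_right 0)" by (intro tendsto_intros Ft(1) t)
  moreover have "\<forall>\<^sub>F R in at_right 0. R * (m t (w t) R / R ^ Suc K) = m t (w t) R / R ^ K"
    using eventually_at_right_less[of "0::real"] by eventually_elim simp
  ultimately have F0K: "((\<lambda>R. m t (w t) R / R ^ K) \<longlongrightarrow> 0) (at_right 0)" by (simp add: tendsto_cong)
  have "\<forall>k. \<exists>a. k < K \<longrightarrow> a \<noteq> 0 \<and> ((\<lambda>R. m t (e t k) R / R ^ Suc k) \<longlongrightarrow> a) (at_right 0)" using e[OF t(3,4)] by blast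
  from choice[OF this] obtain a where a: "\<And>k. k < K \<Longrightarrow> a k \<noteq> 0"
    "\<And>k. k < K \<Longrightarrow> ((\<lambda>R. m t (e t k) R / R ^ Suc k) \<longlongrightarrow> a k) (at_right 0)" by blast
  obtain \<tau> where \<tau>: "alternates (1 + K) (\<lambda>R. m t (w t) R + (\<Sum>k<K. \<tau> k * m t (e t k) R)) \<rho>"
    using alternates_iterate[OF alt F0K a(2,1)] by blast
  define v1 where "v1 = w t + (\<Sum>k<K. \<tau> k *\<^sub>R e t k)"
  have v1: "m t v1 R = m t (w t) R + (\<Sum>k<K. \<tau> k * m t (e t k) R)" if "0 < R" "R < \<rho>" for R
    unfolding v1_def m_def by (rule gM_sum[OF small[OF that]])
  have alt1: "alternates (Suc K) (m t v1) \<rho>"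
    by (rule alternates_cong[OF _ v1[symmetric]]) (use \<tau> in simp)
  let ?m' = "gM' \<phi>0 (l1 t) (n1 t) (l2 t) (n2 t)"
  have der: "(m t v has_real_derivative ?m' v R) (at R)" if "0 < R" "R < \<rho>" for R v
    unfolding m_def by (rule DERIV_gM) (use that small[OF that] in auto)
  obtain \<sigma> Zs where Zs: "finite Zs" "card Zs = Suc K" "Zs \<subseteq> {0<..<\<rho>}"
    and z: "\<And>z. z \<in> Zs \<Longrightarrow> m t v1 z + \<sigma> * m t (e t 0) z = 0 \<and> ?m' v1 z + \<sigma> * ?m' (e t 0) z \<noteq> 0"
  proof (rule simple_zeros[OF alt1 der der])
    show "m t (e t 0) R > 0" if "0 < R" "R < \<rho>" for R by (rule epos) (use that t \<rho> in auto)
  qed (assumption | rule that)+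
  define v where "v = 1 *\<^sub>R v1 + \<sigma> *\<^sub>R e t 0"
  have v: "m t v R = m t v1 R + \<sigma> * m t (e t 0) R" if "0 < R" "R < \<rho>" for R
    unfolding v_def m_def gM_linear[OF small[OF that]] by simp
  have v': "?m' v R = ?m' v1 R + \<sigma> * ?m' (e t 0) R" if R: "0 < R" "R < \<rho>" for R
  proof (rule DERIV_unique[OF der[OF R]])
    have "((\<lambda>R. m t v1 R + \<sigma> * m t (e t 0) R) has_real_derivative ?m' v1 R + \<sigma> * ?m' (e t 0) R) (at R)"
      by (intro DERIV_add DERIV_cmult der R)
    then show "(m t v has_real_derivative ?m' v1 R + \<sigma> * ?m' (e t 0) R) (at R)"
      by (rule has_field_derivative_transform_within_open[where S="{0<..<\<rho>}"]) (use R v in auto)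
  qed
  have zero: "\<forall>x\<in>Zs. gM \<phi>0 (l1 t) (n1 t) (l2 t) (n2 t) v x = 0 \<and> ?m' v x \<noteq> 0"
  proof
    fix x assume that: "x \<in> Zs"
    have x: "0 < x" "x < \<rho>" using that Zs(3) by auto
    show "gM \<phi>0 (l1 t) (n1 t) (l2 t) (n2 t) v x = 0 \<and> ?m' v x \<noteq> 0"
      using z[OF that] v[OF x] v'[OF x] by (simp add: m_def)
  qed
  have "\<exists>\<epsilon>1>0. \<forall>\<epsilon>. 0 < \<epsilon> \<longrightarrow> \<epsilon> < \<epsilon>1 \<longrightarrow>
      has_crossing_limit_cycles (Z1 (base (l1 t) (n1 t) (l2 t) (n2 t) + \<epsilon> *\<^sub>R v)) (Z2 (base (l1 t) (n1 t) (l2 t) (n2 t) + \<epsilon> *\<^sub>R v)) \<nu> U (card Zs)"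
    by (rule cycles[OF g.geometry_axioms \<rho>(2) _ _ _ _ Zs(1,3) zero]) (use bd[OF tI] in blast)+
  then obtain \<epsilon>1 where \<epsilon>1: "\<epsilon>1 > 0" "\<And>\<epsilon>. 0 < \<epsilon> \<Longrightarrow> \<epsilon> < \<epsilon>1 \<Longrightarrow>
      has_crossing_limit_cycles (Z1 (base (l1 t) (n1 t) (l2 t) (n2 t) + \<epsilon> *\<^sub>R v)) (Z2 (base (l1 t) (n1 t) (l2 t) (n2 t) + \<epsilon> *\<^sub>R v)) \<nu> U (Suc K)"
    using Zs(2) by auto
  have "((\<lambda>\<epsilon>. base (l1 t) (n1 t) (l2 t) (n2 t) + \<epsilon> *\<^sub>R v) \<longlongrightarrow> base (l1 t) (n1 t) (l2 t) (n2 t) + 0 *\<^sub>R v) (at_right 0)"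
    by (intro tendsto_intros)
  then have "\<forall>\<^sub>F \<epsilon> in at_right 0. base (l1 t) (n1 t) (l2 t) (n2 t) + \<epsilon> *\<^sub>R v \<in> V"
    by (rule topological_tendstoD) (use V t in simp_all)
  then have "\<forall>\<^sub>F \<epsilon> in at_right 0. base (l1 t) (n1 t) (l2 t) (n2 t) + \<epsilon> *\<^sub>R v \<in> V \<and> \<epsilon> \<in> {0<..<\<epsilon>1}"
    by (intro eventually_conj eventually_at_right_real \<epsilon>1(1))
  then obtain \<epsilon> where "base (l1 t) (n1 t) (l2 t) (n2 t) + \<epsilon> *\<^sub>R v \<in> V" "0 < \<epsilon>" "\<epsilon> < \<epsilon>1"
    using eventually_happens'[of "at_right (0::real)"] by auto
  then show "\<exists>q\<in>V. has_crossing_limit_cycles (Z1 q) (Z2 q) \<nu> U (Suc K)" using \<epsilon>1(2) by blast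
qed

section \<open>Asymptotics of weighted means\<close>

lemma integral_pos_continuous:
  fixes f :: "real \<Rightarrow> real"
  assumes "a < b" "continuous_on {a..b} f" "\<And>x. x \<in> {a..b} \<Longrightarrow> f x \<ge> 0" "x0 \<in> {a..b}" "f x0 > 0"
  shows "integral {a..b} f > 0"
proof -
  have int: "f integrable_on {a..b}" by (rule integrable_continuous_interval[OF assms(2)])
  have "integral {a..b} f \<noteq> 0"
  proof
    assume "integral {a..b} f = 0"
    then have "(f has_integral 0) (cbox a b)" using integrable_integral[OF int] by simp
    then have "f x0 = 0" using assms by (intro has_integral_0_cbox_imp_0[where a=a and b=b]) auto
    then show False using assms by simp
  qed
  moreover have "integral {a..b} f \<ge> 0" by (rule integral_nonneg[OF int]) (use assms in auto)
  ultimately show ?thesis by simp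
qed

text \<open>The leading power of \<open>H\<close> passes through the integral: \<open>p\<close> and
  \<open>g\<close> are bounded by \<open>1\<close>, so the error is small compared with
  \<open>R ^ j\<close> uniformly in the angle.\<close>

lemma weighted_limit:
  fixes H p g :: "real \<Rightarrow> real"
  assumes H: "continuous_on {\<eta>. \<bar>\<eta>\<bar> < \<eta>0} H" and \<eta>0: "\<eta>0 > 0" and lim: "((\<lambda>\<eta>. H \<eta> / \<eta> ^ j) \<longlongrightarrow> a) (at 0)"
    and p: "continuous_on {0..pi} p" "\<And>\<psi>. \<bar>p \<psi>\<bar> \<le> 1" and g: "continuous_on {0..pi} g" "\<And>\<psi>. \<bar>g \<psi>\<bar> \<le> 1"
  shows "((\<lambda>R. integral {0..pi} (\<lambda>\<psi>. p \<psi> * H (R * g \<psi>)) / R ^ j) \<longlongrightarrow> a * integral {0..pi} (\<lambda>\<psi>. p \<psi> * g \<psi> ^ j)) (at_right 0)"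
proof (rule tendstoI)
  fix \<epsilon> :: real assume \<epsilon>: "\<epsilon> > 0"
  define \<epsilon>' where "\<epsilon>' = \<epsilon> / (2 * pi)"
  have \<epsilon>': "\<epsilon>' > 0" using \<epsilon> by (simp add: \<epsilon>'_def)
  \<comment> \<open>The assumed limit does not see the value at \<open>0\<close>, which occurs in
    the integral where \<open>g\<close> vanishes; continuity of \<open>H\<close> determines
    it.\<close>
  have H0: "H 0 = a * 0 ^ j"
  proof (rule tendsto_unique)
    have "open {\<eta>. \<bar>\<eta>\<bar> < \<eta>0}" by (intro open_Collect_less continuous_intros)
    then have "isCont H 0" using H \<eta>0 by (simp add: continuous_on_eq_continuous_at)
    then show "(H \<longlongrightarrow> H 0) (at 0)" by (simp add: isCont_def)
    have "((\<lambda>\<eta>. H \<eta> / \<eta> ^ j * \<eta> ^ j) \<longlongrightarrow> a * 0 ^ j) (at 0)" by (intro tendsto_intros lim)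
    moreover have "\<forall>\<^sub>F \<eta> in at 0. H \<eta> / \<eta> ^ j * \<eta> ^ j = H \<eta>" by (auto simp: eventually_at_filter)
    ultimately show "(H \<longlongrightarrow> a * 0 ^ j) (at 0)" by (simp add: tendsto_cong)
  qed simp
  from tendstoD[OF lim \<epsilon>'] obtain \<delta> where \<delta>: "\<delta> > 0" "\<And>\<eta>. \<eta> \<noteq> 0 \<Longrightarrow> \<bar>\<eta>\<bar> < \<delta> \<Longrightarrow> \<bar>H \<eta> / \<eta> ^ j - a\<bar> < \<epsilon>'"
    unfolding eventually_at by (auto simp: dist_real_def)
  have est: "\<bar>H \<eta> - a * \<eta> ^ j\<bar> \<le> \<epsilon>' * \<bar>\<eta>\<bar> ^ j" if "\<bar>\<eta>\<bar> < \<delta>" for \<eta>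
  proof (cases "\<eta> = 0")
    case True then show ?thesis using H0 \<epsilon>' by simp
  next
    case False
    have "H \<eta> - a * \<eta> ^ j = (H \<eta> / \<eta> ^ j - a) * \<eta> ^ j" using False by (simp add: field_simps)
    then have "\<bar>H \<eta> - a * \<eta> ^ j\<bar> = \<bar>H \<eta> / \<eta> ^ j - a\<bar> * \<bar>\<eta>\<bar> ^ j" by (simp add: abs_mult power_abs)
    also have "\<dots> \<le> \<epsilon>' * \<bar>\<eta>\<bar> ^ j" using \<delta>(2)[OF False that] by (intro mult_right_mono) auto
    finally show ?thesis .
  qed
  have "\<forall>\<^sub>F R in at_right 0. R \<in> {0<..<min \<delta> \<eta>0}" by (rule eventually_at_right_real) (use \<delta> \<eta>0 in simp)
  then show "\<forall>\<^sub>F R in at_right 0. dist (integral {0..pi} (\<lambda>\<psi>. p \<psi> * H (R * g \<psi>)) / R ^ j) (a * integral {0..pi} (\<lambda>\<psi>. p \<psi> * g \<psi> ^ j)) < \<epsilon>"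
  proof eventually_elim
    case (elim R)
    then have R: "0 < R" "R < \<delta>" "R < \<eta>0" by auto
    have Rg: "\<bar>R * g \<psi>\<bar> \<le> R" for \<psi> using g(2)[of \<psi>] R by (simp add: abs_mult mult_left_le)
    have "continuous_on {0..pi} (\<lambda>\<psi>. H (R * g \<psi>))"
      using Rg R by (intro continuous_on_compose2[OF H] continuous_intros g) (auto intro: le_less_trans)
    then have i1: "(\<lambda>\<psi>. p \<psi> * H (R * g \<psi>)) integrable_on {0..pi}"
      by (intro integrable_continuous_interval continuous_intros p)
    have i2: "(\<lambda>\<psi>. a * R ^ j * (p \<psi> * g \<psi> ^ j)) integrable_on {0..pi}"
      by (intro integrable_continuous_interval continuous_intros p g)
    have "\<bar>integral {0..pi} (\<lambda>\<psi>. p \<psi> * H (R * g \<psi>) - a * R ^ j * (p \<psi> * g \<psi> ^ j))\<bar> \<le> (\<epsilon>' * R ^ j) * (pi - 0)"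
    proof (rule integral_bound[where 'a=real, unfolded real_norm_def])
      show "continuous_on {0..pi} (\<lambda>\<psi>. p \<psi> * H (R * g \<psi>) - a * R ^ j * (p \<psi> * g \<psi> ^ j))"
        by (intro continuous_intros p g) fact
      fix \<psi> :: real
      have "p \<psi> * H (R * g \<psi>) - a * R ^ j * (p \<psi> * g \<psi> ^ j) = p \<psi> * (H (R * g \<psi>) - a * (R * g \<psi>) ^ j)"
        by (simp add: power_mult_distrib algebra_simps)
      also have "\<bar>\<dots>\<bar> \<le> 1 * (\<epsilon>' * \<bar>R * g \<psi>\<bar> ^ j)"
        unfolding abs_mult[of "p \<psi>"] by (rule mult_mono[OF p(2) est]) (use le_less_trans[OF Rg R(2)] in auto)
      also have "\<bar>R * g \<psi>\<bar> ^ j \<le> R ^ j" by (rule power_mono[OF Rg]) simp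
      finally show "\<bar>p \<psi> * H (R * g \<psi>) - a * R ^ j * (p \<psi> * g \<psi> ^ j)\<bar> \<le> \<epsilon>' * R ^ j" using \<epsilon>' by (simp add: mult_left_mono)
    qed simp
    also have "integral {0..pi} (\<lambda>\<psi>. p \<psi> * H (R * g \<psi>) - a * R ^ j * (p \<psi> * g \<psi> ^ j)) =
        integral {0..pi} (\<lambda>\<psi>. p \<psi> * H (R * g \<psi>)) - a * R ^ j * integral {0..pi} (\<lambda>\<psi>. p \<psi> * g \<psi> ^ j)"
      by (simp add: Henstock_Kurzweil_Integration.integral_diff[OF i1 i2])
    finally have le: "\<bar>integral {0..pi} (\<lambda>\<psi>. p \<psi> * H (R * g \<psi>)) - a * R ^ j * integral {0..pi} (\<lambda>\<psi>. p \<psi> * g \<psi> ^ j)\<bar> \<le> \<epsilon>' * R ^ j * pi" by simp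
    have "X / R ^ j - a * Y = (X - a * R ^ j * Y) / R ^ j" for X Y using R by (simp add: field_simps)
    then have "\<bar>integral {0..pi} (\<lambda>\<psi>. p \<psi> * H (R * g \<psi>)) / R ^ j - a * integral {0..pi} (\<lambda>\<psi>. p \<psi> * g \<psi> ^ j)\<bar> =
       \<bar>integral {0..pi} (\<lambda>\<psi>. p \<psi> * H (R * g \<psi>)) - a * R ^ j * integral {0..pi} (\<lambda>\<psi>. p \<psi> * g \<psi> ^ j)\<bar> / R ^ j"
      using R by (simp add: abs_divide)
    also have "\<dots> \<le> \<epsilon>' * R ^ j * pi / R ^ j" using R by (intro divide_right_mono le) auto
    also have "\<dots> = \<epsilon> / 2" using R by (simp add: \<epsilon>'_def)
    finally show ?case using \<epsilon> by (simp add: dist_real_def)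
  qed
qed

section \<open>The horizontal family\<close>

text \<open>For \<open>l = 0\<close> and \<open>n = 1\<close> the unperturbed field is
  \<open>1 - y\<close> times the linear rotation. Its orbits are circles already, and the chart is
  the identity.\<close>

lemma cY_01:
  assumes "\<bar>x\<bar> < c\<eta> 0 1" shows "cY 0 1 x = x" "cY' 0 1 x = 1"
proof -
  have w: "cw 0 1 y = 1" if "\<bar>y\<bar> < cc 1" for y
  proof -
    have "1 - y > 0" using cc_bounds(1)[OF that] by auto
    then show ?thesis by (simp add: cw_def powr_minus)
  qed
  have Q: "cQ 0 1 y = 1" if y: "\<bar>y\<bar> < cc 1" for y
  proof -
    have "((\<lambda>t. t) has_integral (1\<^sup>2 / 2 - 0\<^sup>2 / 2)) {0..1::real}"
      by (rule fundamental_theorem_of_calculus)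
        (auto intro!: derivative_eq_intros simp: has_real_derivative_iff_has_vector_derivative[symmetric])
    then have "((\<lambda>t. t) has_integral 1 / 2) {0..1::real}" by simp
    then have "((\<lambda>t. t * cw 0 1 (t * y)) has_integral 1 / 2) {0..1}"
      by (rule has_integral_eq[rotated]) (simp add: w[OF cc_scale[OF y]])
    then show ?thesis by (simp add: cQ_def integral_unique)
  qed
  have "cE 0 1 (cY 0 1 x) = cY 0 1 x" using Q[OF cY_cc[OF assms]] by (simp add: cE_def)
  then show "cY 0 1 x = x" using cE_cY[OF assms] by simp
  show "cY' 0 1 x = 1" using w[OF cY_cc[OF assms]] Q[OF cY_cc[OF assms]] by (simp add: cY'_def cE'_def)
qed

text \<open>On the line \<open>y = 0\<close> the chart reduces to \<open>\<xi> = x\<close> whatever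
  \<open>l\<close> and \<open>n\<close> are. A half orbit thus ends at the distance at which it
  started, and any two unperturbed halves form a center.\<close>

lemma geometry_horizontal:
  assumes R1: "0 < R1" "R1 \<le> c\<eta> l1 n1" "R1 \<le> c\<eta> l2 n2"
  shows "geometry (0, 1) 0 l1 n1 l2 n2 R1 (\<lambda>x. x) (\<lambda>_. 1) (\<lambda>x. x) (\<lambda>_. 1)"
proof
  fix R \<phi> :: real assume R: "0 < R" "R < R1"
  show "0 < \<phi> \<Longrightarrow> \<phi> < 0 + pi \<Longrightarrow> 0 < (0, 1) \<bullet> side.pt l1 n1 R \<phi>"
    using R R1 side.in_J[of R l1 n1 \<phi>] sin_gt_zero[of \<phi>] by (simp add: side.pt_def cY_pos)
  show "0 - pi < \<phi> \<Longrightarrow> \<phi> < 0 \<Longrightarrow> (0, 1) \<bullet> side.pt l2 n2 R \<phi> < 0"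
    using R R1 side.in_J[of R l2 n2 \<phi>] sin_gt_zero[of "- \<phi>"] by (auto simp: side.pt_def intro!: cY_neg mult_pos_neg)
qed (use R1 in \<open>auto simp: side.pt_def start_axis_def norm_Pair zero_prod_def\<close>)

context
  fixes n :: real and d1 m1 d2 m2 :: real
begin

text \<open>The angles \<open>\<psi>\<close> and \<open>- \<psi>\<close> have the same cosine and
  opposite \<open>\<eta>\<close>, so the upper half enters at \<open>\<eta>\<close> and the lower
  one at \<open>- \<eta>\<close> under the common weight \<open>(cos \<psi>)\<^sup>2\<close>. Only
  the directions in \<open>d\<close> and \<open>m\<close> are used, and \<open>l = 1\<close> removes
  the power of \<open>1 - y\<close> from the lower term.\<close>

definition "hor_sum \<eta> = (d1 + m1 * \<eta>) * (1 - \<eta>) powr - 1 + (d2 + m2 * cY 1 n (- \<eta>)) * cY' 1 n (- \<eta>)"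

lemma gM_horizontal:
  assumes R: "0 < R" "R < c\<eta> 0 1" "R < c\<eta> 1 n"
  shows "gM 0 0 1 1 n (d1, d2, 0, 0, m1, m2, 0, 0) R = R * integral {0..pi} (\<lambda>\<psi>. (cos \<psi>)\<^sup>2 * hor_sum (R * sin \<psi>))"
proof -
  have R': "\<bar>R\<bar> < c\<eta> 0 1" "\<bar>R\<bar> < c\<eta> 1 n" using R by auto
  let ?S1 = "side.S 0 1 d1 0 m1 0" and ?S2 = "side.S 1 n d2 0 m2 0"
  have i: "(\<lambda>\<psi>. 1 * cos (0 + 1 * \<psi>) * ?S1 R (0 + 1 * \<psi>)) integrable_on {0..pi}"
    "(\<lambda>\<psi>. - 1 * cos (0 + - 1 * \<psi>) * ?S2 R (0 + - 1 * \<psi>)) integrable_on {0..pi}"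
    by (rule side.integrable_M[OF R'(1)] side.integrable_M[OF R'(2)])+
  have "gM 0 0 1 1 n (d1, d2, 0, 0, m1, m2, 0, 0) R =
      integral {0..pi} (\<lambda>\<psi>. 1 * cos (0 + 1 * \<psi>) * ?S1 R (0 + 1 * \<psi>) - - 1 * cos (0 + - 1 * \<psi>) * ?S2 R (0 + - 1 * \<psi>))"
    unfolding gM_def prod.case side.M_def by (rule Henstock_Kurzweil_Integration.integral_diff[symmetric, OF i])
  also have "\<dots> = integral {0..pi} (\<lambda>\<psi>. R * ((cos \<psi>)\<^sup>2 * hor_sum (R * sin \<psi>)))"
  proof (rule Henstock_Kurzweil_Integration.integral_cong)
    fix \<psi> :: real
    have s: "\<bar>R * sin \<psi>\<bar> < c\<eta> 0 1" "\<bar>- (R * sin \<psi>)\<bar> < c\<eta> 1 n" using side.in_J[OF R'(1)] side.in_J[OF R'(2), of \<psi>] by auto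
    have 1: "?S1 R \<psi> = (d1 + m1 * (R * sin \<psi>)) * (1 - R * sin \<psi>) powr - 1 * (R * cos \<psi>)"
      unfolding side.S_def side.A_def side.B_def side.C_def cY_01[OF s(1)] by simp
    have "1 - cY 1 n (- (R * sin \<psi>)) > 0" by (rule side.Y_lt[OF s(2)])
    then have 2: "?S2 R (- \<psi>) = (d2 + m2 * cY 1 n (- (R * sin \<psi>))) * cY' 1 n (- (R * sin \<psi>)) * (R * cos \<psi>)"
      unfolding side.S_def side.A_def side.B_def side.C_def by simp
    show "1 * cos (0 + 1 * \<psi>) * ?S1 R (0 + 1 * \<psi>) - - 1 * cos (0 + - 1 * \<psi>) * ?S2 R (0 + - 1 * \<psi>) = R * ((cos \<psi>)\<^sup>2 * hor_sum (R * sin \<psi>))"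
      by (simp add: 1 2 hor_sum_def) (simp add: algebra_simps power2_eq_square)
  qed
  finally show ?thesis by simp
qed

lemma horizontal_limit:
  assumes "((\<lambda>x. hor_sum x / x ^ j) \<longlongrightarrow> a) (at 0)"
  shows "((\<lambda>R. gM 0 0 1 1 n (d1, d2, 0, 0, m1, m2, 0, 0) R / R ^ Suc j) \<longlongrightarrow>
    a * integral {0..pi} (\<lambda>\<psi>. (cos \<psi>)\<^sup>2 * sin \<psi> ^ j)) (at_right 0)"
proof -
  define \<eta>0 where "\<eta>0 = min (c\<eta> 0 1) (c\<eta> 1 n)"
  have \<eta>0: "\<eta>0 > 0" using c\<eta>_pos by (simp add: \<eta>0_def)
  have "x \<noteq> 1" if "\<bar>x\<bar> < c\<eta> 0 1" for x using side.Y_lt[OF that] cY_01(1)[OF that] by auto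
  then have "continuous_on {\<eta>. \<bar>\<eta>\<bar> < \<eta>0} hor_sum"
    unfolding hor_sum_def by (intro continuous_intros continuous_on_compose2[OF continuous_cY(1)[of 1 n]]
      continuous_on_compose2[OF continuous_cY(2)[of 1 n]]) (auto simp: \<eta>0_def)
  then have "((\<lambda>R. integral {0..pi} (\<lambda>\<psi>. (cos \<psi>)\<^sup>2 * hor_sum (R * sin \<psi>)) / R ^ j) \<longlongrightarrow>
      a * integral {0..pi} (\<lambda>\<psi>. (cos \<psi>)\<^sup>2 * sin \<psi> ^ j)) (at_right 0)"
    by (rule weighted_limit[OF _ \<eta>0 assms]) (auto intro!: continuous_intros simp: abs_square_le_1)
  moreover have "\<forall>\<^sub>F R in at_right (0::real). R \<in> {0<..<\<eta>0}" by (rule eventually_at_right_real[OF \<eta>0])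
  then have "\<forall>\<^sub>F R in at_right 0. integral {0..pi} (\<lambda>\<psi>. (cos \<psi>)\<^sup>2 * hor_sum (R * sin \<psi>)) / R ^ j =
      gM 0 0 1 1 n (d1, d2, 0, 0, m1, m2, 0, 0) R / R ^ Suc j"
    by eventually_elim (simp add: gM_horizontal \<eta>0_def)
  ultimately show ?thesis by (rule Lim_transform_eventually)
qed

end

lemma horizontal_weight: "integral {0..pi} (\<lambda>\<psi>. (cos \<psi>)\<^sup>2 * sin \<psi> ^ j) > 0"
proof (rule integral_pos_continuous[where ?x0.0="pi / 4"])
  show "continuous_on {0..pi} (\<lambda>\<psi>. (cos \<psi>)\<^sup>2 * sin \<psi> ^ j)" by (intro continuous_intros)
  show "0 \<le> (cos \<psi>)\<^sup>2 * sin \<psi> ^ j" if "\<psi> \<in> {0..pi}" for \<psi>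
    using that by (simp add: sin_ge_zero)
qed (auto simp: sin_45 cos_45)

lemma tendsto_cY_divide: "((\<lambda>x. cY l n (- x) / x) \<longlongrightarrow> - 1) (at 0)"
proof -
  have "(cY l n has_real_derivative 1) (at (- 0))" using DERIV_cY[of 0 l n] c\<eta>_pos by (simp add: cY'_zero)
  from DERIV_chain2[OF this DERIV_minus[OF DERIV_ident]]
  have "((\<lambda>x. cY l n (- x)) has_real_derivative - 1) (at 0)" by simp
  then show ?thesis by (simp add: has_field_derivative_iff)
qed

text \<open>For \<open>l = 1\<close> the weight \<open>cw\<close> is the polynomial \<open>w\<close>
  in \<open>y\<close>, so the square of the chart coordinate is a polynomial too. Expansions in
  \<open>x\<close> can then be replaced by algebra in \<open>y\<close>.\<close>

lemma hor_chart:
  assumes x: "\<bar>x\<bar> < c\<eta> 1 (\<mu> - 1)" "x \<noteq> 0"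
  defines "y \<equiv> cY 1 (\<mu> - 1) (- x)"
  defines "w \<equiv> 1 - \<mu> * y - (1 - \<mu>) * y\<^sup>2"
  shows "y \<noteq> 0" "w > 0" "cY' 1 (\<mu> - 1) (- x) = - (x / (y * w))"
    "x\<^sup>2 = y\<^sup>2 - 2/3 * \<mu> * y ^ 3 - 1/2 * (1 - \<mu>) * y ^ 4"
proof -
  have x': "\<bar>- x\<bar> < c\<eta> 1 (\<mu> - 1)" using x by simp
  have y: "\<bar>y\<bar> < cc (\<mu> - 1)" unfolding y_def by (rule cY_cc[OF x'])
  have cw: "cw 1 (\<mu> - 1) y = 1 - \<mu> * y - (1 - \<mu>) * y\<^sup>2" if "\<bar>y\<bar> < cc (\<mu> - 1)" for y
    using cc_bounds(1)[OF that] by (simp add: cw_def algebra_simps power2_eq_square)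
  then show w: "w > 0" using cw_pos[OF y, of 1] y unfolding w_def by simp
  show y0: "y \<noteq> 0" using cE_cY[OF x'] x(2) unfolding y_def by auto
  have "- x = y * w * cY' 1 (\<mu> - 1) (- x)"
    using cY_key[OF x'] unfolding y_def[symmetric] w_def cw[OF y, symmetric] cw_def by (simp add: mult.assoc)
  then show "cY' 1 (\<mu> - 1) (- x) = - (x / (y * w))" using y0 w by (simp add: field_simps)
  have "(cE 1 (\<mu> - 1) y)\<^sup>2 = y\<^sup>2 - 2/3 * \<mu> * y ^ 3 - 1/2 * (1 - \<mu>) * y ^ 4"
    by (rule cE_square_eqI[OF _ _ y])
      (auto intro!: derivative_eq_intros simp: cw power2_eq_square eval_nat_numeral field_simps)
  then show "x\<^sup>2 = y\<^sup>2 - 2/3 * \<mu> * y ^ 3 - 1/2 * (1 - \<mu>) * y ^ 4" unfolding y_def using cE_cY[OF x'] by simp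
qed

lemma horizontal_eventually:
  assumes "\<And>x. \<lbrakk>x \<noteq> 0; \<bar>x\<bar> < c\<eta> 1 (\<mu> - 1); \<bar>x\<bar> < 1\<rbrakk> \<Longrightarrow> P x"
  shows "\<forall>\<^sub>F x in at 0. P x"
  unfolding eventually_at
  by (intro exI[of _ "min 1 (c\<eta> 1 (\<mu> - 1))"]) (use assms c\<eta>_pos in \<open>auto simp: dist_real_def\<close>)

lemma tendsto_horizontal:
  fixes \<mu> :: real
  defines "y x \<equiv> cY 1 (\<mu> - 1) (- x)"
  shows "((\<lambda>x. y x) \<longlongrightarrow> 0) (at 0)" "((\<lambda>x. 1 - \<mu> * y x - (1 - \<mu>) * (y x)\<^sup>2) \<longlongrightarrow> 1) (at 0)" "((\<lambda>x. x / y x) \<longlongrightarrow> - 1) (at 0)"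
proof -
  have "((\<lambda>x. y x / x * x) \<longlongrightarrow> - 1 * 0) (at 0)" unfolding y_def by (intro tendsto_intros tendsto_cY_divide)
  moreover have "\<forall>\<^sub>F x in at 0. y x / x * x = y x" by (auto simp: eventually_at_filter)
  ultimately show y: "((\<lambda>x. y x) \<longlongrightarrow> 0) (at 0)" by (simp add: tendsto_cong)
  have "((\<lambda>x. 1 - \<mu> * y x - (1 - \<mu>) * (y x)\<^sup>2) \<longlongrightarrow> 1 - \<mu> * 0 - (1 - \<mu>) * 0\<^sup>2) (at 0)" by (intro tendsto_intros y)
  then show "((\<lambda>x. 1 - \<mu> * y x - (1 - \<mu>) * (y x)\<^sup>2) \<longlongrightarrow> 1) (at 0)" by simp
  have "((\<lambda>x. inverse (y x / x)) \<longlongrightarrow> inverse (- 1)) (at 0)" unfolding y_def by (intro tendsto_intros tendsto_cY_divide) simp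
  then show "((\<lambda>x. x / y x) \<longlongrightarrow> - 1) (at 0)" by (simp add: inverse_eq_divide)
qed

text \<open>Here \<open>h\<close> is the sum under study, \<open>a\<close> stands for
  \<open>1 - x\<close>, and \<open>g * y\<close> is the conjugate factor. Two of the powers of
  \<open>y\<close> in the product are used up by the factors \<open>y\<close> on the left, whence
  the exponent \<open>k - 2\<close>.\<close>

lemma quotient_limit_aux:
  fixes x y w a g h q :: real
  assumes eq: "h * (a * y * w) * (g * y) = y ^ k * q" and k: "k \<ge> 2" and nz: "y \<noteq> 0" "a \<noteq> 0" "w \<noteq> 0" "g \<noteq> 0"
  shows "q * (y / x) ^ (k - 2) / (g * a * w) = h / x ^ (k - 2)"
proof -
  have "y ^ k = y ^ (k - 2) * (y * y)" using k by (metis le_add_diff_inverse2 power_add power2_eq_square)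
  with eq have "(h * (g * a * w)) * (y * y) = (q * y ^ (k - 2)) * (y * y)" by (simp add: ac_simps)
  then have "h * (g * a * w) = q * y ^ (k - 2)" using nz by simp
  then have "h = q * y ^ (k - 2) / (g * a * w)" using nz by (simp add: nonzero_eq_divide_eq)
  then show ?thesis by (simp add: power_divide mult.commute)
qed

text \<open>Together with \<open>hor_rest\<close> this is the expansion in \<open>y\<close> of the
  product of the two conjugate factors in \<open>horizontal_last\<close>, after division by
  \<open>y ^ 5\<close>.\<close>

definition hor_lead :: "real \<Rightarrow> real" where
  "hor_lead \<mu> = (- 600)*\<mu> + (- 96)*\<mu>^2 + (1400/3)*\<mu>^3 + (- 176/3)*\<mu>^4 + (- 64/3)*\<mu>^5"

definition hor_rest :: "real \<Rightarrow> real \<Rightarrow> real" where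
  "hor_rest \<mu> y = y ^ 0 * ((- 99) + 630*\<mu> + 932*\<mu>^2 + (- 434)*\<mu>^3 + (- 525)*\<mu>^4 + (388/3)*\<mu>^5 + (52/3)*\<mu>^6) + y ^ 1 * (108 + 330*\<mu> + (- 882)*\<mu>^2 + (- 4244/3)*\<mu>^3 + 1546*\<mu>^4 + (- 98)*\<mu>^5 + (- 256/3)*\<mu>^6 + (8/3)*\<mu>^7) + y ^ 2 * (18 + (- 513)*\<mu> + (- 393/2)*\<mu>^2 + (3215/2)*\<mu>^3 + (- 6211/18)*\<mu>^4 + (- 11473/18)*\<mu>^5 + (1960/9)*\<mu>^6 + (- 22/3)*\<mu>^7) + y ^ 3 * ((- 54) + 129*\<mu> + 102*\<mu>^2 + (1328/3)*\<mu>^3 + (- 1428)*\<mu>^4 + (3065/3)*\<mu>^5 + (- 220)*\<mu>^6 + (20/3)*\<mu>^7) + y ^ 4 * ((99/4) + (9/2)*\<mu> + (227/2)*\<mu>^2 + (- 601)*\<mu>^3 + (3155/4)*\<mu>^4 + (- 803/2)*\<mu>^5 + 73*\<mu>^6 + (- 2)*\<mu>^7)"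

text \<open>
  Multiplied by \<open>(1 - x) y w\<close>, the sum for the direction below is \<open>\<alpha> + \<beta> x\<close> with polynomials \<open>\<alpha>\<close>, \<open>\<beta>\<close> in \<open>y\<close>,
  and \<open>(\<alpha> + \<beta> x) (\<alpha> - \<beta> x)\<close> is a polynomial in \<open>y\<close>. Of its coefficients the lowest nonzero one,
  of \<open>y ^ 5\<close>, vanishes for \<open>\<mu> = 0\<close>.
\<close>

lemma horizontal_last:
  fixes \<mu> :: real
  defines "D \<equiv> - 12 * (1 + \<mu>)" and "v \<equiv> 9 - 9 * \<mu> + 2 * \<mu>\<^sup>2" and "m \<equiv> 9 - \<mu> + 10 * \<mu>\<^sup>2"
  assumes \<mu>: "0 \<le> \<mu>" "\<mu> < 1" and k: "k \<ge> 2" and q: "\<And>y. y ^ 5 * (hor_lead \<mu> + y * hor_rest \<mu> y) = y ^ k * q y" "isCont q 0"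
  shows "((\<lambda>x. hor_sum (\<mu> - 1) (- D) (v + D) (D) (m) x / x ^ (k - 2)) \<longlongrightarrow> q 0 * (- 1) ^ (k - 2) / (- 2 * D)) (at 0)"
proof -
  \<comment> \<open>The constants \<open>D\<close>, \<open>v\<close>, \<open>m\<close> solve the
    equations for the coefficients of order \<open>0\<close>, \<open>1\<close>, \<open>2\<close>.
    Those orders are attained by the three other directions considered below, so in the
    four-dimensional space of \<open>d1\<close>, \<open>m1\<close>, \<open>d2\<close>,
    \<open>m2\<close> the solution is unique up to scaling.\<close>
  define y where "y x = cY 1 (\<mu> - 1) (- x)" for x
  define w where "w x = 1 - \<mu> * y x - (1 - \<mu>) * (y x)\<^sup>2" for x
  define \<alpha> where "\<alpha> x = - D * y x * w x + x\<^sup>2 * (D + m * y x)" for x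
  define \<beta> where "\<beta> x = (v + D) * y x * w x - D - m * y x" for x
  note lim = tendsto_horizontal[of \<mu>, folded y_def, folded w_def]
  have ly: "((\<lambda>x. y x / x) \<longlongrightarrow> - 1) (at 0)" unfolding y_def by (rule tendsto_cY_divide)
  have l2: "((\<lambda>x. - D * w x + x * (x / y x) * (D + m * y x) - \<beta> x * (x / y x)) \<longlongrightarrow>
      - D * 1 + 0 * (- 1) * (D + m * 0) - ((v + D) * 0 * 1 - D - m * 0) * (- 1)) (at 0)"
    unfolding \<beta>_def by (intro tendsto_intros lim)
  have Dn: "- 2 * D \<noteq> 0" using \<mu> by (simp add: D_def)
  have l3: "((\<lambda>x. q (y x)) \<longlongrightarrow> q 0) (at 0)" by (rule isCont_tendsto_compose[OF q(2) lim(1)])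
  \<comment> \<open>The conjugate factor divided by \<open>y\<close>. Its limit
    \<open>- 2 * D\<close> is nonzero, so the vanishing order of the product determines that of the
    sum.\<close>
  let ?g = "\<lambda>x. - D * w x + x * (x / y x) * (D + m * y x) - \<beta> x * (x / y x)"
  have l2': "(?g \<longlongrightarrow> - 2 * D) (at 0)" using l2 by simp
  have "((\<lambda>x. q (y x) * (y x / x) ^ (k - 2) / (?g x * (1 - x) * w x)) \<longlongrightarrow> q 0 * (- 1) ^ (k - 2) / (- 2 * D * (1 - 0) * 1)) (at 0)"
    by (intro tendsto_intros l2' l3 lim ly) (use Dn in simp)
  moreover have "\<forall>\<^sub>F x in at 0. ?g x \<noteq> 0" by (rule tendsto_imp_eventually_ne[OF l2' Dn])
  then have "\<forall>\<^sub>F x in at 0. q (y x) * (y x / x) ^ (k - 2) / (?g x * (1 - x) * w x) =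
      hor_sum (\<mu> - 1) (- D) (v + D) (D) (m) x / x ^ (k - 2)"
  proof (rule eventually_mp[rotated], intro horizontal_eventually[of \<mu>] impI)
    fix x assume x: "x \<noteq> 0" "\<bar>x\<bar> < c\<eta> 1 (\<mu> - 1)" "\<bar>x\<bar> < 1" and g: "?g x \<noteq> 0"
    note ch = hor_chart[OF x(2,1), folded y_def, folded w_def]
    have g': "?g x * y x = \<alpha> x - \<beta> x * x" using ch(1) by (simp add: \<alpha>_def power2_eq_square field_simps)
    let ?h = "hor_sum (\<mu> - 1) (- D) (v + D) (D) (m) x"
    have h: "?h * ((1 - x) * y x * w x) = \<alpha> x + \<beta> x * x"
      using x ch(1,2) unfolding hor_sum_def y_def[symmetric] ch(3)
      by (simp add: \<alpha>_def \<beta>_def powr_minus divide_simps power2_eq_square) (simp add: algebra_simps)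
    have "(\<alpha> x + \<beta> x * x) * (\<alpha> x - \<beta> x * x) = (\<alpha> x)\<^sup>2 - (\<beta> x)\<^sup>2 * x\<^sup>2" by (simp add: algebra_simps power2_eq_square)
    also have "\<dots> = y x ^ 5 * (hor_lead \<mu> + y x * hor_rest \<mu> (y x))"
      unfolding \<alpha>_def \<beta>_def ch(4) w_def D_def v_def m_def hor_lead_def hor_rest_def by algebra
    finally have "?h * ((1 - x) * y x * w x) * (?g x * y x) = y x ^ k * q (y x)" unfolding g' h q(1) .
    then show "q (y x) * (y x / x) ^ (k - 2) / (?g x * (1 - x) * w x) = ?h / x ^ (k - 2)"
      by (rule quotient_limit_aux[OF _ k ch(1)]) (use x ch(2) g in auto)
  qed
  ultimately show ?thesis by (simp add: tendsto_cong)
qed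

text \<open>The two contributions are \<open>x / (1 - x)\<close> and \<open>- (x / w x)\<close>.
  Their terms of order \<open>1\<close> cancel and leave the order \<open>2\<close>.\<close>

lemma horizontal_third:
  "((\<lambda>x. hor_sum (\<mu> - 1) 0 1 0 1 x / x ^ 2) \<longlongrightarrow> 1 + \<mu>) (at 0)"
proof -
  define y where "y x = cY 1 (\<mu> - 1) (- x)" for x
  define w where "w x = 1 - \<mu> * y x - (1 - \<mu>) * (y x)\<^sup>2" for x
  note lim = tendsto_horizontal[of \<mu>, folded y_def, folded w_def]
  have ly: "((\<lambda>x. y x / x) \<longlongrightarrow> - 1) (at 0)" unfolding y_def by (rule tendsto_cY_divide)
  have "((\<lambda>x. (1 - \<mu> * (y x / x) - (1 - \<mu>) * (y x * (y x / x))) / ((1 - x) * w x)) \<longlongrightarrow>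
      (1 - \<mu> * (- 1) - (1 - \<mu>) * (0 * - 1)) / ((1 - 0) * 1)) (at 0)" by (intro tendsto_intros lim ly) simp
  moreover have "\<forall>\<^sub>F x in at 0. (1 - \<mu> * (y x / x) - (1 - \<mu>) * (y x * (y x / x))) / ((1 - x) * w x) = hor_sum (\<mu> - 1) 0 1 0 1 x / x ^ 2"
  proof (rule horizontal_eventually[of \<mu>])
    fix x assume x: "x \<noteq> 0" "\<bar>x\<bar> < c\<eta> 1 (\<mu> - 1)" "\<bar>x\<bar> < 1"
    note ch = hor_chart[OF x(2,1), folded y_def, folded w_def]
    have "hor_sum (\<mu> - 1) 0 1 0 1 x = x * (w x - (1 - x)) / ((1 - x) * w x)"
      using x ch(1,2) unfolding hor_sum_def y_def[symmetric] ch(3) by (simp add: powr_minus field_simps)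
    also have "w x - (1 - x) = x * (1 - \<mu> * (y x / x) - (1 - \<mu>) * (y x * (y x / x)))"
      using x by (simp add: w_def field_simps power2_eq_square)
    finally show "(1 - \<mu> * (y x / x) - (1 - \<mu>) * (y x * (y x / x))) / ((1 - x) * w x) = hor_sum (\<mu> - 1) 0 1 0 1 x / x ^ 2"
      using x by (simp add: power2_eq_square)
  qed
  ultimately show ?thesis by (simp add: tendsto_cong)
qed

lemma horizontal_second:
  "((\<lambda>x. hor_sum (\<mu> - 1) 0 0 0 1 x / x ^ 1) \<longlongrightarrow> - 1) (at 0)"
proof -
  have "((\<lambda>x. - 1 / (1 - \<mu> * cY 1 (\<mu> - 1) (- x) - (1 - \<mu>) * (cY 1 (\<mu> - 1) (- x))\<^sup>2)) \<longlongrightarrow> - 1 / 1) (at 0)"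
    by (intro tendsto_intros tendsto_horizontal) simp
  moreover have "\<forall>\<^sub>F x in at 0. - 1 / (1 - \<mu> * cY 1 (\<mu> - 1) (- x) - (1 - \<mu>) * (cY 1 (\<mu> - 1) (- x))\<^sup>2) = hor_sum (\<mu> - 1) 0 0 0 1 x / x ^ 1"
    by (rule horizontal_eventually[of \<mu>]) (simp add: hor_sum_def hor_chart)
  ultimately show ?thesis by (simp add: tendsto_cong)
qed

text \<open>The choice \<open>m1 = - d1\<close> cancels the denominator \<open>1 - x\<close>
  exactly. The sum is constant and not merely of order \<open>0\<close>, which gives the positive
  function used to make zeros simple.\<close>

lemma horizontal_first:
  assumes "\<bar>x\<bar> < 1" shows "hor_sum n 1 (- 1) 0 0 x = 1"
  using assms by (simp add: hor_sum_def powr_minus)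

text \<open>The centers are indexed by \<open>\<mu>\<close>. In the last direction the first order
  term has order \<open>5\<close> in \<open>R\<close> for \<open>\<mu> = 0\<close> but order
  \<open>4\<close>, with the opposite sign, for small positive \<open>\<mu>\<close>.\<close>

lemma horizontal: "bifurcate_from_origin Z1 Z2 (0, 1) (base 0 1 1 (- 1)) 4"
proof -
  obtain \<eta> where \<eta>: "\<eta> > 0" "\<And>l n. \<bar>l\<bar> \<le> 1 \<Longrightarrow> \<bar>n\<bar> \<le> 1 \<Longrightarrow> \<eta> \<le> c\<eta> l n"
    by (rule chart_uniform[of 1]) auto
  define R1 where "R1 = min \<eta> (1 / 2)"
  have R1: "R1 > 0" "R1 \<le> 1/2" using \<eta> by (auto simp: R1_def)
  have R1c: "R1 \<le> c\<eta> 0 1" "\<mu> \<in> {0..1/10} \<Longrightarrow> R1 \<le> c\<eta> 1 (\<mu> - 1)" for \<mu>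
    using \<eta>(2)[of 0 1] \<eta>(2)[of 1 "\<mu> - 1"] by (auto simp: R1_def)
  define D :: "real \<Rightarrow> real" where "D \<mu> = - 12 * (1 + \<mu>)" for \<mu>
  define v :: "real \<Rightarrow> real" where "v \<mu> = 9 - 9 * \<mu> + 2 * \<mu>\<^sup>2" for \<mu>
  define m :: "real \<Rightarrow> real" where "m \<mu> = 9 - \<mu> + 10 * \<mu>\<^sup>2" for \<mu>
  define e :: "real \<Rightarrow> nat \<Rightarrow> params" where
    "e \<mu> k = (if k = 0 then (1, 0, 0, 0, - 1, 0, 0, 0) else if k = 1 then (0, 0, 0, 0, 0, 1, 0, 0) else (0, 0, 0, 0, 1, 1, 0, 0))" for \<mu> k
  define W where "W j = integral {0..pi} (\<lambda>\<psi>. (cos \<psi>)\<^sup>2 * sin \<psi> ^ j)" for j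
  have W: "W j > 0" for j unfolding W_def by (rule horizontal_weight)
  have F: "((\<lambda>R. gM 0 0 1 1 (\<mu> - 1) (- D \<mu>, D \<mu>, 0, 0, v \<mu> + D \<mu>, m \<mu>, 0, 0) R / R ^ 4) \<longlongrightarrow> hor_lead \<mu> * (- 1) ^ 3 / (- 2 * D \<mu>) * W 3) (at_right 0)"
    if "0 < \<mu>" "\<mu> < 1/10" for \<mu>
  proof -
    have "isCont (\<lambda>y. hor_lead \<mu> + y * hor_rest \<mu> y) 0" unfolding hor_rest_def by (intro isCont_add isCont_mult isCont_power continuous_ident continuous_const)
    from horizontal_last[OF _ _ _ refl this] that
    have "((\<lambda>x. hor_sum (\<mu> - 1) (- D \<mu>) (v \<mu> + D \<mu>) (D \<mu>) (m \<mu>) x / x ^ 3) \<longlongrightarrow> hor_lead \<mu> * (- 1) ^ 3 / (- 2 * D \<mu>)) (at 0)"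
      by (simp add: D_def v_def m_def)
    from horizontal_limit[OF this] show ?thesis by (simp add: W_def)
  qed
  \<comment> \<open>For \<open>\<mu> = 0\<close> the coefficient \<open>hor_lead\<close> vanishes
    and \<open>- 99\<close>, the value of \<open>hor_rest\<close> at \<open>0\<close>, becomes the
    leading one.\<close>
  have F0: "((\<lambda>R. gM 0 0 1 1 (0 - 1) (- D 0, D 0, 0, 0, v 0 + D 0, m 0, 0, 0) R / R ^ 5) \<longlongrightarrow> (- 99) * (- 1) ^ 4 / (- 2 * D 0) * W 4) (at_right 0)"
  proof -
    have "isCont (\<lambda>y::real. - 99 + 108 * y + 18 * y ^ 2 - 54 * y ^ 3 + 99 / 4 * y ^ 4) 0" by (intro continuous_intros)
    moreover have "y ^ 5 * (hor_lead 0 + y * hor_rest 0 y) = y ^ 6 * (- 99 + 108 * y + 18 * y ^ 2 - 54 * y ^ 3 + 99 / 4 * y ^ 4)" for y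
      by (simp add: hor_lead_def hor_rest_def eval_nat_numeral algebra_simps)
    ultimately
    have "((\<lambda>x. hor_sum (0 - 1) (- D 0) (v 0 + D 0) (D 0) (m 0) x / x ^ 4) \<longlongrightarrow> (- 99) * (- 1) ^ 4 / (- 2 * D 0)) (at 0)"
      using horizontal_last[of 0 6 "\<lambda>y. - 99 + 108 * y + 18 * y ^ 2 - 54 * y ^ 3 + 99 / 4 * y ^ 4"]
      by (simp add: D_def v_def m_def)
    from horizontal_limit[OF this] show ?thesis by (simp add: W_def)
  qed
  have "bifurcate_from_origin Z1 Z2 (0, 1) (base 0 1 1 (0 - 1)) (Suc 3)"
  proof (rule bifurcation_criterion[where ?\<phi>0.0=0 and ?l1.0="\<lambda>_. 0" and ?n1.0="\<lambda>_. 1" and ?l2.0="\<lambda>_. 1" and ?n2.0="\<lambda>\<mu>. \<mu> - 1"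
        and w="\<lambda>\<mu>. (- D \<mu>, D \<mu>, 0, 0, v \<mu> + D \<mu>, m \<mu>, 0, 0)" and e=e and L=1 and ?\<delta>0.0="1/10"
        and r="\<lambda>_ x. x" and s="\<lambda>_ x. x" and r'="\<lambda>_ _. 1" and s'="\<lambda>_ _. 1"])
    show "R1 > 0" by (rule R1)
    show "geometry (0, 1) 0 0 1 1 (\<mu> - 1) R1 (\<lambda>x. x) (\<lambda>_. 1) (\<lambda>x. x) (\<lambda>_. 1)" if "\<mu> \<in> {0..1/10}" for \<mu>
      by (rule geometry_horizontal[OF R1(1) R1c(1) R1c(2)[OF that]])
    show "continuous_on {0..1/10} (\<lambda>t. gM 0 0 1 1 (t - 1) (- D t, D t, 0, 0, v t + D t, m t, 0, 0) R)" if "0 < R" "R < R1" for R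
      unfolding D_def v_def m_def
      by (rule continuous_gM; (intro continuous_intros)?) (use that R1c in \<open>auto intro: less_le_trans\<close>)
    show "((\<lambda>R. gM 0 0 1 1 (0 - 1) (- D 0, D 0, 0, 0, v 0 + D 0, m 0, 0, 0) R / R ^ 5) \<longlongrightarrow> (- 99) * (- 1) ^ 4 / (- 2 * D 0) * W 4) (at_right 0)"
      by (rule F0)
    show "((\<lambda>R. gM 0 0 1 1 (\<mu> - 1) (- D \<mu>, D \<mu>, 0, 0, v \<mu> + D \<mu>, m \<mu>, 0, 0) R / R ^ Suc 3) \<longlongrightarrow> hor_lead \<mu> * (- 1) ^ 3 / (- 2 * D \<mu>) * W 3) (at_right 0)"
      if "0 < \<mu>" "\<mu> < 1/10" for \<mu> using F[OF that] by simp
    show "hor_lead \<mu> * (- 1) ^ 3 / (- 2 * D \<mu>) * W 3 * ((- 99) * (- 1) ^ 4 / (- 2 * D 0) * W 4) < 0" if \<mu>: "0 < \<mu>" "\<mu> < 1/10" for \<mu>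
    proof -
      \<comment> \<open>The only positive term of \<open>hor_lead\<close> is thereby dominated by
        \<open>600 * \<mu>\<close>.\<close>
      have "(1400/3) * \<mu> ^ 3 \<le> (1400/3) * \<mu>" using \<mu> power_decreasing[of 1 3 \<mu>] by simp
      moreover have "\<mu> ^ 2 > 0" "\<mu> ^ 4 > 0" "\<mu> ^ 5 > 0" using \<mu> by simp_all
      ultimately have "hor_lead \<mu> < 0" using \<mu> unfolding hor_lead_def by linarith
      then have "hor_lead \<mu> * W 3 < 0" using W by (simp add: mult_neg_pos)
      moreover have "hor_lead \<mu> * (- 1) ^ 3 / (- 2 * D \<mu>) * W 3 = - (hor_lead \<mu> * W 3) / (24 * (1 + \<mu>))" by (simp add: D_def)
      moreover have "- (hor_lead \<mu> * W 3) / (24 * (1 + \<mu>)) > 0" using \<mu> \<open>hor_lead \<mu> * W 3 < 0\<close> by (intro divide_pos_pos) auto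
      ultimately have "hor_lead \<mu> * (- 1) ^ 3 / (- 2 * D \<mu>) * W 3 > 0" by simp
      moreover have "(- 99) * (- 1) ^ 4 / (- 2 * D 0) * W 4 < 0" using W by (simp add: D_def)
      ultimately show ?thesis by (rule mult_pos_neg)
    qed
    show "\<exists>a. a \<noteq> 0 \<and> ((\<lambda>R. gM 0 0 1 1 (\<mu> - 1) (e \<mu> k) R / R ^ Suc k) \<longlongrightarrow> a) (at_right 0)" if "0 < \<mu>" "\<mu> < 1/10" "k < 3" for \<mu> k
    proof -
      have "((\<lambda>x. hor_sum (\<mu> - 1) 1 (- 1) 0 0 x / x ^ 0) \<longlongrightarrow> 1) (at 0)"
        by (rule tendsto_eventually, rule horizontal_eventually[of \<mu>]) (simp add: horizontal_first)
      note l = horizontal_limit[OF this] horizontal_limit[OF horizontal_second[of \<mu>]] horizontal_limit[OF horizontal_third[of \<mu>]]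
      consider "k = 0" | "k = 1" | "k = 2" using \<open>k < 3\<close> by linarith
      then show ?thesis
      proof cases
        case 1 then show ?thesis using l(1) W[of 0] by (intro exI[of _ "1 * W 0"]) (simp add: e_def W_def)
      next
        case 2 then show ?thesis using l(2) W[of 1] by (intro exI[of _ "- 1 * W 1"]) (simp add: e_def W_def)
      next
        case 3 then show ?thesis using l(3) W[of 2] that by (intro exI[of _ "(1 + \<mu>) * W 2"]) (simp add: e_def W_def numeral_2_eq_2)
      qed
    qed
    show "gM 0 0 1 1 (\<mu> - 1) (e \<mu> 0) R > 0" if "0 < \<mu>" "\<mu> < 1/10" "0 < R" "R < R1" for \<mu> R
    proof -
      have R: "R < c\<eta> 0 1" "R < c\<eta> 1 (\<mu> - 1)" using R1c(1) R1c(2)[of \<mu>] that by auto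
      have "\<bar>R * sin \<psi>\<bar> \<le> R" for \<psi> using that by (simp add: abs_mult mult_left_le)
      moreover have "R < 1" using that R1 by simp
      ultimately have "\<bar>R * sin \<psi>\<bar> < 1" for \<psi> by (rule le_less_trans)
      then have "gM 0 0 1 1 (\<mu> - 1) (e \<mu> 0) R = R * W 0"
        using gM_horizontal[OF that(3) R] by (simp add: e_def W_def horizontal_first)
      then show ?thesis using W[of 0] that by simp
    qed
  qed (auto intro!: continuous_intros)
  then show ?thesis by simp
qed

section \<open>The vertical family\<close>

lemma fps_order_limit:
  fixes f :: "real \<Rightarrow> real"
  assumes f: "f has_fps_expansion F" and z: "\<forall>i<j. fps_nth F i = 0"
  shows "((\<lambda>x. f x / x ^ j) \<longlongrightarrow> fps_nth F j) (at 0)"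
proof (cases "F = 0")
  case True
  then have "\<forall>\<^sub>F x in nhds 0. f x = 0" using f by (auto simp: has_fps_expansion_def elim: eventually_mono)
  then have "\<forall>\<^sub>F x in at 0. f x / x ^ j = 0" by (auto simp: eventually_at_filter elim: eventually_mono)
  then show ?thesis using True by (simp add: tendsto_eventually)
next
  case False
  have "j \<le> subdegree F" using False z by (intro subdegree_geI) auto
  from has_fps_expansion_imp_continuous[OF has_fps_expansion_shift[OF f this refl]]
  have "((\<lambda>x. if x = 0 then fps_nth F j else f x / x ^ j) \<longlongrightarrow> fps_nth F j) (at 0)"
    by (simp add: continuous_within)
  then show ?thesis by (rule Lim_transform_eventually) (simp add: eventually_at_filter)
qed

text \<open>Reflection of the interval at \<open>pi / 2\<close>, composed from a reflection at
  \<open>0\<close> and a shift.\<close>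

lemma integral_antisymmetric:
  fixes f :: "real \<Rightarrow> real"
  assumes "\<And>\<psi>. f (pi - \<psi>) = - f \<psi>" shows "integral {0..pi} f = 0"
proof -
  have "integral {0..pi} f = integral {- pi..- 0} (\<lambda>\<psi>. f (- \<psi>))"
    by (rule Henstock_Kurzweil_Integration.integral_reflect_real[symmetric])
  also have "\<dots> = integral {- pi - (- pi)..- 0 - (- pi)} (\<lambda>\<psi>. f (- (\<psi> + - pi)))"
    by (rule integral_shift_real_ivl[symmetric])
  also have "\<dots> = - integral {0..pi} f" using assms by simp
  finally show ?thesis by simp
qed

text \<open>Order \<open>8\<close> is the last one needed: it is the leading order of the last
  direction at the special vertical center.\<close>

lemma fps_mult_coeffs:
  fixes F G :: "real fps"
  shows "fps_nth (F * G) 0 = fps_nth F 0 * fps_nth G 0"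
    "fps_nth (F * G) 1 = fps_nth F 0 * fps_nth G 1 + fps_nth F 1 * fps_nth G 0"
    "fps_nth (F * G) 2 = fps_nth F 0 * fps_nth G 2 + fps_nth F 1 * fps_nth G 1 + fps_nth F 2 * fps_nth G 0"
    "fps_nth (F * G) 3 = fps_nth F 0 * fps_nth G 3 + fps_nth F 1 * fps_nth G 2 + fps_nth F 2 * fps_nth G 1 + fps_nth F 3 * fps_nth G 0"
    "fps_nth (F * G) 4 = fps_nth F 0 * fps_nth G 4 + fps_nth F 1 * fps_nth G 3 + fps_nth F 2 * fps_nth G 2 + fps_nth F 3 * fps_nth G 1 + fps_nth F 4 * fps_nth G 0"
    "fps_nth (F * G) 5 = fps_nth F 0 * fps_nth G 5 + fps_nth F 1 * fps_nth G 4 + fps_nth F 2 * fps_nth G 3 + fps_nth F 3 * fps_nth G 2 + fps_nth F 4 * fps_nth G 1 + fps_nth F 5 * fps_nth G 0"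
    "fps_nth (F * G) 6 = fps_nth F 0 * fps_nth G 6 + fps_nth F 1 * fps_nth G 5 + fps_nth F 2 * fps_nth G 4 + fps_nth F 3 * fps_nth G 3 + fps_nth F 4 * fps_nth G 2 + fps_nth F 5 * fps_nth G 1 + fps_nth F 6 * fps_nth G 0"
    "fps_nth (F * G) 7 = fps_nth F 0 * fps_nth G 7 + fps_nth F 1 * fps_nth G 6 + fps_nth F 2 * fps_nth G 5 + fps_nth F 3 * fps_nth G 4 + fps_nth F 4 * fps_nth G 3 + fps_nth F 5 * fps_nth G 2 + fps_nth F 6 * fps_nth G 1 + fps_nth F 7 * fps_nth G 0"
    "fps_nth (F * G) 8 = fps_nth F 0 * fps_nth G 8 + fps_nth F 1 * fps_nth G 7 + fps_nth F 2 * fps_nth G 6 + fps_nth F 3 * fps_nth G 5 + fps_nth F 4 * fps_nth G 4 + fps_nth F 5 * fps_nth G 3 + fps_nth F 6 * fps_nth G 2 + fps_nth F 7 * fps_nth G 1 + fps_nth F 8 * fps_nth G 0"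
  by (simp_all add: fps_mult_nth eval_nat_numeral)

text \<open>In the logarithmic variable \<open>- ln (1 - y) / 4\<close> the derivative of
  \<open>P\<close> is this difference of exponentials; \<open>VP\<close> is the series of
  \<open>P\<close> itself.\<close>

definition VP' :: "real \<Rightarrow> real fps" where
  "VP' \<tau> = fps_const 8 * (fps_exp (2 - 2 * \<tau>) - fps_exp (- 2 - 2 * \<tau>))"

definition VP :: "real \<Rightarrow> real fps" where
  "VP \<tau> = fps_integral0 (VP' \<tau>)"

lemma VP'_nth:
  shows "fps_nth (VP' \<tau>) 0 = 0"
    "fps_nth (VP' \<tau>) 1 = 32"
    "fps_nth (VP' \<tau>) 2 = (- 64) * \<tau>"
    "fps_nth (VP' \<tau>) 3 = (64 / 3) + 64 * \<tau> ^ 2"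
    "fps_nth (VP' \<tau>) 4 = (- 128 / 3) * \<tau> + (- 128 / 3) * \<tau> ^ 3"
    "fps_nth (VP' \<tau>) 5 = (64 / 15) + (128 / 3) * \<tau> ^ 2 + (64 / 3) * \<tau> ^ 4"
    "fps_nth (VP' \<tau>) 6 = (- 128 / 15) * \<tau> + (- 256 / 9) * \<tau> ^ 3 + (- 128 / 15) * \<tau> ^ 5"
    "fps_nth (VP' \<tau>) 7 = (128 / 315) + (128 / 15) * \<tau> ^ 2 + (128 / 9) * \<tau> ^ 4 + (128 / 45) * \<tau> ^ 6"
    "fps_nth (VP' \<tau>) 8 = (- 256 / 315) * \<tau> + (- 256 / 45) * \<tau> ^ 3 + (- 256 / 45) * \<tau> ^ 5 + (- 256 / 315) * \<tau> ^ 7"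
  unfolding VP'_def by (simp_all add: fact_numeral divide_simps del: One_nat_def) (algebra+)?

lemma VP_nth:
  shows "fps_nth (VP \<tau>) 0 = 0"
    "fps_nth (VP \<tau>) 1 = 0"
    "fps_nth (VP \<tau>) 2 = 16"
    "fps_nth (VP \<tau>) 3 = (- 64 / 3) * \<tau>"
    "fps_nth (VP \<tau>) 4 = (16 / 3) + 16 * \<tau> ^ 2"
    "fps_nth (VP \<tau>) 5 = (- 128 / 15) * \<tau> + (- 128 / 15) * \<tau> ^ 3"
    "fps_nth (VP \<tau>) 6 = (32 / 45) + (64 / 9) * \<tau> ^ 2 + (32 / 9) * \<tau> ^ 4"
    "fps_nth (VP \<tau>) 7 = (- 128 / 105) * \<tau> + (- 256 / 63) * \<tau> ^ 3 + (- 128 / 105) * \<tau> ^ 5"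
    "fps_nth (VP \<tau>) 8 = (16 / 315) + (16 / 15) * \<tau> ^ 2 + (16 / 9) * \<tau> ^ 4 + (16 / 45) * \<tau> ^ 6"
  unfolding VP_def by (simp_all add: fps_integral_def VP'_nth[simplified])

text \<open>\<open>VT1\<close>, \<open>VT2\<close>, \<open>VT3\<close> are the series of
  \<open>P ^ k * P'\<close> for \<open>k = 1, 2, 3\<close>. They start at the orders
  \<open>3\<close>, \<open>5\<close>, \<open>7\<close>.\<close>

definition VT1 :: "real \<Rightarrow> real fps" where "VT1 \<tau> = VP \<tau> * VP' \<tau>"

lemma VT1_nth:
  shows "fps_nth (VT1 \<tau>) 0 = 0"
    "fps_nth (VT1 \<tau>) 1 = 0"
    "fps_nth (VT1 \<tau>) 2 = 0"
    "fps_nth (VT1 \<tau>) 3 = 512"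
    "fps_nth (VT1 \<tau>) 4 = (- 5120 / 3) * \<tau>"
    "fps_nth (VT1 \<tau>) 5 = 512 + (8704 / 3) * \<tau> ^ 2"
    "fps_nth (VT1 \<tau>) 6 = (- 78848 / 45) * \<tau> + (- 50176 / 15) * \<tau> ^ 3"
    "fps_nth (VT1 \<tau>) 7 = (1024 / 5) + (137216 / 45) * \<tau> ^ 2 + (44032 / 15) * \<tau> ^ 4"
    "fps_nth (VT1 \<tau>) 8 = (- 75776 / 105) * \<tau> + (- 376832 / 105) * \<tau> ^ 3 + (- 219136 / 105) * \<tau> ^ 5"
  unfolding VT1_def fps_mult_coeffs VP_nth VP'_nth by (simp_all add: divide_simps del: One_nat_def) (algebra+)?

definition VT2 :: "real \<Rightarrow> real fps" where "VT2 \<tau> = VP \<tau> * VT1 \<tau>"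

lemma VT2_nth:
  shows "fps_nth (VT2 \<tau>) 0 = 0"
    "fps_nth (VT2 \<tau>) 1 = 0"
    "fps_nth (VT2 \<tau>) 2 = 0"
    "fps_nth (VT2 \<tau>) 3 = 0"
    "fps_nth (VT2 \<tau>) 4 = 0"
    "fps_nth (VT2 \<tau>) 5 = 8192"
    "fps_nth (VT2 \<tau>) 6 = (- 114688 / 3) * \<tau>"
    "fps_nth (VT2 \<tau>) 7 = (32768 / 3) + (819200 / 9) * \<tau> ^ 2"
    "fps_nth (VT2 \<tau>) 8 = (- 262144 / 5) * \<tau> + (- 6619136 / 45) * \<tau> ^ 3"
  unfolding VT2_def fps_mult_coeffs VP_nth VT1_nth by (simp_all add: divide_simps del: One_nat_def) (algebra+)?

definition VT3 :: "real \<Rightarrow> real fps" where "VT3 \<tau> = VP \<tau> * VT2 \<tau>"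

lemma VT3_nth:
  shows "fps_nth (VT3 \<tau>) 0 = 0"
    "fps_nth (VT3 \<tau>) 1 = 0"
    "fps_nth (VT3 \<tau>) 2 = 0"
    "fps_nth (VT3 \<tau>) 3 = 0"
    "fps_nth (VT3 \<tau>) 4 = 0"
    "fps_nth (VT3 \<tau>) 5 = 0"
    "fps_nth (VT3 \<tau>) 6 = 0"
    "fps_nth (VT3 \<tau>) 7 = 131072"
    "fps_nth (VT3 \<tau>) 8 = (- 786432) * \<tau>"
  unfolding VT3_def fps_mult_coeffs VP_nth VT2_nth by (simp_all add: divide_simps del: One_nat_def) (algebra+)?

text \<open>The series of the integrands for the directions in \<open>d\<close> and
  \<open>m\<close>; \<open>VC\<close> does the same for the directions in \<open>l1\<close>
  (argument \<open>k\<close>) and \<open>n\<close>. The functions themselves are \<open>QA\<close>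
  and \<open>QC\<close> below.\<close>

definition VA :: "real \<Rightarrow> real \<Rightarrow> real \<Rightarrow> real \<Rightarrow> real \<Rightarrow> real fps" where
  "VA \<tau> d1 m1 d2 m2 = fps_const 4 * (fps_const (d1 + m1) * fps_exp (1 - \<tau>) - fps_const m1 * fps_exp (- 3 - \<tau>)
     + fps_const (d2 + m2) * fps_exp (3 - \<tau>) - fps_const m2 * fps_exp (- 1 - \<tau>))"

definition VC :: "real \<Rightarrow> real \<Rightarrow> real \<Rightarrow> real \<Rightarrow> real fps" where
  "VC \<tau> k h1 h2 = fps_const (4 * h1) * (fps_exp (2 - 2 * \<tau>) - fps_const 2 * fps_exp (- 2 - 2 * \<tau>) + fps_exp (- 6 - 2 * \<tau>))
     - fps_const (4 * h2) * (fps_exp (6 - 2 * \<tau>) - fps_const 2 * fps_exp (2 - 2 * \<tau>) + fps_exp (- 2 - 2 * \<tau>))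
     + fps_const (4 * k) * (fps_X * VP' \<tau>)"

text \<open>
  With \<open>x = - ln (1 - y) / 4\<close> and \<open>P = \<eta>\<^sup>2\<close> as a function of \<open>x\<close>, the forms \<open>P ^ k P' dx = 2 \<eta> ^ (2 k + 1) d\<eta>\<close> do not
  contribute to the first order term. Subtracting multiples of them makes its order at the origin visible.
\<close>

definition VG :: "real \<Rightarrow> real fps \<Rightarrow> real \<Rightarrow> real \<Rightarrow> real \<Rightarrow> real \<Rightarrow> real fps" where
  "VG \<tau> F q0 q1 q2 q3 = F - fps_const (1 / 2) *
     (fps_const q0 * VP' \<tau> + fps_const q1 * VT1 \<tau> + fps_const q2 * VT2 \<tau> + fps_const q3 * VT3 \<tau>)"

lemmas V_nth = VG_def VA_def VC_def VP'_nth VT1_nth VT2_nth VT3_nth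

lemma all_less_numeral:
  "(\<forall>i<(2::nat). P i) \<longleftrightarrow> P 0 \<and> P 1" "(\<forall>i<(4::nat). P i) \<longleftrightarrow> P 0 \<and> P 1 \<and> P 2 \<and> P 3"
  "(\<forall>i<(6::nat). P i) \<longleftrightarrow> P 0 \<and> P 1 \<and> P 2 \<and> P 3 \<and> P 4 \<and> P 5"
  by (simp_all add: eval_nat_numeral All_less_Suc conj_ac)

text \<open>
  Up to constants, \<open>exp (\<tau> x)\<close> times the series for the orders \<open>0\<close>, \<open>2\<close>, \<open>4\<close> belongs to \<open>cosh x\<close>, \<open>cosh x (sinh x)\<^sup>2\<close>, \<open>(sinh x)\<^sup>3\<close>.
  The last direction is the combination of \<open>sinh x\<close> with the latter two whose reduced coefficients of order \<open>2\<close> and \<open>4\<close>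
  vanish; the one of order \<open>6\<close> is a multiple of \<open>\<tau> (1 - \<tau>\<^sup>2) (8 - 9 \<tau>\<^sup>2)\<close>.
\<close>

lemma V_order_0: "fps_nth (VG \<tau> (VA \<tau> 1 0 1 (- 1)) 0 0 0 0) 0 = 8"
  unfolding all_less_numeral
  by ((intro conjI)?; simp add: V_nth VP'_nth(2)[simplified] fact_numeral divide_simps del: One_nat_def;
    (rule add_right_imp_eq[where a=\<tau>], algebra)?)

lemma V_order_1: "(\<forall>i<2. fps_nth (VG \<tau> (VC \<tau> 0 1 0) 0 0 0 0) i = 0) \<and> fps_nth (VG \<tau> (VC \<tau> 0 1 0) 0 0 0 0) 2 = 64"
  unfolding all_less_numeral
  by ((intro conjI)?; simp add: V_nth VP'_nth(2)[simplified] fact_numeral divide_simps del: One_nat_def;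
    (rule add_right_imp_eq[where a=\<tau>], algebra)?)

lemma V_order_2: "(\<forall>i<2. fps_nth (VG \<tau> (VA \<tau> 0 (- 1) 0 1) 0 0 0 0) i = 0) \<and> fps_nth (VG \<tau> (VA \<tau> 0 (- 1) 0 1) 0 0 0 0) 2 = 32"
  unfolding all_less_numeral
  by ((intro conjI)?; simp add: V_nth VP'_nth(2)[simplified] fact_numeral divide_simps del: One_nat_def;
    (rule add_right_imp_eq[where a=\<tau>], algebra)?)

lemma V_order_3: "(\<forall>i<4. fps_nth (VG \<tau> (VC \<tau> (- 1) 1 (- 1)) 0 0 0 0) i = 0) \<and> fps_nth (VG \<tau> (VC \<tau> (- 1) 1 (- 1)) 0 0 0 0) 4 = (1024 / 3)"
  unfolding all_less_numeral
  by ((intro conjI)?; simp add: V_nth VP'_nth(2)[simplified] fact_numeral divide_simps del: One_nat_def;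
    (rule add_right_imp_eq[where a=\<tau>], algebra)?)

lemma V_order_4: "(\<forall>i<4. fps_nth (VG \<tau> (VA \<tau> (- 4) 1 4 (- 3)) 0 (1 / 8) 0 0) i = 0) \<and> fps_nth (VG \<tau> (VA \<tau> (- 4) 1 4 (- 3)) 0 (1 / 8) 0 0) 4 = (224 / 3) * \<tau>"
  unfolding all_less_numeral
  by ((intro conjI)?; simp add: V_nth VP'_nth(2)[simplified] fact_numeral divide_simps del: One_nat_def;
    (rule add_right_imp_eq[where a=\<tau>], algebra)?)

lemma V_order_5: "(\<forall>i<6. fps_nth (VG \<tau> (VC \<tau> \<tau> (- 1 - \<tau>) (\<tau> - 1)) 0 1 ((1 / 16) + (- 1 / 16) * \<tau> ^ 2) 0) i = 0) \<and> fps_nth (VG \<tau> (VC \<tau> \<tau> (- 1 - \<tau>) (\<tau> - 1)) 0 1 ((1 / 16) + (- 1 / 16) * \<tau> ^ 2) 0) 6 = (8192 / 15) * \<tau> + (- 8192 / 15) * \<tau> ^ 3"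
  unfolding all_less_numeral
  by ((intro conjI)?; simp add: V_nth VP'_nth(2)[simplified] fact_numeral divide_simps del: One_nat_def;
    (rule add_right_imp_eq[where a=\<tau>], algebra)?)

text \<open>The four numbers after the direction are found one after the other: they cancel the
  coefficients of order \<open>1\<close>, \<open>3\<close>, \<open>5\<close>, \<open>7\<close>, at
  which the subtracted series start. The first surviving order is thus even, also for the
  \<open>\<tau>\<close> at which the coefficient of order \<open>6\<close> vanishes, and there it is
  order \<open>8\<close>.\<close>

definition "VF \<tau> = VG \<tau> (VA \<tau> (12 - 12 * \<tau> ^ 2) (4 + 7 * \<tau> + 3 * \<tau> ^ 2) (12 * \<tau> ^ 2 - 12) (16 - 7 * \<tau> - 9 * \<tau> ^ 2))
  14
  ((1 / 16) + (- 1 / 16) * \<tau> ^ 2)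
  ((5 / 1024) + (- 7 / 512) * \<tau> ^ 2 + (9 / 1024) * \<tau> ^ 4)
  ((- 11 / 32768) + (- 883 / 294912) * \<tau> ^ 2 + (2431 / 294912) * \<tau> ^ 4 + (- 161 / 32768) * \<tau> ^ 6)"

lemma V_order_last: "(\<forall>i<6. fps_nth (VF \<tau>) i = 0) \<and> fps_nth (VF \<tau>) 6 = (256 / 3) * \<tau> + (- 544 / 3) * \<tau> ^ 3 + 96 * \<tau> ^ 5 \<and> fps_nth (VF \<tau>) 7 = 0 \<and>
  fps_nth (VF \<tau>) 8 = (128 / 105) * \<tau> + (- 9872 / 9) * \<tau> ^ 3 + (109888 / 45) * \<tau> ^ 5 + (- 9424 / 7) * \<tau> ^ 7"
  unfolding all_less_numeral VF_def
  by ((intro conjI)?; simp add: V_nth VP'_nth(2)[simplified] fact_numeral divide_simps del: One_nat_def;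
    (rule add_right_imp_eq[where a=\<tau>], algebra)?)
text \<open>
  The exponents \<open>l1\<close>, \<open>l2\<close> with \<open>n1 = 0\<close>, \<open>n2 = 1\<close> give both halves the same function \<open>P\<close>, so that they share the chart
  and fit together along the vertical axis.
\<close>

locale vertical =
  fixes \<tau> :: real
  assumes \<tau>: "0 < \<tau>" "\<tau> < 1"
begin

abbreviation "l1 \<equiv> (\<tau> - 1) / 4"
abbreviation "l2 \<equiv> (\<tau> - 3) / 4"
abbreviation "\<eta>0 \<equiv> c\<eta> l2 1"

text \<open>The factor \<open>1 - y\<close> that comes from \<open>n = 1\<close> raises the exponent
  by one, and \<open>2 * l1 - 1 = 1 + (2 * l2 - 1)\<close>.\<close>

lemma cw_eq:
  assumes "\<bar>y\<bar> < cc 1" shows "cw l1 0 y = cw l2 1 y"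
proof -
  have "1 - y > 0" using cc_bounds(1)[OF assms] by auto
  then have "(1 - y) * (1 - y) powr (2 * l2 - 1) = (1 - y) powr (1 + (2 * l2 - 1))" by (simp add: powr_mult_base)
  then show ?thesis by (simp add: cw_def field_simps)
qed

lemma cQ_eq:
  assumes "\<bar>y\<bar> < cc 1" shows "cQ l1 0 y = cQ l2 1 y"
proof -
  have "integral {0..1} (\<lambda>t. t * cw l1 0 (t * y)) = integral {0..1} (\<lambda>t. t * cw l2 1 (t * y))"
    by (rule Henstock_Kurzweil_Integration.integral_cong) (simp only: cw_eq[OF cc_scale[OF assms]])
  then show ?thesis by (simp add: cQ_def)
qed

lemma cc_1: "cc 1 \<le> cc 0" "cd 1 \<le> cd 0" "cd 0 \<le> cc 1"
  by (simp_all add: cc_def cd_def)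

lemma chart_eq:
  assumes "\<bar>\<eta>\<bar> < \<eta>0" shows "cY l2 1 \<eta> = cY l1 0 \<eta>" "cY' l2 1 \<eta> = cY' l1 0 \<eta>"
proof -
  define y where "y = cY l2 1 \<eta>"
  have y: "\<bar>y\<bar> < cd 1" "\<bar>y\<bar> < cc 1" "cE l2 1 y = \<eta>" using cY_bound[OF assms] cY_cc[OF assms] cE_cY[OF assms] by (auto simp: y_def)
  have "cE l1 0 y = \<eta>" using y(3) by (simp add: cE_def cQ_eq[OF y(2)])
  then have "cY l1 0 \<eta> = y" using cY_cE[of y 0 l1] y(1) cc_1 by simp
  then show "cY l2 1 \<eta> = cY l1 0 \<eta>" "cY' l2 1 \<eta> = cY' l1 0 \<eta>"
    by (simp_all add: y_def[symmetric] cY'_def cE'_def cw_eq[OF y(2)] cQ_eq[OF y(2)])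
qed

text \<open>The two charts invert the same function on intervals of different length, as
  \<open>cd\<close> depends on \<open>n\<close>; the shorter interval, for \<open>n = 1\<close>,
  gives the common radius.\<close>

lemma \<eta>0: "\<eta>0 > 0" "\<eta>0 \<le> c\<eta> l1 0"
proof -
  show "\<eta>0 > 0" by (rule c\<eta>_pos)
  have d: "0 < cd 1" "cd 1 < cc 1" "cd 1 < cd 0" "cd 0 < cc 0" "cd 1 < cc 0" using cd by (auto simp: cd_def cc_def)
  have "cE l1 0 (cd 1) < cE l1 0 (cd 0)" "cE l1 0 (- cd 0) < cE l1 0 (- cd 1)"
    using cE_strict_mono[of "cd 1" 0 "cd 0" l1] cE_strict_mono[of "- cd 0" 0 "- cd 1" l1] d by auto
  moreover have "cE l1 0 (cd 1) = cE l2 1 (cd 1)" "cE l1 0 (- cd 1) = cE l2 1 (- cd 1)"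
    using d cQ_eq[of "cd 1"] cQ_eq[of "- cd 1"] by (simp_all add: cE_def)
  ultimately show "\<eta>0 \<le> c\<eta> l1 0" unfolding c\<eta>_def by (intro min.mono) auto
qed

text \<open>In this variable all powers of \<open>1 - y\<close> become exponentials, and with the
  chosen \<open>l1\<close> and \<open>l2\<close> the exponents in the integrands are affine in
  \<open>\<tau>\<close> with integer coefficients.\<close>

definition "X \<eta> = - ln (1 - cY l1 0 \<eta>) / 4"
definition "X' \<eta> = cY' l1 0 \<eta> / (4 * (1 - cY l1 0 \<eta>))"
definition "Pf' x = 8 * (exp ((2 - 2 * \<tau>) * x) - exp ((- 2 - 2 * \<tau>) * x))"
definition "Pf x = 8 / (2 - 2 * \<tau>) * (exp ((2 - 2 * \<tau>) * x) - 1) + (- 8) / (- 2 - 2 * \<tau>) * (exp ((- 2 - 2 * \<tau>) * x) - 1)"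

lemma Y_less: "\<bar>\<eta>\<bar> < \<eta>0 \<Longrightarrow> 1 - cY l1 0 \<eta> > 0"
  using side.Y_lt[of \<eta> l1 0] \<eta>0 by simp

lemma powr_Y: "\<bar>\<eta>\<bar> < \<eta>0 \<Longrightarrow> (1 - cY l1 0 \<eta>) powr c = exp (- 4 * c * X \<eta>)"
  using Y_less[of \<eta>] by (simp add: powr_def X_def)

lemma Y_X: "\<bar>\<eta>\<bar> < \<eta>0 \<Longrightarrow> cY l1 0 \<eta> = 1 - exp (- 4 * X \<eta>)"
  using powr_Y[of \<eta> 1] Y_less[of \<eta>] by simp

lemma Y'_X: assumes "\<bar>\<eta>\<bar> < \<eta>0" shows "cY' l1 0 \<eta> = 4 * X' \<eta> * exp (- 4 * X \<eta>)"
proof -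
  have "exp (- 4 * X \<eta>) = 1 - cY l1 0 \<eta>" using Y_X[OF assms] by simp
  moreover have "b = 4 * (b / (4 * a)) * a" if "a > 0" for a b :: real using that by (simp add: field_simps)
  ultimately show ?thesis unfolding X'_def using Y_less[OF assms] by metis
qed

lemma DERIV_X: assumes "\<bar>\<eta>\<bar> < \<eta>0" shows "(X has_real_derivative X' \<eta>) (at \<eta>)"
proof -
  have "((\<lambda>\<eta>. 1 - cY l1 0 \<eta>) has_real_derivative - cY' l1 0 \<eta>) (at \<eta>)"
    using assms \<eta>0(2) by (auto intro!: derivative_eq_intros DERIV_cY)
  from DERIV_cdivide[OF DERIV_minus[OF DERIV_chain2[OF DERIV_ln[OF Y_less[OF assms]] this]], of 4]
  have "(X has_real_derivative - (inverse (1 - cY l1 0 \<eta>) * - cY' l1 0 \<eta>) / 4) (at \<eta>)" unfolding X_def[abs_def] .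
  also have "- (inverse (1 - cY l1 0 \<eta>) * - cY' l1 0 \<eta>) / 4 = X' \<eta>" using Y_less[OF assms] by (simp add: X'_def divide_simps)
  finally show ?thesis .
qed

lemma X_zero: "X 0 = 0" "X' 0 = 1 / 4"
  by (simp_all add: X_def X'_def cY'_zero)

lemma X'_pos: "\<bar>\<eta>\<bar> < \<eta>0 \<Longrightarrow> X' \<eta> > 0"
  unfolding X'_def using Y_less[of \<eta>] cY'_pos[of \<eta> l1 0] \<eta>0(2) by (intro divide_pos_pos) auto

lemma continuous_X: "continuous_on {\<eta>. \<bar>\<eta>\<bar> < \<eta>0} X" "continuous_on {\<eta>. \<bar>\<eta>\<bar> < \<eta>0} X'"
proof -
  show "continuous_on {\<eta>. \<bar>\<eta>\<bar> < \<eta>0} X"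
    by (rule DERIV_continuous_on[OF has_field_derivative_at_within[OF DERIV_X]]) simp
  have "1 - cY l1 0 \<eta> \<noteq> 0" if "\<eta> \<in> {\<eta>. \<bar>\<eta>\<bar> < \<eta>0}" for \<eta> using Y_less[of \<eta>] that by simp
  then show "continuous_on {\<eta>. \<bar>\<eta>\<bar> < \<eta>0} X'"
    unfolding X'_def using \<eta>0(2) by (intro continuous_intros continuous_on_subset[OF continuous_cY(1)]
        continuous_on_subset[OF continuous_cY(2)]) auto
qed

lemma key: assumes "\<bar>\<eta>\<bar> < \<eta>0" shows "2 * \<eta> = Pf' (X \<eta>) * X' \<eta>"
proof -
  have "\<eta> = cY l1 0 \<eta> * (1 - cY l1 0 \<eta>) powr (2 * l1 - 1) * cY' l1 0 \<eta>" using cY_key[of \<eta> l1 0] assms \<eta>0(2) by simp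
  also have "\<dots> = 4 * X' \<eta> * ((1 - exp (- 4 * X \<eta>)) * (exp (- 4 * (2 * l1 - 1) * X \<eta>) * exp (- 4 * X \<eta>)))"
    unfolding powr_Y[OF assms] Y'_X[OF assms] unfolding Y_X[OF assms] by simp
  also have "\<dots> = 4 * X' \<eta> * (exp ((2 - 2 * \<tau>) * X \<eta>) - exp ((- 2 - 2 * \<tau>) * X \<eta>))"
  proof -
    have "- 4 * (2 * l1 - 1) * x + - 4 * x = (2 - 2 * \<tau>) * x" "- 4 * x + (2 - 2 * \<tau>) * x = (- 2 - 2 * \<tau>) * x" for x
      by (simp_all add: field_simps)
    then show ?thesis by (simp only: exp_add[symmetric] left_diff_distrib[of 1] mult_1)
  qed
  finally have "\<eta> = 4 * X' \<eta> * (exp ((2 - 2 * \<tau>) * X \<eta>) - exp ((- 2 - 2 * \<tau>) * X \<eta>))" .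
  then show ?thesis unfolding Pf'_def by algebra
qed

lemma square: assumes "\<bar>\<eta>\<bar> < \<eta>0" shows "\<eta>\<^sup>2 = Pf (X \<eta>)"
proof -
  have J: "{\<eta>. \<bar>\<eta>\<bar> < \<eta>0} = {- \<eta>0<..<\<eta>0}" by (auto simp: abs_less_iff)
  have "\<exists>c. \<forall>\<eta>\<in>{\<eta>. \<bar>\<eta>\<bar> < \<eta>0}. Pf (X \<eta>) - \<eta>\<^sup>2 = c"
  proof (rule has_field_derivative_zero_constant)
    show "convex {\<eta>. \<bar>\<eta>\<bar> < \<eta>0}" unfolding J by simp
    fix \<eta> assume "\<eta> \<in> {\<eta>. \<bar>\<eta>\<bar> < \<eta>0}"
    then have \<eta>: "\<bar>\<eta>\<bar> < \<eta>0" by simp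
    have "((\<lambda>x. c / a * (exp (a * x) - 1)) has_real_derivative c * exp (a * x)) (at x)" if "a \<noteq> 0" for a c x :: real
      using that by (auto intro!: derivative_eq_intros)
    from DERIV_add[OF this[of "2 - 2 * \<tau>" 8] this[of "- 2 - 2 * \<tau>" "- 8"]]
    have "(Pf has_real_derivative Pf' x) (at x)" for x
      unfolding Pf_def[abs_def] Pf'_def using \<tau> by (simp add: right_diff_distrib)
    from DERIV_chain2[OF this DERIV_X[OF \<eta>]]
    have "((\<lambda>\<eta>. Pf (X \<eta>) - \<eta>\<^sup>2) has_real_derivative Pf' (X \<eta>) * X' \<eta> - 2 * \<eta>) (at \<eta>)"
      by (auto intro!: derivative_eq_intros)
    then show "((\<lambda>\<eta>. Pf (X \<eta>) - \<eta>\<^sup>2) has_real_derivative 0) (at \<eta> within {\<eta>. \<bar>\<eta>\<bar> < \<eta>0})"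
      using key[OF \<eta>] by (simp add: has_field_derivative_at_within)
  qed
  then obtain c where c: "\<And>\<eta>. \<bar>\<eta>\<bar> < \<eta>0 \<Longrightarrow> Pf (X \<eta>) - \<eta>\<^sup>2 = c" by blast
  from c[of 0] have "c = 0" using \<eta>0(1) by (simp add: X_zero Pf_def)
  then show ?thesis using c[OF assms] by simp
qed

lemma Pf_expansion: "Pf' has_fps_expansion VP' \<tau>" "Pf has_fps_expansion VP \<tau>"
proof -
  show "Pf' has_fps_expansion VP' \<tau>"
    unfolding Pf'_def[abs_def] VP'_def by (intro fps_expansion_intros)
  let ?G = "fps_const (8 / (2 - 2 * \<tau>)) * (fps_exp (2 - 2 * \<tau>) - 1) + fps_const ((- 8) / (- 2 - 2 * \<tau>)) * (fps_exp (- 2 - 2 * \<tau>) - 1)"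
  have "fps_deriv (fps_const (b / a) * (fps_exp a - 1)) = fps_const b * fps_exp a" if "a \<noteq> 0" for a b :: real
    using that by (simp add: mult.assoc[symmetric])
  from this[of "2 - 2 * \<tau>" 8] this[of "- 2 - 2 * \<tau>" "- 8"]
  have "fps_deriv ?G = VP' \<tau>"
    unfolding VP'_def fps_deriv_add using \<tau> by (simp only:) (simp add: right_diff_distrib fps_const_neg[symmetric] del: fps_const_neg)
  then have "VP \<tau> = ?G" unfolding VP_def using fps_integral0_deriv[of ?G] by simp
  then show "Pf has_fps_expansion VP \<tau>"
    unfolding Pf_def[abs_def] by (simp only:) (intro fps_expansion_intros)
qed

text \<open>The weight \<open>p\<close> is symmetric under
  \<open>\<psi> \<mapsto> pi - \<psi>\<close> while \<open>\<eta> = - R * cos \<psi>\<close> changes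
  sign, so odd powers of \<open>\<eta>\<close> integrate to zero. By \<open>key\<close> and
  \<open>square\<close> the subtracted terms are exactly such odd powers. The rest has even order
  \<open>j\<close>, and the factor \<open>(1 / 4) ^ Suc j\<close> comes from
  \<open>X \<eta> / \<eta>\<close> and from \<open>X'\<close>, both of which tend to
  \<open>1 / 4\<close>.\<close>

lemma vertical_limit:
  assumes Q: "Q has_fps_expansion F" "continuous_on UNIV Q" and j: "even j" "\<forall>i<j. fps_nth (VG \<tau> F q0 q1 q2 q3) i = 0"
    and p: "continuous_on {0..pi} p" "\<And>\<psi>. \<bar>p \<psi>\<bar> \<le> 1" "\<And>\<psi>. p (pi - \<psi>) = p \<psi>"
  shows "((\<lambda>R. integral {0..pi} (\<lambda>\<psi>. p \<psi> * (Q (X (R * - cos \<psi>)) * X' (R * - cos \<psi>))) / R ^ j) \<longlongrightarrow>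
    (1 / 4) ^ Suc j * fps_nth (VG \<tau> F q0 q1 q2 q3) j * integral {0..pi} (\<lambda>\<psi>. p \<psi> * (- cos \<psi>) ^ j)) (at_right 0)"
proof -
  define g where "g x = Q x - 1 / 2 * (q0 * Pf' x + q1 * (Pf x * Pf' x) + q2 * (Pf x * (Pf x * Pf' x)) + q3 * (Pf x * (Pf x * (Pf x * Pf' x))))" for x
  define odd where "odd \<eta> = q0 * \<eta> + q1 * (\<eta>\<^sup>2 * \<eta>) + q2 * (\<eta>\<^sup>2 * (\<eta>\<^sup>2 * \<eta>)) + q3 * (\<eta>\<^sup>2 * (\<eta>\<^sup>2 * (\<eta>\<^sup>2 * \<eta>)))" for \<eta>
  define H where "H \<eta> = Q (X \<eta>) * X' \<eta> - odd \<eta>" for \<eta>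
  have "g has_fps_expansion VG \<tau> F q0 q1 q2 q3"
    unfolding g_def[abs_def] VG_def VT1_def VT2_def VT3_def by (intro fps_expansion_intros Q Pf_expansion)
  from fps_order_limit[OF this j(2)] have lg: "((\<lambda>x. g x / x ^ j) \<longlongrightarrow> fps_nth (VG \<tau> F q0 q1 q2 q3) j) (at 0)" .
  have Hg: "H \<eta> = X' \<eta> * g (X \<eta>)" if "\<bar>\<eta>\<bar> < \<eta>0" for \<eta>
  proof -
    have \<eta>: "\<eta> = Pf' (X \<eta>) * X' \<eta> / 2" using key[OF that] by simp
    have "odd \<eta> = q0 * (Pf' (X \<eta>) * X' \<eta> / 2) + q1 * (Pf (X \<eta>) * (Pf' (X \<eta>) * X' \<eta> / 2)) +
        q2 * (Pf (X \<eta>) * (Pf (X \<eta>) * (Pf' (X \<eta>) * X' \<eta> / 2))) + q3 * (Pf (X \<eta>) * (Pf (X \<eta>) * (Pf (X \<eta>) * (Pf' (X \<eta>) * X' \<eta> / 2))))"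
      unfolding odd_def square[OF that, symmetric] \<eta>[symmetric] ..
    then show ?thesis by (simp add: H_def g_def algebra_simps)
  qed
  have near: "\<forall>\<^sub>F \<eta> in at 0. \<bar>\<eta>\<bar> < \<eta>0 \<and> \<eta> \<noteq> 0" unfolding eventually_at using \<eta>0(1) by (intro exI[of _ \<eta>0]) (auto simp: dist_real_def)
  have nz: "X \<eta> \<noteq> 0" if "\<bar>\<eta>\<bar> < \<eta>0" "\<eta> \<noteq> 0" for \<eta> using square[OF that(1)] that(2) by (auto simp: Pf_def)
  have evnz: "\<forall>\<^sub>F \<eta> in at 0. X \<eta> \<noteq> 0" using near by eventually_elim (simp add: nz)
  have X0: "(X \<longlongrightarrow> 0) (at 0)" using DERIV_isCont[OF DERIV_X, of 0] \<eta>0(1) by (simp add: isCont_def X_zero)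
  have "filterlim X (at 0) (at 0)"
    unfolding filterlim_at using X0 evnz by simp
  from filterlim_compose[OF lg this] have l1: "((\<lambda>\<eta>. g (X \<eta>) / X \<eta> ^ j) \<longlongrightarrow> fps_nth (VG \<tau> F q0 q1 q2 q3) j) (at 0)" .
  have l2: "((\<lambda>\<eta>. X \<eta> / \<eta>) \<longlongrightarrow> 1 / 4) (at 0)" using DERIV_X[of 0] \<eta>0(1) by (simp add: has_field_derivative_iff X_zero)
  have op: "open {\<eta>. \<bar>\<eta>\<bar> < \<eta>0}" by (intro open_Collect_less continuous_intros)
  have "isCont X' 0" using continuous_X(2) op \<eta>0(1) by (simp add: continuous_on_eq_continuous_at)
  then have l3: "(X' \<longlongrightarrow> 1 / 4) (at 0)" by (simp add: isCont_def X_zero)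
  have "((\<lambda>\<eta>. X' \<eta> * (g (X \<eta>) / X \<eta> ^ j) * (X \<eta> / \<eta>) ^ j) \<longlongrightarrow> 1 / 4 * fps_nth (VG \<tau> F q0 q1 q2 q3) j * (1 / 4) ^ j) (at 0)"
    by (intro tendsto_intros l1 l2 l3)
  moreover have "\<forall>\<^sub>F \<eta> in at 0. X' \<eta> * (g (X \<eta>) / X \<eta> ^ j) * (X \<eta> / \<eta>) ^ j = H \<eta> / \<eta> ^ j"
    using near evnz by eventually_elim (simp add: Hg power_divide)
  ultimately have lH: "((\<lambda>\<eta>. H \<eta> / \<eta> ^ j) \<longlongrightarrow> (1 / 4) ^ Suc j * fps_nth (VG \<tau> F q0 q1 q2 q3) j) (at 0)"
    by (simp add: tendsto_cong mult_ac)
  have cQX: "continuous_on {\<eta>. \<bar>\<eta>\<bar> < \<eta>0} (\<lambda>\<eta>. Q (X \<eta>) * X' \<eta>)"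
    by (intro continuous_on_mult continuous_on_compose2[OF Q(2)] continuous_X) auto
  have "continuous_on {\<eta>. \<bar>\<eta>\<bar> < \<eta>0} H"
    unfolding H_def odd_def by (intro continuous_on_diff cQX continuous_intros)
  from weighted_limit[OF this \<eta>0(1) lH p(1,2), of "\<lambda>\<psi>. - cos \<psi>"]
  have "((\<lambda>R. integral {0..pi} (\<lambda>\<psi>. p \<psi> * H (R * - cos \<psi>)) / R ^ j) \<longlongrightarrow>
    (1 / 4) ^ Suc j * fps_nth (VG \<tau> F q0 q1 q2 q3) j * integral {0..pi} (\<lambda>\<psi>. p \<psi> * (- cos \<psi>) ^ j)) (at_right 0)"
    by (simp add: continuous_intros)
  moreover have "\<forall>\<^sub>F R in at_right (0::real). R \<in> {0<..<\<eta>0}" by (rule eventually_at_right_real[OF \<eta>0(1)])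
  then have "\<forall>\<^sub>F R in at_right 0. integral {0..pi} (\<lambda>\<psi>. p \<psi> * H (R * - cos \<psi>)) / R ^ j =
      integral {0..pi} (\<lambda>\<psi>. p \<psi> * (Q (X (R * - cos \<psi>)) * X' (R * - cos \<psi>))) / R ^ j"
  proof eventually_elim
    case (elim R)
    have R: "\<bar>R * - cos \<psi>\<bar> < \<eta>0" for \<psi>
    proof -
      have "\<bar>R * - cos \<psi>\<bar> \<le> R" using elim by (simp add: abs_mult mult_left_le)
      then show ?thesis using elim by simp
    qed
    have c1: "continuous_on {0..pi} (\<lambda>\<psi>. p \<psi> * (Q (X (R * - cos \<psi>)) * X' (R * - cos \<psi>)))"
      by (intro continuous_on_mult[OF p(1)] continuous_on_compose2[OF cQX] continuous_intros) (use R in auto)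
    have c2: "continuous_on {0..pi} (\<lambda>\<psi>. p \<psi> * odd (R * - cos \<psi>))"
      unfolding odd_def by (intro continuous_intros p(1))
    have "integral {0..pi} (\<lambda>\<psi>. p \<psi> * odd (R * - cos \<psi>)) = 0"
      by (rule integral_antisymmetric) (simp add: p(3) odd_def algebra_simps)
    then have "integral {0..pi} (\<lambda>\<psi>. p \<psi> * H (R * - cos \<psi>)) = integral {0..pi} (\<lambda>\<psi>. p \<psi> * (Q (X (R * - cos \<psi>)) * X' (R * - cos \<psi>)))"
      unfolding H_def right_diff_distrib
      using Henstock_Kurzweil_Integration.integral_diff[OF integrable_continuous_interval[OF c1] integrable_continuous_interval[OF c2]]
      by (simp only: diff_0_right)
    then show ?case by simp
  qed
  ultimately show ?thesis by (rule Lim_transform_eventually)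
qed

definition "QA d1 m1 d2 m2 x = 4 * ((d1 + m1) * exp ((1 - \<tau>) * x) - m1 * exp ((- 3 - \<tau>) * x)
  + (d2 + m2) * exp ((3 - \<tau>) * x) - m2 * exp ((- 1 - \<tau>) * x))"

definition "QN h1 h2 x = 4 * h1 * (exp ((2 - 2 * \<tau>) * x) - 2 * exp ((- 2 - 2 * \<tau>) * x) + exp ((- 6 - 2 * \<tau>) * x))
  - 4 * h2 * (exp ((6 - 2 * \<tau>) * x) - 2 * exp ((2 - 2 * \<tau>) * x) + exp ((- 2 - 2 * \<tau>) * x))"

text \<open>The direction in \<open>l1\<close> enters with the weight \<open>sin \<psi> ^ 3\<close>,
  unlike those in \<open>n\<close>. The term with \<open>x * Pf' x\<close> is its replacement under
  the weight \<open>sin \<psi>\<close>, obtained by integration by parts in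
  \<open>gM_C\<close>.\<close>

definition "QC k h1 h2 x = QN h1 h2 x + 4 * k * (x * Pf' x)"

lemma Q_expansion: "QA d1 m1 d2 m2 has_fps_expansion VA \<tau> d1 m1 d2 m2" "QC k h1 h2 has_fps_expansion VC \<tau> k h1 h2"
  "continuous_on UNIV (QA d1 m1 d2 m2)" "continuous_on UNIV (QC k h1 h2)"
  unfolding QA_def[abs_def] VA_def QC_def[abs_def] QN_def VC_def Pf'_def
  by (intro fps_expansion_intros Pf_expansion(1)[unfolded Pf'_def[abs_def]] continuous_intros)+

text \<open>Started on the negative y-half-axis, the two half flows have the same
  \<open>\<eta>\<close> and opposite \<open>\<xi>\<close> at each \<open>\<psi>\<close>. Terms odd
  in \<open>\<xi>\<close>, from \<open>d\<close> and \<open>m\<close>, therefore add up, and terms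
  even in \<open>\<xi>\<close> are subtracted.\<close>

lemma gM_vertical:
  assumes R: "0 < R" "R < \<eta>0"
  defines "\<eta> \<psi> \<equiv> R * - cos \<psi>"
  shows "gM (- (pi / 2)) l1 0 l2 1 (d1, d2, k, 0, m1, m2, h1, h2) R = integral {0..pi} (\<lambda>\<psi>.
    R * ((sin \<psi>)\<^sup>2 * (QA d1 m1 d2 m2 (X (\<eta> \<psi>)) * X' (\<eta> \<psi>))) + sin \<psi> * (QN h1 h2 (X (\<eta> \<psi>)) * X' (\<eta> \<psi>))
    + k * (4 * R\<^sup>2 * (sin \<psi> ^ 3 * X' (\<eta> \<psi>))))"
proof -
  have R': "\<bar>R\<bar> < c\<eta> l1 0" "\<bar>R\<bar> < c\<eta> l2 1" using R \<eta>0 by auto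
  let ?S1 = "side.S l1 0 d1 k m1 h1" and ?S2 = "side.S l2 1 d2 0 m2 h2"
  have i: "(\<lambda>\<psi>. 1 * cos (- (pi / 2) + 1 * \<psi>) * ?S1 R (- (pi / 2) + 1 * \<psi>)) integrable_on {0..pi}"
    "(\<lambda>\<psi>. - 1 * cos (- (pi / 2) + - 1 * \<psi>) * ?S2 R (- (pi / 2) + - 1 * \<psi>)) integrable_on {0..pi}"
    by (rule side.integrable_M[OF R'(1)] side.integrable_M[OF R'(2)])+
  have "gM (- (pi / 2)) l1 0 l2 1 (d1, d2, k, 0, m1, m2, h1, h2) R =
      integral {0..pi} (\<lambda>\<psi>. 1 * cos (- (pi / 2) + 1 * \<psi>) * ?S1 R (- (pi / 2) + 1 * \<psi>) - - 1 * cos (- (pi / 2) + - 1 * \<psi>) * ?S2 R (- (pi / 2) + - 1 * \<psi>))"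
    unfolding gM_def prod.case side.M_def by (rule Henstock_Kurzweil_Integration.integral_diff[symmetric, OF i])
  also have "\<dots> = integral {0..pi} (\<lambda>\<psi>.
    R * ((sin \<psi>)\<^sup>2 * (QA d1 m1 d2 m2 (X (\<eta> \<psi>)) * X' (\<eta> \<psi>))) + sin \<psi> * (QN h1 h2 (X (\<eta> \<psi>)) * X' (\<eta> \<psi>))
    + k * (4 * R\<^sup>2 * (sin \<psi> ^ 3 * X' (\<eta> \<psi>))))"
  proof (rule Henstock_Kurzweil_Integration.integral_cong)
    fix \<psi> :: real
    have tr: "cos (- (pi / 2) + 1 * \<psi>) = sin \<psi>" "sin (- (pi / 2) + 1 * \<psi>) = - cos \<psi>"
      "cos (- (pi / 2) + - 1 * \<psi>) = - sin \<psi>" "sin (- (pi / 2) + - 1 * \<psi>) = - cos \<psi>"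
      by (simp_all add: cos_add sin_add cos_diff sin_diff)
    have h: "\<bar>\<eta> \<psi>\<bar> < \<eta>0" using side.in_J[OF R'(2), of "- (pi / 2) + 1 * \<psi>"] unfolding tr \<eta>_def .
    have h': "R * - cos \<psi> = \<eta> \<psi>" by (simp add: \<eta>_def)
    define x where "x = X (\<eta> \<psi>)"
    define e where "e c = exp (c * x)" for c
    have ee: "e a * e b = e (a + b)" for a b by (simp add: e_def exp_add[symmetric] algebra_simps)
    have Y: "cY l1 0 (\<eta> \<psi>) = 1 - e (- 4)" "cY' l1 0 (\<eta> \<psi>) = 4 * X' (\<eta> \<psi>) * e (- 4)"
      "(1 - cY l1 0 (\<eta> \<psi>)) powr c = e (- 4 * c)" for c
      using Y_X[OF h] Y'_X[OF h] powr_Y[OF h, of c] by (simp_all add: e_def x_def)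
    have pw: "e (- 4) * e (- 4) = e (- 8)" by (simp add: ee)
    have 1: "?S1 R (- (pi / 2) + 1 * \<psi>) = 4 * X' (\<eta> \<psi>) * ((d1 + m1 * (1 - e (- 4))) * (e (- 4 * (l1 - 1)) * e (- 4)) * (R * sin \<psi>)
        + k * (e (- 4 * - 1) * e (- 4)) * (R * sin \<psi>)\<^sup>2 + h1 * (1 - e (- 4))\<^sup>2 * (e (- 4 * (2 * l1 - 1)) * e (- 4)))"
      unfolding side.S_def side.A_def side.B_def side.C_def tr h' Y(3) unfolding Y(1,2) by (simp add: algebra_simps)
    have 2: "?S2 R (- (pi / 2) + - 1 * \<psi>) = 4 * X' (\<eta> \<psi>) * ((d2 + m2 * (1 - e (- 4))) * (e (- 4 * (l2 - 1)) * e (- 4)) * (R * - sin \<psi>)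
        + h2 * (1 - e (- 4))\<^sup>2 * (e (- 4 * (2 * l2 - 1)) * e (- 4)))"
      unfolding side.S_def side.A_def side.B_def side.C_def tr h' chart_eq[OF h] Y(3) unfolding Y(1,2) by (simp add: algebra_simps)
    have ex: "e (- 4 * (l1 - 1)) * e (- 4) = e (1 - \<tau>)" "e (- 4 * - 1) * e (- 4) = 1" "e (- 4 * (2 * l1 - 1)) * e (- 4) = e (2 - 2 * \<tau>)"
      "e (- 4 * (l2 - 1)) * e (- 4) = e (3 - \<tau>)" "e (- 4 * (2 * l2 - 1)) * e (- 4) = e (6 - 2 * \<tau>)"
      unfolding ee by (simp_all add: field_simps) (simp_all add: e_def)
    have ex2: "e (- 4) * e (1 - \<tau>) = e (- 3 - \<tau>)" "e (- 4) * e (3 - \<tau>) = e (- 1 - \<tau>)" "e (- 4) * e (2 - 2 * \<tau>) = e (- 2 - 2 * \<tau>)"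
      "e (- 4) * e (- 2 - 2 * \<tau>) = e (- 6 - 2 * \<tau>)" "e (- 4) * e (6 - 2 * \<tau>) = e (2 - 2 * \<tau>)"
      unfolding ee by (rule arg_cong[of _ _ e]; simp)+
    have QA: "QA d1 m1 d2 m2 (X (\<eta> \<psi>)) = 4 * ((d1 + m1 * (1 - e (- 4))) * e (1 - \<tau>) + (d2 + m2 * (1 - e (- 4))) * e (3 - \<tau>))"
      unfolding QA_def x_def[symmetric] e_def[symmetric] ex2(1,2)[symmetric] by (simp add: algebra_simps)
    have QN: "QN h1 h2 (X (\<eta> \<psi>)) = 4 * (h1 * (1 - e (- 4))\<^sup>2 * e (2 - 2 * \<tau>) - h2 * (1 - e (- 4))\<^sup>2 * e (6 - 2 * \<tau>))"
    proof -
      have "(1 - e (- 4))\<^sup>2 * e (2 - 2 * \<tau>) = e (2 - 2 * \<tau>) - 2 * e (- 2 - 2 * \<tau>) + e (- 6 - 2 * \<tau>)"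
        unfolding ex2(3)[symmetric] ex2(4)[symmetric] by (simp add: algebra_simps power2_eq_square)
      moreover have "(1 - e (- 4))\<^sup>2 * e (6 - 2 * \<tau>) = e (6 - 2 * \<tau>) - 2 * e (2 - 2 * \<tau>) + e (- 2 - 2 * \<tau>)"
        unfolding ex2(3)[symmetric] ex2(5)[symmetric] by (simp add: algebra_simps power2_eq_square)
      ultimately show ?thesis unfolding QN_def x_def[symmetric] e_def[symmetric] by algebra
    qed
    show "1 * cos (- (pi / 2) + 1 * \<psi>) * ?S1 R (- (pi / 2) + 1 * \<psi>) - - 1 * cos (- (pi / 2) + - 1 * \<psi>) * ?S2 R (- (pi / 2) + - 1 * \<psi>) =
      R * ((sin \<psi>)\<^sup>2 * (QA d1 m1 d2 m2 (X (\<eta> \<psi>)) * X' (\<eta> \<psi>))) + sin \<psi> * (QN h1 h2 (X (\<eta> \<psi>)) * X' (\<eta> \<psi>))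
      + k * (4 * R\<^sup>2 * (sin \<psi> ^ 3 * X' (\<eta> \<psi>)))"
      unfolding 1 2 ex QA QN tr by algebra
  qed
  finally show ?thesis .
qed

lemma gM_A:
  assumes R: "0 < R" "R < \<eta>0"
  shows "gM (- (pi / 2)) l1 0 l2 1 (d1, d2, 0, 0, m1, m2, 0, 0) R =
    R * integral {0..pi} (\<lambda>\<psi>. (sin \<psi>)\<^sup>2 * (QA d1 m1 d2 m2 (X (R * - cos \<psi>)) * X' (R * - cos \<psi>)))"
  unfolding gM_vertical[OF R] by (simp add: QN_def)

text \<open>By \<open>key\<close>, the difference between the two forms of the \<open>l1\<close>
  term is the derivative of \<open>4 * R * ((sin \<psi>)\<^sup>2 * X (\<eta> \<psi>))\<close>, which
  vanishes at both ends of the half turn.\<close>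

lemma gM_C:
  assumes R: "0 < R" "R < \<eta>0"
  shows "gM (- (pi / 2)) l1 0 l2 1 (0, 0, k, 0, 0, 0, h1, h2) R =
    integral {0..pi} (\<lambda>\<psi>. sin \<psi> * (QC k h1 h2 (X (R * - cos \<psi>)) * X' (R * - cos \<psi>)))"
proof -
  define \<eta> where "\<eta> \<psi> = R * - cos \<psi>" for \<psi>
  have h: "\<bar>\<eta> \<psi>\<bar> < \<eta>0" for \<psi>
  proof -
    have "\<bar>\<eta> \<psi>\<bar> \<le> R" using R by (simp add: \<eta>_def abs_mult mult_left_le)
    then show ?thesis using R by simp
  qed
  let ?B = "\<lambda>\<psi>. 4 * R\<^sup>2 * (sin \<psi> ^ 3 * X' (\<eta> \<psi>)) - 4 * (sin \<psi> * (X (\<eta> \<psi>) * (Pf' (X (\<eta> \<psi>)) * X' (\<eta> \<psi>))))"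
  have cX: "continuous_on {0..pi} (\<lambda>\<psi>. X (\<eta> \<psi>))" "continuous_on {0..pi} (\<lambda>\<psi>. X' (\<eta> \<psi>))"
    using h by (auto intro!: continuous_on_compose2[OF continuous_X(1)] continuous_on_compose2[OF continuous_X(2)]
      continuous_intros simp: \<eta>_def[abs_def])
  have B: "(?B has_integral 4 * R * ((sin pi)\<^sup>2 * X (\<eta> pi)) - 4 * R * ((sin 0)\<^sup>2 * X (\<eta> 0))) {0..pi}"
  proof (rule fundamental_theorem_of_calculus)
    fix \<psi> :: real
    have "(\<eta> has_real_derivative R * sin \<psi>) (at \<psi> within {0..pi})"
      unfolding \<eta>_def[abs_def] by (auto intro!: derivative_eq_intros)
    from DERIV_chain2[OF DERIV_X[OF h] this]
    have "((\<lambda>\<psi>. 4 * R * ((sin \<psi>)\<^sup>2 * X (\<eta> \<psi>))) has_real_derivative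
        4 * R * (2 * sin \<psi> * cos \<psi> * X (\<eta> \<psi>) + X' (\<eta> \<psi>) * (R * sin \<psi>) * (sin \<psi>)\<^sup>2)) (at \<psi> within {0..pi})"
      by (auto intro!: derivative_eq_intros)
    also have "4 * R * (2 * sin \<psi> * cos \<psi> * X (\<eta> \<psi>) + X' (\<eta> \<psi>) * (R * sin \<psi>) * (sin \<psi>)\<^sup>2) = ?B \<psi>"
      unfolding key[OF h, symmetric] unfolding \<eta>_def by (simp add: algebra_simps power2_eq_square power3_eq_cube)
    finally show "((\<lambda>\<psi>. 4 * R * ((sin \<psi>)\<^sup>2 * X (\<eta> \<psi>))) has_vector_derivative ?B \<psi>) (at \<psi> within {0..pi})"
      by (simp add: has_real_derivative_iff_has_vector_derivative)
  qed simp
  have c: "continuous_on {0..pi} (\<lambda>\<psi>. sin \<psi> * (QC k h1 h2 (X (\<eta> \<psi>)) * X' (\<eta> \<psi>)))"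
    by (intro continuous_intros cX continuous_on_compose2[OF Q_expansion(4) cX(1)]) auto
  have "gM (- (pi / 2)) l1 0 l2 1 (0, 0, k, 0, 0, 0, h1, h2) R =
      integral {0..pi} (\<lambda>\<psi>. sin \<psi> * (QC k h1 h2 (X (\<eta> \<psi>)) * X' (\<eta> \<psi>)) + k * ?B \<psi>)"
    unfolding gM_vertical[OF R] QC_def \<eta>_def[symmetric]
    by (rule Henstock_Kurzweil_Integration.integral_cong) (simp add: QA_def algebra_simps)
  also have "\<dots> = integral {0..pi} (\<lambda>\<psi>. sin \<psi> * (QC k h1 h2 (X (\<eta> \<psi>)) * X' (\<eta> \<psi>))) + integral {0..pi} (\<lambda>\<psi>. k * ?B \<psi>)"
    by (intro Henstock_Kurzweil_Integration.integral_add integrable_continuous_interval[OF c] integrable_on_mult_right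
        has_integral_integrable[OF B])
  also have "integral {0..pi} (\<lambda>\<psi>. k * ?B \<psi>) = 0" using integral_unique[OF B] by simp
  finally show ?thesis by (simp add: \<eta>_def)
qed

text \<open>The directions in \<open>d\<close> and \<open>m\<close> carry one more factor
  \<open>R\<close> than those in \<open>l1\<close> and \<open>n\<close>. For even \<open>j\<close>
  they supply the odd orders in \<open>R\<close>, while \<open>limit_C\<close> supplies the even
  ones.\<close>

lemma limit_A:
  assumes j: "even j" "\<forall>i<j. fps_nth (VG \<tau> (VA \<tau> d1 m1 d2 m2) q0 q1 q2 q3) i = 0"
  shows "((\<lambda>R. gM (- (pi / 2)) l1 0 l2 1 (d1, d2, 0, 0, m1, m2, 0, 0) R / R ^ Suc j) \<longlongrightarrow>
    (1 / 4) ^ Suc j * fps_nth (VG \<tau> (VA \<tau> d1 m1 d2 m2) q0 q1 q2 q3) j * integral {0..pi} (\<lambda>\<psi>. (sin \<psi>)\<^sup>2 * (- cos \<psi>) ^ j)) (at_right 0)"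
proof (rule Lim_transform_eventually[OF vertical_limit[OF Q_expansion(1,3) j]])
  have "\<forall>\<^sub>F R in at_right (0::real). R \<in> {0<..<\<eta>0}" by (rule eventually_at_right_real[OF \<eta>0(1)])
  then show "\<forall>\<^sub>F R in at_right 0. integral {0..pi} (\<lambda>\<psi>. (sin \<psi>)\<^sup>2 * (QA d1 m1 d2 m2 (X (R * - cos \<psi>)) * X' (R * - cos \<psi>))) / R ^ j =
      gM (- (pi / 2)) l1 0 l2 1 (d1, d2, 0, 0, m1, m2, 0, 0) R / R ^ Suc j"
    by eventually_elim (simp add: gM_A)
qed (auto intro!: continuous_intros simp: abs_square_le_1)

lemma limit_C:
  assumes j: "even j" "\<forall>i<j. fps_nth (VG \<tau> (VC \<tau> k h1 h2) q0 q1 q2 q3) i = 0"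
  shows "((\<lambda>R. gM (- (pi / 2)) l1 0 l2 1 (0, 0, k, 0, 0, 0, h1, h2) R / R ^ j) \<longlongrightarrow>
    (1 / 4) ^ Suc j * fps_nth (VG \<tau> (VC \<tau> k h1 h2) q0 q1 q2 q3) j * integral {0..pi} (\<lambda>\<psi>. sin \<psi> * (- cos \<psi>) ^ j)) (at_right 0)"
proof (rule Lim_transform_eventually[OF vertical_limit[OF Q_expansion(2,4) j]])
  have "\<forall>\<^sub>F R in at_right (0::real). R \<in> {0<..<\<eta>0}" by (rule eventually_at_right_real[OF \<eta>0(1)])
  then show "\<forall>\<^sub>F R in at_right 0. integral {0..pi} (\<lambda>\<psi>. sin \<psi> * (QC k h1 h2 (X (R * - cos \<psi>)) * X' (R * - cos \<psi>))) / R ^ j =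
      gM (- (pi / 2)) l1 0 l2 1 (0, 0, k, 0, 0, 0, h1, h2) R / R ^ j"
    by eventually_elim (simp add: gM_C)
qed (auto intro!: continuous_intros)

text \<open>On the line \<open>x = 0\<close> one has \<open>\<xi> = 0\<close> and
  \<open>\<eta>\<close> is \<open>R\<close> or \<open>- R\<close>. The distances to the origin are
  values of the chart inverse alone, and these agree for both halves by
  \<open>chart_eq\<close>.\<close>

lemma geometry_vertical:
  assumes R1: "0 < R1" "R1 \<le> \<eta>0"
  shows "geometry (1, 0) (- (pi / 2)) l1 0 l2 1 R1 (\<lambda>R. - cY l1 0 (- R)) (\<lambda>R. cY' l1 0 (- R)) (cY l1 0) (cY' l1 0)"
proof
  fix R assume R: "0 < R" "R < R1"
  have h: "\<bar>- R\<bar> < \<eta>0" "\<bar>R\<bar> < \<eta>0" "\<bar>- R\<bar> < c\<eta> l1 0" "\<bar>R\<bar> < c\<eta> l1 0" using R R1 \<eta>0 by auto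
  show "side.pt l1 0 R (- (pi / 2)) = - cY l1 0 (- R) *\<^sub>R start_axis (1, 0)"
    "side.pt l2 1 R (- (pi / 2)) = - cY l1 0 (- R) *\<^sub>R start_axis (1, 0)"
    using chart_eq(1)[OF h(1)] by (simp_all add: side.pt_def start_axis_def)
  have "- (pi / 2) - pi = - (3 / 2 * pi)" by simp
  then have t: "sin (- (pi / 2) - pi) = 1" "cos (- (pi / 2) - pi) = 0" by (simp_all only: sin_minus cos_minus sin_3over2_pi cos_3over2_pi)
  show "side.pt l1 0 R (- (pi / 2) + pi) = - cY l1 0 R *\<^sub>R start_axis (1, 0)"
    by (simp add: side.pt_def start_axis_def)
  show "side.pt l2 1 R (- (pi / 2) - pi) = - cY l1 0 R *\<^sub>R start_axis (1, 0)"
    unfolding side.pt_def t using chart_eq(1)[OF h(2)] by (simp add: start_axis_def)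
  show "0 < - cY l1 0 (- R)" using cY_neg[of "- R" l1 0] h R by simp
  show "0 < cY l1 0 R" using cY_pos[of R l1 0] h R by simp
  show "((\<lambda>R. - cY l1 0 (- R)) has_real_derivative cY' l1 0 (- R)) (at R)"
    using DERIV_minus[OF DERIV_chain2[OF DERIV_cY[OF h(3)] DERIV_minus[OF DERIV_ident]]] by simp
  show "0 < cY' l1 0 (- R)" "0 < cY' l1 0 R" by (rule cY'_pos[OF h(3)] cY'_pos[OF h(4)])+
  show "(cY l1 0 has_real_derivative cY' l1 0 R) (at R)" by (rule DERIV_cY[OF h(4)])
next
  fix R \<phi> assume R: "0 < R" "R < R1"
  have R1c: "\<bar>R\<bar> < c\<eta> l1 0" "\<bar>R\<bar> < c\<eta> l2 1" using R R1 \<eta>0 by auto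
  show "0 < (1, 0) \<bullet> side.pt l1 0 R \<phi>" if "- (pi / 2) < \<phi>" "\<phi> < - (pi / 2) + pi"
    using that R cos_gt_zero_pi[of \<phi>] side.Y_lt[OF side.in_J[OF R1c(1)], of \<phi>] by (simp add: side.pt_def)
  show "(1, 0) \<bullet> side.pt l2 1 R \<phi> < 0" if "- (pi / 2) - pi < \<phi>" "\<phi> < - (pi / 2)"
    using that R cos_gt_zero_pi[of "\<phi> + pi"] side.Y_lt[OF side.in_J[OF R1c(2)], of \<phi>]
    by (simp add: side.pt_def mult_pos_neg mult_neg_pos)
qed (use R1 \<eta>0 in \<open>auto simp: norm_Pair\<close>)

end

lemma vertical_weight:
  assumes "even j"
  shows "integral {0..pi} (\<lambda>\<psi>. (sin \<psi>)\<^sup>2 * (- cos \<psi>) ^ j) > 0" "integral {0..pi} (\<lambda>\<psi>. sin \<psi> * (- cos \<psi>) ^ j) > 0"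
  by (rule integral_pos_continuous[where ?x0.0="pi / 4"];
    use assms in \<open>auto simp: sin_45 cos_45 sin_ge_zero zero_le_even_power intro!: continuous_intros mult_nonneg_nonneg\<close>)+

text \<open>The directions \<open>e t k\<close> give the orders \<open>1\<close> to
  \<open>6\<close>, alternating between the two types of integrals. The last direction has order
  \<open>7\<close>, and order \<open>9\<close> at the special center, with opposite signs.\<close>

lemma vertical: "\<exists>q0. bifurcate_from_origin Z1 Z2 (1, 0) q0 7"
proof -
  obtain R1 where R1: "R1 > 0" "\<And>l n. \<bar>l\<bar> \<le> 1 \<Longrightarrow> \<bar>n\<bar> \<le> 1 \<Longrightarrow> R1 \<le> c\<eta> l n"
    by (rule chart_uniform[of 1]) auto
  \<comment> \<open>The starting value is the positive root of
    \<open>8 - 9 * \<tau>\<^sup>2\<close>, a factor of the coefficient of order \<open>6\<close>;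
    for \<open>t > 0\<close> this factor is negative.\<close>
  define T where "T t = 2 * sqrt 2 / 3 + t" for t :: real
  define m1 :: "real \<Rightarrow> real" where "m1 \<tau> = 4 + 7 * \<tau> + 3 * \<tau> ^ 2" for \<tau>
  define m2 :: "real \<Rightarrow> real" where "m2 \<tau> = 16 - 7 * \<tau> - 9 * \<tau> ^ 2" for \<tau>
  define w :: "real \<Rightarrow> params" where "w t = (12 - 12 * T t ^ 2, 12 * T t ^ 2 - 12, 0, 0, m1 (T t), m2 (T t), 0, 0)" for t
  define e :: "real \<Rightarrow> nat \<Rightarrow> params" where "e t k =
    (if k = 0 then (1, 1, 0, 0, 0, - 1, 0, 0) else if k = 1 then (0, 0, 0, 0, 0, 0, 1, 0)
     else if k = 2 then (0, 0, 0, 0, - 1, 1, 0, 0) else if k = 3 then (0, 0, - 1, 0, 0, 0, 1, - 1)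
     else if k = 4 then (- 4, 4, 0, 0, 1, - 3, 0, 0) else (0, 0, T t, 0, 0, 0, - 1 - T t, T t - 1))" for t k
  define W2 where "W2 j = integral {0..pi} (\<lambda>\<psi>. (sin \<psi>)\<^sup>2 * (- cos \<psi>) ^ j)" for j
  define W1 where "W1 j = integral {0..pi} (\<lambda>\<psi>. sin \<psi> * (- cos \<psi>) ^ j)" for j
  have W: "W2 j > 0" "W1 j > 0" if "even j" for j unfolding W1_def W2_def by (rule vertical_weight[OF that])+
  \<comment> \<open>The upper bound is sharp enough to keep \<open>T t\<close> below
    \<open>1\<close> up to \<open>t = 1/25\<close>.\<close>
  have s2: "141 / 100 < sqrt 2" "sqrt 2 < 142 / 100"
    by (rule real_less_rsqrt real_less_lsqrt; simp add: power2_eq_square)+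
  have T: "vertical (T t)" if "t \<in> {0..1/25}" for t
    by standard (use that s2 in \<open>auto simp: T_def\<close>)
  have T0: "T 0 ^ 2 = 8 / 9" by (simp add: T_def power_divide power_mult_distrib)
  \<comment> \<open>With \<open>T 0 ^ 2 = 8 / 9\<close> the odd polynomials in \<open>\<tau>\<close>
    among the coefficients become rational multiples of \<open>T 0\<close>, whose signs are decided
    by arithmetic.\<close>
  have "T 0 ^ 3 = T 0 * (T 0 ^ 2)" "T 0 ^ 5 = T 0 * (T 0 ^ 2) ^ 2" "T 0 ^ 7 = T 0 * (T 0 ^ 2) ^ 3" by algebra+
  then have T0': "T 0 ^ 3 = 8 / 9 * T 0" "T 0 ^ 5 = 64 / 81 * T 0" "T 0 ^ 7 = 512 / 729 * T 0"
    unfolding T0 by (simp_all add: power2_eq_square power3_eq_cube)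
  have bd: "\<bar>(T t - 1) / 4\<bar> \<le> 1" "\<bar>(T t - 3) / 4\<bar> \<le> 1" if "t \<in> {0..1/25}" for t
    using vertical.\<tau>[OF T[OF that]] by (auto simp: abs_le_iff)
  have in0: "(0::real) \<in> {0..1/25}" by simp
  have "bifurcate_from_origin Z1 Z2 (1, 0) (base ((T 0 - 1) / 4) 0 ((T 0 - 3) / 4) 1) (Suc 6)"
  proof (rule bifurcation_criterion[where ?\<phi>0.0="- (pi / 2)" and ?l1.0="\<lambda>t. (T t - 1) / 4" and ?n1.0="\<lambda>_. 0"
        and ?l2.0="\<lambda>t. (T t - 3) / 4" and ?n2.0="\<lambda>_. 1" and w=w and e=e and L=1 and ?\<delta>0.0="1/25"])
    show "R1 > 0" by (rule R1)
    show "geometry (1, 0) (- (pi / 2)) ((T t - 1) / 4) 0 ((T t - 3) / 4) 1 R1 (\<lambda>R. - cY ((T t - 1) / 4) 0 (- R))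
        (\<lambda>R. cY' ((T t - 1) / 4) 0 (- R)) (cY ((T t - 1) / 4) 0) (cY' ((T t - 1) / 4) 0)" if "t \<in> {0..1/25}" for t
      by (rule vertical.geometry_vertical[OF T[OF that] R1(1)]) (use R1(2) bd[OF that] in simp)
    show "\<bar>(T t - 1) / 4\<bar> \<le> 1 \<and> \<bar>0::real\<bar> \<le> 1 \<and> \<bar>(T t - 3) / 4\<bar> \<le> 1 \<and> \<bar>1::real\<bar> \<le> 1" if "t \<in> {0..1/25}" for t
      using bd[OF that] by simp
    show "continuous_on {0..1/25} (\<lambda>t. gM (- (pi / 2)) ((T t - 1) / 4) 0 ((T t - 3) / 4) 1 (w t) R)" if "0 < R" "R < R1" for R
      unfolding w_def
    proof (rule continuous_gM)
      fix t assume t: "t \<in> {0..1/25::real}"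
      show "\<bar>R\<bar> < c\<eta> ((T t - 1) / 4) 0" "\<bar>R\<bar> < c\<eta> ((T t - 3) / 4) 1"
        using that R1(2)[of "(T t - 1) / 4" 0] R1(2)[of "(T t - 3) / 4" 1] bd[OF t] by auto
    qed (unfold T_def m1_def m2_def, (intro continuous_intros; simp)+)
    show "((\<lambda>R. gM (- (pi / 2)) ((T 0 - 1) / 4) 0 ((T 0 - 3) / 4) 1 (w 0) R / R ^ Suc 8) \<longlongrightarrow>
        (1 / 4) ^ Suc 8 * fps_nth (VF (T 0)) 8 * W2 8) (at_right 0)"
    proof -
      have "\<forall>i<8. fps_nth (VF (T 0)) i = 0"
      proof (intro allI impI)
        fix i :: nat assume "i < 8"
        then consider "i < 6" | "i = 6" | "i = 7" by linarith
        then show "fps_nth (VF (T 0)) i = 0"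
        proof cases
          case 2
          then show ?thesis using V_order_last[of "T 0"] unfolding T0' by simp
        qed (use V_order_last[of "T 0"] in auto)
      qed
      from vertical.limit_A[OF T[OF in0] _ this[unfolded VF_def]] show ?thesis
        unfolding w_def m1_def m2_def VF_def W2_def by simp
    qed
    show "((\<lambda>R. gM (- (pi / 2)) ((T t - 1) / 4) 0 ((T t - 3) / 4) 1 (w t) R / R ^ Suc 6) \<longlongrightarrow>
        (1 / 4) ^ Suc 6 * fps_nth (VF (T t)) 6 * W2 6) (at_right 0)" if "0 < t" "t < 1/25" for t
    proof -
      have "\<forall>i<6. fps_nth (VF (T t)) i = 0" using V_order_last[of "T t"] by blast
      from vertical.limit_A[OF T _ this[unfolded VF_def]] that show ?thesis
        unfolding w_def m1_def m2_def VF_def W2_def by simp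
    qed
    show "(1 / 4) ^ Suc 6 * fps_nth (VF (T t)) 6 * W2 6 * ((1 / 4) ^ Suc 8 * fps_nth (VF (T 0)) 8 * W2 8) < 0"
      if t: "0 < t" "t < 1/25" for t
    proof -
      have \<tau>: "0 < T t" "T t < 1" "0 < T 0" using vertical.\<tau>[OF T[of t]] vertical.\<tau>[OF T[OF in0]] t by auto
      have "T 0 < T t" using t by (simp add: T_def)
      then have "T 0 ^ 2 < T t ^ 2" using \<tau> by (intro power_strict_mono) auto
      then have "8 - 9 * T t ^ 2 < 0" by (simp add: T0)
      moreover have "1 - T t ^ 2 > 0" using \<tau> power_strict_mono[of "T t" 1 2] by simp
      ultimately have "32 / 3 * T t * (1 - T t ^ 2) * (8 - 9 * T t ^ 2) < 0" using \<tau> by (intro mult_pos_neg mult_pos_pos) auto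
      moreover have "fps_nth (VF (T t)) 6 = 32 / 3 * T t * (1 - T t ^ 2) * (8 - 9 * T t ^ 2)"
        using V_order_last[of "T t"] by (simp add: eval_nat_numeral algebra_simps)
      ultimately have 1: "(1 / 4) ^ Suc 6 * fps_nth (VF (T t)) 6 * W2 6 < 0"
        using W(1)[of 6] by (intro mult_neg_pos mult_pos_neg) auto
      have "fps_nth (VF (T 0)) 8 = T 0 * (128 / 105 - 9872 / 9 * (8 / 9) + 109888 / 45 * (64 / 81) - 9424 / 7 * (512 / 729))"
        using V_order_last[of "T 0"] unfolding T0' by (simp add: algebra_simps)
      also have "\<dots> > 0" using \<tau> by (intro mult_pos_pos) simp_all
      finally have 2: "(1 / 4) ^ Suc 8 * fps_nth (VF (T 0)) 8 * W2 8 > 0"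
        using W(1)[of 8] by (intro mult_pos_pos) auto
      show ?thesis by (rule mult_neg_pos[OF 1 2])
    qed
    show "\<exists>a. a \<noteq> 0 \<and> ((\<lambda>R. gM (- (pi / 2)) ((T t - 1) / 4) 0 ((T t - 3) / 4) 1 (e t k) R / R ^ Suc k) \<longlongrightarrow> a) (at_right 0)"
      if t: "0 < t" "t < 1/25" and k: "k < 6" for t k
    proof -
      have Tt: "vertical (T t)" using T t by simp
      note \<tau> = vertical.\<tau>[OF Tt]
      have "T t ^ 3 < T t" using \<tau> power_strict_decreasing[of 1 3 "T t"] by simp
      note lA = vertical.limit_A[OF Tt, folded W2_def] and lC = vertical.limit_C[OF Tt, folded W1_def]
      have ev: "even (0::nat)" "even (2::nat)" "even (4::nat)" "even (6::nat)" by simp_all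
      have none: "\<forall>i<0. fps_nth (VG (T t) (VA (T t) 1 0 1 (- 1)) 0 0 0 0) i = 0" by simp
      note l0 = lA[OF ev(1) none, unfolded V_order_0]
        and l1 = lC[OF ev(2) V_order_1[THEN conjunct1], unfolded V_order_1[THEN conjunct2]]
        and l2 = lA[OF ev(2) V_order_2[THEN conjunct1], unfolded V_order_2[THEN conjunct2]]
        and l3 = lC[OF ev(3) V_order_3[THEN conjunct1], unfolded V_order_3[THEN conjunct2]]
        and l4 = lA[OF ev(3) V_order_4[THEN conjunct1], unfolded V_order_4[THEN conjunct2]]
        and l5 = lC[OF ev(4) V_order_5[THEN conjunct1], unfolded V_order_5[THEN conjunct2]]
      have num: "Suc 1 = 2" "Suc 2 = 3" "Suc 3 = 4" "Suc 4 = 5" "Suc 5 = 6" by simp_all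
      consider "k = 0" | "k = 1" | "k = 2" | "k = 3" | "k = 4" | "k = 5" using k by linarith
      then show ?thesis
      proof cases
        case 1 show ?thesis unfolding e_def 1 using l0 W(1)[of 0] by (intro exI[of _ "(1 / 4) ^ Suc 0 * 8 * W2 0"]) simp
      next
        case 2 show ?thesis unfolding e_def 2 num using l1 W(2)[of 2] by (intro exI[of _ "(1 / 4) ^ Suc 2 * 64 * W1 2"]) simp
      next
        case 3 show ?thesis unfolding e_def 3 using l2 W(1)[of 2] by (intro exI[of _ "(1 / 4) ^ Suc 2 * 32 * W2 2"]) simp
      next
        case 4 show ?thesis unfolding e_def 4 num using l3 W(2)[of 4] by (intro exI[of _ "(1 / 4) ^ Suc 4 * (1024 / 3) * W1 4"]) simp
      next
        case 5 show ?thesis unfolding e_def 5 using l4 W(1)[of 4] \<tau> by (intro exI[of _ "(1 / 4) ^ Suc 4 * ((224 / 3) * T t) * W2 4"]) simp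
      next
        case 6 show ?thesis unfolding e_def 6 num using l5 W(2)[of 6] \<open>T t ^ 3 < T t\<close>
          by (intro exI[of _ "(1 / 4) ^ Suc 6 * ((8192 / 15) * T t + (- 8192 / 15) * T t ^ 3) * W1 6"]) simp
      qed
    qed
    show "gM (- (pi / 2)) ((T t - 1) / 4) 0 ((T t - 3) / 4) 1 (e t 0) R > 0" if t: "0 < t" "t < 1/25" "0 < R" "R < R1" for t R
    proof -
      interpret vertical "T t" using T t by simp
      have R: "R < \<eta>0" using R1(2)[of l2 1] bd[of t] t by simp
      have h: "\<bar>R * - cos \<psi>\<bar> < \<eta>0" for \<psi>
      proof -
        have "\<bar>R * - cos \<psi>\<bar> \<le> R" using t by (simp add: abs_mult mult_left_le)
        then show ?thesis using R by simp
      qed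
      \<comment> \<open>For this direction the terms of \<open>QA\<close> reduce to a sum of two
        exponentials with positive coefficients, so the integrand is nonnegative everywhere and
        positive inside.\<close>
      have QA: "QA 1 0 1 (- 1) x > 0" for x by (simp add: QA_def add_pos_pos)
      have "integral {0..pi} (\<lambda>\<psi>. (sin \<psi>)\<^sup>2 * (QA 1 0 1 (- 1) (X (R * - cos \<psi>)) * X' (R * - cos \<psi>))) > 0"
      proof (rule integral_pos_continuous[where ?x0.0="pi / 2"])
        show "continuous_on {0..pi} (\<lambda>\<psi>. (sin \<psi>)\<^sup>2 * (QA 1 0 1 (- 1) (X (R * - cos \<psi>)) * X' (R * - cos \<psi>)))"
          using h by (auto intro!: continuous_on_mult continuous_on_compose2[OF Q_expansion(3)] continuous_on_compose2[OF continuous_X(1)]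
              continuous_on_compose2[OF continuous_X(2)] continuous_intros)
        show "0 \<le> (sin \<psi>)\<^sup>2 * (QA 1 0 1 (- 1) (X (R * - cos \<psi>)) * X' (R * - cos \<psi>))" for \<psi>
          using QA X'_pos[OF h] by (intro mult_nonneg_nonneg) (auto intro: less_imp_le)
        show "0 < (sin (pi / 2))\<^sup>2 * (QA 1 0 1 (- 1) (X (R * - cos (pi / 2))) * X' (R * - cos (pi / 2)))"
          using QA X'_pos[OF h, of "pi / 2"] by simp
      qed auto
      then show ?thesis using gM_A[OF t(3) R, of 1 1 0 "- 1"] t by (simp add: e_def)
    qed
  qed (auto simp: T_def intro!: continuous_intros)
  then show ?thesis by (intro exI) simp
qed

theorem theorem1p1:
  "(\<exists>q0. bifurcate_from_origin Z1 Z2 (0, 1) q0 4) \<and>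
   (\<exists>q0. bifurcate_from_origin Z1 Z2 (1, 0) q0 7)"
  using horizontal vertical by blast

end
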